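(* Let $X$ be a compact complex manifold. Suppose $\omega$ is a Levi-Civita Ricci-flat Hermitian metric on $X$, i.e. $\mathfrak{Ric}(\omega)=0$. Then either (1) $\kappa(X)=-\infty$; or (2) $\kappa(X)=0$ and $(X,\omega)$ is conformally balanced with $K_X$ a holomorphic torsion, i.e. $K_X^{\otimes m}=\mathcal O_X$ for some $m\in\mathbb Z^+$.
   Context: Let $n=\dim_{\mathbb C}X$ and let $K_X$ be the canonical line bundle. The Kodaira dimension is $\kappa(X)=\limsup_{m\to+\infty}\frac{\log\dim_{\mathbb C}H^0(X,K_X^{\otimes m})}{\log m}$, where the logarithm of zero is defined to be $-\infty$. A Hermitian metric $\omega$ is balanced if $d\omega^{n-1}=0$; $(X,\omega)$ is conformally balanced if $e^f\omega$ is balanced for some $f\in C^\infty(X,\mathbb R)$. Levi-Civita Ricci curvature: let $(X,\omega)$ be a Hermitian manifold with $\omega=\sqrt{-1}\,h_{i\bar j}\,dz^i\wedge d\bar z^j$ in local holomorphic coordinates, and extend the Levi-Civita connection of the background Riemannian metric $\mathbb{C}$-linearly to $T_{\mathbb C}X=T^{1,0}X\oplus T^{0,1}X$. Composing it with the projection to $T^{1,0}X$ gives the Levi-Civita connection $\nabla^{\mathrm{LC}}$ on $T^{1,0}X$, with coefficients $\nabla^{\mathrm{LC}}_{\partial/\partial z^i}\frac{\partial}{\partial z^k}=\Gamma_{ik}^p\frac{\partial}{\partial z^p}$ and $\nabla^{\mathrm{LC}}_{\partial/\partial\bar z^j}\frac{\partial}{\partial z^k}=\Gamma_{\bar jk}^p\frac{\partial}{\partial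 z^p}$, where $$\Gamma_{ij}^k=\tfrac12 h^{k\bar\ell}\Big(\frac{\partial h_{j\bar\ell}}{\partial z^i}+\frac{\partial h_{i\bar\ell}}{\partial z^j}\Big),\qquad \Gamma_{\bar ij}^k=\tfrac12 h^{k\bar\ell}\Big(\frac{\partial h_{j\bar\ell}}{\partial\bar z^i}-\frac{\partial h_{j\bar i}}{\partial\bar z^\ell}\Big).$$ The $(1,1)$ components of its curvature are $$\mathfrak R_{i\bar jk}^{\ell}=-\Big(\frac{\partial\Gamma_{ik}^\ell}{\partial\bar z^j}-\frac{\partial\Gamma_{\bar jk}^\ell}{\partial z^i}+\Gamma_{ik}^s\Gamma_{\bar js}^\ell-\Gamma_{\bar jk}^s\Gamma_{si}^\ell\Big).$$ The (first) Levi-Civita Ricci curvature is $\mathfrak{Ric}(\omega)=\sqrt{-1}\,\mathfrak R_{i\bar jk}^{k}\,dz^i\wedge d\bar z^j$ (sum over $k$). The metric $\omega$ is Levi-Civita Ricci-flat if $\mathfrak{Ric}(\omega)=0$. *)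

theory Defs
  imports "HOL-Analysis.Analysis" "HOL-Combinatorics.Permutations"
    "HOL-Library.Function_Algebras"
begin

section \<open>Calculus on open subsets of complex coordinate space\<close>

text \<open>The functions below are only ever tested on open sets.\<close>

definition holomorphic_Cn_on :: "(complex^'n \<Rightarrow> complex) \<Rightarrow> (complex^'n) set \<Rightarrow> bool" where
  "holomorphic_Cn_on f S \<longleftrightarrow>
     (\<forall>z\<in>S. \<exists>D. (f has_derivative D) (at z) \<and> (\<forall>c v. D (c *s v) = c * D v))"

text \<open>\<open>C\<^sup>k\<close> on an open set: by finite dimension it suffices to consider iterated
  directional derivatives in fixed directions.\<close>

primrec Ck_on :: "nat \<Rightarrow> ('v::euclidean_space \<Rightarrow> 'w::real_normed_vector) \<Rightarrow> 'v set \<Rightarrow> bool" where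
  "Ck_on 0 f S \<longleftrightarrow> continuous_on S f"
| "Ck_on (Suc k) f S \<longleftrightarrow>
     (\<forall>x\<in>S. f differentiable (at x)) \<and> (\<forall>v. Ck_on k (\<lambda>x. frechet_derivative f (at x) v) S)"

definition Cinf_on :: "('v::euclidean_space \<Rightarrow> 'w::real_normed_vector) \<Rightarrow> 'v set \<Rightarrow> bool" where
  "Cinf_on f S \<longleftrightarrow> (\<forall>k. Ck_on k f S)"

text \<open>Wirtinger derivatives \<open>\<partial>f/\<partial>z\<^sup>i\<close> and \<open>\<partial>f/\<partial>zbar\<^sup>i\<close>;
  the real coordinate directions of \<open>z\<^sup>i = x\<^sup>i + \<i> y\<^sup>i\<close> are \<open>axis i 1\<close> and \<open>axis i \<i>\<close>.\<close>

definition dz :: "'n \<Rightarrow> (complex^'n \<Rightarrow> complex) \<Rightarrow> complex^'n \<Rightarrow> complex" where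
  "dz i f z = (frechet_derivative f (at z) (axis i 1)
                 - \<i> * frechet_derivative f (at z) (axis i \<i>)) / 2"

definition dzbar :: "'n \<Rightarrow> (complex^'n \<Rightarrow> complex) \<Rightarrow> complex^'n \<Rightarrow> complex" where
  "dzbar i f z = (frechet_derivative f (at z) (axis i 1)
                 + \<i> * frechet_derivative f (at z) (axis i \<i>)) / 2"


section \<open>Complex-valued differential forms in coordinates\<close>

text \<open>A \<open>k\<close>-form is given at each point by its values on \<open>k\<close> tangent vectors
  \<open>v 0, \<dots>, v (k - 1)\<close>; the remaining entries of \<open>v\<close> are ignored, and the degree \<open>k\<close> is
  passed explicitly.  Tangent vectors of \<open>\<complex>\<^sup>n\<close> as a real manifold are elements of
  \<open>complex^'n\<close>.\<close>

type_synonym 'v form = "'v \<Rightarrow> (nat \<Rightarrow> 'v) \<Rightarrow> complex"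

text \<open>Normalised so that \<open>(\<alpha> \<and> \<beta>)(u, v) = \<alpha>(u) \<beta>(v) - \<alpha>(v) \<beta>(u)\<close> for 1-forms.\<close>

definition wedge :: "nat \<Rightarrow> nat \<Rightarrow> 'v form \<Rightarrow> 'v form \<Rightarrow> 'v form" where
  "wedge p q \<alpha> \<beta> = (\<lambda>x v. (\<Sum>\<sigma> | \<sigma> permutes {..<p + q}.
       of_int (sign \<sigma>) * \<alpha> x (\<lambda>i. v (\<sigma> i)) * \<beta> x (\<lambda>i. v (\<sigma> (p + i)))) / (fact p * fact q))"

primrec two_form_power :: "'v form \<Rightarrow> nat \<Rightarrow> 'v form" where
  "two_form_power \<omega> 0 = (\<lambda>x v. 1)"
| "two_form_power \<omega> (Suc k) = wedge 2 (2 * k) \<omega> (two_form_power \<omega> k)"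

definition ext_deriv :: "nat \<Rightarrow> 'v::real_normed_vector form \<Rightarrow> 'v form" where
  "ext_deriv k \<alpha> = (\<lambda>x v. \<Sum>i\<le>k. (-1) ^ i *
       frechet_derivative (\<lambda>y. \<alpha> y (\<lambda>j. if j < i then v j else v (Suc j))) (at x) (v i))"

text \<open>The \<open>(1,1)\<close>-form \<open>\<i> \<Sum> a\<^sub>i\<^sub>j dz\<^sup>i \<and> dzbar\<^sup>j\<close> with coefficient matrix \<open>a\<close>.\<close>

definition form11 :: "(complex^'n \<Rightarrow> complex^'n^'n) \<Rightarrow> (complex^'n) form" where
  "form11 a = (\<lambda>z v. \<i> * (\<Sum>i\<in>UNIV. \<Sum>j\<in>UNIV.
       a z $ i $ j * (v 0 $ i * cnj (v 1 $ j) - v 1 $ i * cnj (v 0 $ j))))"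


section \<open>Compact complex manifolds\<close>

text \<open>A chart is a pair of its domain and its coordinate map; the values of the coordinate map
  outside the domain are irrelevant.\<close>

type_synonym ('a, 'n) chart = "'a set \<times> ('a \<Rightarrow> complex^'n)"

definition dom_of :: "('a, 'n) chart \<Rightarrow> 'a set" where
  "dom_of c = fst c"

definition img_of :: "('a, 'n) chart \<Rightarrow> (complex^'n) set" where
  "img_of c = snd c ` fst c"

definition chart_inv :: "('a, 'n) chart \<Rightarrow> complex^'n \<Rightarrow> 'a" where
  "chart_inv c = inv_into (fst c) (snd c)"

definition complex_atlas :: "'a topology \<Rightarrow> ('a, 'n::finite) chart set \<Rightarrow> bool" where
  "complex_atlas X A \<longleftrightarrow>
     (\<forall>c\<in>A. openin X (dom_of c) \<and> open (img_of c) \<and>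
        homeomorphic_map (subtopology X (dom_of c)) (top_of_set (img_of c)) (snd c)) \<and>
     (\<Union>c\<in>A. dom_of c) = topspace X \<and>
     (\<forall>c\<in>A. \<forall>d\<in>A. \<forall>i. holomorphic_Cn_on (\<lambda>z. snd d (chart_inv c z) $ i)
        (snd c ` (dom_of c \<inter> dom_of d)))"

text \<open>Manifolds are connected, which is needed for a statement about the Kodaira dimension
  of \<open>X\<close>.  Second countability follows from compactness.\<close>

definition compact_complex_manifold :: "'a topology \<Rightarrow> ('a, 'n::finite) chart set \<Rightarrow> bool" where
  "compact_complex_manifold X A \<longleftrightarrow>
     topspace X \<noteq> {} \<and> Hausdorff_space X \<and> compact_space X \<and> connected_space X \<and>
     complex_atlas X A"

text \<open>\<open>jac c d p $ k $ i = \<partial>w\<^sup>k/\<partial>z\<^sup>i\<close> at \<open>p\<close>, with \<open>z\<close> the coordinates of \<open>c\<close> and \<open>w\<close> those of \<open>d\<close>.\<close>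

definition jac :: "('a, 'n::finite) chart \<Rightarrow> ('a, 'n) chart \<Rightarrow> 'a \<Rightarrow> complex^'n^'n" where
  "jac c d p = (\<chi> k i. dz i (\<lambda>z. snd d (chart_inv c z) $ k) (snd c p))"


section \<open>Line bundles and Kodaira dimension\<close>

text \<open>A holomorphic line bundle trivialised over the chart domains is given by its transition
  functions \<open>g c d\<close>: local representatives of a section satisfy \<open>s\<^sub>c = g c d \<cdot> s\<^sub>d\<close> on overlaps.
  For \<open>K\<^sub>X\<close>, the local frame on \<open>c\<close> is \<open>dz\<^sup>1 \<and> \<dots> \<and> dz\<^sup>n\<close>, and
  \<open>dw\<^sup>1 \<and> \<dots> \<and> dw\<^sup>n = det (\<partial>w/\<partial>z) dz\<^sup>1 \<and> \<dots> \<and> dz\<^sup>n\<close>.\<close>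

type_synonym ('a, 'n) line_bundle = "('a, 'n) chart \<Rightarrow> ('a, 'n) chart \<Rightarrow> 'a \<Rightarrow> complex"

definition trivial_bundle :: "('a, 'n) line_bundle" where
  "trivial_bundle = (\<lambda>c d p. 1)"

definition canonical_bundle :: "('a, 'n::finite) line_bundle" where
  "canonical_bundle = (\<lambda>c d p. det (jac c d p))"

definition tensor_power :: "('a, 'n) line_bundle \<Rightarrow> nat \<Rightarrow> ('a, 'n) line_bundle" where
  "tensor_power g m = (\<lambda>c d p. g c d p ^ m)"

definition holomorphic_in_chart :: "('a, 'n::finite) chart \<Rightarrow> ('a \<Rightarrow> complex) \<Rightarrow> bool" where
  "holomorphic_in_chart c f \<longleftrightarrow> holomorphic_Cn_on (\<lambda>z. f (chart_inv c z)) (img_of c)"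

definition bundle_iso ::
  "('a, 'n::finite) chart set \<Rightarrow> ('a, 'n) line_bundle \<Rightarrow> ('a, 'n) line_bundle \<Rightarrow> bool" where
  "bundle_iso A g g' \<longleftrightarrow> (\<exists>u :: ('a, 'n) chart \<Rightarrow> 'a \<Rightarrow> complex.
     (\<forall>c\<in>A. holomorphic_in_chart c (u c) \<and> (\<forall>p\<in>dom_of c. u c p \<noteq> 0)) \<and>
     (\<forall>c\<in>A. \<forall>d\<in>A. \<forall>p\<in>dom_of c \<inter> dom_of d. u c p * g c d p = g' c d p * u d p))"

text \<open>Global holomorphic sections \<open>H\<^sup>0\<close>.  Requiring the value 0 where a local representative is
  not meaningful makes the representation of a section unique.\<close>

definition sections ::
  "('a, 'n::finite) chart set \<Rightarrow> ('a, 'n) line_bundle \<Rightarrow> (('a, 'n) chart \<Rightarrow> 'a \<Rightarrow> complex) set" where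
  "sections A g = {s.
     (\<forall>c\<in>A. holomorphic_in_chart c (s c)) \<and>
     (\<forall>c\<in>A. \<forall>d\<in>A. \<forall>p\<in>dom_of c \<inter> dom_of d. s c p = g c d p * s d p) \<and>
     (\<forall>c p. c \<notin> A \<or> p \<notin> dom_of c \<longrightarrow> s c p = 0)}"

definition scale_family ::
  "complex \<Rightarrow> (('a, 'n) chart \<Rightarrow> 'a \<Rightarrow> complex) \<Rightarrow> ('a, 'n) chart \<Rightarrow> 'a \<Rightarrow> complex" where
  "scale_family k s = (\<lambda>c p. k * s c p)"

lemma vector_space_scale_family: "vector_space scale_family"
  by unfold_locales (auto simp: scale_family_def fun_eq_iff algebra_simps)

lemma subspace_sections: "module.subspace scale_family (sections A g)"
proof -
  interpret vector_space scale_family by (rule vector_space_scale_family)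
  have zero: "holomorphic_in_chart c (\<lambda>p. 0)" for c :: "('a, 'b) chart"
    unfolding holomorphic_in_chart_def holomorphic_Cn_on_def
    by (intro ballI exI[of _ "\<lambda>_. 0"]) simp
  have add: "holomorphic_in_chart c (\<lambda>p. s p + t p)"
    if s: "holomorphic_in_chart c s" and t: "holomorphic_in_chart c t"
    for c :: "('a, 'b) chart" and s t
    unfolding holomorphic_in_chart_def holomorphic_Cn_on_def
  proof
    fix z assume z: "z \<in> img_of c"
    obtain D where D: "((\<lambda>z. s (chart_inv c z)) has_derivative D) (at z)"
      "\<forall>k v. D (k *s v) = k * D v"
      using bspec[OF s[unfolded holomorphic_in_chart_def holomorphic_Cn_on_def] z]
      by (elim exE conjE)
    obtain E where E: "((\<lambda>z. t (chart_inv c z)) has_derivative E) (at z)"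
      "\<forall>k v. E (k *s v) = k * E v"
      using bspec[OF t[unfolded holomorphic_in_chart_def holomorphic_Cn_on_def] z]
      by (elim exE conjE)
    have "\<forall>k v. D (k *s v) + E (k *s v) = k * (D v + E v)"
      using D(2) E(2) by (simp only: distrib_left simp_thms)
    with has_derivative_add[OF D(1) E(1)]
    show "\<exists>D. ((\<lambda>z. s (chart_inv c z) + t (chart_inv c z)) has_derivative D) (at z)
        \<and> (\<forall>k v. D (k *s v) = k * D v)"
      by (intro exI[of _ "\<lambda>v. D v + E v"] conjI)
  qed
  have scale: "holomorphic_in_chart c (\<lambda>p. k * s p)"
    if s: "holomorphic_in_chart c s" for c :: "('a, 'b) chart" and s k
    unfolding holomorphic_in_chart_def holomorphic_Cn_on_def
  proof
    fix z assume z: "z \<in> img_of c"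
    obtain D where D: "((\<lambda>z. s (chart_inv c z)) has_derivative D) (at z)"
      "\<forall>k v. D (k *s v) = k * D v"
      using bspec[OF s[unfolded holomorphic_in_chart_def holomorphic_Cn_on_def] z]
      by (elim exE conjE)
    have "\<forall>l v. k * D (l *s v) = l * (k * D v)"
      using D(2) by (simp only: mult.left_commute simp_thms)
    with has_derivative_mult_right[OF D(1), of k]
    show "\<exists>D. ((\<lambda>z. k * s (chart_inv c z)) has_derivative D) (at z)
        \<and> (\<forall>k v. D (k *s v) = k * D v)"
      by (intro exI[of _ "\<lambda>v. k * D v"] conjI)
  qed
  show ?thesis
  proof (rule subspaceI)
    show "0 \<in> sections A g"
      unfolding sections_def by (simp add: zero zero_fun_def)
  next
    fix s t assume s: "s \<in> sections A g" and t: "t \<in> sections A g"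
    note s' = s[unfolded sections_def mem_Collect_eq] and t' = t[unfolded sections_def mem_Collect_eq]
    have "s c p + t c p = g c d p * (s d p + t d p)"
      if "c \<in> A" "d \<in> A" "p \<in> dom_of c \<inter> dom_of d" for c d p
    proof -
      have "s c p = g c d p * s d p" "t c p = g c d p * t d p"
        using s' t' that by blast+
      then show ?thesis by (simp only: distrib_left)
    qed
    moreover have "\<forall>c\<in>A. holomorphic_in_chart c (\<lambda>p. s c p + t c p)"
      using s' t' by (blast intro: add)
    moreover have "s c p + t c p = 0" if "c \<notin> A \<or> p \<notin> dom_of c" for c p
    proof -
      have "s c p = 0" "t c p = 0" using s' t' that by blast+
      then show ?thesis by simp
    qed
    ultimately show "s + t \<in> sections A g"
      unfolding sections_def plus_fun_def mem_Collect_eq by blast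
  next
    fix k s assume s: "s \<in> sections A g"
    note s' = s[unfolded sections_def mem_Collect_eq]
    have "k * s c p = g c d p * (k * s d p)"
      if "c \<in> A" "d \<in> A" "p \<in> dom_of c \<inter> dom_of d" for c d p
    proof -
      have "s c p = g c d p * s d p" using s' that by blast
      then show ?thesis by (simp only: mult.left_commute)
    qed
    moreover have "\<forall>c\<in>A. holomorphic_in_chart c (\<lambda>p. k * s c p)"
      using s' by (blast intro: scale)
    moreover have "k * s c p = 0" if "c \<notin> A \<or> p \<notin> dom_of c" for c p
    proof -
      have "s c p = 0" using s' that by blast
      then show ?thesis by simp
    qed
    ultimately show "scale_family k s \<in> sections A g"
      unfolding sections_def scale_family_def mem_Collect_eq by blast
  qed
qed

text \<open>On a compact manifold the space of sections is finite-dimensional, so the library's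
  convention of dimension 0 for infinite-dimensional spaces is never used.\<close>

definition h0 :: "('a, 'n::finite) chart set \<Rightarrow> ('a, 'n) line_bundle \<Rightarrow> nat" where
  "h0 A g = vector_space.dim scale_family (sections A g)"

definition kodaira_dim :: "('a, 'n::finite) chart set \<Rightarrow> ereal" where
  "kodaira_dim A = limsup (\<lambda>m. let d = h0 A (tensor_power canonical_bundle m) in
     (if d = 0 then - \<infinity> else ereal (ln (real d) / ln (real m))))"


section \<open>Hermitian metrics\<close>

text \<open>A metric is given by its coefficients \<open>h c z $ i $ j = h\<^sub>i\<^sub>j\<close> (second index conjugate) in each
  chart \<open>c\<close>, at the point with coordinates \<open>z\<close>; the last clause says that the local forms
  \<open>\<i> \<Sum> h\<^sub>i\<^sub>j dz\<^sup>i \<and> dzbar\<^sup>j\<close> agree on overlaps.\<close>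

type_synonym ('a, 'n) metric = "('a, 'n) chart \<Rightarrow> complex^'n \<Rightarrow> complex^'n^'n"

definition hermitian_metric :: "('a, 'n::finite) chart set \<Rightarrow> ('a, 'n) metric \<Rightarrow> bool" where
  "hermitian_metric A h \<longleftrightarrow>
     (\<forall>c\<in>A. (\<forall>i j. Cinf_on (\<lambda>z. h c z $ i $ j) (img_of c)) \<and>
        (\<forall>z\<in>img_of c. (\<forall>i j. h c z $ j $ i = cnj (h c z $ i $ j)) \<and>
           (\<forall>v. v \<noteq> 0 \<longrightarrow> 0 < Re (\<Sum>i\<in>UNIV. \<Sum>j\<in>UNIV. h c z $ i $ j * v $ i * cnj (v $ j))))) \<and>
     (\<forall>c\<in>A. \<forall>d\<in>A. \<forall>p\<in>dom_of c \<inter> dom_of d. \<forall>i j. h c (snd c p) $ i $ j =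
        (\<Sum>k\<in>UNIV. \<Sum>l\<in>UNIV. jac c d p $ k $ i * cnj (jac c d p $ l $ j) * h d (snd d p) $ k $ l))"

definition balanced :: "('a, 'n::finite) chart set \<Rightarrow> ('a, 'n) metric \<Rightarrow> bool" where
  "balanced A h \<longleftrightarrow> (\<forall>c\<in>A. \<forall>z\<in>img_of c. \<forall>v.
     ext_deriv (2 * (CARD('n) - 1)) (two_form_power (form11 (h c)) (CARD('n) - 1)) z v = 0)"

definition smooth_function :: "('a, 'n::finite) chart set \<Rightarrow> ('a \<Rightarrow> real) \<Rightarrow> bool" where
  "smooth_function A f \<longleftrightarrow> (\<forall>c\<in>A. Cinf_on (\<lambda>z. f (chart_inv c z)) (img_of c))"

definition conformal_metric :: "('a \<Rightarrow> real) \<Rightarrow> ('a, 'n::finite) metric \<Rightarrow> ('a, 'n) metric" where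
  "conformal_metric f h =
     (\<lambda>c z. \<chi> i j. complex_of_real (exp (f (chart_inv c z))) * h c z $ i $ j)"

definition conformally_balanced :: "('a, 'n::finite) chart set \<Rightarrow> ('a, 'n) metric \<Rightarrow> bool" where
  "conformally_balanced A h \<longleftrightarrow>
     (\<exists>f. smooth_function A f \<and> balanced A (conformal_metric f h))"


section \<open>Levi-Civita Ricci curvature\<close>

text \<open>All definitions in this section are in local coordinates, for the coefficient matrix \<open>h\<close>
  of a metric.  The inverse \<open>h\<^sup>k\<^sup>l\<close> is determined by \<open>\<Sum>\<^sub>l h\<^sup>k\<^sup>l h\<^sub>j\<^sub>l = \<delta>\<^sub>j\<^sub>k\<close>, whence the
  transposition.\<close>

definition inv_coeff :: "(complex^'n \<Rightarrow> complex^'n^'n) \<Rightarrow> complex^'n \<Rightarrow> 'n \<Rightarrow> 'n \<Rightarrow> complex" where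
  "inv_coeff h z k l = matrix_inv (transpose (h z)) $ k $ l"

text \<open>\<open>LC_Gamma h i j k = \<Gamma>\<^sub>i\<^sub>j\<^sup>k\<close>, and \<open>LC_Gammabar h i j k\<close> is the coefficient with the first lower
  index \<open>i\<close> conjugate: the coefficients of the connection on \<open>T\<^sup>1\<^sup>,\<^sup>0\<close> obtained by projecting the
  complexified Levi-Civita connection.\<close>

definition LC_Gamma ::
  "(complex^'n \<Rightarrow> complex^'n^'n) \<Rightarrow> 'n \<Rightarrow> 'n \<Rightarrow> 'n \<Rightarrow> complex^'n \<Rightarrow> complex" where
  "LC_Gamma h i j k z = (1/2) * (\<Sum>l\<in>UNIV. inv_coeff h z k l *
     (dz i (\<lambda>w. h w $ j $ l) z + dz j (\<lambda>w. h w $ i $ l) z))"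

definition LC_Gammabar ::
  "(complex^'n \<Rightarrow> complex^'n^'n) \<Rightarrow> 'n \<Rightarrow> 'n \<Rightarrow> 'n \<Rightarrow> complex^'n \<Rightarrow> complex" where
  "LC_Gammabar h i j k z = (1/2) * (\<Sum>l\<in>UNIV. inv_coeff h z k l *
     (dzbar i (\<lambda>w. h w $ j $ l) z - dzbar l (\<lambda>w. h w $ j $ i) z))"

definition LC_curvature ::
  "(complex^'n \<Rightarrow> complex^'n^'n) \<Rightarrow> 'n \<Rightarrow> 'n \<Rightarrow> 'n \<Rightarrow> 'n \<Rightarrow> complex^'n \<Rightarrow> complex" where
  "LC_curvature h i j k l z =
     - (dzbar j (LC_Gamma h i k l) z - dz i (LC_Gammabar h j k l) z
        + (\<Sum>s\<in>UNIV. LC_Gamma h i k s z * LC_Gammabar h j s l z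
                    - LC_Gammabar h j k s z * LC_Gamma h s i l z))"

definition LC_Ricci :: "(complex^'n \<Rightarrow> complex^'n^'n) \<Rightarrow> (complex^'n) form" where
  "LC_Ricci h = form11 (\<lambda>z. \<chi> i j. \<Sum>k\<in>UNIV. LC_curvature h i j k k z)"

definition LC_Ricci_flat :: "('a, 'n::finite) chart set \<Rightarrow> ('a, 'n) metric \<Rightarrow> bool" where
  "LC_Ricci_flat A h \<longleftrightarrow> (\<forall>c\<in>A. \<forall>z\<in>img_of c. \<forall>v. LC_Ricci (h c) z v = 0)"

end

theory Submission
  imports Defs "HOL-Complex_Analysis.Complex_Analysis"
begin

text \<open>Write \<open>\<alpha>\<^sub>i = \<Sum> h\<^sup>k\<^sup>l \<partial>\<^sub>k h\<^sub>i\<^sub>l\<close>.  In the trace of the Levi-Civita curvature the quadratic terms cancel, and so do the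
  second derivatives of \<open>log det h\<close>; the Ricci form has coefficients \<open>-1/2\<close> times \<open>\<partial>bar\<^sub>j \<alpha>\<^sub>i\<close> plus the conjugate of
  \<open>\<partial>bar\<^sub>i \<alpha>\<^sub>j\<close> (\<open>ricci_trace\<close>).  Flatness therefore says that the matrix \<open>\<partial>bar\<^sub>j \<alpha>\<^sub>i\<close> is skew-hermitian, so its trace with respect to
  \<open>h\<close> is imaginary.  On the other hand \<open>\<Sum>\<^sub>k \<partial>\<^sub>k h\<^sup>k\<^sup>j = - \<Sum>\<^sub>a \<alpha>\<^sub>a h\<^sup>a\<^sup>j\<close> (\<open>divergence_Q\<close>), so \<open>\<alpha>\<close> measures the failure of the
  Laplacian \<open>\<Sum> h\<^sup>i\<^sup>j \<partial>\<^sub>i \<partial>bar\<^sub>j\<close> to be in divergence form.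

  Let \<open>s\<close> be a holomorphic section of \<open>K\<^sup>m\<close>, \<open>m \<ge> 1\<close>.  Then \<open>N = |s|\<^sup>2\<^sup>/\<^sup>m\<close> is a density, so \<open>N\<close> times the Laplacian of a
  function can be integrated over the manifold, with integral 0 for the constant function 1.  Integrating by parts
  moves the Laplacian to \<open>N\<close>, where it becomes \<open>N (|S|\<^sup>2 + tr \<partial>bar S)\<close> with \<open>S = \<partial> log N - \<alpha>\<close> (\<open>adjoint_density\<close>).
  Since \<open>log |s|\<^sup>2\<close> is pluriharmonic and the trace of \<open>\<partial>bar \<alpha>\<close> is imaginary, the real part is \<open>N |S|\<^sup>2\<close>, whose integral
  vanishes.  So \<open>S = 0\<close>, that is, \<open>\<partial>s = m \<alpha> s\<close> (\<open>section_ode\<close>).  The zeros of \<open>s\<close>, where \<open>N\<close> is not smooth, are handled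
  by replacing \<open>|s|\<^sup>2\<close> with \<open>|s|\<^sup>2 + \<epsilon> (det h)\<^sup>m\<close>; the resulting error is at most a constant times \<open>\<epsilon>\<^sup>1\<^sup>/\<^sup>m\<close>
  (\<open>P_lower_bound\<close>).

  The equation \<open>\<partial>s = m \<alpha> s\<close> is a linear ordinary differential equation along every line segment, so on the connected
  manifold \<open>s\<close> is identically 0 or has no zero (\<open>section_dichotomy\<close>).  Hence any two sections of \<open>K\<^sup>m\<close> are
  proportional, all plurigenera are at most 1, and either all of them vanish or \<open>\<kappa> = 0\<close> and a section without zeros
  trivialises some \<open>K\<^sup>m\<close>.

  In the second case the conformal factor is given by \<open>e\<^sup>(\<^sup>n\<^sup>-\<^sup>1\<^sup>)\<^sup>f = |s|\<^sup>2\<^sup>/\<^sup>m / det h\<close>: up to constant factors the coefficients of \<open>\<omega>\<^sup>n\<^sup>-\<^sup>1\<close>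
  are the cofactors \<open>det h h\<^sup>p\<^sup>q\<close>, so a metric is balanced as soon as \<open>\<Sum>\<^sub>p \<partial>\<^sub>p (det h h\<^sup>p\<^sup>q) = 0\<close>
  (\<open>closed_power_of_divergence_free\<close>).  For the rescaled metric these cofactors are \<open>|s|\<^sup>2\<^sup>/\<^sup>m h\<^sup>p\<^sup>q\<close>, whose divergence
  vanishes because \<open>\<partial> |s|\<^sup>2\<^sup>/\<^sup>m = |s|\<^sup>2\<^sup>/\<^sup>m \<alpha>\<close>.\<close>

unbundle no fps_syntax

section \<open>Functions of class \<open>C\<^sup>k\<close>\<close>

lemma frechet_derivative_cong_open:
  assumes "open S" "x \<in> S" "\<And>y. y \<in> S \<Longrightarrow> f y = g y"
  shows "frechet_derivative f (at x) = frechet_derivative g (at x)"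
proof -
  have "(f has_derivative D) (at x) \<longleftrightarrow> (g has_derivative D) (at x)" for D
    using assms has_derivative_transform_within_open[of f D x UNIV S g]
      has_derivative_transform_within_open[of g D x UNIV S f] by auto
  then show ?thesis unfolding frechet_derivative_def by simp
qed

lemma differentiable_cong_open:
  assumes "open S" "x \<in> S" "\<And>y. y \<in> S \<Longrightarrow> f y = g y"
  shows "f differentiable (at x) \<longleftrightarrow> g differentiable (at x)"
  using assms has_derivative_transform_within_open[of f _ x UNIV S g]
      has_derivative_transform_within_open[of g _ x UNIV S f] unfolding differentiable_def by metis

lemma frechet_derivative_eqI: "(f has_derivative D) (at x) \<Longrightarrow> frechet_derivative f (at x) v = D v"
  using frechet_derivative_at by metis

lemma Ck_on_cong:
  assumes "open S" "\<And>x. x \<in> S \<Longrightarrow> f x = g x"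
  shows "Ck_on k f S \<longleftrightarrow> Ck_on k g S"
  using assms(2)
proof (induction k arbitrary: f g)
  case 0
  then show ?case using continuous_on_cong[of S S f g] by simp
next
  case (Suc k)
  have "Ck_on k (\<lambda>x. frechet_derivative f (at x) v) S \<longleftrightarrow> Ck_on k (\<lambda>x. frechet_derivative g (at x) v) S" for v
    by (rule Suc.IH) (metis frechet_derivative_cong_open assms(1) Suc.prems)
  moreover have "f differentiable (at x) \<longleftrightarrow> g differentiable (at x)" if "x \<in> S" for x
    using differentiable_cong_open[OF assms(1) that] Suc.prems by blast
  ultimately show ?case by simp
qed

lemma Ck_on_subset: "Ck_on k f T \<Longrightarrow> S \<subseteq> T \<Longrightarrow> Ck_on k f S"
  by (induction k arbitrary: f) (auto intro: continuous_on_subset)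

lemma Ck_on_lower: "Ck_on (Suc k) f S \<Longrightarrow> Ck_on k f S"
proof (induction k arbitrary: f)
  case 0
  then show ?case
    by (auto intro!: continuous_at_imp_continuous_on differentiable_imp_continuous_within)
next
  case (Suc k)
  have "\<forall>x\<in>S. f differentiable (at x)" "\<And>v. Ck_on (Suc k) (\<lambda>x. frechet_derivative f (at x) v) S"
    using Suc.prems unfolding Ck_on.simps(2)[of "Suc k"] by blast+
  with Suc.IH show ?case unfolding Ck_on.simps(2)[of k] by blast
qed

lemma Ck_on_le: "Ck_on k f S \<Longrightarrow> j \<le> k \<Longrightarrow> Ck_on j f S"
proof (induction k)
  case (Suc k)
  then show ?case using Ck_on_lower[of k f S] by (cases "j = Suc k") auto
qed auto

lemma Ck_on_continuous: "Ck_on k f S \<Longrightarrow> continuous_on S f"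
  using Ck_on_le[of k f S 0] by simp

lemma Ck_on_frechet: "Ck_on (Suc k) f S \<Longrightarrow> Ck_on k (\<lambda>x. frechet_derivative f (at x) v) S"
  by simp

lemma Ck_on_differentiable: "Ck_on k f S \<Longrightarrow> 1 \<le> k \<Longrightarrow> x \<in> S \<Longrightarrow> f differentiable (at x)"
  using Ck_on_le[of k f S "Suc 0"] by simp

lemma Ck_on_has_derivative:
  "Ck_on k f S \<Longrightarrow> 1 \<le> k \<Longrightarrow> x \<in> S \<Longrightarrow> (f has_derivative frechet_derivative f (at x)) (at x)"
  using Ck_on_differentiable frechet_derivative_works by blast

lemma Ck_on_SucI:
  assumes "open S" "\<And>x. x \<in> S \<Longrightarrow> (f has_derivative D x) (at x)"
    and "\<And>v. Ck_on k (\<lambda>x. D x v) S"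
  shows "Ck_on (Suc k) f S"
proof -
  have "frechet_derivative f (at x) v = D x v" if "x \<in> S" for x v
    using frechet_derivative_eqI[OF assms(2)[OF that]] .
  then have "Ck_on k (\<lambda>x. frechet_derivative f (at x) v) S" for v
    using Ck_on_cong[OF assms(1), of "\<lambda>x. frechet_derivative f (at x) v" "\<lambda>x. D x v"] assms(3) by simp
  then show ?thesis using assms(2) by (auto simp: differentiable_def)
qed

lemma Ck_on_Un:
  assumes "open S" "open T" "Ck_on k f S" "Ck_on k f T"
  shows "Ck_on k f (S \<union> T)"
  using assms(3,4)
  by (induction k arbitrary: f) (auto intro: continuous_on_open_Un assms(1,2))

lemma Ck_on_const: "Ck_on k (\<lambda>x. c) S"
  by (induction k arbitrary: c) (auto simp: frechet_derivative_const)

lemma Ck_on_bounded_linear: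
  fixes f :: "'v::euclidean_space \<Rightarrow> 'w::real_normed_vector"
  assumes "bounded_linear L" "open S" "Ck_on k f S"
  shows "Ck_on k (\<lambda>x. L (f x)) S"
  using assms(3)
proof (induction k arbitrary: f)
  case 0
  then show ?case using bounded_linear.continuous_on[OF assms(1)] by simp
next
  case (Suc k)
  show ?case
  proof (rule Ck_on_SucI[OF assms(2)])
    show "((\<lambda>x. L (f x)) has_derivative (\<lambda>v. L (frechet_derivative f (at x) v))) (at x)" if "x \<in> S" for x
      using bounded_linear.has_derivative[OF assms(1) Ck_on_has_derivative[OF Suc.prems _ that]] by simp
    show "Ck_on k (\<lambda>x. L (frechet_derivative f (at x) v)) S" for v
      using Suc by simp
  qed
qed

lemma Ck_on_add:
  assumes "open S" "Ck_on k f S" "Ck_on k g S"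
  shows "Ck_on k (\<lambda>x. f x + g x) S"
  using assms(2,3)
proof (induction k arbitrary: f g)
  case 0
  then show ?case by (simp add: continuous_on_add)
next
  case (Suc k)
  show ?case
  proof (rule Ck_on_SucI[OF assms(1)])
    show "((\<lambda>x. f x + g x) has_derivative
        (\<lambda>v. frechet_derivative f (at x) v + frechet_derivative g (at x) v)) (at x)" if "x \<in> S" for x
      using has_derivative_add[OF Ck_on_has_derivative[OF Suc.prems(1) _ that] Ck_on_has_derivative[OF Suc.prems(2) _ that]] by simp
    show "Ck_on k (\<lambda>x. frechet_derivative f (at x) v + frechet_derivative g (at x) v) S" for v
      using Suc by simp
  qed
qed

lemma Ck_on_bilinear:
  assumes "bounded_bilinear B" "open S" "Ck_on k f S" "Ck_on k g S"
  shows "Ck_on k (\<lambda>x. B (f x) (g x)) S"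
  using assms(3,4)
proof (induction k arbitrary: f g)
  case 0
  then show ?case using bounded_bilinear.continuous_on[OF assms(1)] by simp
next
  case (Suc k)
  show ?case
  proof (rule Ck_on_SucI[OF assms(2)])
    show "((\<lambda>x. B (f x) (g x)) has_derivative
        (\<lambda>v. B (f x) (frechet_derivative g (at x) v) + B (frechet_derivative f (at x) v) (g x))) (at x)" if "x \<in> S" for x
      using bounded_bilinear.FDERIV[OF assms(1) Ck_on_has_derivative[OF Suc.prems(1) _ that] Ck_on_has_derivative[OF Suc.prems(2) _ that]] by simp
    show "Ck_on k (\<lambda>x. B (f x) (frechet_derivative g (at x) v) + B (frechet_derivative f (at x) v) (g x)) S" for v
      using Suc.IH[OF Ck_on_lower[OF Suc.prems(1)] Ck_on_frechet[OF Suc.prems(2)]]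
        Suc.IH[OF Ck_on_frechet[OF Suc.prems(1)] Ck_on_lower[OF Suc.prems(2)]]
      by (intro Ck_on_add[OF assms(2)])
  qed
qed

lemmas Ck_on_mult = Ck_on_bilinear[OF bounded_bilinear_mult]
lemmas Ck_on_minus = Ck_on_bounded_linear[OF bounded_linear_minus[OF bounded_linear_ident]]
lemmas Ck_on_cnj = Ck_on_bounded_linear[OF bounded_linear_cnj]
lemmas Ck_on_Re = Ck_on_bounded_linear[OF bounded_linear_Re]
lemmas Ck_on_of_real = Ck_on_bounded_linear[OF bounded_linear_of_real]

lemma Ck_on_diff: "open S \<Longrightarrow> Ck_on k f S \<Longrightarrow> Ck_on k g S \<Longrightarrow> Ck_on k (\<lambda>x. f x - g x) S"
  using Ck_on_add[of S k f "\<lambda>x. - g x"] Ck_on_minus[of S k g] by simp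

lemma Ck_on_sum:
  assumes "open S" "\<And>i. i \<in> I \<Longrightarrow> Ck_on k (f i) S"
  shows "Ck_on k (\<lambda>x. \<Sum>i\<in>I. f i x) S"
  using assms(2)
  by (induction I rule: infinite_finite_induct) (auto intro: Ck_on_add[OF assms(1)] Ck_on_const)

lemma Ck_on_prod:
  fixes f :: "'i \<Rightarrow> 'v::euclidean_space \<Rightarrow> 'w::{real_normed_algebra_1, comm_ring_1}"
  assumes "open S" "\<And>i. i \<in> I \<Longrightarrow> Ck_on k (f i) S"
  shows "Ck_on k (\<lambda>x. \<Prod>i\<in>I. f i x) S"
  using assms(2)
  by (induction I rule: infinite_finite_induct) (auto intro: Ck_on_mult[OF assms(1)] Ck_on_const)

lemma Ck_on_power:
  fixes f :: "'v::euclidean_space \<Rightarrow> 'w::{real_normed_algebra_1, comm_ring_1}"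
  assumes "open S" "Ck_on k f S"
  shows "Ck_on k (\<lambda>x. f x ^ m) S"
  using Ck_on_prod[OF assms(1), of "{..<m}" k "\<lambda>_. f"] assms by simp

text \<open>The derivatives \<open>\<phi> 1, \<phi> 2, \<dots>\<close> of \<open>\<phi> 0\<close> are passed along because the chain rule then reproduces a statement of the same shape,
  with \<open>\<phi> (Suc i)\<close> in place of \<open>\<phi> i\<close>.\<close>

lemma Ck_on_field_compose:
  fixes f :: "'v::euclidean_space \<Rightarrow> 'k::real_normed_field" and \<phi> :: "nat \<Rightarrow> 'k \<Rightarrow> 'k"
  assumes "open S" "Ck_on k f S" "\<And>x. x \<in> S \<Longrightarrow> f x \<in> T"
    and "\<And>i y. i < k \<Longrightarrow> y \<in> T \<Longrightarrow> (\<phi> i has_field_derivative \<phi> (Suc i) y) (at y)"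
    and "continuous_on T (\<phi> k)"
  shows "Ck_on k (\<lambda>x. \<phi> 0 (f x)) S"
proof -
  have "Ck_on l (\<lambda>x. \<phi> j (f x)) S" if "j + l = k" for l j
    using that
  proof (induction l arbitrary: j)
    case 0
    then show ?case
      using continuous_on_compose2[OF assms(5) Ck_on_continuous[OF assms(2)]] assms(3) by auto
  next
    case (Suc l)
    show ?case
    proof (rule Ck_on_SucI[OF assms(1)])
      fix x assume x: "x \<in> S"
      show "((\<lambda>x. \<phi> j (f x)) has_derivative (\<lambda>v. \<phi> (Suc j) (f x) * frechet_derivative f (at x) v)) (at x)"
        using has_derivative_compose[OF Ck_on_has_derivative[OF assms(2) _ x],
            of "\<phi> j" "(*) (\<phi> (Suc j) (f x))"] assms(4)[of j "f x"] Suc.prems assms(3)[OF x]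
        by (auto simp: has_field_derivative_def)
    next
      fix v
      have "Ck_on (Suc l) f S" using Ck_on_le[OF assms(2), of "Suc l"] Suc.prems by simp
      then show "Ck_on l (\<lambda>x. \<phi> (Suc j) (f x) * frechet_derivative f (at x) v) S"
        using Suc.IH[of "Suc j"] Suc.prems by (intro Ck_on_mult[OF assms(1)]) auto
    qed
  qed
  then show ?thesis by simp
qed

lemma inverse_derivative_chain:
  "y \<noteq> 0 \<Longrightarrow> ((\<lambda>z. (-1) ^ i * fact i / z ^ Suc i) has_field_derivative
      (-1) ^ Suc i * fact (Suc i) / y ^ Suc (Suc i)) (at (y::'k::real_normed_field))"
  by (rule derivative_eq_intros refl | simp)+

lemma Ck_on_inverse:
  fixes f :: "'v::euclidean_space \<Rightarrow> 'k::real_normed_field"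
  assumes "open S" "Ck_on k f S" "\<And>x. x \<in> S \<Longrightarrow> f x \<noteq> 0"
  shows "Ck_on k (\<lambda>x. inverse (f x)) S"
proof -
  have "Ck_on k (\<lambda>x. (-1) ^ 0 * fact 0 / f x ^ Suc 0) S"
  proof (rule Ck_on_field_compose[OF assms(1,2), of "-{0}" "\<lambda>i z. (-1) ^ i * fact i / z ^ Suc i"])
    show "continuous_on (-{0}) (\<lambda>z::'k. (-1) ^ k * fact k / z ^ Suc k)"
      by (intro continuous_intros) auto
    show "((\<lambda>z::'k. (-1) ^ i * fact i / z ^ Suc i) has_field_derivative
        (-1) ^ Suc i * fact (Suc i) / y ^ Suc (Suc i)) (at y)" if "y \<in> -{0}" for i y
      using that by (intro inverse_derivative_chain) auto
  qed (use assms(3) in auto)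
  then show ?thesis by (simp add: inverse_eq_divide)
qed

lemma Ck_on_divide:
  fixes f :: "'v::euclidean_space \<Rightarrow> 'k::real_normed_field"
  assumes "open S" "Ck_on k f S" "Ck_on k g S" "\<And>x. x \<in> S \<Longrightarrow> g x \<noteq> 0"
  shows "Ck_on k (\<lambda>x. f x / g x) S"
  using Ck_on_mult[OF assms(1,2) Ck_on_inverse[OF assms(1,3,4)]] by (simp add: divide_inverse)

lemma Ck_on_ln:
  fixes f :: "'v::euclidean_space \<Rightarrow> real"
  assumes "open S" "Ck_on k f S" "\<And>x. x \<in> S \<Longrightarrow> f x > 0"
  shows "Ck_on k (\<lambda>x. ln (f x)) S"
proof -
  define \<phi> :: "nat \<Rightarrow> real \<Rightarrow> real" where
    "\<phi> i = (case i of 0 \<Rightarrow> ln | Suc j \<Rightarrow> (\<lambda>z. (-1) ^ j * fact j / z ^ Suc j))" for i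
  have "Ck_on k (\<lambda>x. \<phi> 0 (f x)) S"
  proof (rule Ck_on_field_compose[OF assms(1,2), of "{0<..}"])
    show "(\<phi> i has_field_derivative \<phi> (Suc i) y) (at y)" if "y \<in> {0<..}" for i y
      using inverse_derivative_chain[of y] that DERIV_ln_divide[of y]
      by (cases i) (auto simp: \<phi>_def)
    show "continuous_on {0<..} (\<phi> k)"
      by (cases k) (auto simp: \<phi>_def intro!: continuous_intros)
  qed (use assms in auto)
  then show ?thesis by (simp add: \<phi>_def)
qed

lemma Ck_on_powr:
  fixes f :: "'v::euclidean_space \<Rightarrow> real"
  assumes "open S" "Ck_on k f S" "\<And>x. x \<in> S \<Longrightarrow> f x > 0"
  shows "Ck_on k (\<lambda>x. f x powr a) S"
proof -
  define \<phi> :: "nat \<Rightarrow> real \<Rightarrow> real" where "\<phi> i = (\<lambda>z. (\<Prod>j<i. a - real j) * z powr (a - real i))" for i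
  have "Ck_on k (\<lambda>x. \<phi> 0 (f x)) S"
  proof (rule Ck_on_field_compose[OF assms(1,2), of "{0<..}"])
    show "(\<phi> i has_field_derivative \<phi> (Suc i) y) (at y)" if y: "y \<in> {0<..}" for i y
    proof -
      have "((\<lambda>z. z powr (a - real i)) has_real_derivative (a - real i) * y powr (a - real i - 1)) (at y)"
        using y by (intro has_real_derivative_powr) auto
      from DERIV_cmult[OF this, of "\<Prod>j<i. a - real j"] show ?thesis
        by (simp add: \<phi>_def mult.assoc algebra_simps)
    qed
    show "continuous_on {0<..} (\<phi> k)"
      by (auto simp: \<phi>_def intro!: continuous_intros)
  qed (use assms in auto)
  then show ?thesis by (simp add: \<phi>_def)
qed

text \<open>The cube of the positive part is twice continuously differentiable on the real line, with second derivative \<open>6 max 0 y\<close>.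
  It serves as a cut-off function; two derivatives are all that the Laplacian needs.\<close>

lemma C2_max_cube:
  fixes f :: "'v::euclidean_space \<Rightarrow> real"
  assumes "open S" "Ck_on 2 f S"
  shows "Ck_on 2 (\<lambda>x. max 0 (f x) ^ 3) S"
proof -
  have d: "((\<lambda>y. max 0 y ^ Suc (Suc n)) has_real_derivative real (Suc (Suc n)) * max 0 x ^ Suc n) (at x)" for x :: real and n
  proof (cases x "0::real" rule: linorder_cases)
    case less
    have "((\<lambda>y::real. 0) has_real_derivative 0) (at x)" by simp
    then show ?thesis
      using less by (auto intro: has_field_derivative_transform_within_open[of "\<lambda>_. 0" 0 x "{..<0}"])
  next
    case greater
    have "((\<lambda>y. y ^ Suc (Suc n)) has_real_derivative real (Suc (Suc n)) * x ^ Suc n) (at x)"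
      by (rule derivative_eq_intros refl | simp)+
    then show ?thesis
      using greater by (simp only: max.absorb2[OF less_imp_le[OF greater]])
        (rule has_field_derivative_transform_within_open[of "\<lambda>y. y ^ Suc (Suc n)" _ x "{0<..}"], auto)
  next
    case equal
    have "((\<lambda>h. max 0 h ^ Suc (Suc n) / h) \<longlongrightarrow> 0) (at (0::real))"
    proof (rule Lim_null_comparison)
      show "\<forall>\<^sub>F h in at 0. norm (max 0 h ^ Suc (Suc n) / h) \<le> \<bar>h\<bar> ^ Suc n"
      proof (rule always_eventually, rule allI)
        fix h :: real
        show "norm (max 0 h ^ Suc (Suc n) / h) \<le> \<bar>h\<bar> ^ Suc n"
          using zero_le_power[of "\<bar>h\<bar>" "Suc n"]
          by (cases "h > 0") (simp add: max.absorb2 abs_mult, simp add: max.absorb1 del: power_Suc)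
      qed
      show "((\<lambda>h. \<bar>h\<bar> ^ Suc n) \<longlongrightarrow> 0) (at (0::real))"
        by (rule tendsto_eq_intros refl | simp)+
    qed
    then show ?thesis using equal by (simp add: DERIV_def)
  qed
  define \<phi> :: "nat \<Rightarrow> real \<Rightarrow> real" where
    "\<phi> i = (if i = 0 then (\<lambda>y. max 0 y ^ 3) else if i = 1 then (\<lambda>y. 3 * max 0 y ^ 2) else (\<lambda>y. 6 * max 0 y))" for i
  have "Ck_on 2 (\<lambda>x. \<phi> 0 (f x)) S"
  proof (rule Ck_on_field_compose[OF assms(1,2), of UNIV])
    show "(\<phi> i has_field_derivative \<phi> (Suc i) y) (at y)" if "i < 2" for i y
    proof -
      have "i = 0 \<or> i = 1" using that by auto
      then show ?thesis
        using d[of 1 y] DERIV_cmult[OF d[of 0 y], of 3]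
        by (auto simp: \<phi>_def numeral_3_eq_3 numeral_2_eq_2)
    qed
    show "continuous_on UNIV (\<phi> 2)"
      by (auto simp: \<phi>_def intro!: continuous_intros)
  qed auto
  then show ?thesis by (simp add: \<phi>_def)
qed

lemma frechet_directional:
  assumes "f differentiable (at (x + t *\<^sub>R w))"
  shows "((\<lambda>t. f (x + t *\<^sub>R w)) has_vector_derivative frechet_derivative f (at (x + t *\<^sub>R w)) w) (at t)"
proof -
  have D: "(f has_derivative frechet_derivative f (at (x + t *\<^sub>R w))) (at (x + t *\<^sub>R w))"
    using assms frechet_derivative_works by blast
  have "((\<lambda>t. x + t *\<^sub>R w) has_derivative (\<lambda>s. s *\<^sub>R w)) (at t)"
    by (auto intro!: derivative_eq_intros)
  from has_derivative_compose[OF this D] show ?thesis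
    unfolding has_vector_derivative_def
    using linear_scale[OF has_derivative_linear[OF D]] by simp
qed

text \<open>Integrating \<open>\<partial>\<^sub>v \<partial>\<^sub>w f\<close> along the segment from \<open>x\<close> to \<open>x + t w\<close> gives
  \<open>\<partial>\<^sub>v f (x + t w) - \<partial>\<^sub>v f x\<close>, whose derivative at \<open>t = 0\<close> is \<open>\<partial>\<^sub>w \<partial>\<^sub>v f x\<close>.\<close>

lemma frechet_derivative_commute:
  fixes f :: "'v::euclidean_space \<Rightarrow> 'w::banach"
  assumes "open S" "Ck_on 2 f S" "x \<in> S"
  shows "frechet_derivative (\<lambda>x. frechet_derivative f (at x) v) (at x) w
       = frechet_derivative (\<lambda>x. frechet_derivative f (at x) w) (at x) v"
proof -
  define fv where "fv = (\<lambda>x. frechet_derivative f (at x) v)"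
  define fw where "fw = (\<lambda>x. frechet_derivative f (at x) w)"
  define fvw where "fvw = (\<lambda>x. frechet_derivative fw (at x) v)"
  have f2: "Ck_on (Suc (Suc 0)) f S" using assms(2) by (simp only: numeral_2_eq_2)
  have fv: "Ck_on (Suc 0) fv S" and fw: "Ck_on (Suc 0) fw S"
    using Ck_on_frechet[OF f2] unfolding fv_def fw_def by auto
  have fvw: "continuous_on S fvw" using Ck_on_frechet[OF fw] unfolding fvw_def by simp
  obtain e where e: "e > 0" "cball x e \<subseteq> S"
    using assms(1,3) open_contains_cball by blast
  \<comment> \<open>small enough for all points \<open>x + s v + t w\<close> with \<open>\<bar>s\<bar>, \<bar>t\<bar> \<le> r\<close> to stay in \<open>S\<close>\<close>
  define r where "r = e / (norm v + norm w + 1)"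
  have r: "r > 0" unfolding r_def using e by (smt (verit) divide_pos_pos norm_ge_zero)
  have in_S: "x + s *\<^sub>R v + t *\<^sub>R w \<in> S" if "\<bar>s\<bar> \<le> r" "\<bar>t\<bar> \<le> r" for s t
  proof -
    have "norm (s *\<^sub>R v + t *\<^sub>R w) \<le> \<bar>s\<bar> * norm v + \<bar>t\<bar> * norm w"
      by (metis norm_scaleR norm_triangle_ineq)
    also have "\<dots> \<le> r * norm v + r * norm w" using that by (intro add_mono mult_right_mono) auto
    also have "\<dots> \<le> r * (norm v + norm w + 1)" using r by (simp add: algebra_simps)
    also have "\<dots> = e" unfolding r_def by (smt (verit) nonzero_eq_divide_eq norm_ge_zero)
    finally have "x + (s *\<^sub>R v + t *\<^sub>R w) \<in> cball x e"
      using norm_minus_cancel[of "s *\<^sub>R v + t *\<^sub>R w"] by (simp add: dist_norm)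
    then show ?thesis using e by (auto simp: add.assoc)
  qed
  \<comment> \<open>both sides are derivatives at \<open>s = 0\<close> of \<open>f (x + s v + t w) - f (x + s v)\<close>\<close>
  have w_line: "fv (x + t *\<^sub>R w) - fv x = integral {0..t} (\<lambda>u. fvw (x + u *\<^sub>R w))" if t: "0 \<le> t" "t \<le> r" for t
  proof -
    have ftc: "integral (cbox 0 t) (\<lambda>u. fw (x + s *\<^sub>R v + u *\<^sub>R w)) = f (x + s *\<^sub>R v + t *\<^sub>R w) - f (x + s *\<^sub>R v)"
      if "s \<in> {-r..r}" for s
    proof -
      have "((\<lambda>u. fw (x + s *\<^sub>R v + u *\<^sub>R w)) has_integral f (x + s *\<^sub>R v + t *\<^sub>R w) - f (x + s *\<^sub>R v + 0 *\<^sub>R w)) {0..t}"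
        unfolding fw_def
        by (rule fundamental_theorem_of_calculus[OF t(1)])
          (use that t in_S[of s] Ck_on_differentiable[OF f2] in \<open>auto intro!: has_vector_derivative_at_within[OF frechet_directional]\<close>)
      then show ?thesis by (simp add: integral_unique)
    qed
    have cont: "continuous_on ({-r..r} \<times> cbox 0 t) (\<lambda>(s, u). F (x + s *\<^sub>R v + u *\<^sub>R w))"
      if "continuous_on S F" for F :: "'v \<Rightarrow> 'w"
      unfolding split_beta
      by (rule continuous_on_compose2[OF that]) (use t in_S in \<open>auto intro!: continuous_intros\<close>)
    have "((\<lambda>s. integral (cbox 0 t) (\<lambda>u. fw (x + s *\<^sub>R v + u *\<^sub>R w))) has_vector_derivative
          integral (cbox 0 t) (\<lambda>u. fvw (x + 0 *\<^sub>R v + u *\<^sub>R w))) (at 0 within {-r..r})"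
    proof (rule leibniz_rule_vector_derivative)
      fix s u assume "s \<in> {-r..r}" "u \<in> cbox 0 t"
      then have *: "x + u *\<^sub>R w + s *\<^sub>R v \<in> S" using in_S[of s u] t by (auto simp: algebra_simps)
      show "((\<lambda>s. fw (x + s *\<^sub>R v + u *\<^sub>R w)) has_vector_derivative fvw (x + s *\<^sub>R v + u *\<^sub>R w)) (at s within {-r..r})"
        using frechet_directional[of fw "x + u *\<^sub>R w" s v] Ck_on_differentiable[OF fw _ *]
        by (auto simp: fvw_def algebra_simps intro: has_vector_derivative_at_within)
    next
      fix s assume "s \<in> {-r..r}"
      then show "(\<lambda>u. fw (x + s *\<^sub>R v + u *\<^sub>R w)) integrable_on cbox 0 t"
        using t in_S by (intro integrable_continuous continuous_on_compose2[OF Ck_on_continuous[OF fw]] continuous_intros) auto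
    next
      show "continuous_on ({- r..r} \<times> cbox 0 t) (\<lambda>(s, u). fvw (x + s *\<^sub>R v + u *\<^sub>R w))"
        by (rule cont[OF fvw])
    qed (use r in auto)
    then have "((\<lambda>s. integral (cbox 0 t) (\<lambda>u. fw (x + s *\<^sub>R v + u *\<^sub>R w))) has_vector_derivative
          integral (cbox 0 t) (\<lambda>u. fvw (x + u *\<^sub>R w))) (at 0 within {-r..r})" by simp
    then have 1: "((\<lambda>s. f (x + s *\<^sub>R v + t *\<^sub>R w) - f (x + s *\<^sub>R v)) has_vector_derivative
          integral (cbox 0 t) (\<lambda>u. fvw (x + u *\<^sub>R w))) (at 0 within {-r..r})"
      by (rule has_vector_derivative_transform[of 0 "{-r..r}" _ "\<lambda>s. integral (cbox 0 t) (\<lambda>u. fw (x + s *\<^sub>R v + u *\<^sub>R w))", rotated 2])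
        (use r ftc in auto)
    have d: "((\<lambda>s. f (y + s *\<^sub>R v)) has_vector_derivative fv y) (at 0)" if "y \<in> S" for y
      using frechet_directional[of f y 0 v] Ck_on_differentiable[OF f2 _ that] by (simp add: fv_def)
    have xt: "x + t *\<^sub>R w \<in> S" using in_S[of 0 t] t r by simp
    note has_vector_derivative_at_within[OF has_vector_derivative_diff[OF d[OF xt] d[OF assms(3)]], of "{-r..r}"]
    then have 2: "((\<lambda>s. f (x + s *\<^sub>R v + t *\<^sub>R w) - f (x + s *\<^sub>R v)) has_vector_derivative fv (x + t *\<^sub>R w) - fv x) (at 0 within {-r..r})"
      by (simp add: algebra_simps)
    have "at (0::real) within {-r..r} \<noteq> bot" using r by (simp add: trivial_limit_within islimpt_Icc)
    from vector_derivative_unique_within[OF this 1 2] show ?thesis by simp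
  qed
  have "((\<lambda>t. integral {0..t} (\<lambda>u. fvw (x + u *\<^sub>R w))) has_vector_derivative fvw (x + 0 *\<^sub>R w)) (at 0 within {0..r})"
    by (rule integral_has_vector_derivative)
      (use r in_S[of 0] in \<open>auto intro!: continuous_on_compose2[OF fvw] continuous_intros\<close>)
  then have "((\<lambda>t. integral {0..t} (\<lambda>u. fvw (x + u *\<^sub>R w))) has_vector_derivative fvw x) (at 0 within {0..r})"
    by simp
  then have 3: "((\<lambda>t. fv (x + t *\<^sub>R w) - fv x) has_vector_derivative fvw x) (at 0 within {0..r})"
    by (rule has_vector_derivative_transform[of 0 "{0..r}" _ "\<lambda>t. integral {0..t} (\<lambda>u. fvw (x + u *\<^sub>R w))", rotated 2])
      (use r w_line in auto)
  have 4: "((\<lambda>t. fv (x + t *\<^sub>R w) - fv x) has_vector_derivative frechet_derivative fv (at x) w - 0) (at 0 within {0..r})"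
    using frechet_directional[of fv x 0 w] Ck_on_differentiable[OF fv _ assms(3)]
    by (intro has_vector_derivative_at_within[OF has_vector_derivative_diff[OF _ has_vector_derivative_const]]) auto
  have "at (0::real) within {0..r} \<noteq> bot" using r by (simp add: trivial_limit_within islimpt_Icc)
  from vector_derivative_unique_within[OF this 3 4] show ?thesis
    by (simp add: fvw_def fv_def fw_def)
qed

section \<open>Holomorphic functions of several variables are smooth\<close>

lemma norm_vector_scalar: "norm (c *s (v::complex^'n)) = cmod c * norm v"
  by (simp add: norm_vec_def L2_set_right_distrib norm_mult)

lemma vector_scalar_scaleR: "(of_real t :: complex) *s v = t *\<^sub>R v"
  by (simp add: vec_eq_iff scaleR_conv_of_real[where 'a = complex])

lemma bounded_linear_vector_scalar_left: "bounded_linear (\<lambda>c. c *s (v::complex^'n))"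
  by (intro bounded_linear_intro[where K = "norm v"])
    (auto simp: norm_vector_scalar vector_sadd_rdistrib vec_eq_iff)

lemmas continuous_on_vector_scalar_left =
  bounded_linear.continuous_on[OF bounded_linear_vector_scalar_left]

lemma holomorphic_Cn_has_derivative:
  assumes "holomorphic_Cn_on f S" "z \<in> S"
  shows "(f has_derivative frechet_derivative f (at z)) (at z)"
    and "frechet_derivative f (at z) (c *s v) = c * frechet_derivative f (at z) v"
proof -
  obtain D where D: "(f has_derivative D) (at z)" "\<And>c v. D (c *s v) = c * D v"
    using assms unfolding holomorphic_Cn_on_def by blast
  have "frechet_derivative f (at z) = D" using frechet_derivative_at[OF D(1)] by simp
  then show "(f has_derivative frechet_derivative f (at z)) (at z)"
    "frechet_derivative f (at z) (c *s v) = c * frechet_derivative f (at z) v" using D by auto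
qed

lemma holomorphic_Cn_continuous: "holomorphic_Cn_on f S \<Longrightarrow> continuous_on S f"
  by (meson continuous_at_imp_continuous_on has_derivative_continuous holomorphic_Cn_has_derivative(1))

text \<open>Cauchy's formula for the derivative at 0 of the one-variable function \<open>\<zeta> \<mapsto> f (z + \<zeta> e)\<close>, with the contour integral
  written out as an integral over a real interval so that \<open>z\<close> can be treated as a parameter.\<close>

lemma directional_cauchy:
  fixes f :: "complex^'n \<Rightarrow> complex"
  assumes "open S" "holomorphic_Cn_on f S" "r > 0"
    and disc: "\<And>\<zeta>. cmod \<zeta> \<le> r \<Longrightarrow> z + \<zeta> *s e \<in> S"
  defines "\<gamma> \<equiv> circlepath 0 r"
  shows "frechet_derivative f (at z) e =
    integral {0..1} (\<lambda>t. f (z + \<gamma> t *s e) * (2 * of_real pi * \<i> * \<gamma> t / ((\<gamma> t)\<^sup>2 * (2 * of_real pi * \<i>))))"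
proof -
  define g where "g = (\<lambda>\<zeta>. f (z + \<zeta> *s e))"
  have g: "(g has_field_derivative frechet_derivative f (at (z + \<zeta> *s e)) e) (at \<zeta>)" if "cmod \<zeta> \<le> r" for \<zeta>
  proof -
    note f = holomorphic_Cn_has_derivative[OF assms(2) disc[OF that]]
    have "((\<lambda>\<zeta>. z + \<zeta> *s e) has_derivative (\<lambda>h. h *s e)) (at \<zeta>)"
      using has_derivative_add[OF has_derivative_const[of z] bounded_linear_imp_has_derivative[OF bounded_linear_vector_scalar_left[of e]]]
      by simp
    from has_derivative_compose[OF this f(1)] show ?thesis
      unfolding g_def has_field_derivative_def f(2) by (simp add: mult.commute[of _ "frechet_derivative f _ e"])
  qed
  have hol: "g holomorphic_on ball 0 r" and cont: "continuous_on (cball 0 r) g"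
    using g by (auto simp: holomorphic_on_def field_differentiable_def intro!: continuous_at_imp_continuous_on DERIV_isCont
      intro: has_field_derivative_at_within) (metis less_imp_le has_field_derivative_at_within)
  have "frechet_derivative f (at z) e = 1 / (2 * of_real pi * \<i>) * contour_integral \<gamma> (\<lambda>u. g u / (u - 0)^2)"
    using DERIV_unique[OF g[of 0] Cauchy_derivative_integral_circlepath(2)[OF cont hol, of 0]] assms(3)
    by (simp add: \<gamma>_def)
  also have "\<dots> = integral {0..1} (\<lambda>t. f (z + \<gamma> t *s e) * (2 * of_real pi * \<i> * \<gamma> t / ((\<gamma> t)\<^sup>2 * (2 * of_real pi * \<i>))))"
  proof -
    have "vector_derivative \<gamma> (at t) = 2 * of_real pi * \<i> * \<gamma> t" for t
      unfolding \<gamma>_def vector_derivative_circlepath by (simp add: circlepath)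
    then show ?thesis
      unfolding contour_integral_integral integral_mult_right[symmetric]
      by (intro integral_cong) (simp add: g_def algebra_simps)
  qed
  finally show ?thesis .
qed

lemma circle_kernel_continuous:
  assumes "r > 0"
  shows "continuous_on UNIV (circlepath 0 r)"
    "continuous_on UNIV (\<lambda>t. 2 * of_real pi * \<i> * circlepath 0 r t / ((circlepath 0 r t)\<^sup>2 * (2 * of_real pi * \<i>)))"
  using assms by (auto simp: circlepath intro!: continuous_intros)

text \<open>Cauchy's formula on a disc in the direction \<open>e\<close> expresses the derivative as an integral of \<open>f\<close> alone, which may be
  differentiated under the integral sign.  That step needs a continuous derivative of \<open>f\<close>, which is not part of the
  hypothesis; it is obtained first, from the continuity of the same integral in \<open>z\<close>.\<close>

lemma directional_derivative_holomorphic: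
  fixes f :: "complex^'n \<Rightarrow> complex"
  assumes S: "open S" and f: "holomorphic_Cn_on f S"
  shows "holomorphic_Cn_on (\<lambda>z. frechet_derivative f (at z) e) S"
proof -
  define k where "k r t = 2 * of_real pi * \<i> * circlepath 0 r t / ((circlepath 0 r t)\<^sup>2 * (2 * of_real pi * \<i>))" for r :: real and t
  have k: "continuous_on T (k r)" and c: "continuous_on T (circlepath 0 r)" if "r > 0" for r T
    using circle_kernel_continuous[OF that] unfolding k_def by (auto intro: continuous_on_subset)
  have nrm: "cmod (circlepath 0 r t) = r" if "r > 0" for r t
    using that by (simp add: circlepath norm_mult)
  have local: "\<exists>r U. r > 0 \<and> open U \<and> convex U \<and> z0 \<in> U \<and> U \<subseteq> S \<and>
     (\<forall>z\<in>U. \<forall>\<zeta>. cmod \<zeta> \<le> r \<longrightarrow> z + \<zeta> *s e \<in> S)" if z0: "z0 \<in> S" for z0 e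
  proof -
    obtain d where d: "d > 0" "ball z0 d \<subseteq> S" using S z0 open_contains_ball by blast
    define r where "r = d / (2 * (norm e + 1))"
    have pos: "norm e + 1 > 0" by (smt (verit) norm_ge_zero)
    have r: "r > 0" "r * norm e \<le> d / 2" unfolding r_def using d pos by (auto simp: field_simps)
    have "z + \<zeta> *s e \<in> S" if "z \<in> ball z0 (d/2)" "cmod \<zeta> \<le> r" for z \<zeta>
    proof -
      have "norm (\<zeta> *s e) \<le> d / 2"
        using that r mult_right_mono[of "cmod \<zeta>" r "norm e"] by (simp add: norm_vector_scalar)
      then have "dist z0 (z + \<zeta> *s e) < d"
        using that(1) norm_triangle_ineq4[of "z0 - z" "\<zeta> *s e"] by (simp add: dist_norm algebra_simps)
      then show ?thesis using d by auto
    qed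
    moreover have "ball z0 (d/2) \<subseteq> S" using d by auto
    ultimately show ?thesis using r d by (intro exI[of _ r] exI[of _ "ball z0 (d/2)"]) auto
  qed
  have contD: "continuous_on S (\<lambda>z. frechet_derivative f (at z) e)" for e
  proof (rule continuous_at_imp_continuous_on, rule ballI)
    fix z0 assume "z0 \<in> S"
    from local[OF this, of e] obtain r U where U: "r > 0" "open U" "z0 \<in> U"
      and US: "\<And>z \<zeta>. z \<in> U \<Longrightarrow> cmod \<zeta> \<le> r \<Longrightarrow> z + \<zeta> *s e \<in> S" by blast
    have "continuous_on U (\<lambda>z. integral (cbox 0 1) (\<lambda>t. f (z + circlepath 0 r t *s e) * k r t))"
    proof (rule integral_continuous_on_param)
      show "continuous_on (U \<times> cbox 0 1) (\<lambda>(z, t). f (z + circlepath 0 r t *s e) * k r t)"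
        unfolding split_beta
        by (intro continuous_on_mult continuous_on_compose2[OF holomorphic_Cn_continuous[OF f]]
            continuous_on_compose2[OF k[OF U(1), of UNIV]] continuous_on_add
            continuous_on_vector_scalar_left
            continuous_on_compose2[OF c[OF U(1), of UNIV]] continuous_intros)
          (use US nrm[OF U(1)] in \<open>auto\<close>)
    qed
    moreover have "frechet_derivative f (at z) e = integral (cbox 0 1) (\<lambda>t. f (z + circlepath 0 r t *s e) * k r t)" if "z \<in> U" for z
      using directional_cauchy[OF S f U(1), of z e] US[OF that] unfolding k_def by simp
    ultimately have "continuous_on U (\<lambda>z. frechet_derivative f (at z) e)"
      by (simp cong: continuous_on_cong)
    then show "isCont (\<lambda>z. frechet_derivative f (at z) e) z0"
      using U by (simp add: continuous_on_eq_continuous_at)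
  qed
  show ?thesis unfolding holomorphic_Cn_on_def
  proof
    fix z0 assume "z0 \<in> S"
    from local[OF this, of e] obtain r U where U: "r > 0" "open U" "convex U" "z0 \<in> U"
      and US: "\<And>z \<zeta>. z \<in> U \<Longrightarrow> cmod \<zeta> \<le> r \<Longrightarrow> z + \<zeta> *s e \<in> S" by blast
    define p where "p z t = z + circlepath 0 r t *s e" for z t
    have pS: "p z t \<in> S" if "z \<in> U" for z t unfolding p_def using US[OF that] nrm[OF U(1)] by simp
    have p_cont: "continuous_on (U \<times> T) (\<lambda>x. p (fst x) (snd x))" for T
      unfolding p_def
      by (intro continuous_on_add
            continuous_on_vector_scalar_left
            continuous_on_compose2[OF c[OF U(1), of UNIV]] continuous_intros) auto
    define L where "L z t = Blinfun (\<lambda>v. frechet_derivative f (at (p z t)) v * k r t)" for z t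
    have L: "blinfun_apply (L z t) = (\<lambda>v. frechet_derivative f (at (p z t)) v * k r t)" if "z \<in> U" for z t
      unfolding L_def
      by (rule bounded_linear_Blinfun_apply[OF bounded_linear_mult_const[OF has_derivative_bounded_linear[OF
          holomorphic_Cn_has_derivative(1)[OF f pS[OF that]]]]])
    have Lcont: "continuous_on (U \<times> cbox 0 1) (\<lambda>(z, t). L z t)"
      unfolding split_beta
    proof (rule continuous_on_blinfun_componentwise)
      fix i :: "complex^'n"
      have "continuous_on (U \<times> cbox 0 1) (\<lambda>x. frechet_derivative f (at (p (fst x) (snd x))) i * k r (snd x))"
        by (intro continuous_on_mult continuous_on_compose2[OF contD] p_cont
            continuous_on_compose2[OF k[OF U(1), of UNIV]] continuous_intros) (auto simp: pS)
      then show "continuous_on (U \<times> cbox 0 1) (\<lambda>x. blinfun_apply (L (fst x) (snd x)) i)"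
        by (rule continuous_on_eq) (auto simp: L)
    qed
    have int_f: "(\<lambda>t. f (p z t) * k r t) integrable_on cbox 0 1" if "z \<in> U" for z
    proof (rule integrable_continuous)
      have "continuous_on (cbox 0 1) (\<lambda>t. p z t)" unfolding p_def
        by (intro continuous_on_add continuous_on_const continuous_on_vector_scalar_left c[OF U(1)])
      then show "continuous_on (cbox 0 1) (\<lambda>t. f (p z t) * k r t)"
        by (intro continuous_on_mult continuous_on_compose2[OF holomorphic_Cn_continuous[OF f]] k[OF U(1)]) (auto simp: pS that)
    qed
    define H where "H = integral (cbox 0 1) (L z0)"
    have "((\<lambda>z. integral (cbox 0 1) (\<lambda>t. f (p z t) * k r t)) has_derivative blinfun_apply H) (at z0 within U)"
      unfolding H_def
    proof (rule leibniz_rule[OF _ int_f Lcont U(4,3)])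
      fix z t assume z: "z \<in> U"
      have "((\<lambda>z. p z t) has_derivative (\<lambda>v. v)) (at z)" unfolding p_def
        by (rule has_derivative_eq_rhs[OF has_derivative_add[OF has_derivative_ident has_derivative_const]]) simp
      from has_derivative_mult_left[OF has_derivative_compose[OF this holomorphic_Cn_has_derivative(1)[OF f pS[OF z]]]]
      show "((\<lambda>z. f (p z t) * k r t) has_derivative blinfun_apply (L z t)) (at z within U)"
        unfolding L[OF z] by (rule has_derivative_at_withinI)
    qed
    moreover have "integral (cbox 0 1) (\<lambda>t. f (p z t) * k r t) = frechet_derivative f (at z) e" if "z \<in> U" for z
      using directional_cauchy[OF S f U(1), of z e] US[OF that] unfolding k_def p_def by simp
    ultimately have "((\<lambda>z. frechet_derivative f (at z) e) has_derivative blinfun_apply H) (at z0 within U)"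
      using has_derivative_transform[OF U(4)] by (metis (mono_tags, lifting))
    then have der: "((\<lambda>z. frechet_derivative f (at z) e) has_derivative blinfun_apply H) (at z0)"
      using U at_within_open by metis
    have Lint: "L z0 integrable_on cbox 0 1"
      using continuous_on_compose2[OF Lcont continuous_on_Pair[OF continuous_on_const continuous_on_id], of z0 "cbox 0 1"] U
      by (intro integrable_continuous) auto
    have "blinfun_apply H (c *s v) = c * blinfun_apply H v" for c v
      unfolding H_def blinfun_apply_integral[OF Lint] L[OF U(4)]
        holomorphic_Cn_has_derivative(2)[OF f pS[OF U(4)]] mult.assoc
      by (rule integral_mult_right)
    with der show "\<exists>D. ((\<lambda>z. frechet_derivative f (at z) e) has_derivative D) (at z0) \<and> (\<forall>c v. D (c *s v) = c * D v)"
      by blast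
  qed
qed

lemma holomorphic_Cn_Ck:
  assumes "open S" "holomorphic_Cn_on f S"
  shows "Ck_on k f S"
  using assms(2)
proof (induction k arbitrary: f)
  case 0
  then show ?case by (simp add: holomorphic_Cn_continuous)
next
  case (Suc k)
  then show ?case unfolding Ck_on.simps differentiable_def
    using directional_derivative_holomorphic[OF assms(1)] holomorphic_Cn_has_derivative(1)[OF Suc.prems]
    by blast
qed

section \<open>Wirtinger derivatives\<close>

lemma
  assumes "(f has_derivative D) (at z)"
  shows dz_eqI: "dz i f z = (D (axis i 1) - \<i> * D (axis i \<i>)) / 2"
    and dzbar_eqI: "dzbar i f z = (D (axis i 1) + \<i> * D (axis i \<i>)) / 2"
  unfolding dz_def dzbar_def frechet_derivative_eqI[OF assms] by auto

lemma
  assumes "open S" "z \<in> S" "\<And>y. y \<in> S \<Longrightarrow> f y = g y"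
  shows dz_cong_open: "dz i f z = dz i g z" and dzbar_cong_open: "dzbar i f z = dzbar i g z"
proof -
  have "frechet_derivative f (at z) = frechet_derivative g (at z)"
    by (rule frechet_derivative_cong_open[OF assms])
  then show "dz i f z = dz i g z" "dzbar i f z = dzbar i g z"
    by (simp_all only: dz_def dzbar_def)
qed

lemma differentiable_frechet: "f differentiable (at z) \<Longrightarrow> (f has_derivative frechet_derivative f (at z)) (at z)"
  using frechet_derivative_works by blast

lemma axis_scale: "axis i (c * x) = c *s axis i (x::complex)"
  by (simp add: axis_def vec_eq_iff)

text \<open>This is \<open>df = \<Sum> \<partial>\<^sub>i f dz\<^sup>i + \<partial>bar\<^sub>i f dzbar\<^sup>i\<close>, read off in the real basis \<open>axis i 1\<close>, \<open>axis i \<i>\<close>.\<close>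

lemma has_derivative_wirtinger:
  fixes f :: "complex^'n \<Rightarrow> complex"
  assumes "(f has_derivative D) (at z)"
  shows "D v = (\<Sum>i\<in>UNIV. dz i f z * v $ i + dzbar i f z * cnj (v $ i))"
proof -
  have lin: "linear D" using assms by (rule has_derivative_linear)
  have "v = (\<Sum>i\<in>UNIV. Re (v $ i) *\<^sub>R axis i 1 + Im (v $ i) *\<^sub>R axis i \<i>)"
    by (simp add: vec_eq_iff axis_def complex_eq_iff if_distrib cong: if_cong)
  from arg_cong[OF this, of D]
  have "D v = (\<Sum>i\<in>UNIV. Re (v $ i) *\<^sub>R D (axis i 1) + Im (v $ i) *\<^sub>R D (axis i \<i>))"
    by (simp only: linear_sum[OF lin] linear_add[OF lin] linear_scale[OF lin])
  also have "\<dots> = (\<Sum>i\<in>UNIV. dz i f z * v $ i + dzbar i f z * cnj (v $ i))"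
    unfolding dz_eqI[OF assms] dzbar_eqI[OF assms]
    by (intro sum.cong refl) (auto simp: complex_eq_iff field_simps)
  finally show ?thesis .
qed

lemma
  assumes f: "(f has_derivative D) (at z)" and D: "\<And>c v. D (c *s v) = c * D v"
  shows dz_holomorphic: "dz i f z = D (axis i 1)" and dzbar_holomorphic: "dzbar i f z = 0"
  using D[of \<i> "axis i 1"] unfolding dz_eqI[OF f] dzbar_eqI[OF f] axis_scale[symmetric] by auto

lemma
  assumes "f differentiable (at z)" "g differentiable (at z)"
  shows dz_add: "dz i (\<lambda>z. f z + g z) z = dz i f z + dz i g z"
    and dzbar_add: "dzbar i (\<lambda>z. f z + g z) z = dzbar i f z + dzbar i g z"
    and dz_diff: "dz i (\<lambda>z. f z - g z) z = dz i f z - dz i g z"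
    and dzbar_diff: "dzbar i (\<lambda>z. f z - g z) z = dzbar i f z - dzbar i g z"
    and dz_mult: "dz i (\<lambda>z. f z * g z) z = dz i f z * g z + f z * dz i g z"
    and dzbar_mult: "dzbar i (\<lambda>z. f z * g z) z = dzbar i f z * g z + f z * dzbar i g z"
proof -
  note d = assms[THEN differentiable_frechet]
  show "dz i (\<lambda>z. f z + g z) z = dz i f z + dz i g z" "dzbar i (\<lambda>z. f z + g z) z = dzbar i f z + dzbar i g z"
    unfolding dz_eqI[OF has_derivative_add[OF d]] dzbar_eqI[OF has_derivative_add[OF d]]
    by (simp_all add: dz_def dzbar_def field_simps)
  show "dz i (\<lambda>z. f z - g z) z = dz i f z - dz i g z" "dzbar i (\<lambda>z. f z - g z) z = dzbar i f z - dzbar i g z"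
    unfolding dz_eqI[OF has_derivative_diff[OF d]] dzbar_eqI[OF has_derivative_diff[OF d]]
    by (simp_all add: dz_def dzbar_def field_simps)
  show "dz i (\<lambda>z. f z * g z) z = dz i f z * g z + f z * dz i g z"
    "dzbar i (\<lambda>z. f z * g z) z = dzbar i f z * g z + f z * dzbar i g z"
    unfolding dz_eqI[OF has_derivative_mult[OF d]] dzbar_eqI[OF has_derivative_mult[OF d]]
    by (simp_all add: dz_def dzbar_def field_simps)
qed

lemma dz_const [simp]: "dz i (\<lambda>z. c) z = 0" and dzbar_const [simp]: "dzbar i (\<lambda>z. c) z = 0"
  by (simp_all add: dz_def dzbar_def frechet_derivative_const)

lemma
  assumes "\<And>a. a \<in> I \<Longrightarrow> f a differentiable (at z)"
  shows dz_sum: "dz i (\<lambda>z. \<Sum>a\<in>I. f a z) z = (\<Sum>a\<in>I. dz i (f a) z)"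
    and dzbar_sum: "dzbar i (\<lambda>z. \<Sum>a\<in>I. f a z) z = (\<Sum>a\<in>I. dzbar i (f a) z)"
  using assms
  by (induction I rule: infinite_finite_induct) (auto simp: dz_add dzbar_add differentiable_sum)

lemma
  assumes "f differentiable (at z)"
  shows dz_cnj: "dz i (\<lambda>z. cnj (f z)) z = cnj (dzbar i f z)"
    and dzbar_cnj: "dzbar i (\<lambda>z. cnj (f z)) z = cnj (dz i f z)"
    and dz_cmult: "dz i (\<lambda>z. c * f z) z = c * dz i f z"
    and dzbar_cmult: "dzbar i (\<lambda>z. c * f z) z = c * dzbar i f z"
proof -
  note d = assms[THEN differentiable_frechet]
  note c = bounded_linear.has_derivative[OF bounded_linear_cnj d]
  show "dz i (\<lambda>z. cnj (f z)) z = cnj (dzbar i f z)" "dzbar i (\<lambda>z. cnj (f z)) z = cnj (dz i f z)"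
    unfolding dz_eqI[OF c] dzbar_eqI[OF c] by (simp_all add: dz_def dzbar_def)
  show "dz i (\<lambda>z. c * f z) z = c * dz i f z" "dzbar i (\<lambda>z. c * f z) z = c * dzbar i f z"
    using dz_mult[OF differentiable_const assms, of i c] dzbar_mult[OF differentiable_const assms, of i c] by auto
qed

lemma dz_real_compose:
  fixes f :: "complex^'n \<Rightarrow> real"
  assumes f: "f differentiable (at z)" and \<phi>: "(\<phi> has_real_derivative \<phi>') (at (f z))"
  shows "dz i (\<lambda>z. of_real (\<phi> (f z))) z = of_real \<phi>' * dz i (\<lambda>z. of_real (f z)) z"
proof -
  note d = differentiable_frechet[OF f]
  note 1 = bounded_linear.has_derivative[OF bounded_linear_of_real d]
  note 2 = bounded_linear.has_derivative[OF bounded_linear_of_real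
      has_derivative_compose[OF d \<phi>[unfolded has_field_derivative_def]]]
  show ?thesis unfolding dz_eqI[OF 1] dz_eqI[OF 2]
    by (simp add: algebra_simps diff_divide_distrib)
qed

lemma dzbar_inverse:
  assumes "f differentiable (at z)" "f z \<noteq> 0"
  shows "dzbar i (\<lambda>z. inverse (f z)) z = - dzbar i f z / (f z)\<^sup>2"
proof -
  note d = Deriv.has_derivative_inverse[OF assms(2) differentiable_frechet[OF assms(1)]]
  show ?thesis
    unfolding dzbar_eqI[OF d] by (simp add: dzbar_def power2_eq_square field_simps assms(2))
qed

lemma differentiable_inverse_field:
  fixes f :: "'v::real_normed_vector \<Rightarrow> 'k::real_normed_field"
  shows "f differentiable (at z) \<Longrightarrow> f z \<noteq> 0 \<Longrightarrow> (\<lambda>z. inverse (f z)) differentiable (at z)"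
  unfolding differentiable_def using Deriv.has_derivative_inverse by blast

lemma dzbar_divide:
  assumes "f differentiable (at z)" "g differentiable (at z)" "g z \<noteq> 0"
  shows "dzbar i (\<lambda>z. f z / g z) z = (dzbar i f z * g z - f z * dzbar i g z) / (g z)\<^sup>2"
  unfolding divide_inverse
    dzbar_mult[OF assms(1) differentiable_inverse_field[OF assms(2,3)]] dzbar_inverse[OF assms(2,3)]
  using assms(3) by (simp add: field_simps power2_eq_square)

lemma
  assumes "open S" "Ck_on (Suc k) f S"
  shows Ck_on_dz: "Ck_on k (dz i f) S" and Ck_on_dzbar: "Ck_on k (dzbar i f) S"
proof -
  have h: "Ck_on k (\<lambda>z. frechet_derivative f (at z) v) S" for v using assms(2) by simp
  have "Ck_on k (\<lambda>z. (frechet_derivative f (at z) (axis i 1) - \<i> * frechet_derivative f (at z) (axis i \<i>)) / 2) S"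
       "Ck_on k (\<lambda>z. (frechet_derivative f (at z) (axis i 1) + \<i> * frechet_derivative f (at z) (axis i \<i>)) / 2) S"
    by (intro Ck_on_divide Ck_on_diff Ck_on_add Ck_on_mult Ck_on_const h assms(1); simp)+
  then show "Ck_on k (dz i f) S" "Ck_on k (dzbar i f) S" by (simp_all add: dz_def[abs_def] dzbar_def[abs_def])
qed

lemma dz_dzbar_commute:
  fixes f :: "complex^'n \<Rightarrow> complex"
  assumes "open S" "Ck_on 2 f S" "z \<in> S"
  shows "dz i (dzbar j f) z = dzbar j (dz i f) z"
proof -
  have h: "Ck_on 1 (\<lambda>z. frechet_derivative f (at z) v) S" for v
    using assms(2) by (simp add: numeral_2_eq_2)
  then have d: "(\<lambda>z. frechet_derivative f (at z) v) differentiable (at z)" for v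
    using Ck_on_differentiable[OF h] assms(3) by simp
  have dc: "(\<lambda>z. c * frechet_derivative f (at z) v) differentiable (at z)" for v c
    using differentiable_mult[OF differentiable_const d] by simp
  note fr = frechet_derivative_commute[OF assms]
  have 1: "dz i (dzbar j f) z = (dz i (\<lambda>z. frechet_derivative f (at z) (axis j 1)) z + \<i> * dz i (\<lambda>z. frechet_derivative f (at z) (axis j \<i>)) z) / 2"
  proof -
    have "dzbar j f = (\<lambda>z. 1/2 * (frechet_derivative f (at z) (axis j 1) + \<i> * frechet_derivative f (at z) (axis j \<i>)))"
      by (simp add: dzbar_def fun_eq_iff)
    then show ?thesis by (simp only: dz_cmult dz_add differentiable_add d dc) simp
  qed
  have 2: "dzbar j (dz i f) z = (dzbar j (\<lambda>z. frechet_derivative f (at z) (axis i 1)) z - \<i> * dzbar j (\<lambda>z. frechet_derivative f (at z) (axis i \<i>)) z) / 2"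
  proof -
    have "dz i f = (\<lambda>z. 1/2 * (frechet_derivative f (at z) (axis i 1) - \<i> * frechet_derivative f (at z) (axis i \<i>)))"
      by (simp add: dz_def fun_eq_iff)
    then show ?thesis by (simp only: dzbar_cmult dzbar_diff differentiable_diff d dc) simp
  qed
  show ?thesis
    unfolding 1 2 unfolding dz_def dzbar_def fr[of "axis j _"] by (simp add: field_simps)
qed

section \<open>Integrals of derivatives\<close>

lemma frechet_zero_outside:
  fixes \<phi> :: "'v::euclidean_space \<Rightarrow> 'w::real_normed_vector"
  assumes "closed K" "\<And>x. x \<notin> K \<Longrightarrow> \<phi> x = 0" "x \<notin> K"
  shows "frechet_derivative \<phi> (at x) v = 0"
proof -
  have "frechet_derivative \<phi> (at x) = frechet_derivative (\<lambda>x. 0) (at x)"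
    using assms by (intro frechet_derivative_cong_open[of "-K"]) auto
  then show ?thesis by (simp add: frechet_derivative_const)
qed

lemma integrable_compact_support:
  fixes f :: "'v::euclidean_space \<Rightarrow> 'w::{banach,second_countable_topology}"
  assumes "continuous_on UNIV f" "compact K" "\<And>x. x \<notin> K \<Longrightarrow> f x = 0"
  shows "integrable lborel f"
proof -
  have "integrable lborel (\<lambda>x. indicator K x *\<^sub>R f x)"
    using borel_integrable_compact[OF assms(2)] assms(1) continuous_on_subset by blast
  moreover have "(\<lambda>x. indicator K x *\<^sub>R f x) = f"
    using assms(3) by (auto simp: indicator_def fun_eq_iff)
  ultimately show ?thesis by simp
qed

lemma lborel_integral_shift:
  fixes f :: "'v::euclidean_space \<Rightarrow> 'w::{banach,second_countable_topology}"
  assumes [measurable]: "f \<in> borel_measurable borel"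
  shows "integral\<^sup>L lborel (\<lambda>x. f (x + c)) = integral\<^sup>L lborel f"
proof -
  have "integral\<^sup>L lborel f = integral\<^sup>L (distr lborel borel ((+) c)) f"
    by (simp add: lborel_distr_plus)
  also have "\<dots> = integral\<^sup>L lborel (\<lambda>x. f (c + x))" by (rule integral_distr) auto
  finally show ?thesis by (simp add: add.commute)
qed

text \<open>The integral of \<open>\<phi> (x + t v)\<close> does not depend on \<open>t\<close>, so the difference quotients have integral 0; by dominated convergence
  so does their limit.\<close>

lemma integral_directional_derivative:
  fixes \<phi> :: "'v::euclidean_space \<Rightarrow> 'w::{banach,second_countable_topology}"
  assumes C1: "Ck_on 1 \<phi> UNIV" and K: "compact K" and supp: "\<And>x. x \<notin> K \<Longrightarrow> \<phi> x = 0"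
  shows "integral\<^sup>L lborel (\<lambda>x. frechet_derivative \<phi> (at x) v) = 0"
proof -
  define g where "g = (\<lambda>x. frechet_derivative \<phi> (at x) v)"
  have g: "continuous_on UNIV g" using C1 unfolding g_def by simp
  have \<phi>: "continuous_on UNIV \<phi>" using Ck_on_continuous[OF C1] .
  have int\<phi>: "integrable lborel \<phi>" by (rule integrable_compact_support[OF \<phi> K supp])
  have g0: "g x = 0" if "x \<notin> K" for x
    unfolding g_def using frechet_zero_outside[OF compact_imp_closed[OF K] supp that] .
  have "bounded (g ` K)" using K g by (intro compact_imp_bounded compact_continuous_image) (auto intro: continuous_on_subset)
  then obtain B where "B > 0" and B: "\<And>x. x \<in> K \<Longrightarrow> norm (g x) \<le> B"
    unfolding bounded_pos by auto
  have B: "norm (g x) \<le> B" for x using B[of x] g0[of x] \<open>B > 0\<close> by (cases "x \<in> K") auto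
  \<comment> \<open>all difference quotients below vanish outside the ball of radius \<open>R + norm v\<close>\<close>
  obtain R where "R > 0" and R: "\<And>x. x \<in> K \<Longrightarrow> norm x \<le> R"
    using compact_imp_bounded[OF K] unfolding bounded_pos by auto
  have der: "((\<lambda>t. \<phi> (x + t *\<^sub>R v)) has_vector_derivative g (x + t *\<^sub>R v)) (at t)" for x t
    unfolding g_def using Ck_on_differentiable[OF C1] by (intro frechet_directional) auto
  have mv: "norm (\<phi> (x + t *\<^sub>R v) - \<phi> x) \<le> B * t" if "t \<ge> 0" for x t
  proof -
    have "norm (\<phi> (x + t *\<^sub>R v) - \<phi> (x + 0 *\<^sub>R v)) \<le> B * norm (t - 0)"
    proof (rule differentiable_bound[of "{0..t}" "\<lambda>t. \<phi> (x + t *\<^sub>R v)" "\<lambda>s h. h *\<^sub>R g (x + s *\<^sub>R v)"])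
      show "((\<lambda>t. \<phi> (x + t *\<^sub>R v)) has_derivative (\<lambda>h. h *\<^sub>R g (x + s *\<^sub>R v))) (at s within {0..t})" for s
        using der[of x s] by (simp add: has_vector_derivative_def has_derivative_at_withinI)
      show "onorm (\<lambda>h. h *\<^sub>R g (x + s *\<^sub>R v)) \<le> B" for s
        using B[of "x + s *\<^sub>R v"] by (intro onorm_le) (simp add: mult.commute[of B] mult_left_mono)
    qed (use that in auto)
    then show ?thesis using that by simp
  qed
  define u where "u n x = real (Suc n) *\<^sub>R (\<phi> (x + (1 / real (Suc n)) *\<^sub>R v) - \<phi> x)" for n x
  have meas: "\<phi> \<in> borel_measurable borel" "g \<in> borel_measurable borel"
    using \<phi> g by (auto intro: borel_measurable_continuous_onI)
  have "u n \<in> borel_measurable borel" for n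
    unfolding u_def by (intro borel_measurable_continuous_onI continuous_intros continuous_on_compose2[OF \<phi>]) auto
  then have meas_u: "u n \<in> borel_measurable lborel" for n by simp
  have int0: "integral\<^sup>L lborel (u n) = 0" for n
  proof -
    have "integrable lborel (\<lambda>x. \<phi> (x + c))" for c
    proof (rule integrable_compact_support[of _ "(\<lambda>x. x - c) ` K"])
      show "compact ((\<lambda>x. x - c) ` K)" by (intro compact_continuous_image K continuous_intros)
      show "\<phi> (x + c) = 0" if "x \<notin> (\<lambda>x. x - c) ` K" for x
        using supp[of "x + c"] that by (metis add_diff_cancel_right' image_eqI)
    qed (auto intro!: continuous_on_compose2[OF \<phi>] continuous_intros)
    then show ?thesis unfolding u_def using int\<phi> lborel_integral_shift[OF meas(1)] by simp
  qed
  have "(\<lambda>n. integral\<^sup>L lborel (u n)) \<longlonglongrightarrow> integral\<^sup>L lborel g"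
  proof (rule integral_dominated_convergence[where w = "\<lambda>x. B * indicator (cball 0 (R + norm v)) x"])
    show "integrable lborel (\<lambda>x. B * indicator (cball (0::'v) (R + norm v)) x :: real)"
      by (intro integrable_mult_right integrable_real_indicator)
        (auto intro: emeasure_bounded_finite[OF bounded_cball, unfolded infinity_ennreal_def])
    show "AE x in lborel. (\<lambda>n. u n x) \<longlonglongrightarrow> g x"
    proof (rule AE_I2)
      fix x
      have "((\<lambda>t. (\<phi> (x + t *\<^sub>R v) - \<phi> x) /\<^sub>R t) \<longlongrightarrow> g x) (at 0)"
      proof -
        have "((\<lambda>t. norm (\<phi> (x + t *\<^sub>R v) - \<phi> x - t *\<^sub>R g x) / norm t) \<longlongrightarrow> 0) (at 0)"
          using der[of x 0] by (simp add: has_vector_derivative_def has_derivative_at)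
        moreover have "\<forall>\<^sub>F t in at 0. norm (\<phi> (x + t *\<^sub>R v) - \<phi> x - t *\<^sub>R g x) / norm t
            = norm ((\<phi> (x + t *\<^sub>R v) - \<phi> x) /\<^sub>R t - g x)"
        proof (rule eventually_mono[OF eventually_neq_at_within[of 0]])
          fix t :: real assume "t \<noteq> 0"
          then have "(\<phi> (x + t *\<^sub>R v) - \<phi> x) /\<^sub>R t - g x = (\<phi> (x + t *\<^sub>R v) - \<phi> x - t *\<^sub>R g x) /\<^sub>R t"
            by (simp add: scaleR_diff_right)
          then show "norm (\<phi> (x + t *\<^sub>R v) - \<phi> x - t *\<^sub>R g x) / norm t
            = norm ((\<phi> (x + t *\<^sub>R v) - \<phi> x) /\<^sub>R t - g x)" by (simp add: divide_inverse)
        qed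
        ultimately have "((\<lambda>t. norm ((\<phi> (x + t *\<^sub>R v) - \<phi> x) /\<^sub>R t - g x)) \<longlongrightarrow> 0) (at 0)"
          using tendsto_cong by fastforce
        then show ?thesis by (rule LIM_zero_cancel[OF tendsto_norm_zero_cancel])
      qed
      moreover have "filterlim (\<lambda>n. 1 / real (Suc n)) (at 0) sequentially"
        using LIMSEQ_inverse_real_of_nat unfolding inverse_eq_divide by (simp add: filterlim_at del: of_nat_Suc)
      ultimately have "(\<lambda>n. (\<phi> (x + (1 / real (Suc n)) *\<^sub>R v) - \<phi> x) /\<^sub>R (1 / real (Suc n))) \<longlonglongrightarrow> g x"
        by (rule filterlim_compose)
      then show "(\<lambda>n. u n x) \<longlonglongrightarrow> g x" by (simp add: u_def)
    qed
    fix n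
    show "AE x in lborel. norm (u n x) \<le> B * indicator (cball 0 (R + norm v)) x"
    proof (rule AE_I2)
      fix x
      have 1: "norm (u n x) \<le> B"
      proof -
        have "norm (u n x) = real (Suc n) * norm (\<phi> (x + (1 / real (Suc n)) *\<^sub>R v) - \<phi> x)" unfolding u_def by simp
        also have "\<dots> \<le> real (Suc n) * (B * (1 / real (Suc n)))" by (intro mult_left_mono mv) auto
        finally show ?thesis by simp
      qed
      have 2: "u n x = 0" if "x \<notin> cball 0 (R + norm v)"
      proof -
        have x: "norm x > R + norm v" using that by (simp add: dist_norm)
        have "norm ((1 / real (Suc n)) *\<^sub>R v) \<le> norm v"
          by (simp add: divide_le_eq mult_right_le_one_le) (metis add_increasing le_add_same_cancel1 mult_left_mono mult.right_neutral norm_ge_zero of_nat_0_le_iff)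
        then have "norm (x + (1 / real (Suc n)) *\<^sub>R v) > R"
          using x norm_triangle_ineq4[of "x + (1 / real (Suc n)) *\<^sub>R v" "(1 / real (Suc n)) *\<^sub>R v"] by simp
        moreover have "norm x > R" using x norm_ge_zero[of v] by linarith
        ultimately have "\<phi> (x + (1 / real (Suc n)) *\<^sub>R v) = 0" "\<phi> x = 0" using R supp by force+
        then show ?thesis by (simp add: u_def)
      qed
      show "norm (u n x) \<le> B * indicator (cball 0 (R + norm v)) x"
        using 1 2 by (cases "x \<in> cball 0 (R + norm v)") auto
    qed
  qed (use meas meas_u in auto)
  then show ?thesis using int0 by (simp add: LIMSEQ_const_iff g_def)
qed

section \<open>Change of variables under a holomorphic map\<close>

text \<open>The change of variables formula speaks of \<open>real^'m\<close>.  A type with \<open>2n\<close> elements indexes an orthonormal real basis of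
  \<open>complex^'n\<close>; the order of that basis is irrelevant, since only absolute values of determinants are used.\<close>

definition real_axis :: "'n::finite bit0 \<Rightarrow> complex^'n" where
  "real_axis = (SOME b. bij_betw b UNIV Basis)"

definition realify :: "complex^'n::finite \<Rightarrow> real^('n bit0)" where
  "realify z = (\<chi> i. z \<bullet> real_axis i)"

definition complexify :: "real^('n::finite bit0) \<Rightarrow> complex^'n" where
  "complexify x = (\<Sum>i\<in>UNIV. x $ i *\<^sub>R real_axis i)"

lemma real_axis: "bij_betw (real_axis :: 'n::finite bit0 \<Rightarrow> complex^'n) UNIV Basis"
proof -
  have "card (UNIV :: 'n bit0 set) = card (Basis :: (complex^'n) set)"
    by (simp add: DIM_complex)
  then have "\<exists>b :: 'n bit0 \<Rightarrow> complex^'n. bij_betw b UNIV Basis"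
    by (intro finite_same_card_bij) auto
  then show ?thesis unfolding real_axis_def by (rule someI_ex)
qed

lemma real_axis_inner: "real_axis i \<bullet> (real_axis j :: complex^'n::finite) = (if i = j then 1 else 0)"
proof -
  have "inj (real_axis :: 'n bit0 \<Rightarrow> complex^'n)" "\<And>i. real_axis i \<in> (Basis :: (complex^'n) set)"
    using real_axis[where 'n = 'n] by (auto simp: bij_betw_def)
  then show ?thesis by (simp add: inner_Basis inj_eq)
qed

lemma realify_complexify [simp]: "realify (complexify x) = x"
  by (simp add: realify_def complexify_def vec_eq_iff inner_sum_left real_axis_inner if_distrib cong: if_cong)

lemma complexify_realify [simp]: "complexify (realify z) = (z :: complex^'n::finite)"
proof -
  have "complexify (realify z) = (\<Sum>b\<in>Basis. (z \<bullet> b) *\<^sub>R b)"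
    unfolding complexify_def realify_def
    by (rule sum.reindex_bij_betw[OF real_axis[where 'n='n], of "\<lambda>b. (z \<bullet> b) *\<^sub>R b", simplified, THEN trans[rotated]]) simp
  then show ?thesis by (simp add: euclidean_representation)
qed

lemma linear_realify: "linear realify" and linear_complexify: "linear complexify"
  by (auto intro!: linearI simp: realify_def complexify_def vec_eq_iff inner_add_left scaleR_add_left
      sum.distrib scaleR_sum_right)

lemma inner_complexify: "complexify x \<bullet> complexify y = x \<bullet> y"
proof -
  have "complexify x \<bullet> complexify y = (\<Sum>i\<in>UNIV. x $ i * y $ i)"
    by (simp add: complexify_def inner_sum_left inner_sum_right real_axis_inner if_distrib cong: if_cong)
      (simp add: mult.commute)
  then show ?thesis by (simp add: inner_vec_def)
qed

lemma norm_complexify: "norm (complexify x) = norm x"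
  by (simp add: norm_eq_sqrt_inner inner_complexify)

lemma norm_realify: "norm (realify z) = norm z"
  using norm_complexify[of "realify z"] by simp

text \<open>Both measures assign to a box the product of its side lengths, because the coordinates come from an orthonormal basis.\<close>

lemma lborel_complexify: "distr lborel borel (complexify :: _ \<Rightarrow> complex^'n::finite) = lborel"
proof (rule lborel_eqI[symmetric])
  fix l u :: "complex^'n" assume le: "\<And>b. b \<in> Basis \<Longrightarrow> l \<bullet> b \<le> u \<bullet> b"
  have [measurable]: "complexify \<in> borel_measurable borel"
    using linear_continuous_on[OF linear_conv_bounded_linear[THEN iffD1, OF linear_complexify]]
    by (rule borel_measurable_continuous_onI)
  have bas: "b \<in> range (real_axis :: 'n bit0 \<Rightarrow> complex^'n) \<longleftrightarrow> b \<in> Basis" for b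
    using real_axis[where 'n='n] by (auto simp: bij_betw_def)
  have "(complexify x :: complex^'n) \<bullet> real_axis i = x $ i" for x i
    using arg_cong[OF realify_complexify[of x], of "\<lambda>y. y $ i"] by (simp add: realify_def)
  moreover have B: "Basis = range (real_axis :: 'n bit0 \<Rightarrow> complex^'n)" using bas by blast
  have "y \<in> box l u \<longleftrightarrow> (\<forall>i. l \<bullet> real_axis i < y \<bullet> real_axis i \<and> y \<bullet> real_axis i < u \<bullet> real_axis i)" for y
    unfolding mem_box B by auto
  moreover have "x \<in> box (realify l) (realify u) \<longleftrightarrow> (\<forall>i. l \<bullet> real_axis i < x $ i \<and> x $ i < u \<bullet> real_axis i)" for x
    by (auto simp: mem_box Basis_vec_def inner_axis realify_def)
  ultimately have "complexify -` box l u = box (realify l) (realify u)" by auto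
  then have "emeasure (distr lborel borel complexify) (box l u) = emeasure lborel (box (realify l) (realify u))"
    by (simp add: emeasure_distr)
  also have "\<dots> = (\<Prod>b\<in>Basis. (realify u - realify l) \<bullet> b)"
  proof (rule emeasure_lborel_box)
    have "l \<bullet> real_axis i \<le> u \<bullet> real_axis i" for i using le[of "real_axis i"] bas by blast
    then show "realify l \<bullet> b \<le> realify u \<bullet> b" if "b \<in> Basis" for b
      using that by (auto simp: Basis_vec_def inner_axis realify_def)
  qed
  also have "\<dots> = (\<Prod>b\<in>Basis. (u - l) \<bullet> b)"
  proof -
    have "(\<Prod>b\<in>Basis. (realify u - realify l) \<bullet> b) = (\<Prod>i\<in>UNIV. (u - l) \<bullet> real_axis i)"
      unfolding Basis_vec_def
      by (subst prod.UNION_disjoint) (auto simp: axis_eq_axis inner_axis realify_def inner_diff_left)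
    also have "\<dots> = (\<Prod>b\<in>Basis. (u - l) \<bullet> b)"
      by (rule prod.reindex_bij_betw[OF real_axis])
    finally show ?thesis by simp
  qed
  finally show "emeasure (distr lborel borel complexify) (box l u) = (\<Prod>b\<in>Basis. (u - l) \<bullet> b)" .
qed simp

text \<open>The equality with \<open>(cmod (det M))\<^sup>2\<close>, shown below, follows from multiplicativity: both sides agree on isometries and on
  scalars, these values determine them on stretches of one coordinate and on shears, and every matrix is a limit of products
  of the latter.\<close>

definition real_abs_det :: "complex^'n^'n::finite \<Rightarrow> real" where
  "real_abs_det M = \<bar>det (matrix (realify \<circ> (*v) M \<circ> complexify))\<bar>"

lemma linear_realified: "linear (realify \<circ> (*v) (M::complex^'n^'n::finite) \<circ> complexify)"
proof -
  have "linear ((*v) M)"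
    by (intro linearI) (simp_all add: vec_eq_iff matrix_vector_mult_def scaleR_sum_right distrib_left sum.distrib)
  then show ?thesis by (intro linear_compose linear_realify linear_complexify)
qed

lemma real_abs_det_mult: "real_abs_det (A ** B) = real_abs_det A * real_abs_det B"
proof -
  have "realify \<circ> (*v) (A ** B) \<circ> complexify
      = (realify \<circ> (*v) A \<circ> complexify) \<circ> (realify \<circ> (*v) B \<circ> complexify)"
    by (simp add: fun_eq_iff matrix_vector_mul_assoc)
  then show ?thesis
    unfolding real_abs_det_def
    by (simp only: matrix_compose[OF linear_realified linear_realified] det_mul abs_mult)
qed

lemma real_abs_det_isometry:
  assumes "\<And>z. norm (M *v z) = norm z"
  shows "real_abs_det M = 1"
proof -
  have "orthogonal_transformation (realify \<circ> (*v) M \<circ> complexify)"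
    unfolding orthogonal_transformation using linear_realified assms by (simp add: norm_realify norm_complexify)
  then show ?thesis unfolding real_abs_det_def by (rule orthogonal_transformation_det)
qed

lemma mat_vector_mult: "mat c *v (z::complex^'n) = c *s z"
  by (simp add: matrix_vector_mult_def mat_def vec_eq_iff if_distrib[of "\<lambda>x. x * _"] cong: if_cong)

lemma real_abs_det_mat: "real_abs_det (mat c :: complex^'n^'n::finite) = cmod c ^ (2 * CARD('n))"
proof (cases "c = 0")
  case True
  have "realify \<circ> (*v) (mat 0 :: complex^'n^'n) \<circ> complexify = (*\<^sub>R) 0"
    by (simp add: fun_eq_iff mat_vector_mult linear_0[OF linear_realify])
  then show ?thesis unfolding real_abs_det_def True by (simp only: det_matrix_scaleR) simp
next
  case False
  have "real_abs_det (mat (sgn c) :: complex^'n^'n) = 1"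
    using False by (intro real_abs_det_isometry) (simp add: mat_vector_mult norm_vector_scalar norm_sgn)
  moreover have "realify \<circ> (*v) (mat (of_real (cmod c)) :: complex^'n^'n) \<circ> complexify = (*\<^sub>R) (cmod c)"
    by (simp add: fun_eq_iff mat_vector_mult vector_scalar_scaleR linear_scale[OF linear_realify])
  then have "real_abs_det (mat (of_real (cmod c)) :: complex^'n^'n) = cmod c ^ (2 * CARD('n))"
    unfolding real_abs_det_def by (simp add: det_matrix_scaleR)
  moreover have "(mat c :: complex^'n^'n) = mat (of_real (cmod c)) ** mat (sgn c)"
    by (simp add: vec_eq_iff matrix_matrix_mult_def mat_def sgn_eq if_distrib[of "\<lambda>x. x * _"] False cong: if_cong)
  ultimately show ?thesis by (simp only: real_abs_det_mult)
qed

definition row_op :: "'n \<Rightarrow> complex^'n \<Rightarrow> complex^'n^'n::finite" where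
  "row_op k x = (\<chi> i j. if i = k then x $ j else if i = j then 1 else 0)"

definition stretch :: "'n set \<Rightarrow> complex \<Rightarrow> complex^'n^'n::finite" where
  "stretch K c = (\<chi> i j. if i = j then if i \<in> K then c else 1 else 0)"

lemma stretch_vector: "stretch K c *v z = (\<chi> i. (if i \<in> K then c else 1) * z $ i)"
  by (simp add: matrix_vector_mult_def stretch_def vec_eq_iff if_distrib[of "\<lambda>x. x * _"] cong: if_cong)

lemma row_op_vector: "row_op k x *v z = (\<chi> i. if i = k then \<Sum>j\<in>UNIV. x $ j * z $ j else z $ i)"
  by (simp add: matrix_vector_mult_def row_op_def vec_eq_iff if_distrib[of "\<lambda>x. x * _"] cong: if_cong)

text \<open>Stretching different coordinates gives conjugate matrices, hence equal values; the product over all coordinates is the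
  scalar matrix \<open>c\<close>, whose value is known, and nonnegative roots are unique.\<close>

lemma real_abs_det_stretch: "real_abs_det (stretch {k} c :: complex^'n^'n::finite) = (cmod c)\<^sup>2"
proof -
  have same: "real_abs_det (stretch {l} c) = real_abs_det (stretch {k} c)" for l :: 'n
  proof -
    define P where "P = (\<chi> i j. if j = Transposition.transpose k l i then 1 else 0 :: complex^'n^'n)"
    define \<tau> where "\<tau> = Transposition.transpose k l"
    have Pv: "P *v z = (\<chi> i. z $ \<tau> i)" for z :: "complex^'n"
      by (simp add: P_def \<tau>_def matrix_vector_mult_def vec_eq_iff if_distrib[of "\<lambda>x. x * _"] cong: if_cong)
    have "norm (P *v z) = norm z" for z
      unfolding Pv norm_vec_def L2_set_def
      using sum.reindex_bij_betw[of \<tau> UNIV UNIV "\<lambda>i. (norm (z $ i))\<^sup>2"] by (simp add: \<tau>_def bij_betw_def)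
    then have P1: "real_abs_det P = 1" by (rule real_abs_det_isometry)
    have "P ** stretch {l} c = stretch {k} c ** P"
      unfolding matrix_eq matrix_vector_mul_assoc[symmetric] Pv stretch_vector
      by (auto simp: vec_eq_iff \<tau>_def Transposition.transpose_def)
    then have "real_abs_det (P ** stretch {l} c) = real_abs_det (stretch {k} c ** P)" by simp
    then show ?thesis by (simp add: real_abs_det_mult P1)
  qed
  have "real_abs_det (stretch K c) = real_abs_det (stretch {k} c) ^ card K" for K :: "'n set"
  proof (induction K rule: infinite_finite_induct)
    case empty
    have "norm (stretch {} c *v z) = norm z" for z :: "complex^'n" by (simp add: stretch_vector)
    then show ?case using real_abs_det_isometry by auto
  next
    case (insert l K)
    have "stretch (insert l K) c = stretch {l} c ** stretch K c"
      unfolding matrix_eq matrix_vector_mul_assoc[symmetric] stretch_vector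
      using insert by (auto simp: vec_eq_iff)
    then show ?case using insert by (simp add: real_abs_det_mult same[of l])
  qed simp
  from this[of UNIV] have "real_abs_det (stretch {k} c) ^ CARD('n) = ((cmod c)\<^sup>2) ^ CARD('n)"
  proof -
    have "stretch UNIV c = (mat c :: complex^'n^'n)" by (simp add: stretch_def mat_def vec_eq_iff)
    then show ?thesis using real_abs_det_mat[of c, where 'n='n]
      \<open>real_abs_det (stretch UNIV c) = real_abs_det (stretch {k} c) ^ CARD('n)\<close> by (simp add: power_mult)
  qed
  then show ?thesis
    by (rule power_eq_imp_eq_base) (auto simp: real_abs_det_def)
qed

lemma det_stretch: "det (stretch {k} c :: complex^'n^'n::finite) = c"
  by (subst det_diagonal) (auto simp: stretch_def)

text \<open>Conjugation by \<open>stretch {k} 2\<close> turns the shear into its own square, so a multiplicative function takes on it an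
  invertible idempotent value.\<close>

lemma multiplicative_shear:
  fixes \<mu> :: "complex^'n^'n::finite \<Rightarrow> 'a::field"
  assumes mult: "\<And>A B. \<mu> (A ** B) = \<mu> A * \<mu> B" and "\<mu> (mat 1) = 1" "\<mu> (stretch {k} 2) \<noteq> 0" "(x :: complex^'n) $ k = 1"
  shows "\<mu> (row_op k x) = 1"
proof -
  define s where "s c = row_op k (\<chi> i. if i = k then 1 else c * x $ i)" for c
  have s: "s c *v z = (\<chi> i. if i = k then z $ k + c * (\<Sum>j\<in>-{k}. x $ j * z $ j) else z $ i)" for c z
    unfolding s_def row_op_vector
    by (auto simp: vec_eq_iff sum.remove[of UNIV k] Compl_eq_Diff_UNIV sum_distrib_left mult.assoc intro!: sum.cong)
  have add: "s a ** s b = s (a + b)" for a b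
    unfolding matrix_eq matrix_vector_mul_assoc[symmetric] s by (auto simp: vec_eq_iff algebra_simps)
  have "stretch {k} 2 ** s 1 = s 2 ** stretch {k} 2"
    unfolding matrix_eq matrix_vector_mul_assoc[symmetric] s stretch_vector by (auto simp: vec_eq_iff algebra_simps)
  then have "\<mu> (stretch {k} 2) * \<mu> (s 1) = \<mu> (s 2) * \<mu> (stretch {k} 2)" using mult by metis
  then have "\<mu> (s 1) = \<mu> (s 2)" using assms(3) by simp
  also have "\<dots> = \<mu> (s 1) * \<mu> (s 1)" using add[of 1 1] mult by (metis one_add_one)
  finally have "\<mu> (s 1) = 0 \<or> \<mu> (s 1) = 1" by (metis mult_cancel_right2)
  moreover have "\<mu> (s 1) * \<mu> (s (-1)) = 1"
  proof -
    have "s 0 = mat 1" unfolding matrix_eq s by (auto simp: vec_eq_iff)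
    then show ?thesis using add[of 1 "-1"] mult[of "s 1" "s (-1)"] assms(2) by simp
  qed
  moreover have "row_op k x = s 1" using assms(4) by (auto simp: s_def row_op_def vec_eq_iff)
  ultimately show ?thesis by auto
qed

lemma
  assumes "(x :: complex^'n::finite) $ k \<noteq> 0"
  shows real_abs_det_row_op: "real_abs_det (row_op k x :: complex^'n^'n::finite) = (cmod (x $ k))\<^sup>2"
    and det_row_op: "det (row_op k x) = x $ k"
proof -
  define y where "y = (\<chi> i. x $ i / x $ k)"
  have *: "row_op k x = stretch {k} (x $ k) ** row_op k y"
    unfolding matrix_eq matrix_vector_mul_assoc[symmetric] stretch_vector row_op_vector
    using assms by (auto simp: vec_eq_iff y_def sum_distrib_left)
  have "norm (mat 1 *v z) = norm z" for z :: "complex^'n" by simp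
  then have "real_abs_det (mat 1 :: complex^'n^'n) = 1" by (rule real_abs_det_isometry)
  then have "real_abs_det (row_op k y) = 1"
    by (intro multiplicative_shear[of real_abs_det k y, OF real_abs_det_mult]) (use assms in \<open>auto simp: real_abs_det_stretch y_def\<close>)
  then show "real_abs_det (row_op k x) = (cmod (x $ k))\<^sup>2"
    unfolding * real_abs_det_mult by (simp add: real_abs_det_stretch)
  have "det (row_op k y) = 1"
    by (intro multiplicative_shear[of det k y, OF det_mul]) (use assms in \<open>auto simp: det_stretch y_def\<close>)
  then show "det (row_op k x) = x $ k" unfolding * det_mul by (simp add: det_stretch)
qed

text \<open>These matrices build \<open>M\<close> up from the identity one row at a time.  As long as none of them is singular, consecutive ones
  differ by a factor \<open>row_op k x\<close>; this holds for \<open>M + t I\<close> with generic \<open>t\<close>, and \<open>M\<close> itself is reached by continuity.\<close>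

definition partial_rows :: "complex^'n^'n \<Rightarrow> 'n set \<Rightarrow> complex^'n^'n::finite" where
  "partial_rows M K = (\<chi> i j. if i \<in> K then M $ i $ j else if i = j then 1 else 0)"

lemma real_abs_det_generic:
  fixes M :: "complex^'n^'n::finite"
  assumes "\<And>K. det (partial_rows M K) \<noteq> 0"
  shows "real_abs_det M = (cmod (det M))\<^sup>2"
proof -
  have "real_abs_det (partial_rows M K) = (cmod (det (partial_rows M K)))\<^sup>2" for K
  proof (induction K rule: infinite_finite_induct)
    case empty
    have 1: "partial_rows M {} = mat 1" by (simp add: partial_rows_def mat_def vec_eq_iff)
    have "norm (mat 1 *v z) = norm z" for z :: "complex^'n" by simp
    then show ?case unfolding 1 using real_abs_det_isometry[of "mat 1"] by simp
  next
    case (insert k K)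
    obtain R where R: "R ** partial_rows M K = mat 1"
      using assms[of K] invertible_det_nz[of "partial_rows M K"] unfolding invertible_def by blast
    define x where "x = M $ k v* R"
    have xM: "x v* partial_rows M K = M $ k"
      unfolding x_def using R by (simp add: vector_matrix_mul_assoc)
    have prod: "partial_rows M (insert k K) = row_op k x ** partial_rows M K"
    proof -
      have "(row_op k x ** partial_rows M K) $ i $ j = partial_rows M (insert k K) $ i $ j" for i j
      proof (cases "i = k")
        case True
        then have "(row_op k x ** partial_rows M K) $ i $ j = (x v* partial_rows M K) $ j"
          by (simp add: matrix_matrix_mult_def row_op_def vector_matrix_mult_def mult.commute)
        then show ?thesis using True xM by (simp add: partial_rows_def)
      next
        case False
        then have "(row_op k x ** partial_rows M K) $ i $ j = partial_rows M K $ i $ j"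
          by (simp add: matrix_matrix_mult_def row_op_def if_distrib[of "\<lambda>x. x * _"] cong: if_cong)
        then show ?thesis using False by (simp add: partial_rows_def)
      qed
      then show ?thesis by (simp add: vec_eq_iff)
    qed
    have "x $ k \<noteq> 0"
    proof
      assume "x $ k = 0"
      then have "row_op k x *v axis k 1 = 0"
        by (simp add: row_op_vector vec_eq_iff axis_def if_distrib cong: if_cong)
      moreover have "axis k (1::complex) \<noteq> 0" by (simp add: axis_eq_0_iff)
      ultimately have "det (row_op k x) = 0"
        using invertible_det_nz[of "row_op k x"] matrix_left_invertible_ker[of "row_op k x"]
        unfolding invertible_def by blast
      then show False using assms[of "insert k K"] unfolding prod det_mul by simp
    qed
    then show ?case unfolding prod det_mul real_abs_det_mult insert.IH
      by (simp add: real_abs_det_row_op det_row_op norm_mult power_mult_distrib)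
  qed simp
  from this[of UNIV] show ?thesis by (simp add: partial_rows_def)
qed

lemma det_polynomial: "\<exists>p. \<forall>t. det (\<chi> i j. M $ i $ j + t * N $ i $ j :: complex^'n^'n::finite) = poly p t"
proof (intro exI[of _ "det (\<chi> i j. [:M $ i $ j, N $ i $ j:])"] allI)
  fix t
  have "poly (of_int k) t = of_int k" for k :: int and t :: complex
    by (metis of_int_poly poly_pCons poly_0 mult_zero_right add_0_right)
  then show "det (\<chi> i j. M $ i $ j + t * N $ i $ j) = poly (det (\<chi> i j. [:M $ i $ j, N $ i $ j:])) t"
    by (simp add: det_def poly_sum poly_prod mult.commute)
qed

lemma real_abs_det_eq:
  fixes M :: "complex^'n^'n::finite"
  shows "real_abs_det M = (cmod (det M))\<^sup>2"
proof -
  define N :: "complex^'n^'n" where "N = mat 1"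
  define F where "F K t = det (partial_rows (\<chi> i j. M $ i $ j + t * N $ i $ j) K)" for K t
  have fin: "finite {t. F K t = 0}" for K
  proof -
    define M' where "M' = partial_rows M K"
    define N' where "N' = (\<chi> i j. if i \<in> K then N $ i $ j else 0 :: complex^'n^'n)"
    have eq: "partial_rows (\<chi> i j. M $ i $ j + t * N $ i $ j) K = (\<chi> i j. M' $ i $ j + t * N' $ i $ j)" for t
      by (simp add: partial_rows_def M'_def N'_def vec_eq_iff)
    obtain p where p: "\<And>t. F K t = poly p t"
      using det_polynomial[of M' N'] unfolding F_def eq by blast
    define B where "B = (\<Sum>i\<in>UNIV. \<Sum>j\<in>UNIV. cmod (M $ i $ j))"
    have B: "(\<Sum>j\<in>UNIV. cmod (M $ i $ j)) \<le> B" for i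
      unfolding B_def by (rule member_le_sum) (auto intro: sum_nonneg)
    \<comment> \<open>for this \<open>t\<close> every row of \<open>M + t I\<close> is strictly diagonally dominant\<close>
    define t :: complex where "t = of_real (B + 1)"
    have Bpos: "B \<ge> 0" unfolding B_def by (simp add: sum_nonneg)
    have "F K t \<noteq> 0"
    proof -
      define A where "A = partial_rows (\<chi> i j. M $ i $ j + t * N $ i $ j) K"
      have "v = 0" if Av: "A *v v = 0" for v
      proof (rule ccontr)
        assume "v \<noteq> 0"
        define m where "m = Max (range (\<lambda>i. cmod (v $ i)))"
        obtain i where i: "cmod (v $ i) = m" using Max_in[of "range (\<lambda>i. cmod (v $ i))"] unfolding m_def by fastforce
        have mx: "cmod (v $ j) \<le> m" for j unfolding m_def by (intro Max_ge) auto
        have "m > 0" using \<open>v \<noteq> 0\<close> mx by (metis norm_le_zero_iff not_less order_trans vec_eq_iff zero_index)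
        have *: "(A *v v) $ i = 0" using Av by simp
        show False
        proof (cases "i \<in> K")
          case False
          then have "v $ i = 0" using *
            by (simp add: A_def partial_rows_def matrix_vector_mult_def if_distrib[of "\<lambda>x. x * _"] cong: if_cong)
          then show False using i \<open>m > 0\<close> by simp
        next
          case True
          then have "(\<Sum>j\<in>UNIV. M $ i $ j * v $ j) + t * v $ i = 0" using *
            by (simp add: A_def partial_rows_def N_def mat_def matrix_vector_mult_def algebra_simps sum.distrib
                if_distrib[of "\<lambda>x. _ * x"] cong: if_cong)
          then have "cmod (t * v $ i) = cmod (\<Sum>j\<in>UNIV. M $ i $ j * v $ j)"
            by (metis add_eq_0_iff2 norm_minus_cancel)
          also have "\<dots> \<le> (\<Sum>j\<in>UNIV. cmod (M $ i $ j) * m)"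
            by (intro sum_norm_le) (simp add: norm_mult mult_left_mono mx)
          also have "\<dots> \<le> B * m" using B[of i] \<open>m > 0\<close> by (simp add: sum_distrib_right[symmetric])
          finally have "(B + 1) * m \<le> B * m" using Bpos i by (simp add: norm_mult t_def del: of_real_add)
          then show False using \<open>m > 0\<close> by (simp add: algebra_simps)
        qed
      qed
      then show ?thesis
        using invertible_det_nz[of A] matrix_left_invertible_ker[of A] invertible_left_inverse[of A]
        unfolding A_def F_def by blast
    qed
    then have "p \<noteq> 0" using p by auto
    then show ?thesis using poly_roots_finite[of p] p by simp
  qed
  then have "finite (\<Union>K. {t. F K t = 0})" by auto
  then have "\<forall>\<^sub>F t in at 0. t \<notin> (\<Union>K. {t. F K t = 0})"
    using islimpt_finite[of "\<Union>K. {t. F K t = 0}" 0] unfolding islimpt_iff_eventually by blast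
  then have ev: "\<forall>\<^sub>F t in at 0. real_abs_det (\<chi> i j. M $ i $ j + t * N $ i $ j) = (cmod (det (\<chi> i j. M $ i $ j + t * N $ i $ j)))\<^sup>2"
    by (rule eventually_mono) (auto intro!: real_abs_det_generic simp: F_def)
  have entry: "matrix (realify \<circ> (*v) A \<circ> complexify) $ a $ b = (\<Sum>i\<in>UNIV. (\<Sum>j\<in>UNIV. A $ i $ j * complexify (axis b 1) $ j) \<bullet> real_axis a $ i)"
    for A :: "complex^'n^'n" and a b
    by (simp add: matrix_def realify_def matrix_vector_mult_def inner_vec_def)
  have lim1: "((\<lambda>t. real_abs_det (\<chi> i j. M $ i $ j + t * N $ i $ j)) \<longlongrightarrow> real_abs_det (\<chi> i j. M $ i $ j + 0 * N $ i $ j)) (at 0)"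
    unfolding real_abs_det_def det_def entry by (intro tendsto_intros)
  have lim2: "((\<lambda>t. (cmod (det (\<chi> i j. M $ i $ j + t * N $ i $ j)))\<^sup>2) \<longlongrightarrow> (cmod (det (\<chi> i j. M $ i $ j + 0 * N $ i $ j)))\<^sup>2) (at 0)"
    unfolding det_def by (intro tendsto_intros)
  have "real_abs_det (\<chi> i j. M $ i $ j + 0 * N $ i $ j) = (cmod (det (\<chi> i j. M $ i $ j + 0 * N $ i $ j)))\<^sup>2"
    by (rule tendsto_unique[OF at_neq_bot lim1 tendsto_cong[OF ev, THEN iffD2, OF lim2]])
  then show ?thesis by simp
qed

lemma continuous_complexify: "continuous_on T complexify"
  using linear_continuous_on linear_conv_bounded_linear linear_complexify linear_realify by blast+

lemma
  fixes h :: "complex^'n::finite \<Rightarrow> real"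
  assumes "integrable lborel h"
  shows integrable_complexify: "integrable lborel (\<lambda>x. h (complexify x))"
    and integral_complexify: "integral\<^sup>L lborel (\<lambda>x. h (complexify x)) = integral\<^sup>L lborel h"
proof -
  have [measurable]: "(complexify :: _ \<Rightarrow> complex^'n) \<in> borel_measurable borel"
    by (rule borel_measurable_continuous_onI[OF continuous_complexify])
  have [measurable]: "h \<in> borel_measurable borel" using borel_measurable_integrable[OF assms] by simp
  show "integrable lborel (\<lambda>x. h (complexify x))"
    using assms by (subst (asm) lborel_complexify[symmetric]) (simp add: integrable_distr_eq)
  show "integral\<^sup>L lborel (\<lambda>x. h (complexify x)) = integral\<^sup>L lborel h"
  proof -
    have "integral\<^sup>L lborel h = integral\<^sup>L (distr lborel borel complexify) h" by (simp only: lborel_complexify)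
    also have "\<dots> = integral\<^sup>L lborel (\<lambda>x. h (complexify x))" by (rule integral_distr) auto
    finally show ?thesis by simp
  qed
qed

text \<open>The change of variables formula concerns Henstock-Kurzweil integrals of functions with values in \<open>real^'m\<close>; this passes from a
  scalar Lebesgue integral to such an integral with values in \<open>real^1\<close>.\<close>

lemma lborel_to_absolute_integral:
  fixes F :: "'v::euclidean_space \<Rightarrow> real"
  assumes int: "integrable lborel (\<lambda>x. indicator A x * F x)"
  shows "(\<lambda>x. F x *\<^sub>R (1::real^1)) absolutely_integrable_on A"
    and "integral A (\<lambda>x. F x *\<^sub>R (1::real^1)) = integral\<^sup>L lborel (\<lambda>x. indicator A x * F x) *\<^sub>R 1"
proof -
  have eq: "(\<lambda>x. indicator A x *\<^sub>R (F x *\<^sub>R (1::real^1))) = (\<lambda>x. (indicator A x * F x) *\<^sub>R 1)" by simp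
  have int1: "integrable lborel (\<lambda>x. (indicator A x * F x) *\<^sub>R (1::real^1))"
    using int by (rule integrable_scaleR_left)
  have meas: "(\<lambda>x. (indicator A x * F x) *\<^sub>R (1::real^1)) \<in> borel_measurable lborel"
    using int1 by (rule borel_measurable_integrable)
  show ai: "(\<lambda>x. F x *\<^sub>R (1::real^1)) absolutely_integrable_on A"
    unfolding set_integrable_def eq integrable_completion[OF meas] by (rule int1)
  show "integral A (\<lambda>x. F x *\<^sub>R (1::real^1)) = integral\<^sup>L lborel (\<lambda>x. indicator A x * F x) *\<^sub>R 1"
    unfolding set_lebesgue_integral_eq_integral(2)[OF ai, symmetric] set_lebesgue_integral_def eq
      integral_completion[OF meas]
    using int by (simp add: integral_scaleR_left)
qed

text \<open>In real coordinates the derivative of \<open>g\<close> has absolute determinant \<open>(cmod (det M))\<^sup>2\<close>, by \<open>real_abs_det_eq\<close>.\<close>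

lemma change_of_variables_complex:
  fixes g :: "complex^'n::finite \<Rightarrow> complex^'n" and f :: "complex^'n \<Rightarrow> real"
  assumes S: "open S" and inj: "inj_on g S"
    and der: "\<And>z. z \<in> S \<Longrightarrow> (g has_derivative (*v) (M z)) (at z)"
    and int: "integrable lborel (\<lambda>w. indicator (g ` S) w * f w)"
    and int': "integrable lborel (\<lambda>z. indicator S z * ((cmod (det (M z)))\<^sup>2 * f (g z)))"
  shows "integral\<^sup>L lborel (\<lambda>z. indicator S z * ((cmod (det (M z)))\<^sup>2 * f (g z)))
       = integral\<^sup>L lborel (\<lambda>w. indicator (g ` S) w * f w)"
proof -
  define S' where "S' = complexify -` S"
  define G where "G = realify \<circ> g \<circ> complexify"
  define F where "F x = f (complexify x) *\<^sub>R (1::real^1)" for x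
  have "open S'" unfolding S'_def by (rule open_vimage[OF S continuous_complexify])
  then have S'l: "S' \<in> sets lebesgue" by simp
  have mem: "complexify x \<in> g ` S \<longleftrightarrow> x \<in> G ` S'" for x
  proof -
    have "x \<in> G ` S'" if "z \<in> S" "complexify x = g z" for z
      using that by (intro image_eqI[of _ _ "realify z"]) (auto simp: G_def S'_def simp flip: that(2))
    then show ?thesis by (auto simp: G_def S'_def)
  qed
  have ind: "indicator (g ` S) (complexify x) = (indicator (G ` S') x :: real)"
    "indicator S (complexify x) = (indicator S' x :: real)" for x
    by (auto simp: mem S'_def indicator_def)
  have injG: "inj_on G S'"
  proof (rule inj_onI)
    fix x y assume xy: "x \<in> S'" "y \<in> S'" "G x = G y"
    have "g (complexify x) = g (complexify y)" using arg_cong[OF xy(3), of complexify] by (simp add: G_def)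
    then have "complexify x = complexify y" using inj_onD[OF inj] xy by (simp add: S'_def)
    from arg_cong[OF this, of realify] show "x = y" by simp
  qed
  have derG: "(G has_derivative (realify \<circ> (*v) (M (complexify x)) \<circ> complexify)) (at x within S')" if "x \<in> S'" for x
  proof -
    have lin: "bounded_linear (realify :: complex^'n \<Rightarrow> _)" "bounded_linear (complexify :: _ \<Rightarrow> complex^'n)"
      using linear_realify linear_complexify linear_conv_bounded_linear by blast+
    have "(g has_derivative (*v) (M (complexify x))) (at (complexify x))" using der that by (simp add: S'_def)
    from has_derivative_compose[OF has_derivative_compose[OF bounded_linear_imp_has_derivative[OF lin(2)] this]
        bounded_linear_imp_has_derivative[OF lin(1)]]
    show ?thesis unfolding G_def o_def by (rule has_derivative_at_withinI)
  qed
  have absdet: "\<bar>det (matrix (realify \<circ> (*v) (M (complexify x)) \<circ> complexify))\<bar> = (cmod (det (M (complexify x))))\<^sup>2" for x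
    using real_abs_det_eq[of "M (complexify x)"] unfolding real_abs_det_def .
  have 1: "F absolutely_integrable_on G ` S'"
      "integral (G ` S') F = integral\<^sup>L lborel (\<lambda>w. indicator (g ` S) w * f w) *\<^sub>R 1"
    using lborel_to_absolute_integral[OF integrable_complexify[OF int, unfolded ind]] integral_complexify[OF int, unfolded ind]
    by (simp_all add: F_def[abs_def])
  have 2: "integral S' (\<lambda>x. (cmod (det (M (complexify x))))\<^sup>2 *\<^sub>R F (G x))
     = integral\<^sup>L lborel (\<lambda>z. indicator S z * ((cmod (det (M z)))\<^sup>2 * f (g z))) *\<^sub>R 1"
    using lborel_to_absolute_integral(2)[OF integrable_complexify[OF int', unfolded ind]] integral_complexify[OF int', unfolded ind]
    by (simp add: F_def G_def)
  have "integral (G ` S') F = integral S' (\<lambda>x. (cmod (det (M (complexify x))))\<^sup>2 *\<^sub>R F (G x))"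
    using integral_change_of_variables[OF S'l derG injG disjI1[OF 1(1)]] unfolding absdet .
  then show ?thesis unfolding 1 2 by simp
qed

section \<open>Positive hermitian matrices\<close>

definition pos_hermitian :: "complex^'n^'n::finite \<Rightarrow> bool" where
  "pos_hermitian M \<longleftrightarrow> (\<forall>i j. M $ j $ i = cnj (M $ i $ j)) \<and>
     (\<forall>v. v \<noteq> 0 \<longrightarrow> 0 < Re (\<Sum>i\<in>UNIV. \<Sum>j\<in>UNIV. M $ i $ j * v $ i * cnj (v $ j)))"

text \<open>With the transposition, \<open>herm_inv M k l\<close> is \<open>h\<^sup>k\<^sup>l\<close> for \<open>M = h\<close>: the first index contracts with the first index of \<open>h\<close>.\<close>

definition herm_inv :: "complex^'n^'n::finite \<Rightarrow> 'n \<Rightarrow> 'n \<Rightarrow> complex" where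
  "herm_inv M k l = matrix_inv (transpose M) $ k $ l"

lemma inv_coeff_herm_inv: "inv_coeff h z k l = herm_inv (h z) k l"
  by (simp add: inv_coeff_def herm_inv_def)

lemma det_nonzero_iff_ker:
  fixes M :: "complex^'n^'n::finite"
  shows "det M \<noteq> 0 \<longleftrightarrow> (\<forall>v. M *v v = 0 \<longrightarrow> v = 0)"
  using invertible_det_nz[of M] invertible_left_inverse[of M] matrix_left_invertible_ker[of M] by blast

lemma pos_hermitian_form_transpose:
  "(\<Sum>i\<in>UNIV. \<Sum>j\<in>UNIV. M $ i $ j * v $ i * cnj (v $ j)) = (\<Sum>j\<in>UNIV. (transpose M *v v) $ j * cnj (v $ j))"
  for M :: "complex^'n^'n::finite"
  by (subst sum.swap) (simp add: matrix_vector_mult_def transpose_def sum_distrib_right)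

lemma pos_hermitian_det:
  assumes "pos_hermitian M" shows "det M \<noteq> 0"
proof -
  have "v = 0" if "transpose M *v v = 0" for v
    using assms that unfolding pos_hermitian_def pos_hermitian_form_transpose by force
  then have "det (transpose M) \<noteq> 0" unfolding det_nonzero_iff_ker by blast
  then show ?thesis by simp
qed

lemma matrix_inv_works:
  fixes M :: "complex^'n^'n::finite"
  assumes "det M \<noteq> 0"
  shows "matrix_inv M ** M = mat 1" "M ** matrix_inv M = mat 1"
proof -
  have "\<exists>A'. M ** A' = mat 1 \<and> A' ** M = mat 1"
    using assms invertible_det_nz[of M] unfolding invertible_def by blast
  from someI_ex[OF this] show "matrix_inv M ** M = mat 1" "M ** matrix_inv M = mat 1"
    unfolding matrix_inv_def by auto
qed

lemma matrix_inv_eqI: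
  fixes M :: "complex^'n^'n::finite"
  assumes "B ** M = mat 1"
  shows "matrix_inv M = B"
proof -
  have "det M \<noteq> 0" using arg_cong[OF assms, of det] by (auto simp: det_mul)
  then have "(B ** M) ** matrix_inv M = B ** mat 1"
    using matrix_inv_works(2) by (metis matrix_mul_assoc)
  then show ?thesis using assms by simp
qed

lemma
  fixes M :: "complex^'n^'n::finite"
  assumes "det M \<noteq> 0"
  shows herm_inv_right: "(\<Sum>l\<in>UNIV. herm_inv M k l * M $ j $ l) = (if j = k then 1 else 0)"
    and herm_inv_left: "(\<Sum>k\<in>UNIV. M $ k $ l * herm_inv M k j) = (if l = j then 1 else 0)"
proof -
  have d: "det (transpose M) \<noteq> 0" using assms by simp
  show "(\<Sum>l\<in>UNIV. herm_inv M k l * M $ j $ l) = (if j = k then 1 else 0)"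
    using arg_cong[OF matrix_inv_works(1)[OF d], of "\<lambda>A. A $ k $ j"]
    by (simp add: matrix_matrix_mult_def transpose_def herm_inv_def mat_def eq_commute)
  show "(\<Sum>k\<in>UNIV. M $ k $ l * herm_inv M k j) = (if l = j then 1 else 0)"
    using arg_cong[OF matrix_inv_works(2)[OF d], of "\<lambda>A. A $ l $ j"]
    by (simp add: matrix_matrix_mult_def transpose_def herm_inv_def mat_def)
qed

lemma herm_inv_cnj:
  assumes "pos_hermitian M"
  shows "cnj (herm_inv M k l) = herm_inv M l k"
proof -
  note d = pos_hermitian_det[OF assms]
  have herm: "M $ j $ i = cnj (M $ i $ j)" for i j using assms unfolding pos_hermitian_def by blast
  define B where "B = (\<chi> k l. cnj (herm_inv M l k))"
  have "(B ** transpose M) $ k $ j = mat 1 $ k $ j" for k j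
  proof -
    have "(B ** transpose M) $ k $ j = cnj (\<Sum>l\<in>UNIV. M $ l $ j * herm_inv M l k)"
      by (simp add: matrix_matrix_mult_def B_def transpose_def herm[of j] mult.commute)
    also have "\<dots> = mat 1 $ k $ j" unfolding herm_inv_left[OF d] by (simp add: mat_def)
    finally show ?thesis .
  qed
  then have "B ** transpose M = mat 1" by (simp add: vec_eq_iff)
  from matrix_inv_eqI[OF this] have "herm_inv M l k = B $ l $ k" by (simp add: herm_inv_def)
  then show ?thesis by (simp add: B_def)
qed

text \<open>Substituting \<open>v = M w\<close> turns the form of the inverse into the form of \<open>M\<close> at the conjugate of \<open>w\<close>.\<close>

lemma herm_inv_form:
  fixes M :: "complex^'n^'n::finite"
  assumes "pos_hermitian M"
  shows "0 \<le> Re (\<Sum>l\<in>UNIV. \<Sum>j\<in>UNIV. herm_inv M l j * v $ l * cnj (v $ j))"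
    and "v \<noteq> 0 \<Longrightarrow> 0 < Re (\<Sum>l\<in>UNIV. \<Sum>j\<in>UNIV. herm_inv M l j * v $ l * cnj (v $ j))"
proof -
  note d = pos_hermitian_det[OF assms]
  have herm: "M $ j $ i = cnj (M $ i $ j)" for i j using assms unfolding pos_hermitian_def by blast
  define w where "w = (\<chi> j. \<Sum>l\<in>UNIV. herm_inv M l j * v $ l)"
  have vk: "v $ k = (\<Sum>j\<in>UNIV. M $ k $ j * w $ j)" for k
  proof -
    have "(\<Sum>j\<in>UNIV. M $ k $ j * w $ j) = (\<Sum>l\<in>UNIV. (\<Sum>j\<in>UNIV. herm_inv M l j * M $ k $ j) * v $ l)"
      by (simp add: w_def sum_distrib_left sum_distrib_right) (subst sum.swap, simp add: mult_ac)
    also have "\<dots> = v $ k" unfolding herm_inv_right[OF d]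
      by (simp add: if_distrib[of "\<lambda>x. x * _"] cong: if_cong)
    finally show ?thesis by simp
  qed
  have eq: "(\<Sum>l\<in>UNIV. \<Sum>j\<in>UNIV. herm_inv M l j * v $ l * cnj (v $ j))
      = (\<Sum>i\<in>UNIV. \<Sum>j\<in>UNIV. M $ i $ j * (\<chi> i. cnj (w $ i)) $ i * cnj ((\<chi> i. cnj (w $ i)) $ j))"
  proof -
    have "(\<Sum>l\<in>UNIV. \<Sum>j\<in>UNIV. herm_inv M l j * v $ l * cnj (v $ j)) = (\<Sum>j\<in>UNIV. w $ j * cnj (v $ j))"
      by (subst sum.swap) (simp add: w_def sum_distrib_right)
    also have "\<dots> = (\<Sum>j\<in>UNIV. \<Sum>i\<in>UNIV. w $ j * (M $ i $ j * cnj (w $ i)))"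
      unfolding vk by (simp add: sum_distrib_left herm[symmetric])
    finally show ?thesis by (subst sum.swap) (simp add: mult_ac)
  qed
  have pos: "0 < Re (\<Sum>i\<in>UNIV. \<Sum>j\<in>UNIV. M $ i $ j * u $ i * cnj (u $ j))" if "u \<noteq> 0" for u
    using assms that unfolding pos_hermitian_def by blast
  show "0 \<le> Re (\<Sum>l\<in>UNIV. \<Sum>j\<in>UNIV. herm_inv M l j * v $ l * cnj (v $ j))"
    unfolding eq using pos[of "\<chi> i. cnj (w $ i)"] by (cases "(\<chi> i. cnj (w $ i)) = 0") (force, linarith)
  assume "v \<noteq> 0"
  have "w \<noteq> 0"
  proof
    assume "w = 0"
    then have "v = 0" using vk by (simp add: vec_eq_iff)
    then show False using \<open>v \<noteq> 0\<close> by simp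
  qed
  then have "(\<chi> i. cnj (w $ i)) \<noteq> 0" by (simp add: vec_eq_iff)
  then show "0 < Re (\<Sum>l\<in>UNIV. \<Sum>j\<in>UNIV. herm_inv M l j * v $ l * cnj (v $ j))" unfolding eq by (rule pos)
qed

text \<open>The segment from the identity to \<open>M\<close> consists of positive hermitian matrices, on which the determinant is real and
  never 0; it is 1 at the identity, so it stays positive.\<close>

lemma pos_hermitian_det_pos:
  fixes M :: "complex^'n^'n::finite"
  assumes M: "pos_hermitian M"
  shows "Im (det M) = 0" "Re (det M) > 0"
proof -
  have real: "Im (det B) = 0" if "\<And>i j. B $ j $ i = cnj (B $ i $ j)" for B :: "complex^'n^'n"
  proof -
    have "cnj (B $ i $ j) = B $ j $ i" for i j by (rule that[symmetric])
    then have "(\<chi> i j. cnj (B $ i $ j)) = transpose B" by (simp only: transpose_def)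
    moreover have "cnj (det B) = det (\<chi> i j. cnj (B $ i $ j))" by (simp add: det_def)
    ultimately have "cnj (det B) = det B" by simp
    then show ?thesis by (simp add: complex_eq_iff)
  qed
  have herm: "cnj (M $ i $ j) = M $ j $ i" for i j using M unfolding pos_hermitian_def by metis
  then show "Im (det M) = 0" by (intro real) simp
  define P where "P t = (\<chi> i j. of_real t * M $ i $ j + of_real (1 - t) * (if i = j then 1 else 0) :: complex^'n^'n)" for t :: real
  have P: "pos_hermitian (P t)" if t: "0 \<le> t" "t \<le> 1" for t
    unfolding pos_hermitian_def
  proof (intro conjI allI impI)
    show "P t $ j $ i = cnj (P t $ i $ j)" for i j by (simp add: P_def herm)
    fix v :: "complex^'n" assume v: "v \<noteq> 0"
    define a where "a = Re (\<Sum>i\<in>UNIV. \<Sum>j\<in>UNIV. M $ i $ j * v $ i * cnj (v $ j))"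
    have a: "a > 0" using M v unfolding a_def pos_hermitian_def by blast
    have b: "(\<Sum>i\<in>UNIV. (cmod (v $ i))\<^sup>2) > 0"
    proof -
      obtain i where "v $ i \<noteq> 0" using v by (auto simp: vec_eq_iff)
      then have "0 < (cmod (v $ i))\<^sup>2" by simp
      also have "\<dots> \<le> (\<Sum>i\<in>UNIV. (cmod (v $ i))\<^sup>2)" by (rule member_le_sum) auto
      finally show ?thesis .
    qed
    have "(\<Sum>i\<in>UNIV. \<Sum>j\<in>UNIV. P t $ i $ j * v $ i * cnj (v $ j))
       = of_real t * (\<Sum>i\<in>UNIV. \<Sum>j\<in>UNIV. M $ i $ j * v $ i * cnj (v $ j))
         + of_real (1 - t) * (\<Sum>i\<in>UNIV. v $ i * cnj (v $ i))"
      by (simp add: P_def distrib_right sum.distrib sum_distrib_left mult.assoc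
          if_distrib[of "\<lambda>x. x * _"] if_distrib[of "\<lambda>x. _ * x"] cong: if_cong)
    also have "Re \<dots> = t * a + (1 - t) * (\<Sum>i\<in>UNIV. (cmod (v $ i))\<^sup>2)"
      unfolding a_def complex_norm_square[symmetric] of_real_sum[symmetric] by simp
    also have "\<dots> > 0"
    proof (cases "t = 0")
      case False
      then show ?thesis using t a b by (intro add_pos_nonneg mult_pos_pos mult_nonneg_nonneg) auto
    qed (use b in auto)
    finally show "0 < Re (\<Sum>i\<in>UNIV. \<Sum>j\<in>UNIV. P t $ i $ j * v $ i * cnj (v $ j))" .
  qed
  have nz: "Re (det (P t)) \<noteq> 0" if "0 \<le> t" "t \<le> 1" for t
  proof -
    have "Im (det (P t)) = 0" by (rule real) (simp add: P_def herm)
    then show ?thesis using pos_hermitian_det[OF P[OF that]] by (auto simp: complex_eq_iff)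
  qed
  have P0: "P 0 = mat 1" and P1: "P 1 = M" by (simp_all add: P_def mat_def vec_eq_iff)
  show "Re (det M) > 0"
  proof (rule ccontr)
    assume "\<not> 0 < Re (det M)"
    then have "Re (det (P 1)) \<le> 0" unfolding P1 by simp
    moreover have "0 \<le> Re (det (P 0))" unfolding P0 by simp
    moreover have "continuous_on {0..1} (\<lambda>t. Re (det (P t)))"
      unfolding det_def P_def by (simp, intro continuous_intros)
    ultimately obtain t where "0 \<le> t" "t \<le> 1" "Re (det (P t)) = 0"
      using IVT2'[of "\<lambda>t. Re (det (P t))" 1 0 0] by auto
    then show False using nz by blast
  qed
qed

lemma Ck_on_det:
  fixes B :: "'v::euclidean_space \<Rightarrow> complex^'n^'n::finite"
  assumes "open S" "\<And>i j. Ck_on k (\<lambda>z. B z $ i $ j) S"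
  shows "Ck_on k (\<lambda>z. det (B z)) S"
  unfolding det_def by (intro Ck_on_sum Ck_on_mult Ck_on_prod Ck_on_const assms)

lemma Ck_on_herm_inv:
  fixes B :: "'v::euclidean_space \<Rightarrow> complex^'n^'n::finite"
  assumes "open S" "\<And>i j. Ck_on k (\<lambda>z. B z $ i $ j) S" "\<And>z. z \<in> S \<Longrightarrow> det (B z) \<noteq> 0"
  shows "Ck_on k (\<lambda>z. herm_inv (B z) a b) S"
proof -
  have eq: "herm_inv (B z) a b = det (\<chi> i j. if j = a then axis b 1 $ i else B z $ j $ i) / det (B z)" if z: "z \<in> S" for z
  proof -
    have d: "det (transpose (B z)) \<noteq> 0" using assms(3)[OF z] by simp
    define x where "x = matrix_inv (transpose (B z)) *v axis b 1"
    have "transpose (B z) *v x = axis b 1"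
      unfolding x_def matrix_vector_mul_assoc matrix_inv_works(2)[OF d] by simp
    then have "x = (\<chi> k. det (\<chi> i j. if j = k then axis b 1 $ i else transpose (B z) $ i $ j) / det (transpose (B z)))"
      using cramer[OF d] by blast
    then have "x $ a = det (\<chi> i j. if j = a then axis b 1 $ i else transpose (B z) $ i $ j) / det (transpose (B z))"
      by (metis (no_types, lifting) vec_lambda_beta)
    moreover have "x $ a = herm_inv (B z) a b"
      by (simp add: x_def herm_inv_def matrix_vector_mult_def axis_def if_distrib cong: if_cong)
    ultimately have "herm_inv (B z) a b = det (\<chi> i j. if j = a then axis b 1 $ i else transpose (B z) $ i $ j) / det (B z)"
      by (simp only: det_transpose)
    then show ?thesis by (simp add: transpose_def cong: if_cong)
  qed
  have "Ck_on k (\<lambda>z. (if j = a then axis b 1 $ i else B z $ j $ i)) S" for i j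
    by (cases "j = a") (simp_all add: Ck_on_const assms(2))
  then have "Ck_on k (\<lambda>z. det (\<chi> i j. if j = a then axis b 1 $ i else B z $ j $ i) / det (B z)) S"
    by (intro Ck_on_divide Ck_on_det assms) simp_all
  then show ?thesis using Ck_on_cong[OF assms(1), of "\<lambda>z. herm_inv (B z) a b"] eq by simp
qed

text \<open>This is \<open>dQ = - Q (dM) Q\<close>, obtained by applying any derivation to \<open>Q M = 1\<close>.\<close>

lemma herm_inv_derivation:
  fixes Q M dQ dM :: "'n::finite \<Rightarrow> 'n \<Rightarrow> complex"
  assumes QM: "\<And>k j. (\<Sum>l\<in>UNIV. Q k l * M j l) = (if j = k then 1 else 0)"
    and MQ: "\<And>l j. (\<Sum>k\<in>UNIV. M k l * Q k j) = (if l = j then 1 else 0)"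
    and d: "\<And>k j. (\<Sum>l\<in>UNIV. dQ k l * M j l + Q k l * dM j l) = 0"
  shows "dQ k m = - (\<Sum>a\<in>UNIV. \<Sum>b\<in>UNIV. Q k b * dM a b * Q a m)"
proof -
  have "dQ k m = (\<Sum>l\<in>UNIV. dQ k l * (\<Sum>a\<in>UNIV. M a l * Q a m))"
    unfolding MQ by (simp add: if_distrib[of "\<lambda>x. _ * x"] cong: if_cong)
  also have "\<dots> = (\<Sum>a\<in>UNIV. (\<Sum>l\<in>UNIV. dQ k l * M a l) * Q a m)"
    by (simp add: sum_distrib_left sum_distrib_right) (subst sum.swap, simp add: mult_ac)
  also have "\<dots> = (\<Sum>a\<in>UNIV. - (\<Sum>l\<in>UNIV. Q k l * dM a l) * Q a m)"
  proof -
    have "(\<Sum>l\<in>UNIV. dQ k l * M a l) = - (\<Sum>l\<in>UNIV. Q k l * dM a l)" for a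
      using d[of k a] by (simp add: sum.distrib add_eq_0_iff)
    then show ?thesis by simp
  qed
  finally show ?thesis by (simp add: sum_negf sum_distrib_right)
qed

section \<open>Charts of a hermitian manifold\<close>

lemma has_derivative_vec:
  fixes f :: "'v::real_normed_vector \<Rightarrow> complex^'n::finite"
  assumes "\<And>i. ((\<lambda>z. f z $ i) has_derivative (\<lambda>v. D v $ i)) (at z)"
  shows "(f has_derivative D) (at z)"
proof -
  have bl: "bounded_linear (axis i :: complex \<Rightarrow> complex^'n)" for i
    by (rule linear_conv_bounded_linear[THEN iffD1]) (auto intro!: linearI simp: axis_def vec_eq_iff)
  have "((\<lambda>z. \<Sum>i\<in>UNIV. axis i (f z $ i)) has_derivative (\<lambda>v. \<Sum>i\<in>UNIV. axis i (D v $ i))) (at z)"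
    by (intro has_derivative_sum bounded_linear.has_derivative[OF bl] assms)
  moreover have "(\<Sum>i\<in>UNIV. axis i (x $ i)) = x" for x :: "complex^'n"
    by (simp add: vec_eq_iff axis_def if_distrib cong: if_cong)
  ultimately show ?thesis by simp
qed

lemma Ck_on_vec:
  fixes f :: "'v::euclidean_space \<Rightarrow> complex^'n::finite"
  assumes "open S" "\<And>i. Ck_on k (\<lambda>z. f z $ i) S"
  shows "Ck_on k f S"
proof -
  have bl: "bounded_linear (axis i :: complex \<Rightarrow> complex^'n)" for i
    by (rule linear_conv_bounded_linear[THEN iffD1]) (auto intro!: linearI simp: axis_def vec_eq_iff)
  have "Ck_on k (\<lambda>z. \<Sum>i\<in>UNIV. axis i (f z $ i)) S"
    by (intro Ck_on_sum Ck_on_bounded_linear[OF bl] assms)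
  moreover have "(\<Sum>i\<in>UNIV. axis i (x $ i)) = x" for x :: "complex^'n"
    by (simp add: vec_eq_iff axis_def if_distrib cong: if_cong)
  ultimately show ?thesis by simp
qed

lemma
  fixes f :: "complex^'m::finite \<Rightarrow> complex" and \<Phi> :: "complex^'n::finite \<Rightarrow> complex^'m"
  assumes f: "f differentiable (at (\<Phi> z))" and \<Phi>: "(\<Phi> has_derivative (*v) J) (at z)"
  shows dz_chain: "dz i (\<lambda>z. f (\<Phi> z)) z = (\<Sum>k\<in>UNIV. dz k f (\<Phi> z) * J $ k $ i)"
    and dzbar_chain: "dzbar i (\<lambda>z. f (\<Phi> z)) z = (\<Sum>k\<in>UNIV. dzbar k f (\<Phi> z) * cnj (J $ k $ i))"
proof -
  note d = has_derivative_compose[OF \<Phi> differentiable_frechet[OF f]]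
  have J: "(J *v axis i x) $ k = J $ k $ i * x" for k x
    by (simp add: matrix_vector_mult_def axis_def if_distrib cong: if_cong)
  show "dz i (\<lambda>z. f (\<Phi> z)) z = (\<Sum>k\<in>UNIV. dz k f (\<Phi> z) * J $ k $ i)"
    "dzbar i (\<lambda>z. f (\<Phi> z)) z = (\<Sum>k\<in>UNIV. dzbar k f (\<Phi> z) * cnj (J $ k $ i))"
    unfolding dz_eqI[OF d] dzbar_eqI[OF d] has_derivative_wirtinger[OF differentiable_frechet[OF f]] J
    by (simp_all add: sum_distrib_left sum_divide_distrib sum_subtractf[symmetric] sum.distrib[symmetric])
      (simp_all add: field_simps)
qed

text \<open>The complex Laplacian of the Chern connection, \<open>h\<^sup>i\<^sup>j \<partial>\<^sub>i \<partial>bar\<^sub>j\<close>.  As it contains no first derivatives, it does not depend on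
  the choice of holomorphic coordinates.\<close>

definition laplacian :: "(complex^'n \<Rightarrow> complex^'n^'n::finite) \<Rightarrow> (complex^'n \<Rightarrow> complex) \<Rightarrow> complex^'n \<Rightarrow> complex" where
  "laplacian h f z = (\<Sum>i\<in>UNIV. \<Sum>j\<in>UNIV. herm_inv (h z) i j * dz i (dzbar j f) z)"

locale hermitian_manifold =
  fixes X :: "'a topology" and A :: "('a, 'n::finite) chart set" and h :: "('a, 'n) metric"
  assumes X: "compact_complex_manifold X A" and h: "hermitian_metric A h"
begin

lemma atlas: "complex_atlas X A" and haus: "Hausdorff_space X" and comp: "compact_space X"
  and conn: "connected_space X" and nonempty: "topspace X \<noteq> {}"
  using X unfolding compact_complex_manifold_def by auto

lemma open_dom: "c \<in> A \<Longrightarrow> openin X (dom_of c)" and open_img: "c \<in> A \<Longrightarrow> open (img_of c)"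
  and homeo: "c \<in> A \<Longrightarrow> homeomorphic_map (subtopology X (dom_of c)) (top_of_set (img_of c)) (snd c)"
  and cover: "(\<Union>c\<in>A. dom_of c) = topspace X"
  using atlas unfolding complex_atlas_def by auto

lemma dom_subset: "c \<in> A \<Longrightarrow> dom_of c \<subseteq> topspace X"
  using open_dom openin_subset by blast

lemma topspace_dom [simp]: "c \<in> A \<Longrightarrow> topspace (subtopology X (dom_of c)) = dom_of c"
  by (metis dom_subset inf.absorb_iff2 topspace_subtopology)

lemma inj_chart: "c \<in> A \<Longrightarrow> inj_on (snd c) (dom_of c)"
  using homeomorphic_imp_injective_map[OF homeo, of c] topspace_dom[of c] by simp

lemma chart_in_img [simp]: "p \<in> dom_of c \<Longrightarrow> snd c p \<in> img_of c"
  unfolding img_of_def dom_of_def by blast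

lemma chart_inv_in_dom [simp]: "z \<in> img_of c \<Longrightarrow> chart_inv c z \<in> dom_of c"
  unfolding img_of_def dom_of_def chart_inv_def by (rule inv_into_into)

lemma chart_chart_inv [simp]: "z \<in> img_of c \<Longrightarrow> snd c (chart_inv c z) = z"
  unfolding img_of_def dom_of_def chart_inv_def by (rule f_inv_into_f)

lemma chart_inv_chart [simp]: "c \<in> A \<Longrightarrow> p \<in> dom_of c \<Longrightarrow> chart_inv c (snd c p) = p"
  unfolding chart_inv_def using inj_chart by (simp add: dom_of_def)

lemma open_chart_image:
  assumes "c \<in> A" "openin X U" shows "open (snd c ` (dom_of c \<inter> U))"
proof -
  have "openin (subtopology X (dom_of c)) (dom_of c \<inter> U)"
    using assms by (metis inf_commute openin_subtopology)
  then have "openin (top_of_set (img_of c)) (snd c ` (dom_of c \<inter> U))"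
    using homeomorphic_imp_open_map[OF homeo[OF assms(1)]] unfolding open_map_def by blast
  then show ?thesis using open_img[OF assms(1)] openin_open_eq by blast
qed

lemma chart_inv_continuous:
  assumes "c \<in> A" shows "continuous_map (top_of_set (img_of c)) X (chart_inv c)"
proof -
  obtain g where g: "homeomorphic_maps (subtopology X (dom_of c)) (top_of_set (img_of c)) (snd c) g"
    using homeo[OF assms] homeomorphic_map_maps by blast
  have "g z = chart_inv c z" if "z \<in> img_of c" for z
  proof -
    have "g z \<in> dom_of c" "snd c (g z) = z" using g that assms
      unfolding homeomorphic_maps_def continuous_map_def by auto
    then show ?thesis using chart_inv_chart[OF assms] by metis
  qed
  moreover have "continuous_map (top_of_set (img_of c)) X g"
    using g unfolding homeomorphic_maps_def by (auto simp: continuous_map_in_subtopology)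
  ultimately show ?thesis by (metis (mono_tags, lifting) continuous_map_eq topspace_euclidean_subtopology)
qed

lemma open_chart_inv_image:
  assumes "c \<in> A" "open V" shows "openin X {p \<in> dom_of c. snd c p \<in> V}"
proof -
  have "openin (subtopology X (dom_of c)) {p \<in> topspace (subtopology X (dom_of c)). snd c p \<in> img_of c \<inter> V}"
    using homeomorphic_imp_continuous_map[OF homeo[OF assms(1)]] assms(2)
    by (intro openin_continuous_map_preimage) auto
  moreover have "{p \<in> topspace (subtopology X (dom_of c)). snd c p \<in> img_of c \<inter> V} = {p \<in> dom_of c. snd c p \<in> V}"
    unfolding topspace_dom[OF assms(1)] by auto
  ultimately show ?thesis using open_dom[OF assms(1)] openin_trans_full by metis
qed

lemma closed_chart_inv_compact:
  assumes "c \<in> A" "compact K" "K \<subseteq> img_of c"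
  shows "compactin X (chart_inv c ` K)" "closedin X (chart_inv c ` K)"
proof -
  show "compactin X (chart_inv c ` K)"
    by (rule image_compactin[OF _ chart_inv_continuous[OF assms(1)]])
      (use assms in \<open>simp add: compactin_subtopology compactin_euclidean_iff\<close>)
  then show "closedin X (chart_inv c ` K)" using haus compactin_imp_closedin by blast
qed

lemma compact_chart_image:
  assumes "c \<in> A" "compactin X K" "K \<subseteq> dom_of c" shows "compact (snd c ` K)"
proof -
  have "compactin (top_of_set (img_of c)) (snd c ` K)"
    by (rule image_compactin[OF _ homeomorphic_imp_continuous_map[OF homeo[OF assms(1)]]])
      (use assms in \<open>simp add: compactin_subtopology\<close>)
  then show ?thesis by (simp add: compactin_subtopology)
qed

subsection \<open>Transition maps\<close>

definition overlap :: "('a, 'n) chart \<Rightarrow> ('a, 'n) chart \<Rightarrow> (complex^'n) set" where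
  "overlap c d = snd c ` (dom_of c \<inter> dom_of d)"

definition transition :: "('a, 'n) chart \<Rightarrow> ('a, 'n) chart \<Rightarrow> complex^'n \<Rightarrow> complex^'n" where
  "transition c d z = snd d (chart_inv c z)"

lemma open_overlap: "c \<in> A \<Longrightarrow> d \<in> A \<Longrightarrow> open (overlap c d)"
  unfolding overlap_def using open_chart_image open_dom by blast

lemma overlap_subset: "overlap c d \<subseteq> img_of c"
  unfolding overlap_def by auto

lemma overlap_iff: "c \<in> A \<Longrightarrow> z \<in> overlap c d \<longleftrightarrow> z \<in> img_of c \<and> chart_inv c z \<in> dom_of d"
  unfolding overlap_def by (auto intro!: image_eqI[of z "snd c" "chart_inv c z"])

lemma transition_holomorphic:
  "c \<in> A \<Longrightarrow> d \<in> A \<Longrightarrow> holomorphic_Cn_on (\<lambda>z. transition c d z $ k) (overlap c d)"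
  using atlas unfolding complex_atlas_def overlap_def transition_def by blast

lemma Ck_transition: "c \<in> A \<Longrightarrow> d \<in> A \<Longrightarrow> Ck_on k (transition c d) (overlap c d)"
  by (intro Ck_on_vec open_overlap holomorphic_Cn_Ck transition_holomorphic)

text \<open>The real derivative of a transition map is complex linear, so it is the matrix of its \<open>\<partial>\<close>-derivatives.\<close>

lemma transition_has_derivative:
  assumes "c \<in> A" "d \<in> A" "z \<in> overlap c d"
  shows "(transition c d has_derivative (*v) (jac c d (chart_inv c z))) (at z)"
proof (rule has_derivative_vec)
  fix k
  define D where "D = frechet_derivative (\<lambda>z. transition c d z $ k) (at z)"
  have D: "((\<lambda>z. transition c d z $ k) has_derivative D) (at z)" and lin: "\<And>a v. D (a *s v) = a * D v"
    using holomorphic_Cn_has_derivative[OF transition_holomorphic[OF assms(1,2)] assms(3)] unfolding D_def by auto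
  have z: "snd c (chart_inv c z) = z" using assms(3) overlap_subset chart_chart_inv by blast
  have "jac c d (chart_inv c z) $ k $ i = dz i (\<lambda>z. transition c d z $ k) z" for i
    unfolding jac_def transition_def using z by simp
  then have "D v = (jac c d (chart_inv c z) *v v) $ k" for v
    unfolding has_derivative_wirtinger[OF D] dzbar_holomorphic[OF D lin] by (simp add: matrix_vector_mult_def)
  then show "((\<lambda>z. transition c d z $ k) has_derivative (\<lambda>v. (jac c d (chart_inv c z) *v v) $ k)) (at z)"
    using D by (metis (no_types, lifting) ext)
qed

lemma jac_entry: "z \<in> overlap c d \<Longrightarrow> jac c d (chart_inv c z) $ k $ i = dz i (\<lambda>z. transition c d z $ k) z"
  unfolding jac_def transition_def using overlap_subset by (simp add: subset_iff)

lemma jac_holomorphic: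
  assumes "c \<in> A" "d \<in> A"
  shows "holomorphic_Cn_on (\<lambda>z. jac c d (chart_inv c z) $ k $ i) (overlap c d)"
proof -
  define F where "F z = frechet_derivative (\<lambda>z. transition c d z $ k) (at z) (axis i 1)" for z
  have F: "holomorphic_Cn_on F (overlap c d)" unfolding F_def
    by (intro directional_derivative_holomorphic open_overlap transition_holomorphic assms)
  have eq: "jac c d (chart_inv c z) $ k $ i = F z" if "z \<in> overlap c d" for z
    unfolding jac_entry[OF that] F_def
    using dz_holomorphic[OF holomorphic_Cn_has_derivative[OF transition_holomorphic[OF assms] that]] .
  show ?thesis unfolding holomorphic_Cn_on_def
  proof
    fix z assume z: "z \<in> overlap c d"
    obtain D where D: "(F has_derivative D) (at z)" "\<forall>a v. D (a *s v) = a * D v"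
      using F z unfolding holomorphic_Cn_on_def by blast
    have "((\<lambda>z. jac c d (chart_inv c z) $ k $ i) has_derivative D) (at z)"
      using has_derivative_transform_within_open[OF D(1) open_overlap[OF assms] z] eq by simp
    with D show "\<exists>D. ((\<lambda>z. jac c d (chart_inv c z) $ k $ i) has_derivative D) (at z) \<and> (\<forall>a v. D (a *s v) = a * D v)"
      by blast
  qed
qed

subsection \<open>The metric\<close>

lemma metric_Ck: "c \<in> A \<Longrightarrow> Ck_on k (\<lambda>z. h c z $ i $ j) (img_of c)"
  using h unfolding hermitian_metric_def Cinf_on_def by blast

lemma metric_pos: "c \<in> A \<Longrightarrow> z \<in> img_of c \<Longrightarrow> pos_hermitian (h c z)"
  using h unfolding hermitian_metric_def pos_hermitian_def by blast

text \<open>The transformation rule of the metric as a matrix identity \<open>h\<^sup>T = J\<^sup>* h\<^sup>T J\<close>, from which the rules for the determinant and the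
  inverse follow.\<close>

lemma metric_transform:
  assumes "c \<in> A" "d \<in> A" "p \<in> dom_of c \<inter> dom_of d"
  shows "transpose (h c (snd c p)) = (\<chi> j l. cnj (jac c d p $ l $ j)) ** (transpose (h d (snd d p)) ** jac c d p)"
proof -
  have "h c (snd c p) $ i $ j = (\<Sum>k\<in>UNIV. \<Sum>l\<in>UNIV. jac c d p $ k $ i * cnj (jac c d p $ l $ j) * h d (snd d p) $ k $ l)" for i j
    using h assms unfolding hermitian_metric_def by blast
  then have "transpose (h c (snd c p)) $ j $ i = ((\<chi> j l. cnj (jac c d p $ l $ j)) ** (transpose (h d (snd d p)) ** jac c d p)) $ j $ i" for i j
    by (simp add: transpose_def matrix_matrix_mult_def sum_distrib_left) (subst sum.swap, simp add: mult_ac)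
  then show ?thesis by (simp add: vec_eq_iff)
qed

lemma det_cnj_transpose: "det (\<chi> j l. cnj (J $ l $ j)) = cnj (det (J :: complex^'n^'n))"
proof -
  have "det (\<chi> j l. cnj (J $ l $ j)) = det (transpose (\<chi> j l. cnj (J $ j $ l)))" by (simp add: transpose_def)
  also have "\<dots> = det (\<chi> j l. cnj (J $ j $ l))" by (rule det_transpose)
  also have "\<dots> = cnj (det J)" by (simp add: det_def)
  finally show ?thesis .
qed

lemma det_metric_transform:
  assumes "c \<in> A" "d \<in> A" "p \<in> dom_of c \<inter> dom_of d"
  shows "det (h c (snd c p)) = of_real ((cmod (det (jac c d p)))\<^sup>2) * det (h d (snd d p))"
    and "det (jac c d p) \<noteq> 0"
proof -
  show eq: "det (h c (snd c p)) = of_real ((cmod (det (jac c d p)))\<^sup>2) * det (h d (snd d p))"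
    using arg_cong[OF metric_transform[OF assms], of det]
    by (simp add: det_mul det_cnj_transpose complex_norm_square mult_ac del: of_real_power)
  show "det (jac c d p) \<noteq> 0"
    using pos_hermitian_det[OF metric_pos[OF assms(1), of "snd c p"]] eq assms(3) by auto
qed

lemma herm_inv_transform:
  assumes "c \<in> A" "d \<in> A" "p \<in> dom_of c \<inter> dom_of d"
  shows "(\<Sum>i\<in>UNIV. \<Sum>j\<in>UNIV. herm_inv (h c (snd c p)) i j * jac c d p $ k $ i * cnj (jac c d p $ l $ j))
     = herm_inv (h d (snd d p)) k l"
proof -
  define J where "J = jac c d p"
  define Js where "Js = (\<chi> j l. cnj (J $ l $ j))"
  define Tc where "Tc = transpose (h c (snd c p))"
  define Td where "Td = transpose (h d (snd d p))"
  have T: "Tc = Js ** (Td ** J)" using metric_transform[OF assms] unfolding Tc_def Td_def Js_def J_def .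
  have dc: "det Tc \<noteq> 0" unfolding Tc_def det_transpose using assms by (intro pos_hermitian_det metric_pos) auto
  have dJ: "det J \<noteq> 0" unfolding J_def by (rule det_metric_transform[OF assms])
  have dJs: "det Js \<noteq> 0" unfolding Js_def det_cnj_transpose using dJ by simp
  have "matrix_inv Td = J ** (matrix_inv Tc ** Js)"
  proof (rule matrix_inv_eqI)
    have "(J ** (matrix_inv Tc ** Js)) ** Td = J ** ((matrix_inv Tc ** (Js ** (Td ** J))) ** matrix_inv J)"
      using matrix_inv_works(2)[OF dJ] by (simp add: matrix_mul_assoc[symmetric])
    also have "\<dots> = mat 1" unfolding T[symmetric] matrix_inv_works(1)[OF dc] using matrix_inv_works(2)[OF dJ] by simp
    finally show "(J ** (matrix_inv Tc ** Js)) ** Td = mat 1" .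
  qed
  from arg_cong[OF this, of "\<lambda>B. B $ k $ l"] show ?thesis
    by (simp add: herm_inv_def Tc_def Td_def J_def Js_def matrix_matrix_mult_def sum_distrib_left mult_ac)
qed

text \<open>Because transition maps are holomorphic, the chain rule for \<open>\<partial>\<^sub>i \<partial>bar\<^sub>j\<close> has no term with second derivatives of the transition
  map.\<close>

lemma laplacian_invariant:
  assumes cd: "c \<in> A" "d \<in> A" and p: "p \<in> dom_of c \<inter> dom_of d"
    and F: "Ck_on 2 (\<lambda>z. F (chart_inv d z)) (img_of d)"
  shows "laplacian (h c) (\<lambda>z. F (chart_inv c z)) (snd c p) = laplacian (h d) (\<lambda>z. F (chart_inv d z)) (snd d p)"
proof -
  define f where "f = (\<lambda>z. F (chart_inv d z))"
  define U where "U = overlap c d"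
  define J where "J z = jac c d (chart_inv c z)" for z
  define z0 where "z0 = snd c p"
  have U: "open U" unfolding U_def using cd by (rule open_overlap)
  have z0: "z0 \<in> U" unfolding U_def z0_def overlap_def using p by blast
  have t: "transition c d z \<in> img_of d" "chart_inv d (transition c d z) = chart_inv c z" if "z \<in> U" for z
    using that cd unfolding U_def transition_def by (auto simp: overlap_iff)
  have tz0: "transition c d z0 = snd d p" unfolding transition_def z0_def using cd p by simp
  have der: "(transition c d has_derivative (*v) (J z)) (at z)" if "z \<in> U" for z
    unfolding J_def using transition_has_derivative[OF cd] that unfolding U_def by blast
  have fd: "f differentiable (at w)" and f2: "dzbar l f differentiable (at w)" if "w \<in> img_of d" for w l
  proof -
    show "f differentiable (at w)" using Ck_on_differentiable[OF F _ that] by (simp add: f_def)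
    have "Ck_on 1 (dzbar l f) (img_of d)"
      using F by (intro Ck_on_dzbar open_img cd) (simp add: f_def numeral_2_eq_2)
    then show "dzbar l f differentiable (at w)" using Ck_on_differentiable that by blast
  qed
  have J_hol: "holomorphic_Cn_on (\<lambda>z. J z $ l $ j) U" for l j
    unfolding J_def U_def by (rule jac_holomorphic[OF cd])
  note J_der = holomorphic_Cn_has_derivative[OF J_hol z0]
  have J_diff: "(\<lambda>z. J z $ l $ j) differentiable (at z0)" for l j
    using J_der(1) unfolding differentiable_def by blast
  have first: "dzbar j (\<lambda>z. F (chart_inv c z)) z = (\<Sum>l\<in>UNIV. dzbar l f (transition c d z) * cnj (J z $ l $ j))" if "z \<in> U" for z j
  proof -
    have "dzbar j (\<lambda>z. F (chart_inv c z)) z = dzbar j (\<lambda>z. f (transition c d z)) z"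
      using t(2) by (intro dzbar_cong_open[OF U that]) (simp add: f_def)
    then show ?thesis unfolding dzbar_chain[OF fd[OF t(1)[OF that]] der[OF that]] .
  qed
  have second: "dz i (dzbar j (\<lambda>z. F (chart_inv c z))) z0
      = (\<Sum>l\<in>UNIV. \<Sum>k\<in>UNIV. dz k (dzbar l f) (snd d p) * J z0 $ k $ i * cnj (J z0 $ l $ j))" for i j
  proof -
    have c: "(\<lambda>z. cnj (J z $ l $ j)) differentiable (at z0)" for l
      using bounded_linear.has_derivative[OF bounded_linear_cnj J_der(1)] unfolding differentiable_def by blast
    have cc: "(\<lambda>z. dzbar l f (transition c d z)) differentiable (at z0)" for l
      using has_derivative_compose[OF der[OF z0] differentiable_frechet[OF f2[OF t(1)[OF z0]]]]
      unfolding differentiable_def by blast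
    have "dz i (\<lambda>z. cnj (J z $ l $ j)) z0 = 0" for l
      unfolding dz_cnj[OF J_diff] dzbar_holomorphic[OF J_der] by simp
    moreover have "dz i (dzbar j (\<lambda>z. F (chart_inv c z))) z0 = dz i (\<lambda>z. \<Sum>l\<in>UNIV. dzbar l f (transition c d z) * cnj (J z $ l $ j)) z0"
      by (rule dz_cong_open[OF U z0 first])
    ultimately show ?thesis
      using tz0 by (simp add: dz_sum differentiable_mult c cc dz_mult dz_chain[OF f2[OF t(1)[OF z0]] der[OF z0]] sum_distrib_right)
  qed
  have "laplacian (h c) (\<lambda>z. F (chart_inv c z)) z0
    = (\<Sum>i\<in>UNIV. \<Sum>j\<in>UNIV. \<Sum>l\<in>UNIV. \<Sum>k\<in>UNIV. herm_inv (h c z0) i j * (dz k (dzbar l f) (snd d p) * J z0 $ k $ i * cnj (J z0 $ l $ j)))"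
    unfolding laplacian_def second by (simp add: sum_distrib_left)
  also have "\<dots> = (\<Sum>i\<in>UNIV. \<Sum>l\<in>UNIV. \<Sum>k\<in>UNIV. \<Sum>j\<in>UNIV. herm_inv (h c z0) i j * (dz k (dzbar l f) (snd d p) * J z0 $ k $ i * cnj (J z0 $ l $ j)))"
    by (rule sum.cong[OF refl], subst sum.swap, rule sum.cong[OF refl], rule sum.swap)
  also have "\<dots> = (\<Sum>l\<in>UNIV. \<Sum>k\<in>UNIV. \<Sum>i\<in>UNIV. \<Sum>j\<in>UNIV. herm_inv (h c z0) i j * (dz k (dzbar l f) (snd d p) * J z0 $ k $ i * cnj (J z0 $ l $ j)))"
    by (subst sum.swap, rule sum.cong[OF refl], rule sum.swap)
  also have "\<dots> = (\<Sum>l\<in>UNIV. \<Sum>k\<in>UNIV. herm_inv (h d (snd d p)) k l * dz k (dzbar l f) (snd d p))"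
  proof (intro sum.cong refl)
    fix l k
    have Jz: "J z0 = jac c d p" unfolding J_def z0_def using cd p by simp
    show "(\<Sum>i\<in>UNIV. \<Sum>j\<in>UNIV. herm_inv (h c z0) i j * (dz k (dzbar l f) (snd d p) * J z0 $ k $ i * cnj (J z0 $ l $ j)))
        = herm_inv (h d (snd d p)) k l * dz k (dzbar l f) (snd d p)"
      unfolding Jz unfolding z0_def herm_inv_transform[OF cd p, symmetric]
      by (simp add: sum_distrib_left mult_ac)
  qed
  also have "\<dots> = laplacian (h d) f (snd d p)"
    unfolding laplacian_def by (rule sum.swap)
  finally show ?thesis unfolding z0_def f_def .
qed

end

section \<open>Integration by parts and densities\<close>

text \<open>Functions on a chart with compact support are integrated over the whole coordinate space, after extension by 0.\<close>

definition zero_extend :: "'v set \<Rightarrow> ('v \<Rightarrow> 'w::zero) \<Rightarrow> 'v \<Rightarrow> 'w" where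
  "zero_extend U f = (\<lambda>x. if x \<in> U then f x else 0)"

lemma Ck_on_zero_extend:
  fixes f :: "'v::euclidean_space \<Rightarrow> 'w::real_normed_vector"
  assumes U: "open U" and K: "compact K" "K \<subseteq> U" and f: "Ck_on k f U" "\<And>x. x \<in> U \<Longrightarrow> x \<notin> K \<Longrightarrow> f x = 0"
  shows "Ck_on k (zero_extend U f) UNIV"
proof -
  have o: "open (- K)" using K compact_imp_closed by auto
  have "Ck_on k (zero_extend U f) U"
    using f(1) Ck_on_cong[OF U, of "zero_extend U f" f k] by (simp add: zero_extend_def)
  moreover have "Ck_on k (zero_extend U f) (- K)"
    using Ck_on_const[of k 0 "-K"] Ck_on_cong[OF o, of "zero_extend U f" "\<lambda>x. 0" k] f(2) by (auto simp: zero_extend_def)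
  ultimately have "Ck_on k (zero_extend U f) (U \<union> - K)" by (rule Ck_on_Un[OF U o])
  moreover have "U \<union> - K = UNIV" using K by auto
  ultimately show ?thesis by simp
qed

lemma integrable_zero_extend:
  fixes f :: "'v::euclidean_space \<Rightarrow> 'w::{banach,second_countable_topology}"
  assumes U: "open U" and K: "compact K" "K \<subseteq> U" and f: "continuous_on U f" "\<And>x. x \<in> U \<Longrightarrow> x \<notin> K \<Longrightarrow> f x = 0"
  shows "integrable lborel (zero_extend U f)"
proof (rule integrable_compact_support[OF _ K(1)])
  show "continuous_on UNIV (zero_extend U f)"
    using Ck_on_zero_extend[OF U K, of 0 f] f by simp
  show "zero_extend U f x = 0" if "x \<notin> K" for x using f(2) that by (auto simp: zero_extend_def)
qed

text \<open>The extension of \<open>u \<phi>\<close> by 0 is continuously differentiable with compact support, so its derivatives have integral 0.\<close>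

lemma
  fixes u \<phi> :: "complex^'n::finite \<Rightarrow> complex"
  assumes U: "open U" and K: "compact K" "K \<subseteq> U"
    and u: "Ck_on 1 u U" and \<phi>: "Ck_on 1 \<phi> U" "\<And>x. x \<in> U \<Longrightarrow> x \<notin> K \<Longrightarrow> \<phi> x = 0"
  shows integral_by_parts_dz: "integral\<^sup>L lborel (zero_extend U (\<lambda>x. u x * dz i \<phi> x)) = - integral\<^sup>L lborel (zero_extend U (\<lambda>x. dz i u x * \<phi> x))"
    and integral_by_parts_dzbar: "integral\<^sup>L lborel (zero_extend U (\<lambda>x. u x * dzbar i \<phi> x)) = - integral\<^sup>L lborel (zero_extend U (\<lambda>x. dzbar i u x * \<phi> x))"
proof -
  define g where "g = zero_extend U (\<lambda>x. u x * \<phi> x)"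
  have g1: "Ck_on 1 g UNIV" unfolding g_def
    by (intro Ck_on_zero_extend[OF U K] Ck_on_mult U u \<phi>) (simp add: \<phi>)
  have g0: "g x = 0" if "x \<notin> K" for x using \<phi>(2) that by (auto simp: g_def zero_extend_def)
  note fz = frechet_zero_outside[OF compact_imp_closed[OF K(1)] g0]
  have int0: "integral\<^sup>L lborel (\<lambda>x. frechet_derivative g (at x) v) = 0" for v
    by (rule integral_directional_derivative[OF g1 K(1) g0])
  have int: "integrable lborel (\<lambda>x. frechet_derivative g (at x) v)" for v
    using g1 by (intro integrable_compact_support[OF _ K(1)] fz) auto
  have zero: "integral\<^sup>L lborel (dz i g) = 0" "integral\<^sup>L lborel (dzbar i g) = 0"
    unfolding dz_def[abs_def] dzbar_def[abs_def] using int int0 by simp_all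
  have d: "u differentiable (at x)" "\<phi> differentiable (at x)" if "x \<in> U" for x
    using Ck_on_differentiable[OF u _ that] Ck_on_differentiable[OF \<phi>(1) _ that] by auto
  have loc: "dz i g x = dz i (\<lambda>x. u x * \<phi> x) x" "dzbar i g x = dzbar i (\<lambda>x. u x * \<phi> x) x" if "x \<in> U" for x
    by (rule dz_cong_open[OF U that] dzbar_cong_open[OF U that]; simp add: g_def zero_extend_def)+
  have out: "dz i g x = 0" "dzbar i g x = 0" if "x \<notin> U" for x
  proof -
    have "x \<notin> K" using that K(2) by blast
    then show "dz i g x = 0" "dzbar i g x = 0" using fz by (auto simp: dz_def dzbar_def)
  qed
  have \<phi>0: "dz i \<phi> x = 0" "dzbar i \<phi> x = 0" if x: "x \<in> U" "x \<notin> K" for x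
  proof -
    have "dz i \<phi> x = dz i (\<lambda>x. 0) x" "dzbar i \<phi> x = dzbar i (\<lambda>x. 0) x"
      by (rule dz_cong_open[of "U - K"] dzbar_cong_open[of "U - K"];
          use x \<phi>(2) U compact_imp_closed[OF K(1)] in \<open>auto intro: open_Diff\<close>)+
    then show "dz i \<phi> x = 0" "dzbar i \<phi> x = 0" by auto
  qed
  note c = Ck_on_continuous[OF u] Ck_on_continuous[OF \<phi>(1)]
  have dc: "continuous_on U (dz i f)" "continuous_on U (dzbar i f)" if "Ck_on 1 f U" for f
    using Ck_on_dz[OF U, of 0 f i] Ck_on_dzbar[OF U, of 0 f i] that by auto
  have "dz i g = (\<lambda>x. zero_extend U (\<lambda>x. dz i u x * \<phi> x) x + zero_extend U (\<lambda>x. u x * dz i \<phi> x) x)"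
    using loc(1) out(1) dz_mult[OF d] by (auto simp: zero_extend_def fun_eq_iff)
  moreover have "integrable lborel (zero_extend U (\<lambda>x. dz i u x * \<phi> x))"
      "integrable lborel (zero_extend U (\<lambda>x. u x * dz i \<phi> x))"
    by (intro integrable_zero_extend[OF U K] continuous_on_mult c dc u \<phi>; simp add: \<phi> \<phi>0)+
  ultimately have "integral\<^sup>L lborel (zero_extend U (\<lambda>x. dz i u x * \<phi> x)) + integral\<^sup>L lborel (zero_extend U (\<lambda>x. u x * dz i \<phi> x)) = 0"
    using zero(1) by simp
  then show "integral\<^sup>L lborel (zero_extend U (\<lambda>x. u x * dz i \<phi> x)) = - integral\<^sup>L lborel (zero_extend U (\<lambda>x. dz i u x * \<phi> x))"
    by (simp add: add_eq_0_iff)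
  have "dzbar i g = (\<lambda>x. zero_extend U (\<lambda>x. dzbar i u x * \<phi> x) x + zero_extend U (\<lambda>x. u x * dzbar i \<phi> x) x)"
    using loc(2) out(2) dzbar_mult[OF d] by (auto simp: zero_extend_def fun_eq_iff)
  moreover have "integrable lborel (zero_extend U (\<lambda>x. dzbar i u x * \<phi> x))"
      "integrable lborel (zero_extend U (\<lambda>x. u x * dzbar i \<phi> x))"
    by (intro integrable_zero_extend[OF U K] continuous_on_mult c dc u \<phi>; simp add: \<phi> \<phi>0)+
  ultimately have "integral\<^sup>L lborel (zero_extend U (\<lambda>x. dzbar i u x * \<phi> x)) + integral\<^sup>L lborel (zero_extend U (\<lambda>x. u x * dzbar i \<phi> x)) = 0"
    using zero(2) by simp
  then show "integral\<^sup>L lborel (zero_extend U (\<lambda>x. u x * dzbar i \<phi> x)) = - integral\<^sup>L lborel (zero_extend U (\<lambda>x. dzbar i u x * \<phi> x))"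
    by (simp add: add_eq_0_iff)
qed

context hermitian_manifold
begin

text \<open>A cut-off function on the manifold, positive exactly on the preimage of the ball of radius \<open>r\<close> around \<open>a\<close>.\<close>

definition bump :: "('a, 'n) chart \<Rightarrow> complex^'n \<Rightarrow> real \<Rightarrow> 'a \<Rightarrow> real" where
  "bump c a r p = (if p \<in> dom_of c then max 0 (r\<^sup>2 - (norm (snd c p - a))\<^sup>2) ^ 3 else 0)"

text \<open>Any chart \<open>d\<close> is covered by its overlap with \<open>c\<close>, where the function is a polynomial cut-off of a transition map, and by
  the complement of the compact preimage of the ball, where it is 0.  The Hausdorff property makes that complement open.\<close>

lemma Ck_bump:
  assumes c: "c \<in> A" and d: "d \<in> A" and r: "cball a r \<subseteq> img_of c" "r > 0"
  shows "Ck_on 2 (\<lambda>z. bump c a r (chart_inv d z)) (img_of d)"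
proof -
  define K where "K = chart_inv c ` cball a r"
  define V where "V = snd d ` (dom_of d \<inter> (topspace X - K))"
  have K: "closedin X K" unfolding K_def by (rule closed_chart_inv_compact) (use c r in auto)
  have V: "open V" unfolding V_def by (rule open_chart_image[OF d openin_diff[OF openin_topspace K]])
  have O: "open (overlap d c)" by (rule open_overlap[OF d c])
  have "Ck_on 2 (\<lambda>z. max 0 (r\<^sup>2 - (transition d c z - a) \<bullet> (transition d c z - a)) ^ 3) (overlap d c)"
    by (intro C2_max_cube Ck_on_diff Ck_on_const O Ck_on_bilinear[OF bounded_bilinear_inner] Ck_transition c d)
  moreover have "bump c a r (chart_inv d z) = max 0 (r\<^sup>2 - (transition d c z - a) \<bullet> (transition d c z - a)) ^ 3"
    if "z \<in> overlap d c" for z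
    using that d by (simp add: bump_def overlap_iff transition_def power2_norm_eq_inner)
  ultimately have 1: "Ck_on 2 (\<lambda>z. bump c a r (chart_inv d z)) (overlap d c)"
    using Ck_on_cong[OF O, of "\<lambda>z. bump c a r (chart_inv d z)"] by simp
  have "bump c a r (chart_inv d z) = 0" if "z \<in> V" for z
  proof -
    from that obtain q where q: "q \<in> dom_of d" "q \<notin> K" "z = snd d q" unfolding V_def by auto
    have "norm (snd c q - a) > r" if "q \<in> dom_of c"
    proof (rule ccontr)
      assume "\<not> r < norm (snd c q - a)"
      then have "snd c q \<in> cball a r" by (simp add: dist_norm norm_minus_commute)
      then have "q \<in> K" unfolding K_def using chart_inv_chart[OF c that] by (metis image_eqI)
      then show False using q by simp
    qed
    then have "(norm (snd c q - a))\<^sup>2 \<ge> r\<^sup>2" if "q \<in> dom_of c" using that r by (intro power_mono) auto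
    then show ?thesis using q d by (simp add: bump_def)
  qed
  then have 2: "Ck_on 2 (\<lambda>z. bump c a r (chart_inv d z)) V"
    using Ck_on_cong[OF V, of "\<lambda>z. bump c a r (chart_inv d z)" "\<lambda>z. 0"] Ck_on_const by auto
  have "img_of d \<subseteq> overlap d c \<union> V"
  proof
    fix z assume z: "z \<in> img_of d"
    have "K \<subseteq> dom_of c" unfolding K_def using r by auto
    moreover have "chart_inv d z \<in> topspace X" using z dom_subset[OF d] by auto
    moreover have "z = snd d (chart_inv d z)" "chart_inv d z \<in> dom_of d" using z by auto
    ultimately show "z \<in> overlap d c \<union> V" unfolding V_def overlap_def by blast
  qed
  then show ?thesis using Ck_on_subset[OF Ck_on_Un[OF O V 1 2]] by blast
qed

text \<open>The index set consists of the centres of finitely many coordinate balls that cover the compact manifold; dividing the bump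
  functions by their positive sum gives total 1.  The prescribed point \<open>p0\<close> is added as a further centre, with a prescribed
  chart, so that its own summand is positive there.\<close>

lemma partition_of_unity:
  assumes c0: "c0 \<in> A" and p0: "p0 \<in> dom_of c0"
  obtains I :: "'a set" and b K \<rho> where "finite I" "\<And>i. i \<in> I \<Longrightarrow> b i \<in> A"
    "\<And>i. i \<in> I \<Longrightarrow> compactin X (K i)" "\<And>i. i \<in> I \<Longrightarrow> K i \<subseteq> dom_of (b i)"
    "\<And>i p. i \<in> I \<Longrightarrow> 0 \<le> (\<rho> i p :: real)" "\<And>i p. i \<in> I \<Longrightarrow> p \<notin> K i \<Longrightarrow> \<rho> i p = 0"
    "\<And>p. p \<in> topspace X \<Longrightarrow> (\<Sum>i\<in>I. \<rho> i p) = 1"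
    "\<And>i d. i \<in> I \<Longrightarrow> d \<in> A \<Longrightarrow> Ck_on 2 (\<lambda>z. \<rho> i (chart_inv d z)) (img_of d)"
    "p0 \<in> I" "b p0 = c0" "\<rho> p0 p0 > 0"
proof -
  have "\<exists>c. c \<in> A \<and> p \<in> dom_of c" if "p \<in> topspace X" for p using that cover by blast
  then obtain b0 where b0: "\<And>p. p \<in> topspace X \<Longrightarrow> b0 p \<in> A \<and> p \<in> dom_of (b0 p)" by metis
  \<comment> \<open>\<open>b p\<close> is a chart around \<open>p\<close>\<close>
  define b where "b = b0(p0 := c0)"
  have b: "b p \<in> A" "p \<in> dom_of (b p)" if "p \<in> topspace X" for p
    using b0[OF that] c0 p0 by (auto simp: b_def)
  have "\<exists>r>0. cball (snd (b p) p) r \<subseteq> img_of (b p)" if "p \<in> topspace X" for p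
    using open_contains_cball open_img[OF b(1)[OF that]] chart_in_img[OF b(2)[OF that]] by blast
  then obtain r where r: "\<And>p. p \<in> topspace X \<Longrightarrow> r p > 0 \<and> cball (snd (b p) p) (r p) \<subseteq> img_of (b p)" by metis
  define \<beta> where "\<beta> p = bump (b p) (snd (b p) p) (r p)" for p
  define K where "K p = chart_inv (b p) ` cball (snd (b p) p) (r p)" for p
  define W where "W p = {q \<in> dom_of (b p). snd (b p) q \<in> ball (snd (b p) p) (r p)}" for p
  have p0X: "p0 \<in> topspace X" using p0 dom_subset[OF c0] by blast
  have \<beta>0: "\<beta> p q = 0" if p: "p \<in> topspace X" and q: "q \<notin> K p" for p q
  proof (cases "q \<in> dom_of (b p)")
    case True
    have "snd (b p) q \<notin> cball (snd (b p) p) (r p)"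
      using q chart_inv_chart[OF b(1)[OF p] True] unfolding K_def by (metis image_eqI)
    then have "(norm (snd (b p) q - snd (b p) p))\<^sup>2 \<ge> (r p)\<^sup>2" using r[OF p]
      by (intro power_mono) (auto simp: dist_norm norm_minus_commute)
    then show ?thesis unfolding \<beta>_def bump_def by simp
  qed (simp add: \<beta>_def bump_def)
  have \<beta>pos: "\<beta> p q > 0" if p: "p \<in> topspace X" and q: "q \<in> W p" for p q
  proof -
    have "(norm (snd (b p) q - snd (b p) p))\<^sup>2 < (r p)\<^sup>2" using q r[OF p]
      by (intro power_strict_mono) (auto simp: W_def dist_norm norm_minus_commute)
    then show ?thesis using q unfolding \<beta>_def bump_def W_def by simp
  qed
  have \<beta>nonneg: "\<beta> p q \<ge> 0" for p q unfolding \<beta>_def bump_def by simp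
  have W: "openin X (W p)" "p \<in> W p" if "p \<in> topspace X" for p
    unfolding W_def using open_chart_inv_image[OF b(1)[OF that] open_ball] b(2)[OF that] r[OF that]
    by (blast, simp)
  have "\<forall>U\<in>W ` topspace X. openin X U" "topspace X \<subseteq> \<Union>(W ` topspace X)" using W by auto
  with comp[unfolded compact_space_alt] obtain F where F: "finite F" "F \<subseteq> W ` topspace X" "topspace X \<subseteq> \<Union>F" by meson
  then obtain I0 where I0: "I0 \<subseteq> topspace X" "finite I0" "F = W ` I0" by (metis finite_subset_image)
  define I where "I = insert p0 I0"
  have I: "finite I" "I \<subseteq> topspace X" "p0 \<in> I" using I0 p0X unfolding I_def by auto
  define B where "B q = (\<Sum>i\<in>I. \<beta> i q)" for q
  have B: "B q > 0" if q: "q \<in> topspace X" for q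
  proof -
    obtain i where i: "i \<in> I0" "q \<in> W i" using F I0 q by blast
    have "0 < \<beta> i q" using \<beta>pos i I0 by blast
    also have "\<dots> \<le> B q" unfolding B_def using I i \<beta>nonneg by (intro member_le_sum) (auto simp: I_def)
    finally show ?thesis .
  qed
  define \<rho> where "\<rho> i q = \<beta> i q / B q" for i q
  show thesis
  proof (rule that[of I b K \<rho>])
    show "b i \<in> A" "compactin X (K i)" "K i \<subseteq> dom_of (b i)" if "i \<in> I" for i
    proof -
      have i: "i \<in> topspace X" using that I by blast
      show "b i \<in> A" using b i by blast
      show "compactin X (K i)" unfolding K_def using b[OF i] r[OF i] by (intro closed_chart_inv_compact) auto
      show "K i \<subseteq> dom_of (b i)" unfolding K_def using r[OF i] by auto
    qed
    show "0 \<le> \<rho> i p" for i p unfolding \<rho>_def B_def by (intro divide_nonneg_nonneg sum_nonneg \<beta>nonneg)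
    show "\<rho> i p = 0" if "i \<in> I" "p \<notin> K i" for i p using \<beta>0[of i p] that I unfolding \<rho>_def by auto
    show "(\<Sum>i\<in>I. \<rho> i p) = 1" if "p \<in> topspace X" for p
      unfolding \<rho>_def sum_divide_distrib[symmetric] B_def[symmetric] using B[OF that] by simp
    show "Ck_on 2 (\<lambda>z. \<rho> i (chart_inv d z)) (img_of d)" if i: "i \<in> I" and d: "d \<in> A" for i d
    proof -
      have "Ck_on 2 (\<lambda>z. \<beta> j (chart_inv d z)) (img_of d)" if "j \<in> I" for j
        unfolding \<beta>_def using b r I that by (intro Ck_bump d) auto
      moreover have "B (chart_inv d z) \<noteq> 0" if "z \<in> img_of d" for z
        using B[of "chart_inv d z"] dom_subset[OF d] that by force
      ultimately show ?thesis unfolding \<rho>_def B_def using i by (intro Ck_on_divide Ck_on_sum open_img d) auto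
    qed
    show "b p0 = c0" by (simp add: b_def)
    show "\<rho> p0 p0 > 0" unfolding \<rho>_def using \<beta>pos[OF p0X W(2)[OF p0X]] B[OF p0X] by simp
  qed (use I in auto)
qed

text \<open>The real part suffices, since the Laplacian of a real function is real.\<close>

definition lap :: "('a \<Rightarrow> real) \<Rightarrow> ('a, 'n) chart \<Rightarrow> complex^'n \<Rightarrow> real" where
  "lap F c z = Re (laplacian (h c) (\<lambda>z. of_real (F (chart_inv c z))) z)"

text \<open>The transformation rule of the coefficient of a top-degree form \<open>N |dz\<^sup>1 \<and> \<dots> \<and> dz\<^sup>n|\<^sup>2\<close>, for which integrals over the manifold do
  not depend on charts.\<close>

definition density :: "(('a, 'n) chart \<Rightarrow> complex^'n \<Rightarrow> real) \<Rightarrow> bool" where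
  "density N \<longleftrightarrow> (\<forall>c\<in>A. continuous_on (img_of c) (N c)) \<and>
     (\<forall>c\<in>A. \<forall>d\<in>A. \<forall>p\<in>dom_of c \<inter> dom_of d. N c (snd c p) = (cmod (det (jac c d p)))\<^sup>2 * N d (snd d p))"

lemma herm_inv_Ck: "c \<in> A \<Longrightarrow> Ck_on k (\<lambda>z. herm_inv (h c z) i j) (img_of c)"
  by (intro Ck_on_herm_inv open_img metric_Ck pos_hermitian_det metric_pos)

lemma lap_continuous:
  assumes "c \<in> A" "Ck_on 2 (\<lambda>z. F (chart_inv c z)) (img_of c)"
  shows "continuous_on (img_of c) (lap F c)"
proof -
  note o = open_img[OF assms(1)]
  have "Ck_on 0 (dz i (dzbar j (\<lambda>z. of_real (F (chart_inv c z))))) (img_of c)" for i j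
    using assms(2) by (intro Ck_on_dz Ck_on_dzbar o Ck_on_of_real) (simp add: numeral_2_eq_2)
  then show ?thesis unfolding lap_def laplacian_def
    using Ck_on_continuous[OF herm_inv_Ck[OF assms(1)]] by (intro continuous_intros) auto
qed

lemma lap_local_zero:
  assumes c: "c \<in> A" and K: "closedin X K" "\<And>p. p \<notin> K \<Longrightarrow> F p = 0" and z: "z \<in> img_of c" "chart_inv c z \<notin> K"
  shows "lap F c z = 0"
proof -
  define V where "V = snd c ` (dom_of c \<inter> (topspace X - K))"
  have V: "open V" unfolding V_def by (rule open_chart_image[OF c openin_diff[OF openin_topspace K(1)]])
  have zV: "z \<in> V" unfolding V_def using z dom_subset[OF c] by (intro image_eqI[of _ _ "chart_inv c z"]) auto
  have F0: "F (chart_inv c w) = 0" if "w \<in> V" for w using that c K(2) unfolding V_def by auto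
  have "dzbar j (\<lambda>z. of_real (F (chart_inv c z))) w = 0" if "w \<in> V" for j w
  proof -
    have "dzbar j (\<lambda>z. of_real (F (chart_inv c z))) w = dzbar j (\<lambda>z. 0) w"
      by (rule dzbar_cong_open[OF V that]) (simp add: F0)
    then show ?thesis by simp
  qed
  then have "dz i (dzbar j (\<lambda>z. of_real (F (chart_inv c z)))) z = dz i (\<lambda>z. 0) z" for i j
    by (intro dz_cong_open[OF V zV])
  then show ?thesis unfolding lap_def laplacian_def by simp
qed

text \<open>The integrand \<open>N G (lap F)\<close> is a density supported in \<open>K \<inter> L\<close>, inside the overlap of both charts; there the
  transition map changes one integral into the other.\<close>

lemma density_integral_swap:
  assumes N: "density N" and a: "a \<in> A" and b: "b \<in> A"
    and K: "compactin X K" "K \<subseteq> dom_of a" and L: "compactin X L" "L \<subseteq> dom_of b"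
    and F: "\<And>d. d \<in> A \<Longrightarrow> Ck_on 2 (\<lambda>z. F (chart_inv d z)) (img_of d)" "\<And>p. p \<notin> K \<Longrightarrow> F p = 0"
    and G: "\<And>d. d \<in> A \<Longrightarrow> Ck_on 2 (\<lambda>z. G (chart_inv d z)) (img_of d)" "\<And>p. p \<notin> L \<Longrightarrow> G p = 0"
  shows "integral\<^sup>L lborel (zero_extend (img_of a) (\<lambda>z. N a z * G (chart_inv a z) * lap F a z))
       = integral\<^sup>L lborel (zero_extend (img_of b) (\<lambda>z. N b z * G (chart_inv b z) * lap F b z))"
proof -
  define E where "E d z = N d z * G (chart_inv d z) * lap F d z" for d z
  define S where "S = overlap a b"
  have cl: "closedin X K" "closedin X L" using K L haus compactin_imp_closedin by auto
  have KL: "compactin X (K \<inter> L)" using K(1) cl(2) by (rule compact_Int_closedin)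
  have E0: "E d z = 0" if "d \<in> A" "z \<in> img_of d" "chart_inv d z \<notin> K \<inter> L" for d z
    using lap_local_zero[OF that(1) cl(1) F(2) that(2)] G(2) that(3) unfolding E_def by auto
  have Ec: "continuous_on (img_of d) (E d)" if "d \<in> A" for d
    unfolding E_def using N that Ck_on_continuous[OF G(1)[OF that]] lap_continuous[OF that F(1)[OF that]]
    unfolding density_def by (intro continuous_intros) auto
  have E0': "E d z = 0" if d: "d \<in> A" and z: "z \<in> img_of d" "z \<notin> snd d ` (K \<inter> L)" for d z
  proof (rule E0[OF d z(1)])
    show "chart_inv d z \<notin> K \<inter> L" using z by (metis chart_chart_inv image_eqI)
  qed
  have img: "transition a b ` S = overlap b a"
  proof (intro set_eqI iffI)
    fix w assume "w \<in> transition a b ` S"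
    then show "w \<in> overlap b a" using a unfolding S_def transition_def overlap_def by auto
  next
    fix w assume "w \<in> overlap b a"
    then obtain p where p: "p \<in> dom_of a" "p \<in> dom_of b" "w = snd b p" unfolding overlap_def by auto
    then show "w \<in> transition a b ` S" using a unfolding S_def transition_def overlap_def
      by (intro image_eqI[of _ _ "snd a p"]) auto
  qed
  have inj: "inj_on (transition a b) S"
  proof (rule inj_onI)
    fix z w assume zw: "z \<in> S" "w \<in> S" "transition a b z = transition a b w"
    then have "chart_inv a z = chart_inv a w"
      using inj_onD[OF inj_chart[OF b]] a by (auto simp: S_def overlap_iff transition_def)
    then show "z = w" using zw a by (metis S_def chart_chart_inv overlap_iff)
  qed
  have sub: "snd d ` (K \<inter> L) \<subseteq> overlap d e" if "d \<in> A" "K \<inter> L \<subseteq> dom_of d \<inter> dom_of e" for d e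
    using that unfolding overlap_def by auto
  have full: "indicator (overlap d e) z * E d z = zero_extend (img_of d) (E d) z"
    if "d \<in> A" "K \<inter> L \<subseteq> dom_of d \<inter> dom_of e" for d e z
  proof (cases "z \<in> overlap d e")
    case True
    then show ?thesis using overlap_subset[of d e] by (auto simp: zero_extend_def)
  next
    case False
    then have "z \<notin> snd d ` (K \<inter> L)" using sub[OF that] by blast
    then show ?thesis using False E0'[OF that(1), of z] by (auto simp: zero_extend_def)
  qed
  have int: "integrable lborel (zero_extend (img_of d) (E d))" if "d \<in> A" "K \<inter> L \<subseteq> dom_of d" for d
  proof (rule integrable_zero_extend[of _ "snd d ` (K \<inter> L)"])
    show "compact (snd d ` (K \<inter> L))" by (rule compact_chart_image[OF that(1) KL that(2)])
    show "snd d ` (K \<inter> L) \<subseteq> img_of d" using that(2) by auto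
  qed (use open_img Ec E0' that in auto)
  have transform_E: "(cmod (det (jac a b (chart_inv a z))))\<^sup>2 * E b (transition a b z) = E a z" if z: "z \<in> S" for z
  proof -
    have z': "z \<in> img_of a" "chart_inv a z \<in> dom_of b" using z a by (auto simp: S_def overlap_iff)
    define p where "p = chart_inv a z"
    have p: "p \<in> dom_of a \<inter> dom_of b" "z = snd a p" unfolding p_def using z' by auto
    have "lap F a (snd a p) = lap F b (snd b p)" unfolding lap_def
      using laplacian_invariant[OF a b p(1), of "\<lambda>p. of_real (F p)"] F(1)[OF b] by (simp add: Ck_on_of_real open_img b)
    moreover have "N a (snd a p) = (cmod (det (jac a b p)))\<^sup>2 * N b (snd b p)"
      using N a b p(1) unfolding density_def by blast
    ultimately show ?thesis using p a b by (simp add: E_def transition_def)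
  qed
  have subs: "K \<inter> L \<subseteq> dom_of a \<inter> dom_of b" "K \<inter> L \<subseteq> dom_of b \<inter> dom_of a" using K L by auto
  have "integral\<^sup>L lborel (\<lambda>z. indicator S z * ((cmod (det (jac a b (chart_inv a z))))\<^sup>2 * E b (transition a b z)))
     = integral\<^sup>L lborel (\<lambda>w. indicator (transition a b ` S) w * E b w)"
  proof (rule change_of_variables_complex)
    show "open S" unfolding S_def by (rule open_overlap[OF a b])
    show "inj_on (transition a b) S" by (rule inj)
    show "(transition a b has_derivative (*v) (jac a b (chart_inv a z))) (at z)" if "z \<in> S" for z
      using transition_has_derivative[OF a b] that unfolding S_def by blast
    show "integrable lborel (\<lambda>w. indicator (transition a b ` S) w * E b w)"
      unfolding img full[OF b subs(2)] using int[OF b] subs by auto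
    have "(\<lambda>z. indicator S z * ((cmod (det (jac a b (chart_inv a z))))\<^sup>2 * E b (transition a b z))) = (\<lambda>z. indicator S z * E a z)"
      using transform_E by (auto simp: indicator_def fun_eq_iff)
    then show "integrable lborel (\<lambda>z. indicator S z * ((cmod (det (jac a b (chart_inv a z))))\<^sup>2 * E b (transition a b z)))"
      unfolding S_def using full[OF a subs(1)] int[OF a] subs by auto
  qed
  moreover have "(\<lambda>z. indicator S z * ((cmod (det (jac a b (chart_inv a z))))\<^sup>2 * E b (transition a b z))) = zero_extend (img_of a) (E a)"
  proof
    fix z
    have "indicator S z * ((cmod (det (jac a b (chart_inv a z))))\<^sup>2 * E b (transition a b z)) = indicator S z * E a z"
      using transform_E by (cases "z \<in> S") simp_all
    then show "indicator S z * ((cmod (det (jac a b (chart_inv a z))))\<^sup>2 * E b (transition a b z)) = zero_extend (img_of a) (E a) z"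
      using full[OF a subs(1)] by (simp add: S_def)
  qed
  moreover have "(\<lambda>w. indicator (transition a b ` S) w * E b w) = zero_extend (img_of b) (E b)"
    unfolding img full[OF b subs(2)] ..
  ultimately show ?thesis unfolding E_def[symmetric] by (simp add: E_def[abs_def])
qed

text \<open>The sum is the integral of \<open>N\<close> times the Laplacian of \<open>\<Sum>\<^sub>i \<rho>\<^sub>i = 1\<close>.  Each Laplacian is computed in its own chart, so the
  integrand of the \<open>i\<close>-th summand is first divided up as \<open>\<Sum>\<^sub>k N \<rho>\<^sub>k (lap \<rho>\<^sub>i)\<close>; after moving the \<open>(i, k)\<close>-term to the chart of \<open>k\<close>, the
  summation over \<open>i\<close> takes place in a fixed chart.\<close>

theorem density_integral_laplacian:
  assumes N: "density N" and I: "finite I" "\<And>i. i \<in> I \<Longrightarrow> b i \<in> A"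
    and K: "\<And>i. i \<in> I \<Longrightarrow> compactin X (K i)" "\<And>i. i \<in> I \<Longrightarrow> K i \<subseteq> dom_of (b i)"
    and \<rho>0: "\<And>i p. i \<in> I \<Longrightarrow> p \<notin> K i \<Longrightarrow> \<rho> i p = 0"
    and \<rho>1: "\<And>p. p \<in> topspace X \<Longrightarrow> (\<Sum>i\<in>I. \<rho> i p) = 1"
    and \<rho>C: "\<And>i d. i \<in> I \<Longrightarrow> d \<in> A \<Longrightarrow> Ck_on 2 (\<lambda>z. \<rho> i (chart_inv d z)) (img_of d)"
  shows "(\<Sum>i\<in>I. integral\<^sup>L lborel (zero_extend (img_of (b i)) (\<lambda>z. N (b i) z * lap (\<rho> i) (b i) z))) = 0"
proof -
  define E where "E i k d = zero_extend (img_of d) (\<lambda>z. N d z * \<rho> k (chart_inv d z) * lap (\<rho> i) d z)" for i k d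
  have \<rho>1': "(\<Sum>i\<in>I. \<rho> i (chart_inv d z)) = 1" if "d \<in> A" "z \<in> img_of d" for d z
    using \<rho>1[of "chart_inv d z"] dom_subset[OF that(1)] that(2) by force
  have Nc: "continuous_on (img_of d) (N d)" if "d \<in> A" for d using N that unfolding density_def by blast
  have int: "integrable lborel (E i k d)" if i: "i \<in> I" "k \<in> I" and d: "d = b i \<or> d = b k" for i k d
  proof -
    \<comment> \<open>the integrand vanishes outside \<open>K i \<inter> K k\<close>; take the one of the two sets that lies in the chart \<open>d\<close>\<close>
    define L where "L = (if d = b i then K i else K k)"
    have dA: "d \<in> A" using that I by auto
    have L: "compactin X L" "L \<subseteq> dom_of d" using K that unfolding L_def by auto
    show ?thesis unfolding E_def
    proof (rule integrable_zero_extend[OF open_img[OF dA] compact_chart_image[OF dA L]])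
      show "snd d ` L \<subseteq> img_of d" using L by auto
      show "continuous_on (img_of d) (\<lambda>z. N d z * \<rho> k (chart_inv d z) * lap (\<rho> i) d z)"
        by (intro continuous_on_mult Nc dA lap_continuous \<rho>C i Ck_on_continuous[OF \<rho>C])
      fix z assume z: "z \<in> img_of d" "z \<notin> snd d ` L"
      then have "chart_inv d z \<notin> L" by (metis chart_chart_inv image_eqI)
      then consider "chart_inv d z \<notin> K i" | "chart_inv d z \<notin> K k" unfolding L_def by (metis (full_types))
      then show "N d z * \<rho> k (chart_inv d z) * lap (\<rho> i) d z = 0"
      proof cases
        case 1
        have "lap (\<rho> i) d z = 0"
          by (rule lap_local_zero[OF dA _ \<rho>0[OF i(1)] z(1) 1]) (use K(1)[OF i(1)] haus compactin_imp_closedin in blast)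
        then show ?thesis by simp
      qed (simp add: \<rho>0 i)
    qed
  qed
  have lap_sum: "(\<Sum>i\<in>I. lap (\<rho> i) d z) = 0" if d: "d \<in> A" and z: "z \<in> img_of d" for d z
  proof -
    define f where "f i = (\<lambda>z. complex_of_real (\<rho> i (chart_inv d z)))" for i
    have f: "Ck_on 2 (f i) (img_of d)" if "i \<in> I" for i
      unfolding f_def by (intro Ck_on_of_real open_img d \<rho>C that)
    have f1: "f i differentiable (at w)" if "i \<in> I" "w \<in> img_of d" for i w
      using Ck_on_differentiable[OF f[OF that(1)] _ that(2)] by simp
    have "Ck_on 1 (dzbar j (f i)) (img_of d)" if "i \<in> I" for i j
      using f[OF that] by (intro Ck_on_dzbar open_img d) (simp add: numeral_2_eq_2)
    then have f2: "dzbar j (f i) differentiable (at z)" if "i \<in> I" for i j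
      using Ck_on_differentiable that z by blast
    have "dzbar j (\<lambda>w. 1) w = (\<Sum>i\<in>I. dzbar j (f i) w)" if w: "w \<in> img_of d" for w j
    proof -
      have "(\<Sum>i\<in>I. f i v) = 1" if "v \<in> img_of d" for v
        using \<rho>1'[OF d that] unfolding f_def of_real_sum[symmetric] by simp
      then have "dzbar j (\<lambda>w. 1) w = dzbar j (\<lambda>w. \<Sum>i\<in>I. f i w) w"
        by (intro dzbar_cong_open[OF open_img[OF d] w]) simp
      then show ?thesis using f1 w by (simp add: dzbar_sum)
    qed
    then have "0 = dz i (\<lambda>w. \<Sum>k\<in>I. dzbar j (f k) w) z" for i j
      using dz_cong_open[OF open_img[OF d] z, of "\<lambda>w. 0" "\<lambda>w. \<Sum>k\<in>I. dzbar j (f k) w" i] by simp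
    then have s0: "(\<Sum>k\<in>I. dz i (dzbar j (f k)) z) = 0" for i j using f2 by (simp add: dz_sum)
    have "(\<Sum>k\<in>I. laplacian (h d) (f k) z) = (\<Sum>i\<in>UNIV. \<Sum>k\<in>I. \<Sum>j\<in>UNIV. herm_inv (h d z) i j * dz i (dzbar j (f k)) z)"
      unfolding laplacian_def by (rule sum.swap)
    also have "\<dots> = (\<Sum>i\<in>UNIV. \<Sum>j\<in>UNIV. herm_inv (h d z) i j * (\<Sum>k\<in>I. dz i (dzbar j (f k)) z))"
      by (simp add: sum_distrib_left) (rule sum.cong[OF refl], rule sum.swap)
    also have "\<dots> = 0" unfolding s0 by simp
    finally show ?thesis unfolding lap_def f_def[symmetric] Re_sum[symmetric] by simp
  qed
  have "integral\<^sup>L lborel (zero_extend (img_of (b i)) (\<lambda>z. N (b i) z * lap (\<rho> i) (b i) z))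
      = (\<Sum>k\<in>I. integral\<^sup>L lborel (E i k (b i)))" if i: "i \<in> I" for i
  proof -
    have "zero_extend (img_of (b i)) (\<lambda>z. N (b i) z * lap (\<rho> i) (b i) z) = (\<lambda>z. \<Sum>k\<in>I. E i k (b i) z)"
    proof
      fix z
      show "zero_extend (img_of (b i)) (\<lambda>z. N (b i) z * lap (\<rho> i) (b i) z) z = (\<Sum>k\<in>I. E i k (b i) z)"
        using \<rho>1'[OF I(2)[OF i], of z]
        by (simp add: E_def zero_extend_def sum_distrib_left[symmetric] sum_distrib_right[symmetric])
    qed
    then show ?thesis using int i by simp
  qed
  then have "(\<Sum>i\<in>I. integral\<^sup>L lborel (zero_extend (img_of (b i)) (\<lambda>z. N (b i) z * lap (\<rho> i) (b i) z)))
     = (\<Sum>i\<in>I. \<Sum>k\<in>I. integral\<^sup>L lborel (E i k (b i)))" by simp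
  also have "\<dots> = (\<Sum>i\<in>I. \<Sum>k\<in>I. integral\<^sup>L lborel (E i k (b k)))"
    unfolding E_def by (intro sum.cong refl density_integral_swap[OF N I(2) I(2) K(1) K(2) K(1) K(2) \<rho>C \<rho>0 \<rho>C \<rho>0])
  also have "\<dots> = (\<Sum>k\<in>I. integral\<^sup>L lborel (\<lambda>z. \<Sum>i\<in>I. E i k (b k) z))"
    by (subst sum.swap) (simp add: int)
  also have "\<dots> = 0"
  proof (intro sum.neutral ballI)
    fix k assume k: "k \<in> I"
    have "(\<lambda>z. \<Sum>i\<in>I. E i k (b k) z) = (\<lambda>z. 0)"
    proof
      fix z
      show "(\<Sum>i\<in>I. E i k (b k) z) = 0"
        using lap_sum[OF I(2)[OF k], of z]
        by (cases "z \<in> img_of (b k)") (simp_all add: E_def zero_extend_def sum_distrib_left[symmetric])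
    qed
    then show "integral\<^sup>L lborel (\<lambda>z. \<Sum>i\<in>I. E i k (b k) z) = 0" by simp
  qed
  finally show ?thesis .
qed

end

section \<open>Levi-Civita Ricci curvature of a local metric\<close>

locale local_metric =
  fixes U :: "(complex^'n::finite) set" and h :: "complex^'n \<Rightarrow> complex^'n^'n"
  assumes U: "open U" and h_Ck: "\<And>k i j. Ck_on k (\<lambda>z. h z $ i $ j) U"
    and h_pos: "\<And>z. z \<in> U \<Longrightarrow> pos_hermitian (h z)"
begin

text \<open>The inverse metric \<open>h\<^sup>k\<^sup>l\<close>.\<close>

definition Q :: "'n \<Rightarrow> 'n \<Rightarrow> complex^'n \<Rightarrow> complex" where "Q k l z = herm_inv (h z) k l"

text \<open>This is \<open>\<partial>\<^sub>i log det h\<close> plus the trace of the torsion \<open>h\<^sup>k\<^sup>l (\<partial>\<^sub>k h\<^sub>i\<^sub>l - \<partial>\<^sub>i h\<^sub>k\<^sub>l)\<close> of the Chern connection.\<close>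

definition alpha :: "'n \<Rightarrow> complex^'n \<Rightarrow> complex" where
  "alpha i z = (\<Sum>k\<in>UNIV. \<Sum>l\<in>UNIV. Q k l z * dz k (\<lambda>w. h w $ i $ l) z)"

lemma Q_Ck: "Ck_on k (Q i j) U"
  unfolding Q_def by (intro Ck_on_herm_inv U h_Ck pos_hermitian_det h_pos)

lemma dh_Ck: "Ck_on k (dz a (\<lambda>w. h w $ i $ l)) U" "Ck_on k (dzbar a (\<lambda>w. h w $ i $ l)) U"
  by (rule Ck_on_dz Ck_on_dzbar; intro U h_Ck)+

lemma alpha_Ck: "Ck_on k (alpha i) U"
  unfolding alpha_def by (intro Ck_on_sum Ck_on_mult U Q_Ck dh_Ck)

lemma differentiable_all: "(\<And>k. Ck_on k f U) \<Longrightarrow> z \<in> U \<Longrightarrow> f differentiable (at z)"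
  using Ck_on_differentiable[of 1] by blast

lemmas Q_diff = differentiable_all[OF Q_Ck] and h_diff = differentiable_all[OF h_Ck]
  and dh_diff = differentiable_all[OF dh_Ck(1)] differentiable_all[OF dh_Ck(2)]
  and alpha_diff = differentiable_all[OF alpha_Ck]

lemma h_cnj: "z \<in> U \<Longrightarrow> cnj (h z $ i $ j) = h z $ j $ i"
  using h_pos unfolding pos_hermitian_def by metis

lemma Q_cnj: "z \<in> U \<Longrightarrow> cnj (Q i j z) = Q j i z"
  unfolding Q_def by (intro herm_inv_cnj h_pos)

lemma Q_pos: "z \<in> U \<Longrightarrow> 0 \<le> Re (\<Sum>l\<in>UNIV. \<Sum>j\<in>UNIV. Q l j z * v l * cnj (v j))"
  using herm_inv_form(1)[OF h_pos, of z "\<chi> i. v i"] unfolding Q_def by simp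

lemma Q_pos_strict: "z \<in> U \<Longrightarrow> v l \<noteq> 0 \<Longrightarrow> 0 < Re (\<Sum>l\<in>UNIV. \<Sum>j\<in>UNIV. Q l j z * v l * cnj (v j))"
  using herm_inv_form(2)[OF h_pos, of z "\<chi> i. v i"] unfolding Q_def by (auto simp: vec_eq_iff)

lemma dh_cnj:
  assumes z: "z \<in> U"
  shows "cnj (dz k (\<lambda>w. h w $ i $ j) z) = dzbar k (\<lambda>w. h w $ j $ i) z"
proof -
  have "dzbar k (\<lambda>w. h w $ j $ i) z = dzbar k (\<lambda>w. cnj (h w $ i $ j)) z"
    by (rule dzbar_cong_open[OF U z]) (simp add: h_cnj)
  then show ?thesis by (simp add: dzbar_cnj[OF h_diff[OF z]])
qed

lemma cnj_alpha:
  assumes "z \<in> U"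
  shows "cnj (alpha j z) = (\<Sum>k\<in>UNIV. \<Sum>l\<in>UNIV. Q k l z * dzbar l (\<lambda>w. h w $ k $ j) z)"
  unfolding alpha_def using assms by (simp add: Q_cnj dh_cnj) (rule sum.swap)

lemma
  assumes z: "z \<in> U"
  shows dz_Q: "dz i (Q k m) z = - (\<Sum>a\<in>UNIV. \<Sum>b\<in>UNIV. Q k b z * dz i (\<lambda>w. h w $ a $ b) z * Q a m z)"
    and dzbar_Q: "dzbar i (Q k m) z = - (\<Sum>a\<in>UNIV. \<Sum>b\<in>UNIV. Q k b z * dzbar i (\<lambda>w. h w $ a $ b) z * Q a m z)"
proof -
  have d: "det (h w) \<noteq> 0" if "w \<in> U" for w using pos_hermitian_det[OF h_pos[OF that]] .
  have QM: "(\<Sum>l\<in>UNIV. Q k l w * h w $ j $ l) = (if j = k then 1 else 0)" if "w \<in> U" for k j w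
    unfolding Q_def by (rule herm_inv_right[OF d[OF that]])
  have MQ: "(\<Sum>k\<in>UNIV. h z $ k $ l * Q k j z) = (if l = j then 1 else 0)" for l j
    unfolding Q_def by (rule herm_inv_left[OF d[OF z]])
  have "dz i (\<lambda>w. \<Sum>l\<in>UNIV. Q k l w * h w $ j $ l) z = dz i (\<lambda>w. if j = k then 1 else 0) z"
    "dzbar i (\<lambda>w. \<Sum>l\<in>UNIV. Q k l w * h w $ j $ l) z = dzbar i (\<lambda>w. if j = k then 1 else 0) z" for k j
    by (rule dz_cong_open[OF U z] dzbar_cong_open[OF U z]; simp add: QM)+
  then have "(\<Sum>l\<in>UNIV. dz i (Q k l) z * h z $ j $ l + Q k l z * dz i (\<lambda>w. h w $ j $ l) z) = 0"
    "(\<Sum>l\<in>UNIV. dzbar i (Q k l) z * h z $ j $ l + Q k l z * dzbar i (\<lambda>w. h w $ j $ l) z) = 0" for k j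
    by (simp_all add: dz_sum dzbar_sum dz_mult dzbar_mult Q_diff[OF z] h_diff[OF z] differentiable_mult)
  then show "dz i (Q k m) z = - (\<Sum>a\<in>UNIV. \<Sum>b\<in>UNIV. Q k b z * dz i (\<lambda>w. h w $ a $ b) z * Q a m z)"
    "dzbar i (Q k m) z = - (\<Sum>a\<in>UNIV. \<Sum>b\<in>UNIV. Q k b z * dzbar i (\<lambda>w. h w $ a $ b) z * Q a m z)"
    by (intro herm_inv_derivation[of "\<lambda>k l. Q k l z" "\<lambda>k l. h z $ k $ l" _ "\<lambda>k l. _ i (\<lambda>w. h w $ k $ l) z"];
        simp add: QM[OF z] MQ)+
qed

text \<open>Contracting \<open>\<partial>(h\<^sup>-\<^sup>1) = - h\<^sup>-\<^sup>1 (\<partial>h) h\<^sup>-\<^sup>1\<close> over the index of the derivative produces exactly the contraction that defines \<open>\<alpha>\<close>.\<close>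

lemma divergence_Q:
  assumes z: "z \<in> U"
  shows "(\<Sum>i\<in>UNIV. dz i (Q i j) z) = - (\<Sum>a\<in>UNIV. Q a j z * alpha a z)"
    and "(\<Sum>i\<in>UNIV. dzbar i (Q j i) z) = - (\<Sum>b\<in>UNIV. Q j b z * cnj (alpha b z))"
proof -
  have "(\<Sum>i\<in>UNIV. dz i (Q i j) z) = - (\<Sum>i\<in>UNIV. \<Sum>a\<in>UNIV. \<Sum>b\<in>UNIV. Q i b z * dz i (\<lambda>w. h w $ a $ b) z * Q a j z)"
    unfolding dz_Q[OF z] by (simp add: sum_negf)
  also have "\<dots> = - (\<Sum>a\<in>UNIV. Q a j z * alpha a z)"
    by (subst sum.swap) (simp add: alpha_def sum_distrib_left mult_ac)
  finally show "(\<Sum>i\<in>UNIV. dz i (Q i j) z) = - (\<Sum>a\<in>UNIV. Q a j z * alpha a z)" .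
  have "(\<Sum>i\<in>UNIV. dzbar i (Q j i) z) = - (\<Sum>i\<in>UNIV. \<Sum>a\<in>UNIV. \<Sum>b\<in>UNIV. Q j b z * dzbar i (\<lambda>w. h w $ a $ b) z * Q a i z)"
    unfolding dzbar_Q[OF z] by (simp add: sum_negf)
  also have "\<dots> = - (\<Sum>b\<in>UNIV. \<Sum>a\<in>UNIV. \<Sum>i\<in>UNIV. Q j b z * dzbar i (\<lambda>w. h w $ a $ b) z * Q a i z)"
    by (subst sum.swap, subst (2) sum.swap, subst sum.swap) simp
  also have "\<dots> = - (\<Sum>b\<in>UNIV. Q j b z * cnj (alpha b z))"
    unfolding cnj_alpha[OF z] by (simp add: sum_distrib_left mult_ac)
  finally show "(\<Sum>i\<in>UNIV. dzbar i (Q j i) z) = - (\<Sum>b\<in>UNIV. Q j b z * cnj (alpha b z))" .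
qed

text \<open>The quadratic terms cancel after exchanging the two summation indices, by the symmetry of the first Christoffel symbols.
  The traces of the two kinds of Christoffel symbols are \<open>(\<beta>\<^sub>i + \<alpha>\<^sub>i) / 2\<close> and half the difference of \<open>\<beta>\<close> and the conjugate of \<open>\<alpha>\<close>,
  where \<open>\<beta>\<close> stands for \<open>\<partial>\<^sub>i log det h\<close> and \<open>\<partial>bar\<^sub>i log det h\<close>; the contributions of \<open>\<beta>\<close> cancel because mixed derivatives commute.\<close>

lemma ricci_trace:
  assumes z: "z \<in> U"
  shows "(\<Sum>k\<in>UNIV. LC_curvature h i j k k z) = - (dzbar j (alpha i) z + cnj (dzbar i (alpha j) z)) / 2"
proof -
  define beta where "beta i z = (\<Sum>k\<in>UNIV. \<Sum>l\<in>UNIV. Q k l z * dz i (\<lambda>w. h w $ k $ l) z)" for i z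
  define betab where "betab i z = (\<Sum>k\<in>UNIV. \<Sum>l\<in>UNIV. Q k l z * dzbar i (\<lambda>w. h w $ k $ l) z)" for i z
  have Qi: "inv_coeff h w k l = Q k l w" for k l w by (simp add: Q_def inv_coeff_herm_inv)
  have Gc: "Ck_on r (LC_Gamma h a b c) U" "Ck_on r (LC_Gammabar h a b c) U" for r a b c
    unfolding LC_Gamma_def LC_Gammabar_def Qi
    by (intro Ck_on_mult Ck_on_const Ck_on_sum Ck_on_add Ck_on_diff U Q_Ck dh_Ck)+
  note Gd = differentiable_all[OF Gc(1) z] differentiable_all[OF Gc(2) z]
  have bc: "Ck_on r (beta a) U" "Ck_on r (betab a) U" for r a
    unfolding beta_def betab_def by (intro Ck_on_mult Ck_on_sum U Q_Ck dh_Ck)+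
  note bd = differentiable_all[OF bc(1) z] differentiable_all[OF bc(2) z]
  have quad: "(\<Sum>k\<in>UNIV. \<Sum>s\<in>UNIV. LC_Gamma h i k s z * LC_Gammabar h j s k z - LC_Gammabar h j k s z * LC_Gamma h s i k z) = 0"
  proof -
    have sym: "LC_Gamma h s i k z = LC_Gamma h i s k z" for s k by (simp add: LC_Gamma_def add.commute)
    have "(\<Sum>k\<in>UNIV. \<Sum>s\<in>UNIV. LC_Gamma h i k s z * LC_Gammabar h j s k z)
        = (\<Sum>k\<in>UNIV. \<Sum>s\<in>UNIV. LC_Gammabar h j k s z * LC_Gamma h s i k z)"
      unfolding sym by (subst sum.swap) (simp add: mult.commute)
    then show ?thesis by (simp add: sum_subtractf)
  qed
  have tr1: "(\<Sum>k\<in>UNIV. LC_Gamma h i k k w) = (1/2) * (beta i w + alpha i w)" for w i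
    by (simp add: LC_Gamma_def Qi beta_def alpha_def distrib_left sum.distrib sum_distrib_left)
  have tr2: "(\<Sum>k\<in>UNIV. LC_Gammabar h i k k w) = (1/2) * (betab i w - cnj (alpha i w))" if "w \<in> U" for w i
    unfolding cnj_alpha[OF that] by (simp add: LC_Gammabar_def Qi betab_def right_diff_distrib sum_subtractf sum_distrib_left)
  have ca: "(\<lambda>w. cnj (alpha i w)) differentiable (at z)" for i
    using Ck_on_cnj[OF U alpha_Ck] by (rule differentiable_all[OF _ z])
  have 1: "(\<Sum>k\<in>UNIV. dzbar j (LC_Gamma h i k k) z) = (1/2) * (dzbar j (beta i) z + dzbar j (alpha i) z)"
  proof -
    have "(\<Sum>k\<in>UNIV. dzbar j (LC_Gamma h i k k) z) = dzbar j (\<lambda>w. \<Sum>k\<in>UNIV. LC_Gamma h i k k w) z"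
      by (simp add: dzbar_sum Gd)
    also have "\<dots> = (1/2) * (dzbar j (beta i) z + dzbar j (alpha i) z)"
      unfolding tr1 using bd alpha_diff[OF z] by (simp only: dzbar_cmult differentiable_add dzbar_add)
    finally show ?thesis .
  qed
  have 2: "(\<Sum>k\<in>UNIV. dz i (LC_Gammabar h j k k) z) = (1/2) * (dz i (betab j) z - cnj (dzbar i (alpha j) z))"
  proof -
    have "(\<Sum>k\<in>UNIV. dz i (LC_Gammabar h j k k) z) = dz i (\<lambda>w. \<Sum>k\<in>UNIV. LC_Gammabar h j k k w) z"
      by (simp add: dz_sum Gd)
    also have "\<dots> = dz i (\<lambda>w. (1/2) * (betab j w - cnj (alpha j w))) z"
      by (rule dz_cong_open[OF U z tr2])
    also have "\<dots> = (1/2) * (dz i (betab j) z - dz i (\<lambda>w. cnj (alpha j w)) z)"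
      using bd ca by (simp only: dz_cmult differentiable_diff dz_diff)
    finally show ?thesis by (simp only: dz_cnj[OF alpha_diff[OF z]])
  qed
  have 3: "dzbar j (beta i) z = dz i (betab j) z"
  proof -
    have "dzbar j (beta i) z = (\<Sum>k\<in>UNIV. \<Sum>l\<in>UNIV. dzbar j (Q k l) z * dz i (\<lambda>w. h w $ k $ l) z + Q k l z * dzbar j (dz i (\<lambda>w. h w $ k $ l)) z)"
      unfolding beta_def using Q_diff[OF z] dh_diff[OF z]
      by (simp add: dzbar_sum dzbar_mult differentiable_sum differentiable_mult)
    moreover have "dz i (betab j) z = (\<Sum>k\<in>UNIV. \<Sum>l\<in>UNIV. dz i (Q k l) z * dzbar j (\<lambda>w. h w $ k $ l) z + Q k l z * dz i (dzbar j (\<lambda>w. h w $ k $ l)) z)"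
      unfolding betab_def using Q_diff[OF z] dh_diff[OF z]
      by (simp add: dz_sum dz_mult differentiable_sum differentiable_mult)
    moreover have "dz i (dzbar j (\<lambda>w. h w $ k $ l)) z = dzbar j (dz i (\<lambda>w. h w $ k $ l)) z" for k l
      by (rule dz_dzbar_commute[OF U h_Ck z])
    moreover have "(\<Sum>k\<in>UNIV. \<Sum>l\<in>UNIV. dzbar j (Q k l) z * dz i (\<lambda>w. h w $ k $ l) z)
        = (\<Sum>k\<in>UNIV. \<Sum>l\<in>UNIV. dz i (Q k l) z * dzbar j (\<lambda>w. h w $ k $ l) z)"
    proof -
      have "(\<Sum>k\<in>UNIV. \<Sum>l\<in>UNIV. dzbar j (Q k l) z * dz i (\<lambda>w. h w $ k $ l) z)
        = - (\<Sum>k\<in>UNIV. \<Sum>l\<in>UNIV. \<Sum>a\<in>UNIV. \<Sum>b\<in>UNIV. Q k b z * dzbar j (\<lambda>w. h w $ a $ b) z * Q a l z * dz i (\<lambda>w. h w $ k $ l) z)"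
        unfolding dzbar_Q[OF z] by (simp add: sum_negf sum_distrib_right)
      also have "\<dots> = - (\<Sum>k\<in>UNIV. \<Sum>a\<in>UNIV. \<Sum>b\<in>UNIV. \<Sum>l\<in>UNIV. Q k b z * dzbar j (\<lambda>w. h w $ a $ b) z * Q a l z * dz i (\<lambda>w. h w $ k $ l) z)"
        by (rule arg_cong[of _ _ uminus], rule sum.cong[OF refl], rule trans[OF sum.swap], rule sum.cong[OF refl], rule sum.swap)
      also have "\<dots> = - (\<Sum>a\<in>UNIV. \<Sum>b\<in>UNIV. \<Sum>k\<in>UNIV. \<Sum>l\<in>UNIV. Q k b z * dzbar j (\<lambda>w. h w $ a $ b) z * Q a l z * dz i (\<lambda>w. h w $ k $ l) z)"
        by (rule arg_cong[of _ _ uminus], rule trans[OF sum.swap], rule sum.cong[OF refl], rule sum.swap)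
      also have "\<dots> = (\<Sum>k\<in>UNIV. \<Sum>l\<in>UNIV. dz i (Q k l) z * dzbar j (\<lambda>w. h w $ k $ l) z)"
        unfolding dz_Q[OF z] by (simp add: sum_negf sum_distrib_left mult_ac)
      finally show ?thesis .
    qed
    ultimately show ?thesis by (simp add: sum.distrib)
  qed
  have "(\<Sum>k\<in>UNIV. LC_curvature h i j k k z)
      = - ((\<Sum>k\<in>UNIV. dzbar j (LC_Gamma h i k k) z) - (\<Sum>k\<in>UNIV. dz i (LC_Gammabar h j k k) z)
          + (\<Sum>k\<in>UNIV. \<Sum>s\<in>UNIV. LC_Gamma h i k s z * LC_Gammabar h j s k z - LC_Gammabar h j k s z * LC_Gamma h s i k z))"
    unfolding LC_curvature_def by (simp add: sum.distrib sum_subtractf sum_negf)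
  also have "\<dots> = - (dzbar j (alpha i) z + cnj (dzbar i (alpha j) z)) / 2"
    unfolding 1 2 3 quad by (simp add: field_simps)
  finally show ?thesis .
qed

text \<open>The vectors \<open>axis p 1\<close>, \<open>axis q 1\<close> and \<open>axis p 1\<close>, \<open>axis q \<i>\<close> detect the difference and the sum of the entries \<open>(p, q)\<close> and
  \<open>(q, p)\<close>.\<close>

lemma form11_eq_0:
  fixes a :: "complex^'n \<Rightarrow> complex^'n^'n"
  assumes "\<And>v. form11 a z v = 0" shows "a z $ p $ q = 0"
proof -
  have ax: "axis p x $ i * cnj (axis q y $ j) = (if j = q then if i = p then x * cnj y else 0 else 0)" for p q i j :: 'n and x y
    by (simp add: axis_def)
  have eq: "form11 a z (\<lambda>i. if i = 0 then axis p 1 else axis q y) = \<i> * (a z $ p $ q * cnj y - y * a z $ q $ p)" for y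
    unfolding form11_def by (simp add: ax right_diff_distrib sum_subtractf if_distrib[of "\<lambda>x. _ * x"] cong: if_cong)
  have "a z $ p $ q - a z $ q $ p = 0" using assms[of "\<lambda>i. if i = 0 then axis p 1 else axis q 1"] unfolding eq by simp
  moreover have "a z $ p $ q + a z $ q $ p = 0"
    using assms[of "\<lambda>i. if i = 0 then axis p 1 else axis q \<i>"] unfolding eq by (simp add: algebra_simps)
  ultimately show ?thesis by simp
qed

text \<open>The second part is the trace of the first: a skew-hermitian matrix has imaginary trace with respect to a hermitian metric.\<close>

lemma ricci_flat_alpha:
  assumes z: "z \<in> U" and flat: "\<And>v. LC_Ricci h z v = 0"
  shows "dzbar j (alpha i) z + cnj (dzbar i (alpha j) z) = 0"
    and "Re (\<Sum>l\<in>UNIV. \<Sum>j\<in>UNIV. Q l j z * dzbar j (alpha l) z) = 0"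
proof -
  show eq: "dzbar j (alpha i) z + cnj (dzbar i (alpha j) z) = 0" for i j
    using form11_eq_0[OF flat[unfolded LC_Ricci_def], of i j] ricci_trace[OF z, of i j] by (auto simp: complex_eq_iff)
  define T where "T = (\<Sum>l\<in>UNIV. \<Sum>j\<in>UNIV. Q l j z * dzbar j (alpha l) z)"
  have "cnj T = (\<Sum>l\<in>UNIV. \<Sum>j\<in>UNIV. Q j l z * cnj (dzbar j (alpha l) z))"
    unfolding T_def by (simp add: Q_cnj[OF z])
  also have "\<dots> = (\<Sum>l\<in>UNIV. \<Sum>j\<in>UNIV. Q l j z * cnj (dzbar l (alpha j) z))" by (rule sum.swap)
  finally have "T + cnj T = (\<Sum>l\<in>UNIV. \<Sum>j\<in>UNIV. Q l j z * (dzbar j (alpha l) z + cnj (dzbar l (alpha j) z)))"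
    unfolding T_def by (simp add: distrib_left sum.distrib)
  then have "T + cnj T = 0" unfolding eq by simp
  then show "Re (\<Sum>l\<in>UNIV. \<Sum>j\<in>UNIV. Q l j z * dzbar j (alpha l) z) = 0"
    unfolding T_def[symmetric] by (simp add: complex_eq_iff)
qed

text \<open>The left side is the formal adjoint of the Laplacian applied to \<open>N\<close>.  The first divergence \<open>\<Sum>\<^sub>i \<partial>\<^sub>i (N Q\<^sub>i\<^sub>j)\<close> equals
  \<open>\<Sum>\<^sub>l N Q\<^sub>l\<^sub>j S\<^sub>l\<close> by \<open>divergence_Q\<close>; in the second one the derivatives that fall on \<open>N Q\<^sub>l\<^sub>j\<close> combine in the same way to the
  conjugate of \<open>S\<close>.\<close>

lemma adjoint_density:
  fixes N :: "complex^'n \<Rightarrow> real"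
  assumes N: "\<And>k. Ck_on k N U" and Npos: "\<And>z. z \<in> U \<Longrightarrow> N z > 0" and z: "z \<in> U"
  defines "S \<equiv> \<lambda>l z. dz l (\<lambda>z. of_real (N z)) z / of_real (N z) - alpha l z"
  shows "(\<Sum>i\<in>UNIV. \<Sum>j\<in>UNIV. dzbar j (dz i (\<lambda>z. of_real (N z) * Q i j z)) z)
     = of_real (N z) * (\<Sum>l\<in>UNIV. \<Sum>j\<in>UNIV. Q l j z * (dzbar j (S l) z + S l z * cnj (S j z)))"
proof -
  define n where "n = (\<lambda>z. complex_of_real (N z))"
  have nC: "Ck_on k n U" for k unfolding n_def by (intro Ck_on_of_real U N)
  have n0: "n w \<noteq> 0" if "w \<in> U" for w using Npos[OF that] by (simp add: n_def)
  have dnC: "Ck_on k (dz l n) U" for k l by (intro Ck_on_dz U nC)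
  have SC: "Ck_on k (S l) U" for k l unfolding S_def n_def[symmetric]
    using n0 by (intro Ck_on_diff Ck_on_divide U alpha_Ck nC) (simp_all add: dnC[unfolded n_def] nC[unfolded n_def] n_def)
  note nd = differentiable_all[OF nC] and Sd = differentiable_all[OF SC]
  have dn: "dz l n w = n w * (S l w + alpha l w)" if "w \<in> U" for l w
    using n0[OF that] unfolding S_def by (simp add: n_def)
  have dbn: "dzbar j n w = n w * (cnj (S j w) + cnj (alpha j w))" if "w \<in> U" for j w
  proof -
    have "dzbar j n w = dzbar j (\<lambda>w. cnj (n w)) w" by (simp add: n_def)
    also have "\<dots> = cnj (dz j n w)" by (rule dzbar_cnj[OF nd[OF that]])
    finally show ?thesis unfolding dn[OF that] by (simp add: n_def)
  qed
  have nQd: "(\<lambda>z. n z * Q i j z) differentiable (at w)" if "w \<in> U" for i j w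
    by (intro differentiable_mult nd Q_diff that)
  have first: "(\<Sum>i\<in>UNIV. dz i (\<lambda>z. n z * Q i j z) w) = (\<Sum>l\<in>UNIV. n w * Q l j w * S l w)" if w: "w \<in> U" for j w
  proof -
    have "(\<Sum>i\<in>UNIV. dz i (\<lambda>z. n z * Q i j z) w) = (\<Sum>i\<in>UNIV. dz i n w * Q i j w) + n w * (\<Sum>i\<in>UNIV. dz i (Q i j) w)"
      by (simp add: dz_mult nd[OF w] Q_diff[OF w] sum.distrib sum_distrib_left)
    also have "\<dots> = (\<Sum>l\<in>UNIV. n w * Q l j w * S l w)"
      unfolding divergence_Q(1)[OF w] dn[OF w] by (simp add: algebra_simps sum.distrib sum_distrib_left)
    finally show ?thesis .
  qed
  have "Ck_on k (dz i (\<lambda>z. n z * Q i j z)) U" for k i j by (intro Ck_on_dz U Ck_on_mult nC Q_Ck)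
  note d1 = differentiable_all[OF this z]
  have "(\<Sum>i\<in>UNIV. \<Sum>j\<in>UNIV. dzbar j (dz i (\<lambda>z. n z * Q i j z)) z)
      = (\<Sum>j\<in>UNIV. dzbar j (\<lambda>w. \<Sum>i\<in>UNIV. dz i (\<lambda>z. n z * Q i j z) w) z)"
    by (subst sum.swap) (simp add: dzbar_sum d1)
  also have "\<dots> = (\<Sum>j\<in>UNIV. dzbar j (\<lambda>w. \<Sum>l\<in>UNIV. n w * Q l j w * S l w) z)"
    by (intro sum.cong refl dzbar_cong_open[OF U z first])
  also have "\<dots> = (\<Sum>j\<in>UNIV. \<Sum>l\<in>UNIV. (dzbar j n z * Q l j z + n z * dzbar j (Q l j) z) * S l z + n z * Q l j z * dzbar j (S l) z)"
    using nd[OF z] Q_diff[OF z] Sd[OF z] by (simp add: dzbar_sum dzbar_mult differentiable_mult)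
  also have "\<dots> = (\<Sum>l\<in>UNIV. (\<Sum>j\<in>UNIV. n z * Q l j z * (dzbar j (S l) z + S l z * cnj (S j z)))
       + n z * S l z * ((\<Sum>j\<in>UNIV. Q l j z * cnj (alpha j z)) + (\<Sum>j\<in>UNIV. dzbar j (Q l j) z)))"
    unfolding dbn[OF z] by (subst sum.swap) (simp add: algebra_simps sum.distrib sum_distrib_left)
  also have "\<dots> = n z * (\<Sum>l\<in>UNIV. \<Sum>j\<in>UNIV. Q l j z * (dzbar j (S l) z + S l z * cnj (S j z)))"
    unfolding divergence_Q(2)[OF z] by (simp add: sum_distrib_left mult.assoc)
  finally show ?thesis unfolding n_def .
qed

end

section \<open>The integral estimate in a chart\<close>

lemma Re_of_real_mult: "Re (of_real a * z) = a * Re z" by simp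

text \<open>Two integrations by parts, without boundary terms since \<open>\<rho>\<close> has compact support.\<close>

lemma laplacian_integral_by_parts:
  fixes N \<rho> :: "complex^'n::finite \<Rightarrow> real"
  assumes lm: "local_metric U h" and K: "compact K" "K \<subseteq> U"
    and N: "\<And>k. Ck_on k N U" and \<rho>: "Ck_on 2 \<rho> U" "\<And>z. z \<in> U \<Longrightarrow> z \<notin> K \<Longrightarrow> \<rho> z = 0"
  defines "P \<equiv> \<lambda>z. Re (\<Sum>i\<in>UNIV. \<Sum>j\<in>UNIV. dzbar j (dz i (\<lambda>z. of_real (N z) * local_metric.Q h i j z)) z)"
  shows "integral\<^sup>L lborel (zero_extend U (\<lambda>z. N z * Re (laplacian h (\<lambda>z. of_real (\<rho> z)) z)))
     = integral\<^sup>L lborel (zero_extend U (\<lambda>z. P z * \<rho> z))" and "continuous_on U P"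
proof -
  interpret local_metric U h by (rule lm)
  define n where "n = (\<lambda>z. complex_of_real (N z))"
  define r where "r = (\<lambda>z. complex_of_real (\<rho> z))"
  have nC: "Ck_on k n U" for k unfolding n_def by (intro Ck_on_of_real U N)
  have r2: "Ck_on 2 r U" unfolding r_def by (intro Ck_on_of_real U \<rho>)
  have r0: "r z = 0" if "z \<in> U" "z \<notin> K" for z using \<rho>(2)[OF that] by (simp add: r_def)
  have r1: "Ck_on 1 r U" using Ck_on_le[OF r2, of 1] by simp
  have drC: "Ck_on 1 (dzbar j r) U" for j using r2 by (intro Ck_on_dzbar U) (simp add: numeral_2_eq_2)
  have dr0: "dzbar j r z = 0" if z: "z \<in> U" "z \<notin> K" for j z
  proof -
    have "dzbar j r z = dzbar j (\<lambda>x. 0) z"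
      by (rule dzbar_cong_open[of "U - K"]; use z r0 U compact_imp_closed[OF K(1)] in \<open>auto intro: open_Diff\<close>)
    then show ?thesis by simp
  qed
  have ddr0: "dz i (dzbar j r) z = 0" if z: "z \<in> U" "z \<notin> K" for i j z
  proof -
    have "dz i (dzbar j r) z = dz i (\<lambda>x. 0) z"
      by (rule dz_cong_open[of "U - K"]; use z dr0 U compact_imp_closed[OF K(1)] in \<open>auto intro: open_Diff\<close>)
    then show ?thesis by simp
  qed
  define u where "u i j = (\<lambda>z. n z * Q i j z)" for i j
  have uC: "Ck_on k (u i j) U" for k i j unfolding u_def by (intro Ck_on_mult U nC Q_Ck)
  have duC: "Ck_on k (dz i (u i j)) U" for k i j by (intro Ck_on_dz U uC)
  have dduC: "Ck_on k (dzbar j (dz i (u i j))) U" for k i j by (intro Ck_on_dzbar U duC)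
  show "continuous_on U P" unfolding P_def n_def[symmetric] u_def[symmetric]
    by (intro Ck_on_continuous[of 0] Ck_on_Re Ck_on_sum U) (use dduC in \<open>simp add: u_def n_def\<close>)
  have step: "integral\<^sup>L lborel (zero_extend U (\<lambda>z. u i j z * dz i (dzbar j r) z))
      = integral\<^sup>L lborel (zero_extend U (\<lambda>z. dzbar j (dz i (u i j)) z * r z))" for i j
  proof -
    have "integral\<^sup>L lborel (zero_extend U (\<lambda>z. u i j z * dz i (dzbar j r) z))
      = - integral\<^sup>L lborel (zero_extend U (\<lambda>z. dz i (u i j) z * dzbar j r z))"
      by (rule integral_by_parts_dz[OF U K uC drC dr0])
    also have "integral\<^sup>L lborel (zero_extend U (\<lambda>z. dz i (u i j) z * dzbar j r z))
      = - integral\<^sup>L lborel (zero_extend U (\<lambda>z. dzbar j (dz i (u i j)) z * r z))"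
      by (rule integral_by_parts_dzbar[OF U K duC r1 r0])
    finally show ?thesis by simp
  qed
  have int1: "integrable lborel (zero_extend U (\<lambda>z. u i j z * dz i (dzbar j r) z))" for i j
    using Ck_on_dz[OF U, of 0 "dzbar j r" i] drC[of j]
    by (intro integrable_zero_extend[OF U K] continuous_on_mult Ck_on_continuous[OF uC]) (auto simp: ddr0)
  have int2: "integrable lborel (zero_extend U (\<lambda>z. dzbar j (dz i (u i j)) z * r z))" for i j
    by (intro integrable_zero_extend[OF U K] continuous_on_mult Ck_on_continuous[OF dduC] Ck_on_continuous[OF r1]) (auto simp: r0)
  have e1: "zero_extend U (\<lambda>z. N z * Re (laplacian h r z)) = (\<lambda>z. Re (\<Sum>i\<in>UNIV. \<Sum>j\<in>UNIV. zero_extend U (\<lambda>z. u i j z * dz i (dzbar j r) z) z))"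
  proof
    fix z
    have "of_real (N z) * laplacian h r z = (\<Sum>i\<in>UNIV. \<Sum>j\<in>UNIV. u i j z * dz i (dzbar j r) z)"
      by (simp add: laplacian_def u_def n_def Q_def sum_distrib_left mult.assoc)
    from arg_cong[OF this, of Re]
    show "zero_extend U (\<lambda>z. N z * Re (laplacian h r z)) z
        = Re (\<Sum>i\<in>UNIV. \<Sum>j\<in>UNIV. zero_extend U (\<lambda>z. u i j z * dz i (dzbar j r) z) z)"
      unfolding Re_of_real_mult by (cases "z \<in> U") (simp_all add: zero_extend_def)
  qed
  have e2: "zero_extend U (\<lambda>z. P z * \<rho> z) = (\<lambda>z. Re (\<Sum>i\<in>UNIV. \<Sum>j\<in>UNIV. zero_extend U (\<lambda>z. dzbar j (dz i (u i j)) z * r z) z))"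
  proof
    fix z
    have "(\<Sum>i\<in>UNIV. \<Sum>j\<in>UNIV. dzbar j (dz i (u i j)) z) * of_real (\<rho> z) = (\<Sum>i\<in>UNIV. \<Sum>j\<in>UNIV. dzbar j (dz i (u i j)) z * r z)"
      by (simp add: r_def sum_distrib_right)
    from arg_cong[OF this, of Re]
    have "P z * \<rho> z = Re (\<Sum>i\<in>UNIV. \<Sum>j\<in>UNIV. dzbar j (dz i (u i j)) z * r z)"
      by (simp add: P_def u_def n_def)
    then show "zero_extend U (\<lambda>z. P z * \<rho> z) z
        = Re (\<Sum>i\<in>UNIV. \<Sum>j\<in>UNIV. zero_extend U (\<lambda>z. dzbar j (dz i (u i j)) z * r z) z)"
      by (cases "z \<in> U") (simp_all add: zero_extend_def)
  qed
  show "integral\<^sup>L lborel (zero_extend U (\<lambda>z. N z * Re (laplacian h (\<lambda>z. of_real (\<rho> z)) z)))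
     = integral\<^sup>L lborel (zero_extend U (\<lambda>z. P z * \<rho> z))"
    unfolding r_def[symmetric] e1 e2 using int1 int2 step by (simp add: integral_Re)
qed

text \<open>Here \<open>\<sigma>\<close> is the local representative of a section of \<open>K\<^sup>m\<close>.  The weight \<open>\<Delta>\<close> will be \<open>(det h)\<^sup>m\<close>, which transforms like
  \<open>|\<sigma>|\<^sup>2\<close>, so that \<open>N = (|\<sigma>|\<^sup>2 + \<epsilon> \<Delta>)\<^sup>1\<^sup>/\<^sup>m\<close> is a density that is smooth and positive for \<open>\<epsilon> > 0\<close> also at the zeros of \<open>\<sigma>\<close>.\<close>

locale regularised_density = local_metric U h
  for U :: "(complex^'n::finite) set" and h :: "complex^'n \<Rightarrow> complex^'n^'n" +
  fixes \<sigma> :: "complex^'n \<Rightarrow> complex" and \<Delta> :: "complex^'n \<Rightarrow> real" and m :: nat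
  assumes \<sigma>: "holomorphic_Cn_on \<sigma> U" and \<Delta>_Ck: "\<And>k. Ck_on k \<Delta> U" and \<Delta>_pos: "\<And>z. z \<in> U \<Longrightarrow> \<Delta> z > 0"
    and m: "m > 0"
begin

definition M :: "real \<Rightarrow> complex^'n \<Rightarrow> real" where "M \<epsilon> z = Re (\<sigma> z * cnj (\<sigma> z)) + \<epsilon> * \<Delta> z"

definition N :: "real \<Rightarrow> complex^'n \<Rightarrow> real" where "N \<epsilon> z = M \<epsilon> z powr (1 / real m)"

text \<open>The derivatives \<open>\<partial>\<^sub>l M\<close> (\<open>dz_M\<close>).  The explicit form makes sense and is continuous for all \<open>\<epsilon> \<ge> 0\<close>.\<close>

definition dM :: "real \<Rightarrow> 'n \<Rightarrow> complex^'n \<Rightarrow> complex" where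
  "dM \<epsilon> l z = dz l \<sigma> z * cnj (\<sigma> z) + of_real \<epsilon> * dz l (\<lambda>z. of_real (\<Delta> z)) z"

text \<open>This is \<open>\<partial>\<^sub>l log N - \<alpha>\<^sub>l\<close> (\<open>S_eq\<close>), in a form that is continuous up to \<open>\<epsilon> = 0\<close> away from the zeros of \<open>\<sigma>\<close>; at \<open>\<epsilon> = 0\<close> it is
  \<open>\<partial>\<^sub>l \<sigma> / (m \<sigma>) - \<alpha>\<^sub>l\<close>.\<close>

definition S :: "real \<Rightarrow> 'n \<Rightarrow> complex^'n \<Rightarrow> complex" where
  "S \<epsilon> l z = dM \<epsilon> l z / (of_nat m * of_real (M \<epsilon> z)) - alpha l z"

definition S_norm :: "real \<Rightarrow> complex^'n \<Rightarrow> real" where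
  "S_norm \<epsilon> z = Re (\<Sum>l\<in>UNIV. \<Sum>j\<in>UNIV. Q l j z * S \<epsilon> l z * cnj (S \<epsilon> j z))"

definition P :: "real \<Rightarrow> complex^'n \<Rightarrow> real" where
  "P \<epsilon> z = Re (\<Sum>i\<in>UNIV. \<Sum>j\<in>UNIV. dzbar j (dz i (\<lambda>z. of_real (N \<epsilon> z) * Q i j z)) z)"

text \<open>This is \<open>\<Delta>\<close> times the complex Hessian of \<open>log \<Delta>\<close>.\<close>

definition hess :: "'n \<Rightarrow> 'n \<Rightarrow> complex^'n \<Rightarrow> complex" where
  "hess l j z = dzbar j (dz l (\<lambda>z. of_real (\<Delta> z))) z
     - dz l (\<lambda>z. of_real (\<Delta> z)) z * dzbar j (\<lambda>z. of_real (\<Delta> z)) z / of_real (\<Delta> z)"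

definition B :: "complex^'n \<Rightarrow> real" where
  "B z = \<Delta> z powr (1 / real m - 1) * cmod (\<Sum>l\<in>UNIV. \<Sum>j\<in>UNIV. Q l j z * hess l j z)"

lemma \<sigma>_Ck: "Ck_on k \<sigma> U" by (rule holomorphic_Cn_Ck[OF U \<sigma>])

lemma \<Delta>c_Ck: "Ck_on k (\<lambda>z. complex_of_real (\<Delta> z)) U" by (intro Ck_on_of_real U \<Delta>_Ck)

lemma M_complex: "complex_of_real (M \<epsilon> z) = \<sigma> z * cnj (\<sigma> z) + of_real \<epsilon> * of_real (\<Delta> z)"
  by (simp add: M_def complex_eq_iff)

lemma M_Ck: "Ck_on k (M \<epsilon>) U"
  unfolding M_def by (intro Ck_on_add Ck_on_Re Ck_on_mult Ck_on_const Ck_on_cnj U \<sigma>_Ck \<Delta>_Ck)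

lemma M_ge: "z \<in> U \<Longrightarrow> \<epsilon> * \<Delta> z \<le> M \<epsilon> z"
  by (simp add: M_def complex_mult_cnj)

lemma M_pos: "z \<in> U \<Longrightarrow> \<epsilon> > 0 \<Longrightarrow> M \<epsilon> z > 0"
  using M_ge[of z \<epsilon>] \<Delta>_pos[of z] mult_pos_pos[of \<epsilon> "\<Delta> z"] by linarith

lemma N_Ck: "\<epsilon> > 0 \<Longrightarrow> Ck_on k (N \<epsilon>) U"
  unfolding N_def by (intro Ck_on_powr U M_Ck M_pos)

lemma N_pos: "z \<in> U \<Longrightarrow> \<epsilon> > 0 \<Longrightarrow> N \<epsilon> z > 0"
  using M_pos[of z \<epsilon>] by (simp add: N_def)

lemma \<sigma>_dzbar: "z \<in> U \<Longrightarrow> dzbar j \<sigma> z = 0"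
  using dzbar_holomorphic[OF holomorphic_Cn_has_derivative[OF \<sigma>]] .

lemma d\<sigma>_dzbar: assumes z: "z \<in> U" shows "dzbar j (dz l \<sigma>) z = 0"
proof -
  have eq: "dz l \<sigma> w = frechet_derivative \<sigma> (at w) (axis l 1)" if "w \<in> U" for w
    by (rule dz_holomorphic[OF holomorphic_Cn_has_derivative[OF \<sigma> that]])
  have "dzbar j (dz l \<sigma>) z = dzbar j (\<lambda>w. frechet_derivative \<sigma> (at w) (axis l 1)) z"
    by (rule dzbar_cong_open[OF U z eq])
  also have "\<dots> = 0"
    by (rule dzbar_holomorphic[OF holomorphic_Cn_has_derivative[OF directional_derivative_holomorphic[OF U \<sigma>] z]])
  finally show ?thesis .
qed

lemma
  assumes z: "z \<in> U"
  shows dz_M: "dz l (\<lambda>z. of_real (M \<epsilon> z)) z = dM \<epsilon> l z"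
    and dzbar_M: "dzbar j (\<lambda>z. of_real (M \<epsilon> z)) z = \<sigma> z * cnj (dz j \<sigma> z) + of_real \<epsilon> * dzbar j (\<lambda>z. of_real (\<Delta> z)) z"
    and dzbar_dM: "dzbar j (dM \<epsilon> l) z = dz l \<sigma> z * cnj (dz j \<sigma> z) + of_real \<epsilon> * dzbar j (dz l (\<lambda>z. of_real (\<Delta> z))) z"
proof -
  note d = differentiable_all[OF \<sigma>_Ck z] differentiable_all[OF Ck_on_cnj[OF U \<sigma>_Ck] z] differentiable_all[OF \<Delta>c_Ck z]
    differentiable_all[OF Ck_on_dz[OF U \<sigma>_Ck] z] differentiable_all[OF Ck_on_dz[OF U \<Delta>c_Ck] z]
  have d': "(\<lambda>z. complex_of_real \<epsilon> * of_real (\<Delta> z)) differentiable (at z)" "(\<lambda>z. \<sigma> z * cnj (\<sigma> z)) differentiable (at z)"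
    "(\<lambda>z. dz l \<sigma> z * cnj (\<sigma> z)) differentiable (at z)" "(\<lambda>z. of_real \<epsilon> * dz l (\<lambda>z. of_real (\<Delta> z)) z) differentiable (at z)" for l
    using d by (auto intro!: differentiable_mult)
  have c: "dz l (\<lambda>z. cnj (\<sigma> z)) z = 0" "dzbar l (\<lambda>z. cnj (\<sigma> z)) z = cnj (dz l \<sigma> z)" for l
    using \<sigma>_dzbar[OF z] d(1) by (simp_all add: dz_cnj dzbar_cnj)
  show "dz l (\<lambda>z. of_real (M \<epsilon> z)) z = dM \<epsilon> l z"
    unfolding M_complex using d d' c by (simp add: dz_add dz_mult dz_cmult dM_def)
  show "dzbar j (\<lambda>z. of_real (M \<epsilon> z)) z = \<sigma> z * cnj (dz j \<sigma> z) + of_real \<epsilon> * dzbar j (\<lambda>z. of_real (\<Delta> z)) z"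
    unfolding M_complex using d d' c by (simp add: dzbar_add dzbar_mult dzbar_cmult \<sigma>_dzbar[OF z])
  show "dzbar j (dM \<epsilon> l) z = dz l \<sigma> z * cnj (dz j \<sigma> z) + of_real \<epsilon> * dzbar j (dz l (\<lambda>z. of_real (\<Delta> z))) z"
    unfolding dM_def[abs_def] using d d' c by (simp add: dzbar_add dzbar_mult dzbar_cmult d\<sigma>_dzbar[OF z])
qed

lemma dM_Ck: "Ck_on k (dM \<epsilon> l) U"
  unfolding dM_def by (intro Ck_on_add Ck_on_mult Ck_on_const Ck_on_cnj U \<sigma>_Ck Ck_on_dz \<Delta>c_Ck)

lemma S_eq:
  assumes z: "z \<in> U" and \<epsilon>: "\<epsilon> > 0"
  shows "dz l (\<lambda>z. of_real (N \<epsilon> z)) z / of_real (N \<epsilon> z) - alpha l z = S \<epsilon> l z"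
proof -
  have M: "M \<epsilon> z > 0" by (rule M_pos[OF z \<epsilon>])
  have "((\<lambda>x. x powr (1 / real m)) has_real_derivative (1 / real m) * M \<epsilon> z powr (1 / real m - 1)) (at (M \<epsilon> z))"
    using M by (rule has_real_derivative_powr)
  from dz_real_compose[OF differentiable_all[OF M_Ck z] this]
  have "dz l (\<lambda>z. of_real (N \<epsilon> z)) z = of_real ((1 / real m) * M \<epsilon> z powr (1 / real m - 1)) * dM \<epsilon> l z"
    unfolding N_def dz_M[OF z] .
  moreover have "M \<epsilon> z powr (1 / real m - 1) = N \<epsilon> z / M \<epsilon> z"
    using M by (simp add: N_def powr_diff)
  ultimately show ?thesis using N_pos[OF z \<epsilon>] M m by (simp add: S_def)
qed

text \<open>The left side is the complex Hessian of \<open>log (|\<sigma>|\<^sup>2 + \<epsilon> \<Delta>)\<close>.  Since \<open>log |\<sigma>|\<^sup>2\<close> is pluriharmonic, what remains is a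
  nonnegative form of rank one and a term of order \<open>\<epsilon> / M\<close>; the second one is the only error of the regularisation.\<close>

lemma log_hessian:
  assumes z: "z \<in> U" and \<epsilon>: "\<epsilon> > 0"
  defines "a \<equiv> \<lambda>l. dz l \<sigma> z - \<sigma> z * dz l (\<lambda>z. of_real (\<Delta> z)) z / of_real (\<Delta> z)"
  shows "dzbar j (\<lambda>z. dM \<epsilon> l z / of_real (M \<epsilon> z)) z
     = of_real (\<epsilon> * \<Delta> z / (M \<epsilon> z)\<^sup>2) * (a l * cnj (a j)) + of_real (\<epsilon> / M \<epsilon> z) * hess l j z"
proof -
  define D where "D = complex_of_real (\<Delta> z)"
  define e where "e = complex_of_real \<epsilon>"
  define s where "s = \<sigma> z"
  define dl where "dl = dz l (\<lambda>z. complex_of_real (\<Delta> z)) z"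
  define dj where "dj = dzbar j (\<lambda>z. complex_of_real (\<Delta> z)) z"
  define H where "H = dzbar j (dz l (\<lambda>z. complex_of_real (\<Delta> z))) z"
  define sl where "sl = dz l \<sigma> z"
  define t where "t = cnj (dz j \<sigma> z)"
  define u where "u = complex_of_real (M \<epsilon> z)"
  have D0: "D \<noteq> 0" unfolding D_def using \<Delta>_pos[OF z] by simp
  have u0: "u \<noteq> 0" unfolding u_def using M_pos[OF z \<epsilon>] by simp
  have u: "u = s * cnj s + e * D" unfolding u_def s_def e_def D_def by (rule M_complex)
  have cdj: "cnj (dz j (\<lambda>z. complex_of_real (\<Delta> z)) z) = dj"
    unfolding dj_def using dzbar_cnj[OF differentiable_all[OF \<Delta>c_Ck z], of j] by simp
  have "dzbar j (\<lambda>z. dM \<epsilon> l z / of_real (M \<epsilon> z)) z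
     = ((sl * t + e * H) * u - (sl * cnj s + e * dl) * (s * t + e * dj)) / u\<^sup>2"
    unfolding dzbar_divide[OF differentiable_all[OF dM_Ck z] differentiable_all[OF Ck_on_of_real[OF U M_Ck] z] u0[unfolded u_def]]
      dzbar_dM[OF z] dzbar_M[OF z]
    by (simp add: sl_def t_def e_def H_def u_def s_def dl_def dj_def dM_def)
  also have "(sl * t + e * H) * u - (sl * cnj s + e * dl) * (s * t + e * dj)
     = e * D * ((sl - s * dl / D) * (t - cnj s * dj / D)) + e * u * (H - dl * dj / D)"
    unfolding u using D0 by (simp add: field_simps)
  also have "\<dots> / u\<^sup>2 = e * D / u\<^sup>2 * ((sl - s * dl / D) * (t - cnj s * dj / D)) + e / u * (H - dl * dj / D)"
    using u0 by (simp add: field_simps power2_eq_square)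
  finally show ?thesis
    using cdj by (simp add: a_def hess_def D_def e_def s_def dl_def dj_def H_def sl_def t_def u_def)
qed

text \<open>By \<open>adjoint_density\<close>, \<open>P\<close> is \<open>N |S|\<^sup>2\<close> plus \<open>N / m\<close> times the trace of the Hessian of \<open>log M\<close>, as flatness removes the trace of
  \<open>\<partial>bar \<alpha>\<close>.  By \<open>log_hessian\<close> that trace is at least \<open>- \<epsilon> / M\<close> times a continuous function, and
  \<open>N \<epsilon> / M = \<epsilon> M\<^sup>1\<^sup>/\<^sup>m\<^sup>-\<^sup>1 \<le> \<epsilon>\<^sup>1\<^sup>/\<^sup>m \<Delta>\<^sup>1\<^sup>/\<^sup>m\<^sup>-\<^sup>1\<close> because \<open>M \<ge> \<epsilon> \<Delta>\<close> and the exponent \<open>1/m - 1\<close> is not positive.\<close>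

lemma P_lower_bound:
  assumes z: "z \<in> U" and \<epsilon>: "\<epsilon> > 0" and flat: "\<And>v. LC_Ricci h z v = 0"
  shows "N \<epsilon> z * S_norm \<epsilon> z - \<epsilon> powr (1 / real m) * B z \<le> P \<epsilon> z"
proof -
  have Mp: "M \<epsilon> z > 0" by (rule M_pos[OF z \<epsilon>])
  have Dp: "\<Delta> z > 0" by (rule \<Delta>_pos[OF z])
  have N_p: "N \<epsilon> z > 0" by (rule N_pos[OF z \<epsilon>])
  define a where "a = (\<lambda>l. dz l \<sigma> z - \<sigma> z * dz l (\<lambda>z. of_real (\<Delta> z)) z / of_real (\<Delta> z))"
  define L where "L l j = dzbar j (\<lambda>z. dM \<epsilon> l z / of_real (M \<epsilon> z)) z" for l j
  define T where "T f = Re (\<Sum>l\<in>UNIV. \<Sum>j\<in>UNIV. Q l j z * f l j)" for f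
  have T_add: "T (\<lambda>l j. f l j + g l j) = T f + T g" and T_diff: "T (\<lambda>l j. f l j - g l j) = T f - T g" for f g
    unfolding T_def by (simp_all add: distrib_left sum.distrib right_diff_distrib sum_subtractf)
  have T_mult: "T (\<lambda>l j. of_real c * f l j) = c * T f" for c f
  proof -
    have "(\<Sum>l\<in>UNIV. \<Sum>j\<in>UNIV. Q l j z * (of_real c * f l j)) = of_real c * (\<Sum>l\<in>UNIV. \<Sum>j\<in>UNIV. Q l j z * f l j)"
      by (simp add: sum_distrib_left mult_ac)
    then show ?thesis unfolding T_def by simp
  qed
  \<comment> \<open>\<open>T\<close> is the real part of the trace; the term of rank one in \<open>log_hessian\<close> has nonnegative trace\<close>
  have TL: "T L \<ge> - (\<epsilon> / M \<epsilon> z) * cmod (\<Sum>l\<in>UNIV. \<Sum>j\<in>UNIV. Q l j z * hess l j z)"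
  proof -
    have "L = (\<lambda>l j. of_real (\<epsilon> * \<Delta> z / (M \<epsilon> z)\<^sup>2) * (a l * cnj (a j)) + of_real (\<epsilon> / M \<epsilon> z) * hess l j z)"
      unfolding L_def a_def fun_eq_iff using log_hessian[OF z \<epsilon>] by blast
    then have "T L = \<epsilon> * \<Delta> z / (M \<epsilon> z)\<^sup>2 * T (\<lambda>l j. a l * cnj (a j)) + \<epsilon> / M \<epsilon> z * T (\<lambda>l j. hess l j z)"
      by (simp only: T_add T_mult)
    moreover have "T (\<lambda>l j. a l * cnj (a j)) \<ge> 0"
      unfolding T_def using Q_pos[OF z, of a] by (simp add: mult.assoc)
    moreover have "T (\<lambda>l j. hess l j z) \<ge> - cmod (\<Sum>l\<in>UNIV. \<Sum>j\<in>UNIV. Q l j z * hess l j z)"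
      unfolding T_def using abs_Re_le_cmod[of "\<Sum>l\<in>UNIV. \<Sum>j\<in>UNIV. Q l j z * hess l j z"] by linarith
    then have "\<epsilon> / M \<epsilon> z * T (\<lambda>l j. hess l j z) \<ge> \<epsilon> / M \<epsilon> z * (- cmod (\<Sum>l\<in>UNIV. \<Sum>j\<in>UNIV. Q l j z * hess l j z))"
      using \<epsilon> Mp by (intro mult_left_mono) auto
    moreover have "\<epsilon> * \<Delta> z / (M \<epsilon> z)\<^sup>2 \<ge> 0" using \<epsilon> Dp by simp
    ultimately show ?thesis using mult_nonneg_nonneg[of "\<epsilon> * \<Delta> z / (M \<epsilon> z)\<^sup>2" "T (\<lambda>l j. a l * cnj (a j))"] by simp
  qed
  have dS: "dzbar j (\<lambda>z. dz l (\<lambda>z. of_real (N \<epsilon> z)) z / of_real (N \<epsilon> z) - alpha l z) z = of_real (1 / real m) * L l j - dzbar j (alpha l) z" for l j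
  proof -
    have "dzbar j (\<lambda>z. dz l (\<lambda>z. of_real (N \<epsilon> z)) z / of_real (N \<epsilon> z) - alpha l z) z
       = dzbar j (\<lambda>z. of_real (1 / real m) * (dM \<epsilon> l z / of_real (M \<epsilon> z)) - alpha l z) z"
      by (rule dzbar_cong_open[OF U z], subst S_eq[OF _ \<epsilon>]) (simp_all add: S_def)
    moreover have d: "(\<lambda>z. dM \<epsilon> l z / of_real (M \<epsilon> z)) differentiable (at z)"
      using Ck_on_divide[OF U dM_Ck Ck_on_of_real[OF U M_Ck]] M_pos[OF _ \<epsilon>]
      by (intro differentiable_all[OF _ z]) (metis less_numeral_extra(3) of_real_eq_0_iff)
    moreover have "(\<lambda>z. of_real (1 / real m) * (dM \<epsilon> l z / of_real (M \<epsilon> z))) differentiable (at z)"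
      using d by (intro differentiable_mult) auto
    ultimately show ?thesis unfolding L_def using alpha_diff[OF z] by (simp only: dzbar_diff dzbar_cmult)
  qed
  have "P \<epsilon> z = Re (of_real (N \<epsilon> z) * (\<Sum>l\<in>UNIV. \<Sum>j\<in>UNIV. Q l j z *
      ((of_real (1 / real m) * L l j - dzbar j (alpha l) z) + S \<epsilon> l z * cnj (S \<epsilon> j z))))"
    unfolding P_def using adjoint_density[OF N_Ck[OF \<epsilon>] N_pos[OF _ \<epsilon>] z] unfolding dS S_eq[OF z \<epsilon>] by (rule arg_cong)
  then have "P \<epsilon> z = N \<epsilon> z * T (\<lambda>l j. (of_real (1 / real m) * L l j - dzbar j (alpha l) z) + S \<epsilon> l z * cnj (S \<epsilon> j z))"
    unfolding T_def Re_of_real_mult .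
  also have "\<dots> = N \<epsilon> z * (1 / real m * T L - T (\<lambda>l j. dzbar j (alpha l) z) + S_norm \<epsilon> z)"
    unfolding T_add T_diff T_mult unfolding S_norm_def T_def by (simp add: mult.assoc)
  also have "T (\<lambda>l j. dzbar j (alpha l) z) = 0"
    unfolding T_def by (rule ricci_flat_alpha(2)[OF z flat])
  finally have Peq: "P \<epsilon> z = N \<epsilon> z * S_norm \<epsilon> z + N \<epsilon> z * (1 / real m * T L)" by (simp add: algebra_simps)
  define C where "C = cmod (\<Sum>l\<in>UNIV. \<Sum>j\<in>UNIV. Q l j z * hess l j z)"
  have C0: "C \<ge> 0" unfolding C_def by simp
  have m1: "1 / real m \<le> 1" "1 / real m > 0" using m by auto
  have "N \<epsilon> z * (\<epsilon> / M \<epsilon> z) = \<epsilon> * M \<epsilon> z powr (1 / real m - 1)"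
    using Mp by (simp add: N_def powr_diff)
  also have "\<dots> \<le> \<epsilon> * (\<epsilon> * \<Delta> z) powr (1 / real m - 1)"
    using \<epsilon> Dp M_ge[OF z, of \<epsilon>] m1 by (intro mult_left_mono powr_mono2') auto
  also have "\<dots> = \<epsilon> powr (1 / real m) * \<Delta> z powr (1 / real m - 1)"
    using \<epsilon> Dp by (simp add: powr_mult powr_diff)
  finally have NM: "N \<epsilon> z * (\<epsilon> / M \<epsilon> z) \<le> \<epsilon> powr (1 / real m) * \<Delta> z powr (1 / real m - 1)" .
  have TLC: "- (1 / real m * T L) \<le> \<epsilon> / M \<epsilon> z * C"
  proof -
    have "- (1 / real m * T L) \<le> 1 / real m * (\<epsilon> / M \<epsilon> z * C)"
      using mult_left_mono[OF TL, of "1 / real m"] m1 unfolding C_def by simp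
    also have "\<dots> \<le> 1 * (\<epsilon> / M \<epsilon> z * C)" using m1 \<epsilon> Mp C0 by (intro mult_right_mono) auto
    finally show ?thesis by simp
  qed
  have "- (N \<epsilon> z * (1 / real m * T L)) \<le> N \<epsilon> z * (\<epsilon> / M \<epsilon> z) * C"
    using mult_left_mono[OF TLC less_imp_le[OF N_p]] by (simp only: mult.assoc mult_minus_right)
  also have "\<dots> \<le> \<epsilon> powr (1 / real m) * B z"
    unfolding B_def C_def[symmetric] using mult_right_mono[OF NM C0] by (simp add: mult.assoc)
  finally show ?thesis unfolding Peq by linarith
qed

lemma S_norm_nonneg: "z \<in> U \<Longrightarrow> S_norm \<epsilon> z \<ge> 0"
  unfolding S_norm_def by (rule Q_pos)

lemma B_continuous: "continuous_on U B"
proof -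
  have "Ck_on k (hess l j) U" for k l j unfolding hess_def
    using \<Delta>_pos by (intro Ck_on_diff Ck_on_divide Ck_on_mult U Ck_on_dz Ck_on_dzbar \<Delta>c_Ck) force
  note c = Ck_on_continuous[OF this] Ck_on_continuous[OF Q_Ck] Ck_on_continuous[OF \<Delta>_Ck]
  show ?thesis unfolding B_def using \<Delta>_pos by (intro continuous_intros c) force
qed

lemma chart_integral_lower_bound:
  fixes \<rho> :: "complex^'n \<Rightarrow> real"
  assumes K: "compact K" "K \<subseteq> U" and \<epsilon>: "\<epsilon> > 0" and flat: "\<And>z v. z \<in> U \<Longrightarrow> LC_Ricci h z v = 0"
    and \<rho>: "Ck_on 2 \<rho> U" "\<And>z. z \<in> U \<Longrightarrow> z \<notin> K \<Longrightarrow> \<rho> z = 0" "\<And>z. \<rho> z \<ge> 0"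
  shows "integral\<^sup>L lborel (zero_extend U (\<lambda>z. \<rho> z * N \<epsilon> z * S_norm \<epsilon> z))
      - \<epsilon> powr (1 / real m) * integral\<^sup>L lborel (zero_extend U (\<lambda>z. \<rho> z * B z))
      \<le> integral\<^sup>L lborel (zero_extend U (\<lambda>z. N \<epsilon> z * Re (laplacian h (\<lambda>z. of_real (\<rho> z)) z)))"
    and "integrable lborel (zero_extend U (\<lambda>z. \<rho> z * N \<epsilon> z * S_norm \<epsilon> z))"
proof -
  have ibp: "integral\<^sup>L lborel (zero_extend U (\<lambda>z. N \<epsilon> z * Re (laplacian h (\<lambda>z. of_real (\<rho> z)) z)))
     = integral\<^sup>L lborel (zero_extend U (\<lambda>z. P \<epsilon> z * \<rho> z))" "continuous_on U (P \<epsilon>)"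
    unfolding P_def by (rule laplacian_integral_by_parts[OF local_metric_axioms K N_Ck[OF \<epsilon>] \<rho>(1,2)]; assumption?)+
  note c = Ck_on_continuous[OF \<rho>(1)] Ck_on_continuous[OF N_Ck[OF \<epsilon>]] B_continuous ibp(2)
  have "Ck_on k (S \<epsilon> l) U" for k l unfolding S_def
    using M_pos[OF _ \<epsilon>] m by (intro Ck_on_diff Ck_on_divide Ck_on_mult Ck_on_const Ck_on_of_real U dM_Ck M_Ck alpha_Ck) force
  note cS = Ck_on_continuous[OF this]
  have Sn: "continuous_on U (S_norm \<epsilon>)" unfolding S_norm_def
    by (intro continuous_intros Ck_on_continuous[OF Q_Ck] cS)
  show i1: "integrable lborel (zero_extend U (\<lambda>z. \<rho> z * N \<epsilon> z * S_norm \<epsilon> z))"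
    by (intro integrable_zero_extend[OF U K] continuous_on_mult c Sn) (simp add: \<rho>)
  have i2: "integrable lborel (zero_extend U (\<lambda>z. \<rho> z * B z))"
    by (intro integrable_zero_extend[OF U K] continuous_on_mult c) (simp add: \<rho>)
  have i3: "integrable lborel (zero_extend U (\<lambda>z. P \<epsilon> z * \<rho> z))"
  proof (rule integrable_zero_extend[OF U K])
    show "continuous_on U (\<lambda>z. P \<epsilon> z * \<rho> z)" by (intro continuous_on_mult c)
    show "P \<epsilon> z * \<rho> z = 0" if "z \<in> U" "z \<notin> K" for z using \<rho>(2)[OF that] by simp
  qed
  have "integral\<^sup>L lborel (zero_extend U (\<lambda>z. \<rho> z * N \<epsilon> z * S_norm \<epsilon> z))
      - \<epsilon> powr (1 / real m) * integral\<^sup>L lborel (zero_extend U (\<lambda>z. \<rho> z * B z))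
    = integral\<^sup>L lborel (\<lambda>z. zero_extend U (\<lambda>z. \<rho> z * N \<epsilon> z * S_norm \<epsilon> z) z - \<epsilon> powr (1 / real m) * zero_extend U (\<lambda>z. \<rho> z * B z) z)"
    using i1 i2 by simp
  also have "\<dots> \<le> integral\<^sup>L lborel (zero_extend U (\<lambda>z. P \<epsilon> z * \<rho> z))"
  proof (rule integral_mono)
    show "integrable lborel (\<lambda>z. zero_extend U (\<lambda>z. \<rho> z * N \<epsilon> z * S_norm \<epsilon> z) z - \<epsilon> powr (1 / real m) * zero_extend U (\<lambda>z. \<rho> z * B z) z)"
      using i1 i2 by simp
    fix z
    show "zero_extend U (\<lambda>z. \<rho> z * N \<epsilon> z * S_norm \<epsilon> z) z - \<epsilon> powr (1 / real m) * zero_extend U (\<lambda>z. \<rho> z * B z) z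
        \<le> zero_extend U (\<lambda>z. P \<epsilon> z * \<rho> z) z"
      using mult_left_mono[OF P_lower_bound[OF _ \<epsilon> flat] \<rho>(3), of z z]
      by (auto simp: zero_extend_def algebra_simps)
  qed (rule i3)
  finally show "integral\<^sup>L lborel (zero_extend U (\<lambda>z. \<rho> z * N \<epsilon> z * S_norm \<epsilon> z))
      - \<epsilon> powr (1 / real m) * integral\<^sup>L lborel (zero_extend U (\<lambda>z. \<rho> z * B z))
      \<le> integral\<^sup>L lborel (zero_extend U (\<lambda>z. N \<epsilon> z * Re (laplacian h (\<lambda>z. of_real (\<rho> z)) z)))"
    unfolding ibp(1) .
qed

text \<open>The integrand is jointly continuous in \<open>\<epsilon> \<ge> 0\<close> and in \<open>z\<close> away from the zeros of \<open>\<sigma>\<close>.  If it were positive at \<open>\<epsilon> = 0\<close>, \<open>z = z0\<close>, the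
  integrals would stay above a positive constant as \<open>\<epsilon>\<close> tends to 0, against the bound.  So \<open>S = 0\<close> at \<open>\<epsilon> = 0\<close>, \<open>z = z0\<close>.\<close>

lemma ode_of_vanishing_limit:
  fixes \<rho> :: "complex^'n \<Rightarrow> real"
  assumes \<rho>: "continuous_on U \<rho>" "\<And>z. \<rho> z \<ge> 0" and z0: "z0 \<in> U" "\<rho> z0 > 0" "\<sigma> z0 \<noteq> 0"
    and int: "\<And>\<epsilon>. \<epsilon> > 0 \<Longrightarrow> integrable lborel (zero_extend U (\<lambda>z. \<rho> z * N \<epsilon> z * S_norm \<epsilon> z))"
    and bound: "\<And>\<epsilon>. \<epsilon> > 0 \<Longrightarrow> integral\<^sup>L lborel (zero_extend U (\<lambda>z. \<rho> z * N \<epsilon> z * S_norm \<epsilon> z)) \<le> \<epsilon> powr (1 / real m) * C"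
  shows "dz l \<sigma> z0 = of_nat m * alpha l z0 * \<sigma> z0"
proof -
  define g where "g \<epsilon> z = \<rho> z * N \<epsilon> z * S_norm \<epsilon> z" for \<epsilon> z
  define V where "V = {z \<in> U. \<sigma> z \<noteq> 0}"
  have "V = U \<inter> \<sigma> -` (-{0})" unfolding V_def by auto
  then have V: "open V"
    using continuous_open_preimage[OF Ck_on_continuous[OF \<sigma>_Ck] U, of "-{0}"] by (simp add: open_Compl)
  have M0: "M \<epsilon> z > 0" if "\<epsilon> \<ge> 0" "z \<in> V" for \<epsilon> z
  proof -
    have "Re (\<sigma> z * cnj (\<sigma> z)) = (cmod (\<sigma> z))\<^sup>2" by (simp add: cmod_power2) (simp add: power2_eq_square)
    moreover have "cmod (\<sigma> z) > 0" "\<Delta> z > 0" using that \<Delta>_pos[of z] by (auto simp: V_def)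
    ultimately show ?thesis unfolding M_def using that by (intro add_pos_nonneg mult_nonneg_nonneg) auto
  qed
  have VU: "V \<subseteq> U" unfolding V_def by auto
  have z0V: "z0 \<in> V" using z0 by (simp add: V_def)
  have g0: "g 0 z0 = 0"
  proof (rule ccontr)
    assume ne: "g 0 z0 \<noteq> 0"
    have gnn: "g \<epsilon> z \<ge> 0" if "z \<in> U" for \<epsilon> z
      unfolding g_def N_def using \<rho>(2) S_norm_nonneg[OF that] by simp
    define \<eta> where "\<eta> = g 0 z0 / 2"
    have \<eta>: "\<eta> > 0" using ne gnn[OF z0(1), of 0] unfolding \<eta>_def by simp
    have snd_c: "continuous_on ({0..1::real} \<times> V) (\<lambda>x. f (snd x))" if "continuous_on U f" for f :: "complex^'n \<Rightarrow> 'b::real_normed_vector"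
      by (rule continuous_on_compose2[OF that]) (use VU in \<open>auto intro!: continuous_intros\<close>)
    have M_c: "continuous_on ({0..1} \<times> V) (\<lambda>x. M (fst x) (snd x))"
      unfolding M_def by (intro continuous_intros snd_c Ck_on_continuous[OF \<sigma>_Ck] Ck_on_continuous[OF \<Delta>_Ck])
    have dM_c: "continuous_on ({0..1} \<times> V) (\<lambda>x. dM (fst x) l (snd x))" for l
      unfolding dM_def by (intro continuous_intros snd_c[OF Ck_on_continuous[OF \<sigma>_Ck]]
          snd_c[OF Ck_on_continuous[OF Ck_on_dz[OF U \<sigma>_Ck]]] snd_c[OF Ck_on_continuous[OF Ck_on_dz[OF U \<Delta>c_Ck]]])
    have S_c: "continuous_on ({0..1} \<times> V) (\<lambda>x. S (fst x) l (snd x))" for l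
      unfolding S_def using M0 m
      by (intro continuous_intros dM_c M_c snd_c[OF Ck_on_continuous[OF alpha_Ck]]) force
    have "continuous_on ({0..1} \<times> V) (\<lambda>x. g (fst x) (snd x))"
      unfolding g_def N_def S_norm_def using M0
      by (intro continuous_intros snd_c[OF \<rho>(1)] M_c S_c snd_c[OF Ck_on_continuous[OF Q_Ck]]) force
    moreover have "(0::real, z0) \<in> {0..1} \<times> V" using z0 by (simp add: V_def)
    ultimately obtain d where d: "d > 0" "\<And>x. x \<in> {0..1} \<times> V \<Longrightarrow> dist x (0, z0) < d \<Longrightarrow> dist (g (fst x) (snd x)) (g 0 z0) < \<eta>"
      using \<eta> unfolding continuous_on_iff by (metis fst_conv snd_conv)
    obtain r where r: "r > 0" "ball z0 r \<subseteq> V" using V z0V open_contains_ball by blast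
    \<comment> \<open>half of \<open>d\<close> is left for the distance in \<open>\<epsilon>\<close>, the other half for the distance in \<open>z\<close>\<close>
    define r' where "r' = min (min r (d / 2)) 1"
    have r': "r' > 0" "r' \<le> r" "r' \<le> d / 2" "r' \<le> 1" using r d unfolding r'_def by auto
    have big: "g \<epsilon> z > \<eta>" if "0 < \<epsilon>" "\<epsilon> < r'" "z \<in> ball z0 r'" for \<epsilon> z
    proof -
      have "dist (\<epsilon>, z) (0, z0) \<le> dist \<epsilon> 0 + dist z z0"
        unfolding dist_Pair_Pair using sqrt_sum_squares_le_sum[of "dist \<epsilon> 0" "dist z z0"] by simp
      also have "\<dots> < d" using that r' by (simp add: dist_commute)
      finally have "dist (g \<epsilon> z) (g 0 z0) < \<eta>" using d(2)[of "(\<epsilon>, z)"] that r r' by (auto simp: subset_iff)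
      then show ?thesis unfolding \<eta>_def dist_real_def by linarith
    qed
    define vol where "vol = measure lborel (ball z0 r')"
    have vol: "vol > 0" unfolding vol_def using r' content_ball_pos by simp
    have low: "\<eta> * vol \<le> \<epsilon> powr (1 / real m) * C" if \<epsilon>: "0 < \<epsilon>" "\<epsilon> < r'" for \<epsilon>
    proof -
      have "\<eta> * vol = integral\<^sup>L lborel (\<lambda>z. \<eta> * indicator (ball z0 r') z)"
        unfolding vol_def by simp
      also have "\<dots> \<le> integral\<^sup>L lborel (zero_extend U (g \<epsilon>))"
      proof (rule integral_mono)
        show "integrable lborel (\<lambda>z. \<eta> * indicator (ball z0 r') z)"
          by (intro integrable_mult_right integrable_real_indicator)
            (auto intro: emeasure_bounded_finite[OF bounded_ball, unfolded infinity_ennreal_def])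
        show "integrable lborel (zero_extend U (g \<epsilon>))" unfolding g_def by (rule int[OF \<epsilon>(1)])
        fix z
        show "\<eta> * indicator (ball z0 r') z \<le> zero_extend U (g \<epsilon>) z"
        proof (cases "z \<in> ball z0 r'")
          case True
          then have "z \<in> U" using r r' VU by (auto simp: subset_iff)
          then show ?thesis using True big[OF \<epsilon> True] by (simp add: zero_extend_def)
        qed (auto simp: zero_extend_def gnn)
      qed
      also have "\<dots> \<le> \<epsilon> powr (1 / real m) * C" using bound[OF \<epsilon>(1)] unfolding g_def .
      finally show ?thesis .
    qed
    have "((\<lambda>\<epsilon>. \<epsilon> powr (1 / real m) * C) \<longlongrightarrow> 0 powr (1 / real m) * C) (at_right 0)"
      by (intro tendsto_mult tendsto_const tendsto_powr' tendsto_ident_at) (use m in \<open>auto simp: eventually_at_filter\<close>)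
    moreover have "\<forall>\<^sub>F \<epsilon> in at_right 0. \<eta> * vol \<le> \<epsilon> powr (1 / real m) * C"
      using low r'(1) unfolding eventually_at_right_field by blast
    ultimately have "\<eta> * vol \<le> 0 powr (1 / real m) * C"
      by (intro tendsto_lowerbound) auto
    then show False using \<eta> vol mult_pos_pos[OF \<eta> vol] by simp
  qed
  have "N 0 z0 > 0" using M0[of 0 z0] z0V by (simp add: N_def)
  then have "S_norm 0 z0 = 0" using g0 z0(2) unfolding g_def by simp
  then have "S 0 l z0 = 0" using Q_pos_strict[OF z0(1), of "\<lambda>l. S 0 l z0" l] unfolding S_norm_def by fastforce
  then have "dz l \<sigma> z0 * cnj (\<sigma> z0) / (of_nat m * (\<sigma> z0 * cnj (\<sigma> z0))) = alpha l z0"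
    unfolding S_def dM_def M_complex by simp
  then show ?thesis using z0(3) m by (simp add: field_simps)
qed

end

section \<open>Pluricanonical sections solve a linear differential equation\<close>

text \<open>The product of \<open>y\<close> with the integrating factor \<open>exp (- \<integral> k)\<close> is constant.\<close>

lemma linear_ode_zero:
  fixes y k :: "real \<Rightarrow> complex"
  assumes y: "\<And>t. t \<in> {0..1} \<Longrightarrow> (y has_vector_derivative k t * y t) (at t within {0..1})"
    and k: "continuous_on {0..1} k" and "y 1 = 0"
  shows "y 0 = 0"
proof -
  define L where "L t = integral {0..t} k" for t
  have L: "(L has_vector_derivative k t) (at t within {0..1})" if "t \<in> {0..1}" for t
    unfolding L_def using integral_has_vector_derivative[OF k that] .
  have E: "((\<lambda>t. exp (- L t) * y t) has_vector_derivative 0) (at t within {0..1})" if t: "t \<in> {0..1}" for t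
  proof -
    have "((\<lambda>t. exp (- L t)) has_vector_derivative (- k t) * exp (- L t)) (at t within {0..1})"
      using field_vector_diff_chain_within[OF has_vector_derivative_minus[OF L[OF t]], of exp "exp (- L t)"]
      by (auto simp: o_def intro: DERIV_exp has_field_derivative_at_within)
    from has_vector_derivative_mult[OF this y[OF t]] show ?thesis by (simp add: algebra_simps)
  qed
  obtain c where "\<And>t. t \<in> {0..1} \<Longrightarrow> exp (- L t) * y t = c"
    using has_vector_derivative_zero_constant[OF convex_real_interval(5) E] by blast
  from this[of 0] this[of 1] show ?thesis using assms(3) by simp
qed

text \<open>Along the segment from \<open>z1\<close> to \<open>z0\<close> the equation becomes a linear ordinary differential equation.\<close>

lemma (in local_metric) holomorphic_ode_zero_set:
  assumes \<sigma>: "holomorphic_Cn_on \<sigma> U" and z0: "z0 \<in> U" "\<sigma> z0 = 0"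
    and ode: "\<And>z l. z \<in> U \<Longrightarrow> dz l \<sigma> z = a * alpha l z * \<sigma> z"
    and r: "ball z0 r \<subseteq> U" and z1: "z1 \<in> ball z0 r"
  shows "\<sigma> z1 = 0"
proof -
  define \<gamma> where "\<gamma> t = z1 + t *\<^sub>R (z0 - z1)" for t :: real
  have "r > 0" using z1 by (metis ball_eq_empty empty_iff not_le)
  have \<gamma>: "\<gamma> t \<in> U" if "t \<in> {0..1}" for t
  proof -
    have "\<gamma> t = (1 - t) *\<^sub>R z1 + t *\<^sub>R z0" by (simp add: \<gamma>_def algebra_simps)
    then have "\<gamma> t \<in> ball z0 r"
      using convexD[OF convex_ball z1, of z0 "1 - t" t] that \<open>r > 0\<close> by simp
    then show ?thesis using r by blast
  qed
  define k where "k t = a * (\<Sum>l\<in>UNIV. (z0 - z1) $ l * alpha l (\<gamma> t))" for t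
  have \<gamma>c: "continuous_on {0..1} \<gamma>" unfolding \<gamma>_def by (intro continuous_intros)
  have "\<sigma> (\<gamma> 0) = 0"
  proof (rule linear_ode_zero[where k = k])
    fix t :: real assume t: "t \<in> {0..1}"
    note d = holomorphic_Cn_has_derivative[OF \<sigma> \<gamma>[OF t]]
    have "frechet_derivative \<sigma> (at (\<gamma> t)) (z0 - z1) = k t * \<sigma> (\<gamma> t)"
      unfolding has_derivative_wirtinger[OF d(1)] dzbar_holomorphic[OF d] ode[OF \<gamma>[OF t]] k_def
      by (simp add: sum_distrib_left sum_distrib_right mult_ac)
    moreover have "\<sigma> differentiable (at (z1 + t *\<^sub>R (z0 - z1)))" using d(1) unfolding \<gamma>_def differentiable_def by blast
    ultimately show "((\<lambda>t. \<sigma> (\<gamma> t)) has_vector_derivative k t * \<sigma> (\<gamma> t)) (at t within {0..1})"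
      using frechet_directional[of \<sigma> z1 t "z0 - z1"] unfolding \<gamma>_def
      by (auto intro: has_vector_derivative_at_within)
  next
    show "continuous_on {0..1} k" unfolding k_def
      by (intro continuous_intros continuous_on_compose2[OF Ck_on_continuous[OF alpha_Ck] \<gamma>c]) (use \<gamma> in auto)
  qed (use z0 in \<open>simp add: \<gamma>_def\<close>)
  then show ?thesis by (simp add: \<gamma>_def)
qed

text \<open>At a zero of \<open>\<sigma>\<close> the right side is 0.  If \<open>\<partial>\<^sub>l \<sigma>\<close> were not 0 there, the equation would fail on a neighbourhood, on which \<open>\<sigma>\<close>
  would then have to be 0.\<close>

lemma (in local_metric) ode_extends_to_zeros:
  assumes \<sigma>: "holomorphic_Cn_on \<sigma> U" and ode: "\<And>z. z \<in> U \<Longrightarrow> \<sigma> z \<noteq> 0 \<Longrightarrow> dz l \<sigma> z = a * alpha l z * \<sigma> z"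
    and z: "z \<in> U"
  shows "dz l \<sigma> z = a * alpha l z * \<sigma> z"
proof (rule ccontr)
  assume ne: "dz l \<sigma> z \<noteq> a * alpha l z * \<sigma> z"
  then have \<sigma>0: "\<sigma> z = 0" using ode[OF z] by blast
  have C: "Ck_on k \<sigma> U" for k by (rule holomorphic_Cn_Ck[OF U \<sigma>])
  define F where "F = (\<lambda>z. dz l \<sigma> z - a * alpha l z * \<sigma> z)"
  have "continuous_on U F" unfolding F_def
    by (intro continuous_intros Ck_on_continuous[OF C] Ck_on_continuous[OF alpha_Ck] Ck_on_continuous[OF Ck_on_dz[OF U C]])
  then have "open (U \<inter> F -` (-{0}))" by (rule continuous_open_preimage[OF _ U]) (simp add: open_Compl)
  moreover have "z \<in> U \<inter> F -` (-{0})" using z ne by (simp add: F_def)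
  moreover have "\<sigma> w = 0" if "w \<in> U \<inter> F -` (-{0})" for w using that ode[of w] by (auto simp: F_def)
  ultimately have "dz l \<sigma> z = dz l (\<lambda>w. 0) z" by (intro dz_cong_open[of "U \<inter> F -` (-{0})"]) auto
  then show False using ne \<sigma>0 by simp
qed

context hermitian_manifold
begin

lemma local_metric_chart: "c \<in> A \<Longrightarrow> local_metric (img_of c) (h c)"
  by unfold_locales (auto intro: open_img metric_Ck metric_pos)

definition det_metric :: "('a, 'n) chart \<Rightarrow> complex^'n \<Rightarrow> real" where "det_metric c z = Re (det (h c z))"

lemma det_metric_Ck: "c \<in> A \<Longrightarrow> Ck_on k (det_metric c) (img_of c)"
  unfolding det_metric_def by (intro Ck_on_Re Ck_on_det open_img metric_Ck)

lemma det_metric_pos: "c \<in> A \<Longrightarrow> z \<in> img_of c \<Longrightarrow> det_metric c z > 0"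
  unfolding det_metric_def by (intro pos_hermitian_det_pos metric_pos)

lemma det_metric_eq: "c \<in> A \<Longrightarrow> z \<in> img_of c \<Longrightarrow> det (h c z) = of_real (det_metric c z)"
  unfolding det_metric_def using pos_hermitian_det_pos(1)[OF metric_pos] by (simp add: complex_eq_iff)

lemma det_metric_change:
  assumes "c \<in> A" "d \<in> A" "p \<in> dom_of c \<inter> dom_of d"
  shows "det_metric c (snd c p) = (cmod (det (jac c d p)))\<^sup>2 * det_metric d (snd d p)"
  using arg_cong[OF det_metric_transform(1)[OF assms], of Re] unfolding det_metric_def by (simp del: of_real_power)

definition local_section :: "(('a, 'n) chart \<Rightarrow> 'a \<Rightarrow> complex) \<Rightarrow> ('a, 'n) chart \<Rightarrow> complex^'n \<Rightarrow> complex" where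
  "local_section s c z = s c (chart_inv c z)"

lemma
  assumes "s \<in> sections A (tensor_power canonical_bundle m)"
  shows section_holomorphic: "c \<in> A \<Longrightarrow> holomorphic_Cn_on (local_section s c) (img_of c)"
    and section_change: "c \<in> A \<Longrightarrow> d \<in> A \<Longrightarrow> p \<in> dom_of c \<inter> dom_of d \<Longrightarrow> s c p = det (jac c d p) ^ m * s d p"
    and section_default: "c \<notin> A \<or> p \<notin> dom_of c \<Longrightarrow> s c p = 0"
  using assms unfolding sections_def holomorphic_in_chart_def tensor_power_def canonical_bundle_def local_section_def
  by blast+

lemma regularised_chart:
  assumes "s \<in> sections A (tensor_power canonical_bundle m)" "m > 0" "c \<in> A"
  shows "regularised_density (img_of c) (h c) (local_section s c) (\<lambda>z. det_metric c z ^ m) m"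
proof -
  interpret local_metric "img_of c" "h c" by (rule local_metric_chart[OF assms(3)])
  show ?thesis
    by unfold_locales (use assms det_metric_pos in \<open>auto intro!: section_holomorphic Ck_on_power open_img det_metric_Ck\<close>)
qed

text \<open>Both \<open>|s|\<^sup>2\<close> and \<open>(det h)\<^sup>m\<close> are multiplied by \<open>|det J|\<^sup>2\<^sup>m\<close> under a change of chart with Jacobian \<open>J\<close>.\<close>

lemma regularised_is_density:
  assumes s: "s \<in> sections A (tensor_power canonical_bundle m)" and m: "m > 0" and \<epsilon>: "\<epsilon> > 0"
  shows "density (\<lambda>c. regularised_density.N (local_section s c) (\<lambda>z. det_metric c z ^ m) m \<epsilon>)"
  unfolding density_def
proof (intro conjI ballI)
  fix c assume c: "c \<in> A"
  interpret regularised_density "img_of c" "h c" "local_section s c" "\<lambda>z. det_metric c z ^ m" m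
    by (rule regularised_chart[OF s m c])
  show "continuous_on (img_of c) (N \<epsilon>)" by (rule Ck_on_continuous[OF N_Ck[OF \<epsilon>]])
next
  fix c d p assume c: "c \<in> A" and d: "d \<in> A" and p: "p \<in> dom_of c \<inter> dom_of d"
  interpret c: regularised_density "img_of c" "h c" "local_section s c" "\<lambda>z. det_metric c z ^ m" m
    by (rule regularised_chart[OF s m c])
  interpret d: regularised_density "img_of d" "h d" "local_section s d" "\<lambda>z. det_metric d z ^ m" m
    by (rule regularised_chart[OF s m d])
  define J where "J = (cmod (det (jac c d p)))\<^sup>2"
  have J: "J > 0" unfolding J_def using det_metric_transform(2)[OF c d p] by simp
  have sq: "Re (z * cnj z) = (cmod z)\<^sup>2" for z by (simp add: cmod_power2) (simp add: power2_eq_square)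
  have "c.M \<epsilon> (snd c p) = J ^ m * d.M \<epsilon> (snd d p)"
    unfolding c.M_def d.M_def sq local_section_def using p c d section_change[OF s c d p] det_metric_change[OF c d p]
    by (simp add: J_def norm_mult norm_power power_mult_distrib power_mult[symmetric] mult.commute[of 2] algebra_simps)
  then show "c.N \<epsilon> (snd c p) = (cmod (det (jac c d p)))\<^sup>2 * d.N \<epsilon> (snd d p)"
    unfolding c.N_def d.N_def J_def[symmetric] using J m d.M_pos[of "snd d p" \<epsilon>] \<epsilon> p
    by (simp add: powr_mult powr_powr flip: powr_realpow)
qed

end

locale ricci_flat_manifold = hermitian_manifold X A h
  for X :: "'a topology" and A :: "('a, 'n::finite) chart set" and h :: "('a, 'n) metric" +
  assumes flat: "LC_Ricci_flat A h"
begin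

lemma chart_flat: "c \<in> A \<Longrightarrow> z \<in> img_of c \<Longrightarrow> LC_Ricci (h c) z v = 0"
  using flat unfolding LC_Ricci_flat_def by blast

text \<open>The chart estimates are added up over a partition of unity; the Laplacian terms cancel by \<open>density_integral_laplacian\<close>, so the
  sum of the nonnegative integrals of \<open>\<rho> N |S|\<^sup>2\<close> is at most \<open>\<epsilon>\<^sup>1\<^sup>/\<^sup>m\<close> times a constant.  This bounds the summand at \<open>p0\<close>, to which
  \<open>ode_of_vanishing_limit\<close> applies.\<close>

lemma section_ode_nonzero:
  assumes s: "s \<in> sections A (tensor_power canonical_bundle m)" and m: "m > 0"
    and c0: "c0 \<in> A" and p0: "p0 \<in> dom_of c0" and nz: "s c0 p0 \<noteq> 0"
  shows "dz l (local_section s c0) (snd c0 p0)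
      = of_nat m * local_metric.alpha (h c0) l (snd c0 p0) * local_section s c0 (snd c0 p0)"
proof (rule partition_of_unity[OF c0 p0])
  fix I :: "'a set" and b K \<rho>
  assume I: "finite I" "\<And>i. i \<in> I \<Longrightarrow> b i \<in> A"
    and K: "\<And>i. i \<in> I \<Longrightarrow> compactin X (K i)" "\<And>i. i \<in> I \<Longrightarrow> K i \<subseteq> dom_of (b i)"
    and \<rho>: "\<And>i p. i \<in> I \<Longrightarrow> 0 \<le> (\<rho> i p :: real)" "\<And>i p. i \<in> I \<Longrightarrow> p \<notin> K i \<Longrightarrow> \<rho> i p = 0"
    "\<And>p. p \<in> topspace X \<Longrightarrow> (\<Sum>i\<in>I. \<rho> i p) = 1"
    "\<And>i d. i \<in> I \<Longrightarrow> d \<in> A \<Longrightarrow> Ck_on 2 (\<lambda>z. \<rho> i (chart_inv d z)) (img_of d)"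
    and p0I: "p0 \<in> I" "b p0 = c0" "\<rho> p0 p0 > 0"
  define U where "U i = img_of (b i)" for i
  define D where "D i = (\<lambda>z. det_metric (b i) z ^ m)" for i
  define \<sigma> where "\<sigma> i = local_section s (b i)" for i
  define r where "r i = (\<lambda>z. \<rho> i (chart_inv (b i) z))" for i
  define N where "N \<epsilon> i = regularised_density.N (\<sigma> i) (D i) m \<epsilon>" for \<epsilon> i
  note N_loc = N_def
  define G where "G \<epsilon> i = integral\<^sup>L lborel (zero_extend (U i) (\<lambda>z. r i z * N \<epsilon> i z * regularised_density.S_norm (h (b i)) (\<sigma> i) (D i) m \<epsilon> z))" for \<epsilon> i
  define C where "C i = integral\<^sup>L lborel (zero_extend (U i) (\<lambda>z. r i z * regularised_density.B (h (b i)) (D i) m z))" for i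
  have reg: "regularised_density (U i) (h (b i)) (\<sigma> i) (D i) m" if "i \<in> I" for i
    unfolding U_def \<sigma>_def D_def by (rule regularised_chart[OF s m I(2)[OF that]])
  have Kc: "compact (snd (b i) ` K i)" "snd (b i) ` K i \<subseteq> U i" if "i \<in> I" for i
  proof -
    show "compact (snd (b i) ` K i)" by (rule compact_chart_image[OF I(2) K(1,2)]) (use that in auto)
    show "snd (b i) ` K i \<subseteq> U i"
    proof (rule image_subsetI)
      fix x assume "x \<in> K i"
      then show "snd (b i) x \<in> U i" using K(2)[OF that] unfolding U_def by (intro chart_in_img) auto
    qed
  qed
  have r: "Ck_on 2 (r i) (U i)" "\<And>z. z \<in> U i \<Longrightarrow> z \<notin> snd (b i) ` K i \<Longrightarrow> r i z = 0" "\<And>z. r i z \<ge> 0" if i: "i \<in> I" for i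
  proof -
    show "Ck_on 2 (r i) (U i)" unfolding r_def U_def by (rule \<rho>(4)[OF i I(2)[OF i]])
    show "r i z \<ge> 0" for z unfolding r_def by (rule \<rho>(1)[OF i])
    fix z assume "z \<in> U i" "z \<notin> snd (b i) ` K i"
    then have "chart_inv (b i) z \<notin> K i" unfolding U_def by (metis chart_chart_inv image_eqI)
    then show "r i z = 0" unfolding r_def by (rule \<rho>(2)[OF i])
  qed
  have fl: "LC_Ricci (h (b i)) z v = 0" if "i \<in> I" "z \<in> U i" for i z v
    using chart_flat[OF I(2)[OF that(1)]] that(2) unfolding U_def by blast
  have low: "G \<epsilon> i - \<epsilon> powr (1 / real m) * C i
      \<le> integral\<^sup>L lborel (zero_extend (U i) (\<lambda>z. N \<epsilon> i z * lap (\<rho> i) (b i) z))" if "i \<in> I" "\<epsilon> > 0" for \<epsilon> i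
    using regularised_density.chart_integral_lower_bound(1)[OF reg[OF that(1)] Kc[OF that(1)] that(2) fl[OF that(1)] r[OF that(1)]]
    unfolding G_def C_def N_def lap_def r_def by simp
  have Gint: "integrable lborel (zero_extend (U i) (\<lambda>z. r i z * N \<epsilon> i z * regularised_density.S_norm (h (b i)) (\<sigma> i) (D i) m \<epsilon> z))" if "i \<in> I" "\<epsilon> > 0" for \<epsilon> i
    using regularised_density.chart_integral_lower_bound(2)[OF reg[OF that(1)] Kc[OF that(1)] that(2) fl[OF that(1)] r[OF that(1)]]
    unfolding N_def by simp
  have total: "(\<Sum>i\<in>I. integral\<^sup>L lborel (zero_extend (U i) (\<lambda>z. N \<epsilon> i z * lap (\<rho> i) (b i) z))) = 0" if "\<epsilon> > 0" for \<epsilon>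
    unfolding N_def U_def \<sigma>_def D_def
    by (rule density_integral_laplacian[OF regularised_is_density[OF s m that] I K \<rho>(2,3,4)])
  have Gnn: "G \<epsilon> i \<ge> 0" if i: "i \<in> I" "\<epsilon> > 0" for \<epsilon> i
    unfolding G_def
  proof (rule integral_nonneg_AE, rule AE_I2)
    fix z
    interpret regularised_density "U i" "h (b i)" "\<sigma> i" "D i" m by (rule reg[OF i(1)])
    show "0 \<le> zero_extend (U i) (\<lambda>z. r i z * N \<epsilon> i z * S_norm \<epsilon> z) z"
      using r(3)[OF i(1), of z] S_norm_nonneg[of z \<epsilon>] N_pos[OF _ i(2), of z]
      by (auto simp: zero_extend_def N_loc intro!: mult_nonneg_nonneg)
  qed
  have bound: "G \<epsilon> p0 \<le> \<epsilon> powr (1 / real m) * (\<Sum>i\<in>I. C i)" if \<epsilon>: "\<epsilon> > 0" for \<epsilon>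
  proof -
    have "(\<Sum>i\<in>I. G \<epsilon> i) - \<epsilon> powr (1 / real m) * (\<Sum>i\<in>I. C i) = (\<Sum>i\<in>I. G \<epsilon> i - \<epsilon> powr (1 / real m) * C i)"
      by (simp add: sum_subtractf sum_distrib_left)
    also have "\<dots> \<le> (\<Sum>i\<in>I. integral\<^sup>L lborel (zero_extend (U i) (\<lambda>z. N \<epsilon> i z * lap (\<rho> i) (b i) z)))"
      by (rule sum_mono) (rule low[OF _ \<epsilon>])
    also have "\<dots> = 0" by (rule total[OF \<epsilon>])
    finally have "(\<Sum>i\<in>I. G \<epsilon> i) \<le> \<epsilon> powr (1 / real m) * (\<Sum>i\<in>I. C i)" by simp
    moreover have "G \<epsilon> p0 \<le> (\<Sum>i\<in>I. G \<epsilon> i)" by (rule member_le_sum) (use p0I I Gnn \<epsilon> in auto)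
    ultimately show ?thesis by linarith
  qed
  interpret regularised_density "U p0" "h (b p0)" "\<sigma> p0" "D p0" m by (rule reg[OF p0I(1)])
  have "dz l (\<sigma> p0) (snd c0 p0) = of_nat m * alpha l (snd c0 p0) * \<sigma> p0 (snd c0 p0)"
  proof (rule ode_of_vanishing_limit[where \<rho> = "r p0" and C = "\<Sum>i\<in>I. C i"])
    show "continuous_on (U p0) (r p0)" using Ck_on_continuous[OF r(1)[OF p0I(1)]] .
    show "0 \<le> r p0 z" for z by (rule r(3)[OF p0I(1)])
    show "snd c0 p0 \<in> U p0" unfolding U_def p0I(2) using p0 by simp
    show "0 < r p0 (snd c0 p0)" unfolding r_def p0I(2) using p0I(3) p0 c0 by simp
    show "\<sigma> p0 (snd c0 p0) \<noteq> 0" unfolding \<sigma>_def p0I(2) local_section_def using nz p0 c0 by simp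
    show "integrable lborel (zero_extend (U p0) (\<lambda>z. r p0 z * regularised_density.N (\<sigma> p0) (D p0) m \<epsilon> z * S_norm \<epsilon> z))" if "\<epsilon> > 0" for \<epsilon>
      using Gint[OF p0I(1) that] unfolding N_loc .
    show "integral\<^sup>L lborel (zero_extend (U p0) (\<lambda>z. r p0 z * regularised_density.N (\<sigma> p0) (D p0) m \<epsilon> z * S_norm \<epsilon> z)) \<le> \<epsilon> powr (1 / real m) * (\<Sum>i\<in>I. C i)" if "\<epsilon> > 0" for \<epsilon>
      using bound[OF that] unfolding G_def N_loc .
  qed
  then show ?thesis unfolding \<sigma>_def p0I(2) .
qed

lemma section_ode:
  assumes s: "s \<in> sections A (tensor_power canonical_bundle m)" and m: "m > 0" and c: "c \<in> A" and z: "z \<in> img_of c"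
  shows "dz l (local_section s c) z = of_nat m * local_metric.alpha (h c) l z * local_section s c z"
proof -
  interpret local_metric "img_of c" "h c" by (rule local_metric_chart[OF c])
  show ?thesis
  proof (rule ode_extends_to_zeros[OF section_holomorphic[OF s c] _ z])
    fix w assume w: "w \<in> img_of c" "local_section s c w \<noteq> 0"
    then show "dz l (local_section s c) w = of_nat m * alpha l w * local_section s c w"
      using section_ode_nonzero[OF s m c, of "chart_inv c w" l] by (simp add: local_section_def)
  qed
qed

text \<open>The zero set is closed, and by the differential equation it is also open; the manifold is connected.\<close>

theorem section_dichotomy:
  assumes s: "s \<in> sections A (tensor_power canonical_bundle m)" and m: "m > 0"
  shows "(\<forall>c\<in>A. \<forall>p\<in>dom_of c. s c p \<noteq> 0) \<or> s = (\<lambda>c p. 0)"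
proof -
  define Z where "Z = {p \<in> topspace X. \<exists>c\<in>A. p \<in> dom_of c \<and> s c p = 0}"
  define Y where "Y = {p \<in> topspace X. \<exists>c\<in>A. p \<in> dom_of c \<and> s c p \<noteq> 0}"
  have change: "s c p = 0 \<longleftrightarrow> s d p = 0" if "c \<in> A" "d \<in> A" "p \<in> dom_of c" "p \<in> dom_of d" for c d p
    using section_change[OF s that(1,2), of p] det_metric_transform(2)[OF that(1,2), of p] that by auto
  have YZ: "Y = topspace X - Z" unfolding Y_def Z_def using change cover by blast
  have Yopen: "openin X Y"
  proof (subst openin_subopen, intro ballI)
    fix p assume "p \<in> Y"
    then obtain c where c: "c \<in> A" "p \<in> dom_of c" "s c p \<noteq> 0" unfolding Y_def by blast
    define W where "W = img_of c \<inter> local_section s c -` (-{0})"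
    have "open W" unfolding W_def
      by (rule continuous_open_preimage[OF holomorphic_Cn_continuous[OF section_holomorphic[OF s c(1)]] open_img[OF c(1)]])
        (simp add: open_Compl)
    then have "openin X {q \<in> dom_of c. snd c q \<in> W}" by (rule open_chart_inv_image[OF c(1)])
    moreover have "p \<in> {q \<in> dom_of c. snd c q \<in> W}" using c by (simp add: W_def local_section_def)
    moreover have "{q \<in> dom_of c. snd c q \<in> W} \<subseteq> Y"
      using c dom_subset[OF c(1)] unfolding W_def Y_def local_section_def by auto
    ultimately show "\<exists>T. openin X T \<and> p \<in> T \<and> T \<subseteq> Y" by blast
  qed
  have Zopen: "openin X Z"
  proof (subst openin_subopen, intro ballI)
    fix p assume "p \<in> Z"
    then obtain c where c: "c \<in> A" "p \<in> dom_of c" "s c p = 0" unfolding Z_def by blast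
    interpret local_metric "img_of c" "h c" by (rule local_metric_chart[OF c(1)])
    have in_img: "snd c p \<in> img_of c" using c by simp
    obtain r where r: "r > 0" "ball (snd c p) r \<subseteq> img_of c" using U in_img open_contains_ball by blast
    have "openin X {q \<in> dom_of c. snd c q \<in> ball (snd c p) r}" by (rule open_chart_inv_image[OF c(1) open_ball])
    moreover have "p \<in> {q \<in> dom_of c. snd c q \<in> ball (snd c p) r}" using c r by simp
    moreover have "{q \<in> dom_of c. snd c q \<in> ball (snd c p) r} \<subseteq> Z"
    proof
      fix q assume q: "q \<in> {q \<in> dom_of c. snd c q \<in> ball (snd c p) r}"
      have "local_section s c (snd c q) = 0"
        by (rule holomorphic_ode_zero_set[OF section_holomorphic[OF s c(1)] in_img _ section_ode[OF s m c(1)] r(2)])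
          (use c q in \<open>auto simp: local_section_def\<close>)
      then show "q \<in> Z" using q c dom_subset[OF c(1)] unfolding Z_def local_section_def by auto
    qed
    ultimately show "\<exists>T. openin X T \<and> p \<in> T \<and> T \<subseteq> Z" by blast
  qed
  have "closedin X Z" unfolding closedin_def using Yopen YZ Z_def by auto
  then have "Z = {} \<or> Z = topspace X" using conn Zopen unfolding connected_space_clopen_in by blast
  then show ?thesis
  proof
    assume "Z = {}"
    then have "\<forall>c\<in>A. \<forall>p\<in>dom_of c. s c p \<noteq> 0" using dom_subset unfolding Z_def by blast
    then show ?thesis ..
  next
    assume Z: "Z = topspace X"
    have "s c p = 0" for c p
    proof (cases "c \<in> A \<and> p \<in> dom_of c")
      case True
      then have "p \<in> Z" using Z dom_subset by blast
      then obtain d where "d \<in> A" "p \<in> dom_of d" "s d p = 0" unfolding Z_def by blast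
      then show ?thesis using change True by blast
    qed (use section_default[OF s] in blast)
    then show ?thesis by (intro disjI2 ext)
  qed
qed

end

section \<open>Exterior derivative of powers of a (1,1)-form\<close>

definition alt_sum :: "nat \<Rightarrow> ((nat \<Rightarrow> nat) \<Rightarrow> complex) \<Rightarrow> complex" where
  "alt_sum m f = (\<Sum>\<sigma> | \<sigma> permutes {..<m}. of_int (sign \<sigma>) * f \<sigma>)"

lemma finite_perms [simp]: "finite {\<sigma>. \<sigma> permutes {..<m::nat}}"
  by (rule finite_permutations) simp

lemma permutation_lessThan: "\<sigma> permutes {..<m::nat} \<Longrightarrow> permutation \<sigma>"
  using permutation_permutes by blast

text \<open>Composition with a permutation of the slots is a bijection of the index set that multiplies every sign by \<open>sign \<tau>\<close>.\<close>

lemma alt_sum_compose: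
  assumes \<tau>: "\<tau> permutes {..<m}"
  shows "alt_sum m (\<lambda>\<sigma>. f (\<sigma> \<circ> \<tau>)) = of_int (sign \<tau>) * alt_sum m f"
proof -
  have "alt_sum m f = (\<Sum>\<sigma> | \<sigma> permutes {..<m}. of_int (sign (\<sigma> \<circ> \<tau>)) * f (\<sigma> \<circ> \<tau>))"
    unfolding alt_sum_def
    by (rule sum.reindex_bij_witness[of _ "\<lambda>\<sigma>. \<sigma> \<circ> \<tau>" "\<lambda>\<sigma>. \<sigma> \<circ> inv \<tau>"])
      (use \<tau> in \<open>auto simp: permutes_compose permutes_inv o_assoc[symmetric] permutes_inv_o\<close>)
  also have "\<dots> = of_int (sign \<tau>) * (\<Sum>\<sigma> | \<sigma> permutes {..<m}. of_int (sign \<sigma>) * f (\<sigma> \<circ> \<tau>))"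
    unfolding sum_distrib_left
    by (intro sum.cong refl) (use \<tau> in \<open>simp add: sign_compose permutation_lessThan mult_ac\<close>)
  finally have "alt_sum m f = of_int (sign \<tau>) * alt_sum m (\<lambda>\<sigma>. f (\<sigma> \<circ> \<tau>))" unfolding alt_sum_def .
  then show ?thesis by (simp add: sign_def)
qed

lemma alt_sum_add: "alt_sum m (\<lambda>\<sigma>. f \<sigma> + g \<sigma>) = alt_sum m f + alt_sum m g"
  and alt_sum_sum: "alt_sum m (\<lambda>\<sigma>. \<Sum>i\<in>I. F i \<sigma>) = (\<Sum>i\<in>I. alt_sum m (F i))"
  and alt_sum_cmult: "alt_sum m (\<lambda>\<sigma>. c * f \<sigma>) = c * alt_sum m f"
proof -
  show "alt_sum m (\<lambda>\<sigma>. f \<sigma> + g \<sigma>) = alt_sum m f + alt_sum m g"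
    unfolding alt_sum_def by (simp add: distrib_left sum.distrib)
  show "alt_sum m (\<lambda>\<sigma>. \<Sum>i\<in>I. F i \<sigma>) = (\<Sum>i\<in>I. alt_sum m (F i))"
    unfolding alt_sum_def sum_distrib_left by (rule sum.swap)
  show "alt_sum m (\<lambda>\<sigma>. c * f \<sigma>) = c * alt_sum m f"
    unfolding alt_sum_def sum_distrib_left by (simp add: mult_ac)
qed

definition shift_perm :: "nat \<Rightarrow> (nat \<Rightarrow> nat) \<Rightarrow> nat \<Rightarrow> nat" where
  "shift_perm p \<tau> i = (if i < p then i else p + \<tau> (i - p))"

lemma shift_perm_permutes:
  assumes "\<tau> permutes {..<q}"
  shows "shift_perm p \<tau> permutes {..<p + q}" "sign (shift_perm p \<tau>) = sign \<tau>"
proof -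
  have "shift_perm p \<tau> permutes {..<p + q} \<and> sign (shift_perm p \<tau>) = sign \<tau>"
    using assms finite_lessThan
  proof (induction rule: permutes_induct)
    case id
    have "shift_perm p id = id" by (auto simp: shift_perm_def fun_eq_iff)
    then show ?case by (simp only: permutes_id simp_thms)
  next
    case (swap a b \<tau>)
    have eq: "shift_perm p (Transposition.transpose a b \<circ> \<tau>) = Transposition.transpose (p + a) (p + b) \<circ> shift_perm p \<tau>"
      by (auto simp: shift_perm_def fun_eq_iff Transposition.transpose_def)
    have tr: "Transposition.transpose (p + a) (p + b) permutes {..<p + q}"
      using swap by (intro permutes_swap_id) auto
    have "permutation \<tau>" using swap permutation_lessThan by blast
    moreover have "permutation (shift_perm p \<tau>)" using swap permutation_lessThan by blast
    ultimately have "sign (Transposition.transpose (p + a) (p + b) \<circ> shift_perm p \<tau>) = sign (Transposition.transpose a b \<circ> \<tau>)"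
      using swap by (simp only: sign_compose permutation_swap_id sign_swap_id) simp
    then show ?case unfolding eq using permutes_compose[OF _ tr] swap by blast
  qed
  then show "shift_perm p \<tau> permutes {..<p + q}" "sign (shift_perm p \<tau>) = sign \<tau>" by auto
qed

text \<open>The inner permutation of the last \<open>q\<close> slots can be absorbed into the outer one, at the price of its sign, which cancels the sign
  already present; each of the \<open>q!\<close> inner terms then contributes the same amount.\<close>

lemma alt_sum_nested:
  "alt_sum (p + q) (\<lambda>\<sigma>. a (\<lambda>i. \<sigma> i) * alt_sum q (\<lambda>\<tau>. b (\<lambda>i. \<sigma> (p + \<tau> i))))
     = fact q * alt_sum (p + q) (\<lambda>\<sigma>. a \<sigma> * b (\<lambda>i. \<sigma> (p + i)))"
  if a: "\<And>\<sigma> \<sigma>'. (\<And>i. i < p \<Longrightarrow> \<sigma> i = \<sigma>' i) \<Longrightarrow> a \<sigma> = (a \<sigma>' :: complex)"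
proof -
  define F where "F \<sigma> = a \<sigma> * b (\<lambda>i. \<sigma> (p + i))" for \<sigma>
  have comp: "a \<sigma> * b (\<lambda>i. \<sigma> (p + \<tau> i)) = F (\<sigma> \<circ> shift_perm p \<tau>)" for \<sigma> \<tau>
  proof -
    have "a (\<sigma> \<circ> shift_perm p \<tau>) = a \<sigma>" by (rule a) (simp add: shift_perm_def)
    then show ?thesis by (simp add: F_def shift_perm_def)
  qed
  have "alt_sum (p + q) (\<lambda>\<sigma>. a \<sigma> * alt_sum q (\<lambda>\<tau>. b (\<lambda>i. \<sigma> (p + \<tau> i))))
      = alt_sum (p + q) (\<lambda>\<sigma>. \<Sum>\<tau> | \<tau> permutes {..<q}. of_int (sign \<tau>) * F (\<sigma> \<circ> shift_perm p \<tau>))"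
    unfolding comp[symmetric] by (simp add: alt_sum_def[of q] sum_distrib_left mult_ac)
  also have "\<dots> = (\<Sum>\<tau> | \<tau> permutes {..<q}. of_int (sign \<tau>) * alt_sum (p + q) (\<lambda>\<sigma>. F (\<sigma> \<circ> shift_perm p \<tau>)))"
    unfolding alt_sum_sum alt_sum_cmult ..
  also have "\<dots> = (\<Sum>\<tau> | \<tau> permutes {..<q}. alt_sum (p + q) F)"
  proof (intro sum.cong refl)
    fix \<tau> assume "\<tau> \<in> {\<tau>. \<tau> permutes {..<q}}"
    then have "\<tau> permutes {..<q}" by simp
    from alt_sum_compose[OF shift_perm_permutes(1)[OF this], of p F] shift_perm_permutes(2)[OF this]
    show "of_int (sign \<tau>) * alt_sum (p + q) (\<lambda>\<sigma>. F (\<sigma> \<circ> shift_perm p \<tau>)) = alt_sum (p + q) F"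
      by (simp add: sign_def)
  qed
  also have "\<dots> = fact q * alt_sum (p + q) F" by (simp add: card_permutations)
  finally show ?thesis unfolding F_def .
qed

definition pairing :: "(complex^'n^'n) \<Rightarrow> complex^'n \<Rightarrow> complex^'n \<Rightarrow> complex" where
  "pairing H u v = (\<Sum>i\<in>UNIV. \<Sum>j\<in>UNIV. H $ i $ j * u $ i * cnj (v $ j))"

lemma form11_pairing: "form11 h z v = \<i> * (pairing (h z) (v 0) (v 1) - pairing (h z) (v 1) (v 0))"
  by (simp add: form11_def pairing_def sum_subtractf right_diff_distrib mult_ac)

text \<open>Only the independence of \<open>c\<close> from \<open>h\<close>, \<open>z\<close> and \<open>v\<close> matters, so its value \<open>\<i>\<^sup>k\<close> is left open.  In each wedge factor the two
  terms of the (1,1)-form give equal contributions to the alternating sum.\<close>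

lemma two_form_power_expand:
  "\<exists>c. \<forall>h z v. two_form_power (form11 h :: (complex^'n::finite) form) k z v
      = c * alt_sum (2 * k) (\<lambda>\<sigma>. \<Prod>l<k. pairing (h z) (v (\<sigma> (2 * l))) (v (\<sigma> (2 * l + 1))))"
proof (induction k)
  case 0
  have "{\<sigma>. \<sigma> permutes {..<0::nat}} = {id}" by auto
  then have "alt_sum (2 * 0) f = f id" for f unfolding alt_sum_def by simp
  then show ?case by (intro exI[of _ 1]) simp
next
  case (Suc k)
  then obtain c where c: "\<And>h z v. two_form_power (form11 h :: (complex^'n) form) k z v
      = c * alt_sum (2 * k) (\<lambda>\<sigma>. \<Prod>l<k. pairing (h z) (v (\<sigma> (2 * l))) (v (\<sigma> (2 * l + 1))))" by blast
  define K where "K = fact 2 * (fact (2 * k) :: complex)"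
  have "two_form_power (form11 h :: (complex^'n) form) (Suc k) z v
      = (\<i> * 2 * c * fact (2 * k) / K) * alt_sum (2 * Suc k) (\<lambda>\<sigma>. \<Prod>l<Suc k. pairing (h z) (v (\<sigma> (2 * l))) (v (\<sigma> (2 * l + 1))))"
    for h z v
  proof -
    define g where "g a b = pairing (h z) (v a) (v b)" for a b
    define R where "R \<tau> = (\<Prod>l<k. g (\<tau> (2 * l)) (\<tau> (2 * l + 1)))" for \<tau>
    have "two_form_power (form11 h) (Suc k) z v = alt_sum (2 + 2 * k) (\<lambda>\<sigma>. (\<i> * (g (\<sigma> 0) (\<sigma> 1) - g (\<sigma> 1) (\<sigma> 0))) *
        (c * alt_sum (2 * k) (\<lambda>\<tau>. R (\<lambda>i. \<sigma> (2 + \<tau> i))))) / K"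
      unfolding two_form_power.simps wedge_def c alt_sum_def[of "2 + 2 * k"] form11_pairing g_def R_def K_def
      by (simp add: mult.assoc)
    also have "(\<lambda>\<sigma>. (\<i> * (g (\<sigma> 0) (\<sigma> 1) - g (\<sigma> 1) (\<sigma> 0))) * (c * alt_sum (2 * k) (\<lambda>\<tau>. R (\<lambda>i. \<sigma> (2 + \<tau> i)))))
        = (\<lambda>\<sigma>. (\<i> * c) * ((g (\<sigma> 0) (\<sigma> 1) - g (\<sigma> 1) (\<sigma> 0)) * alt_sum (2 * k) (\<lambda>\<tau>. R (\<lambda>i. \<sigma> (2 + \<tau> i)))))"
      by (simp add: mult_ac)
    also have "alt_sum (2 + 2 * k) \<dots> = (\<i> * c) * (fact (2 * k) * alt_sum (2 + 2 * k) (\<lambda>\<sigma>. (g (\<sigma> 0) (\<sigma> 1) - g (\<sigma> 1) (\<sigma> 0)) * R (\<lambda>i. \<sigma> (2 + i))))"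
      unfolding alt_sum_cmult
      by (subst alt_sum_nested[of 2 "\<lambda>\<sigma>. g (\<sigma> 0) (\<sigma> 1) - g (\<sigma> 1) (\<sigma> 0)" "2 * k" R]) auto
    also have "alt_sum (2 + 2 * k) (\<lambda>\<sigma>. (g (\<sigma> 0) (\<sigma> 1) - g (\<sigma> 1) (\<sigma> 0)) * R (\<lambda>i. \<sigma> (2 + i)))
        = 2 * alt_sum (2 + 2 * k) (\<lambda>\<sigma>. g (\<sigma> 0) (\<sigma> 1) * R (\<lambda>i. \<sigma> (2 + i)))"
    proof -
      define f where "f \<sigma> = g (\<sigma> 0) (\<sigma> 1) * R (\<lambda>i. \<sigma> (2 + i))" for \<sigma> :: "nat \<Rightarrow> nat"
      have t: "Transposition.transpose 0 1 permutes {..<2 + 2 * k}" by (intro permutes_swap_id) auto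
      have "g (\<sigma> 1) (\<sigma> 0) * R (\<lambda>i. \<sigma> (2 + i)) = f (\<sigma> \<circ> Transposition.transpose 0 1)" for \<sigma>
        by (simp add: f_def Transposition.transpose_def)
      then have "alt_sum (2 + 2 * k) (\<lambda>\<sigma>. (g (\<sigma> 0) (\<sigma> 1) - g (\<sigma> 1) (\<sigma> 0)) * R (\<lambda>i. \<sigma> (2 + i)))
          = alt_sum (2 + 2 * k) (\<lambda>\<sigma>. f \<sigma> + (-1) * f (\<sigma> \<circ> Transposition.transpose 0 1))"
        by (simp add: f_def left_diff_distrib)
      also have "\<dots> = alt_sum (2 + 2 * k) f + (-1) * (of_int (sign (Transposition.transpose 0 (1::nat))) * alt_sum (2 + 2 * k) f)"
        unfolding alt_sum_add alt_sum_cmult alt_sum_compose[OF t, of f] ..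
      also have "\<dots> = 2 * alt_sum (2 + 2 * k) f" by (simp add: sign_swap_id)
      finally show ?thesis unfolding f_def .
    qed
    also have "(\<lambda>\<sigma>. g (\<sigma> 0) (\<sigma> 1) * R (\<lambda>i. \<sigma> (2 + i))) = (\<lambda>\<sigma>. \<Prod>l<Suc k. g (\<sigma> (2 * l)) (\<sigma> (2 * l + 1)))"
      by (simp add: R_def prod.lessThan_Suc_shift del: prod.lessThan_Suc)
    finally show ?thesis by (simp add: g_def mult_ac)
  qed
  then show ?case by blast
qed

text \<open>The cycle that moves \<open>i\<close> to the front and keeps the order of the other numbers.\<close>

definition front_cycle :: "nat \<Rightarrow> nat \<Rightarrow> nat" where
  "front_cycle i j = (if j = 0 then i else if j \<le> i then j - 1 else j)"

lemma front_cycle_permutes: "i \<le> m \<Longrightarrow> front_cycle i permutes {..<Suc m} \<and> sign (front_cycle i) = (-1) ^ i"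
proof (induction i)
  case 0
  have c0: "front_cycle 0 = id" by (auto simp: front_cycle_def fun_eq_iff)
  show ?case unfolding c0 by (simp only: permutes_id sign_id power_0 simp_thms)
next
  case (Suc i)
  have eq: "front_cycle (Suc i) = Transposition.transpose i (Suc i) \<circ> front_cycle i"
    by (auto simp: front_cycle_def fun_eq_iff Transposition.transpose_def)
  have t: "Transposition.transpose i (Suc i) permutes {..<Suc m}" using Suc.prems by (intro permutes_swap_id) auto
  have IH: "front_cycle i permutes {..<Suc m}" "sign (front_cycle i) = (-1) ^ i" using Suc by auto
  have "sign (Transposition.transpose i (Suc i) \<circ> front_cycle i) = (-1) ^ Suc i"
    unfolding sign_compose[OF permutation_swap_id permutation_lessThan[OF IH(1)]] sign_swap_id IH(2) by simp
  then show ?case unfolding eq using permutes_compose[OF IH(1) t] by blast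
qed

text \<open>The alternating sum in the exterior derivative and the one in the form combine into one alternating sum over an additional slot:
  a permutation is determined by its value \<open>i\<close> at 0 and a permutation of the remaining slots.\<close>

lemma alt_sum_expand_first:
  "(\<Sum>i\<le>m. (-1) ^ i * alt_sum m (\<lambda>\<tau>. \<Phi> i (\<lambda>l. if \<tau> l < i then \<tau> l else Suc (\<tau> l))))
     = alt_sum (Suc m) (\<lambda>\<sigma>. \<Phi> (\<sigma> 0) (\<lambda>l. \<sigma> (Suc l)))"
proof -
  define S where "S = {..m} \<times> {\<tau>. \<tau> permutes {..<m}}"
  define G where "G x = front_cycle (fst x) \<circ> shift_perm 1 (snd x)" for x
  define H where "H \<sigma> = \<sigma> 0" for \<sigma> :: "nat \<Rightarrow> nat"
  have perm: "G x permutes {..<Suc m}" "sign (G x) = (-1) ^ fst x * sign (snd x)" if "x \<in> S" for x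
  proof -
    have 1: "front_cycle (fst x) permutes {..<Suc m}" "sign (front_cycle (fst x)) = (-1) ^ fst x" using that front_cycle_permutes unfolding S_def by auto
    have 2: "shift_perm 1 (snd x) permutes {..<Suc m}" "sign (shift_perm 1 (snd x)) = sign (snd x)"
      using that shift_perm_permutes[of "snd x" m 1] unfolding S_def by auto
    show "G x permutes {..<Suc m}" "sign (G x) = (-1) ^ fst x * sign (snd x)"
      unfolding G_def using permutes_compose[OF 2(1) 1(1)] 1 2 by (auto simp: sign_compose permutation_lessThan)
  qed
  have val: "G (i, \<tau>) 0 = i" "G (i, \<tau>) (Suc l) = (if \<tau> l < i then \<tau> l else Suc (\<tau> l))" for i \<tau> l
    by (auto simp: G_def front_cycle_def shift_perm_def)
  have inj: "inj_on G S"
  proof (rule inj_onI, safe)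
    fix i \<tau> j \<rho> assume eq: "G (i, \<tau>) = G (j, \<rho>)"
    have ij: "i = j" using fun_cong[OF eq, of 0] unfolding val .
    have "\<tau> l = \<rho> l" for l using fun_cong[OF eq, of "Suc l"] unfolding val ij by (auto split: if_splits)
    then show "i = j" "\<tau> = \<rho>" using ij by auto
  qed
  have img: "G ` S = {\<sigma>. \<sigma> permutes {..<Suc m}}"
  proof (rule card_subset_eq)
    show "G ` S \<subseteq> {\<sigma>. \<sigma> permutes {..<Suc m}}" using perm by auto
    show "card (G ` S) = card {\<sigma>. \<sigma> permutes {..<Suc m}}"
      unfolding card_image[OF inj] by (simp add: S_def card_cartesian_product card_permutations)
  qed simp
  have "alt_sum (Suc m) (\<lambda>\<sigma>. \<Phi> (\<sigma> 0) (\<lambda>l. \<sigma> (Suc l))) = (\<Sum>x\<in>S. of_int (sign (G x)) * \<Phi> (G x 0) (\<lambda>l. G x (Suc l)))"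
    unfolding alt_sum_def img[symmetric] sum.reindex[OF inj] by simp
  also have "\<dots> = (\<Sum>x\<in>S. case x of (i, \<tau>) \<Rightarrow> (-1) ^ i * (of_int (sign \<tau>) * \<Phi> i (\<lambda>l. if \<tau> l < i then \<tau> l else Suc (\<tau> l))))"
    by (intro sum.cong refl) (auto simp: perm val)
  also have "\<dots> = (\<Sum>i\<le>m. (-1) ^ i * alt_sum m (\<lambda>\<tau>. \<Phi> i (\<lambda>l. if \<tau> l < i then \<tau> l else Suc (\<tau> l))))"
    unfolding S_def alt_sum_def sum_distrib_left by (rule sum.cartesian_product[symmetric])
  finally show ?thesis ..
qed

text \<open>In \<open>d (\<omega>\<^sup>k)\<close> the vector with number 0 is the direction of differentiation, and the \<open>l\<close>-th factor \<open>\<omega>\<close> takes those with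
  numbers \<open>2 l + 1\<close> and \<open>2 l + 2\<close>.  The numbers \<open>slot 0, \<dots>, slot k\<close> are the arguments in which the (k + 1, k)-part of
  \<open>d (\<omega>\<^sup>k)\<close> is complex linear; in the others it is conjugate linear.\<close>

definition slot :: "nat \<Rightarrow> nat" where "slot l = (if l = 0 then 0 else 2 * l - 1)"

lemma slot_inj: "slot a = slot b \<longleftrightarrow> a = b" and slot_less: "a \<le> k \<Longrightarrow> slot a < Suc (2 * k)"
  and slot_even: "slot a \<noteq> 2 * l + 2"
  by (auto simp: slot_def) presburger+

definition dotc :: "complex^'n::finite \<Rightarrow> complex^'n \<Rightarrow> complex" where
  "dotc x u = (\<Sum>i\<in>UNIV. x $ i * u $ i)"

definition slot_form :: "nat \<Rightarrow> (nat \<Rightarrow> complex^'n::finite) \<Rightarrow> (nat \<Rightarrow> 'n) \<Rightarrow> (nat \<Rightarrow> complex^'n) \<Rightarrow> complex" where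
  "slot_form k v J x = alt_sum (Suc (2 * k))
     (\<lambda>\<sigma>. (\<Prod>l<Suc k. dotc (x l) (v (\<sigma> (slot l)))) * (\<Prod>l<k. cnj (v (\<sigma> (2 * l + 2)) $ J l)))"

lemma slot_form_cong: "(\<And>l. l < Suc k \<Longrightarrow> x l = y l) \<Longrightarrow> slot_form k v J x = slot_form k v J y"
  unfolding slot_form_def by (intro arg_cong[of _ _ "alt_sum _"] ext arg_cong2[of _ _ _ _ "(*)"] prod.cong refl) auto

text \<open>Exchanging two of the covectors amounts to exchanging the slots that they occupy.\<close>

lemma slot_form_swap:
  assumes ab: "a < Suc k" "b < Suc k" "a \<noteq> b"
  shows "slot_form k v J (x \<circ> Transposition.transpose a b) = - slot_form k v J x"
proof -
  define \<tau> where "\<tau> = Transposition.transpose (slot a) (slot b)"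
  have \<tau>: "\<tau> permutes {..<Suc (2 * k)}" "sign \<tau> = -1"
    unfolding \<tau>_def using ab slot_less[of a k] slot_less[of b k] by (auto intro!: permutes_swap_id simp: sign_swap_id slot_inj)
  define f where "f \<sigma> = (\<Prod>l<Suc k. dotc (x l) (v (\<sigma> (slot l)))) * (\<Prod>l<k. cnj (v (\<sigma> (2 * l + 2)) $ J l))" for \<sigma>
  have sl: "\<tau> (slot l) = slot (Transposition.transpose a b l)" for l
    unfolding \<tau>_def by (auto simp: Transposition.transpose_def slot_inj)
  have ev: "\<tau> (2 * l + 2) = 2 * l + 2" for l
    unfolding \<tau>_def using slot_even[of a l] slot_even[of b l] by (simp add: Transposition.transpose_def)
  have t: "Transposition.transpose a b permutes {..<Suc k}" using ab by (intro permutes_swap_id) auto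
  have "f (\<sigma> \<circ> \<tau>) = (\<Prod>l<Suc k. dotc ((x \<circ> Transposition.transpose a b) l) (v (\<sigma> (slot l)))) * (\<Prod>l<k. cnj (v (\<sigma> (2 * l + 2)) $ J l))" for \<sigma>
  proof -
    have "(\<Prod>l<Suc k. dotc (x l) (v (\<sigma> (slot (Transposition.transpose a b l)))))
        = (\<Prod>l<Suc k. dotc (x (Transposition.transpose a b l)) (v (\<sigma> (slot l))))"
      by (rule prod.reindex_bij_witness[of _ "Transposition.transpose a b" "Transposition.transpose a b"])
        (use permutes_in_image[OF t] in auto)
    then show ?thesis unfolding f_def o_def sl ev by simp
  qed
  then have "slot_form k v J (x \<circ> Transposition.transpose a b) = alt_sum (Suc (2 * k)) (\<lambda>\<sigma>. f (\<sigma> \<circ> \<tau>))"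
    unfolding slot_form_def by simp
  also have "\<dots> = - slot_form k v J x"
    unfolding alt_sum_compose[OF \<tau>(1), of f] \<tau>(2) unfolding slot_form_def f_def by simp
  finally show ?thesis .
qed

lemma slot_form_repeat:
  assumes "a < Suc k" "b < Suc k" "a \<noteq> b" "x a = x b"
  shows "slot_form k v J x = 0"
proof -
  have "x \<circ> Transposition.transpose a b = x" using assms(4) by (auto simp: fun_eq_iff Transposition.transpose_def)
  then have "slot_form k v J x = - slot_form k v J x" using slot_form_swap[OF assms(1-3), of v J x] by simp
  then show ?thesis by (simp add: complex_eq_iff)
qed

lemma slot_form_expand:
  fixes x :: "nat \<Rightarrow> complex^'n::finite"
  assumes x: "\<And>l. l < Suc k \<Longrightarrow> x l = (\<Sum>j\<in>UNIV. c l j *s y l j)"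
  shows "slot_form k v J x = (\<Sum>f\<in>{..<Suc k} \<rightarrow>\<^sub>E (UNIV :: 'm::finite set). (\<Prod>l<Suc k. c l (f l)) * slot_form k v J (\<lambda>l. y l (f l)))"
proof -
  have d: "dotc (\<Sum>j\<in>UNIV. c l j *s y l j) u = (\<Sum>j\<in>UNIV. c l j * dotc (y l j) u)" for l u
    unfolding dotc_def by (simp add: sum_distrib_left sum_distrib_right mult.assoc) (rule sum.swap)
  have p: "(\<Prod>l<Suc k. dotc (x l) (w l)) = (\<Sum>f\<in>{..<Suc k} \<rightarrow>\<^sub>E (UNIV :: 'm set). (\<Prod>l<Suc k. c l (f l)) * (\<Prod>l<Suc k. dotc (y l (f l)) (w l)))" for w
  proof -
    have "(\<Prod>l<Suc k. dotc (x l) (w l)) = (\<Prod>l<Suc k. \<Sum>j\<in>UNIV. c l j * dotc (y l j) (w l))"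
      by (intro prod.cong refl) (simp add: x d del: prod.lessThan_Suc)
    also have "\<dots> = (\<Sum>f\<in>{..<Suc k} \<rightarrow>\<^sub>E (UNIV :: 'm set). \<Prod>l<Suc k. c l (f l) * dotc (y l (f l)) (w l))"
      by (rule prod_sum_PiE) auto
    finally show ?thesis by (simp only: prod.distrib)
  qed
  show ?thesis unfolding slot_form_def p alt_sum_cmult[symmetric] alt_sum_sum[symmetric]
    by (simp only: sum_distrib_right mult.assoc)
qed

text \<open>Every permutation is a product of transpositions, each of which changes the sign by \<open>slot_form_swap\<close>.\<close>

lemma slot_form_sign:
  fixes \<pi> :: "'n::finite \<Rightarrow> 'n" and J' :: "nat \<Rightarrow> 'n" and e :: "'n \<Rightarrow> complex^'n"
  assumes \<pi>: "\<pi> permutes UNIV" and J': "bij_betw J' {..<Suc k} UNIV"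
  shows "slot_form k v J (\<lambda>l. e (\<pi> (J' l))) = of_int (sign \<pi>) * slot_form k v J (\<lambda>l. e (J' l))"
  using \<pi> finite[of UNIV]
proof (induction rule: permutes_induct)
  case (swap a b \<pi>)
  have perm: "\<pi> permutes UNIV" and ab: "a \<noteq> b" using swap.hyps by auto
  have bij: "bij_betw (\<lambda>l. \<pi> (J' l)) {..<Suc k} UNIV"
    using bij_betw_trans[OF J' permutes_imp_bij[OF perm]] by (simp add: o_def)
  then obtain p q where pq: "p < Suc k" "\<pi> (J' p) = a" "q < Suc k" "\<pi> (J' q) = b"
    unfolding bij_betw_def by (metis (no_types, lifting) UNIV_I imageE lessThan_iff)
  have "p \<noteq> q" using pq ab by auto
  have inj: "\<pi> (J' l) = \<pi> (J' m) \<longleftrightarrow> l = m" if "l < Suc k" "m < Suc k" for l m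
    using bij that unfolding bij_betw_def inj_on_def by (metis lessThan_iff)
  have "slot_form k v J (\<lambda>l. e ((Transposition.transpose a b \<circ> \<pi>) (J' l))) = slot_form k v J ((\<lambda>l. e (\<pi> (J' l))) \<circ> Transposition.transpose p q)"
    by (rule slot_form_cong) (use pq inj in \<open>auto simp: Transposition.transpose_def\<close>)
  also have "\<dots> = - slot_form k v J (\<lambda>l. e (\<pi> (J' l)))" by (rule slot_form_swap[OF pq(1,3) \<open>p \<noteq> q\<close>])
  finally have 1: "slot_form k v J (\<lambda>l. e ((Transposition.transpose a b \<circ> \<pi>) (J' l))) = - slot_form k v J (\<lambda>l. e (\<pi> (J' l)))" .
  have "permutation \<pi>" using perm by (auto simp: permutation_permutes)
  then have sg: "sign (Transposition.transpose a b \<circ> \<pi>) = - sign \<pi>"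
    using ab by (simp only: sign_compose permutation_swap_id sign_swap_id) simp
  show ?case unfolding 1 swap.IH sg by simp
qed (simp add: sign_id)

text \<open>Expanding the columns in the standard basis leaves, by alternation, only the terms in which the chosen basis vectors are
  permuted; these sum up to the Leibniz formula.\<close>

lemma slot_form_det:
  fixes H :: "complex^'n^'n::finite"
  assumes J': "bij_betw J' {..<Suc k} UNIV"
  shows "slot_form k v J (\<lambda>l. column (J' l) H) = det H * slot_form k v J (\<lambda>l. axis (J' l) 1)"
proof -
  define P where "P = {..<Suc k} \<rightarrow>\<^sub>E (UNIV :: 'n set)"
  define T where "T f = (\<Prod>l<Suc k. H $ f l $ J' l) * slot_form k v J (\<lambda>l. axis (f l) 1)" for f
  define r where "r \<pi> = restrict (\<lambda>l. \<pi> (J' l)) {..<Suc k}" for \<pi> :: "'n \<Rightarrow> 'n"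
  have col: "column j H = (\<Sum>i\<in>UNIV. H $ i $ j *s axis i 1)" for j
    by (simp add: column_def vec_eq_iff axis_def if_distrib cong: if_cong)
  have "slot_form k v J (\<lambda>l. column (J' l) H) = (\<Sum>f\<in>P. T f)"
    unfolding P_def T_def by (rule slot_form_expand[where c = "\<lambda>l i. H $ i $ J' l" and y = "\<lambda>l i. axis i 1"]) (rule col)
  also have "\<dots> = (\<Sum>f\<in>r ` {\<pi>. \<pi> permutes UNIV}. T f)"
  proof (rule sum.mono_neutral_right)
    show "finite P" unfolding P_def by (intro finite_PiE) auto
    show "r ` {\<pi>. \<pi> permutes UNIV} \<subseteq> P" unfolding P_def r_def by (rule image_subsetI) simp
    show "\<forall>f\<in>P - r ` {\<pi>. \<pi> permutes UNIV}. T f = 0"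
    proof
      fix f assume f: "f \<in> P - r ` {\<pi>. \<pi> permutes UNIV}"
      have "\<not> inj_on f {..<Suc k}"
      proof
        assume inj: "inj_on f {..<Suc k}"
        define \<pi> where "\<pi> = f \<circ> inv_into {..<Suc k} J'"
        have b: "bij_betw (inv_into {..<Suc k} J') UNIV {..<Suc k}" by (rule bij_betw_inv_into[OF J'])
        have "inj \<pi>" unfolding \<pi>_def by (rule comp_inj_on) (use b inj in \<open>auto simp: bij_betw_def\<close>)
        then have "bij \<pi>" by (simp add: bij_def finite_UNIV_inj_surj)
        then have perm: "\<pi> permutes UNIV" by (simp add: permutes_def bij_iff)
        have "r \<pi> = f"
        proof
          fix l
          show "r \<pi> l = f l"
            using f J' bij_betw_inv_into_left[OF J', of l] unfolding r_def \<pi>_def P_def PiE_def extensional_def by auto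
        qed
        then show False using f perm by blast
      qed
      then obtain a b where "a < Suc k" "b < Suc k" "a \<noteq> b" "f a = f b" unfolding inj_on_def by auto
      then have "slot_form k v J (\<lambda>l. axis (f l) 1) = 0" by (intro slot_form_repeat[of a k b]) auto
      then show "T f = 0" unfolding T_def by simp
    qed
  qed
  also have "\<dots> = (\<Sum>\<pi> | \<pi> permutes UNIV. T (r \<pi>))"
  proof (rule sum.reindex_cong[OF _ refl refl])
    show "inj_on r {\<pi>. \<pi> permutes UNIV}"
    proof (rule inj_onI)
      fix \<pi> \<rho> assume eq: "r \<pi> = r \<rho>"
      show "\<pi> = \<rho>"
      proof
        fix i
        obtain l where "l < Suc k" "i = J' l" using J' unfolding bij_betw_def by (metis UNIV_I imageE lessThan_iff)
        then show "\<pi> i = \<rho> i" using fun_cong[OF eq, of l] by (simp add: r_def)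
      qed
    qed
  qed
  also have "\<dots> = (\<Sum>\<pi> | \<pi> permutes UNIV. of_int (sign \<pi>) * (\<Prod>i\<in>UNIV. transpose H $ i $ \<pi> i) * slot_form k v J (\<lambda>l. axis (J' l) 1))"
  proof (intro sum.cong refl)
    fix \<pi> :: "'n \<Rightarrow> 'n" assume "\<pi> \<in> {\<pi>. \<pi> permutes UNIV}"
    then have \<pi>: "\<pi> permutes UNIV" by simp
    have "slot_form k v J (\<lambda>l. axis (r \<pi> l) 1) = slot_form k v J (\<lambda>l. axis (\<pi> (J' l)) 1)"
      by (rule slot_form_cong) (simp add: r_def)
    also have "\<dots> = of_int (sign \<pi>) * slot_form k v J (\<lambda>l. axis (J' l) 1)"
      by (rule slot_form_sign[OF \<pi> J', where e = "\<lambda>i. axis i 1"])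
    finally have 1: "slot_form k v J (\<lambda>l. axis (r \<pi> l) 1) = of_int (sign \<pi>) * slot_form k v J (\<lambda>l. axis (J' l) 1)" .
    have "(\<Prod>l<Suc k. H $ r \<pi> l $ J' l) = (\<Prod>l\<in>{..<Suc k}. H $ \<pi> (J' l) $ J' l)"
      by (rule prod.cong) (auto simp: r_def)
    also have "\<dots> = (\<Prod>i\<in>UNIV. H $ \<pi> i $ i)" by (rule prod.reindex_bij_betw[OF J', of "\<lambda>i. H $ \<pi> i $ i"])
    finally show "T (r \<pi>) = of_int (sign \<pi>) * (\<Prod>i\<in>UNIV. transpose H $ i $ \<pi> i) * slot_form k v J (\<lambda>l. axis (J' l) 1)"
      unfolding T_def 1 by (simp add: transpose_def mult_ac)
  qed
  also have "\<dots> = det (transpose H) * slot_form k v J (\<lambda>l. axis (J' l) 1)"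
    unfolding det_def sum_distrib_right ..
  finally show ?thesis by simp
qed

text \<open>By alternation the value is 0 unless \<open>J\<close> enumerates all indices but one, say \<open>q\<close>.  In that case \<open>axis p 1\<close> is a combination of the
  columns of \<open>H\<close>, in which only the column \<open>q\<close>, with coefficient \<open>herm_inv H p q\<close>, is not already present in another slot; the
  columns together give the determinant.\<close>

lemma slot_form_cofactor:
  fixes v :: "nat \<Rightarrow> complex^'n::finite"
  assumes n: "CARD('n) = Suc k"
  shows "\<exists>C q. \<forall>H. det H \<noteq> 0 \<longrightarrow> (\<forall>p. slot_form k v J (\<lambda>l. if l = 0 then axis p 1 else column (J (l - 1)) H)
      = C * (det H * herm_inv H p q))"
proof (cases "inj_on J {..<k}")
  case False
  then obtain a b where ab: "a < k" "b < k" "a \<noteq> b" "J a = J b" unfolding inj_on_def by auto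
  have "slot_form k v J (\<lambda>l. if l = 0 then axis p 1 else column (J (l - 1)) H) = 0" for p H
    by (rule slot_form_repeat[of "Suc a" k "Suc b"]) (use ab in auto)
  then show ?thesis by (intro exI[of _ 0]) simp
next
  case True
  have "card (J ` {..<k}) = k" using True by (simp add: card_image)
  then have "J ` {..<k} \<noteq> UNIV" using n by (metis n_not_Suc_n)
  then obtain q where q: "q \<notin> J ` {..<k}" by blast
  define J' where "J' l = (if l = 0 then q else J (l - 1))" for l
  have inj: "inj_on J' {..<Suc k}"
    using True q unfolding inj_on_def J'_def by (auto simp: image_iff) (metis One_nat_def Suc_less_SucD Suc_pred lessThan_iff less_Suc_eq_0_disj)+
  have "J' ` {..<Suc k} = UNIV"
    by (rule card_subset_eq) (use inj n in \<open>auto simp: card_image\<close>)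
  then have J': "bij_betw J' {..<Suc k} UNIV" using inj by (simp add: bij_betw_def)
  have "slot_form k v J (\<lambda>l. if l = 0 then axis p 1 else column (J (l - 1)) H)
      = slot_form k v J (\<lambda>l. axis (J' l) 1) * (det H * herm_inv H p q)" if d: "det H \<noteq> 0" for H p
  proof -
    define y where "y l j = (if l = 0 then column j H else column (J (l - 1)) H)" for l :: nat and j
    define c where "c l j = (if l = 0 then herm_inv H p j else if j = q then 1 else 0)" for l :: nat and j
    have "axis p 1 = (\<Sum>j\<in>UNIV. herm_inv H p j *s column j H)"
      using herm_inv_right[OF d, of p] by (simp add: vec_eq_iff column_def axis_def eq_commute)
    then have x: "(if l = 0 then axis p 1 else column (J (l - 1)) H) = (\<Sum>j\<in>UNIV. c l j *s y l j)" for l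
      by (simp add: c_def y_def vec_eq_iff if_distrib[of "\<lambda>x. x * _"] cong: if_cong)
    \<comment> \<open>the only index family that contributes; in the slots other than 0 the expansion is trivial, with the dummy index \<open>q\<close>\<close>
    define f0 where "f0 = restrict (\<lambda>l. q) {..<Suc k}"
    have "slot_form k v J (\<lambda>l. if l = 0 then axis p 1 else column (J (l - 1)) H)
        = (\<Sum>f\<in>{..<Suc k} \<rightarrow>\<^sub>E UNIV. (\<Prod>l<Suc k. c l (f l)) * slot_form k v J (\<lambda>l. y l (f l)))"
      by (rule slot_form_expand) (rule x)
    also have "\<dots> = (\<Sum>f\<in>{f0}. (\<Prod>l<Suc k. c l (f l)) * slot_form k v J (\<lambda>l. y l (f l)))"
    proof (rule sum.mono_neutral_right)
      show "finite ({..<Suc k} \<rightarrow>\<^sub>E (UNIV :: 'n set))" by (intro finite_PiE) auto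
      show "{f0} \<subseteq> {..<Suc k} \<rightarrow>\<^sub>E UNIV" unfolding f0_def by auto
      show "\<forall>f\<in>({..<Suc k} \<rightarrow>\<^sub>E UNIV) - {f0}. (\<Prod>l<Suc k. c l (f l)) * slot_form k v J (\<lambda>l. y l (f l)) = 0"
      proof
        fix f assume f: "f \<in> ({..<Suc k} \<rightarrow>\<^sub>E UNIV) - {f0}"
        show "(\<Prod>l<Suc k. c l (f l)) * slot_form k v J (\<lambda>l. y l (f l)) = 0"
        proof (cases "\<exists>l. 0 < l \<and> l < Suc k \<and> f l \<noteq> q")
          case True
          then obtain l where l: "0 < l" "l < Suc k" "f l \<noteq> q" by blast
          have "c l (f l) = 0" using l by (simp add: c_def)
          then have "(\<Prod>l<Suc k. c l (f l)) = 0" using l by (intro prod_zero) auto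
          then show ?thesis by simp
        next
          case False
          have "f 0 \<noteq> q"
          proof
            assume "f 0 = q"
            have "f = f0"
            proof
              fix l
              show "f l = f0 l" using f False \<open>f 0 = q\<close> unfolding f0_def PiE_def extensional_def by (cases "l = 0") auto
            qed
            then show False using f by simp
          qed
          have "f 0 \<in> J' ` {..<Suc k}" using \<open>J' ` {..<Suc k} = UNIV\<close> by simp
          then obtain l where l: "l < Suc k" "f 0 = J' l" by auto
          then obtain a where a: "a < k" "f 0 = J a" using \<open>f 0 \<noteq> q\<close> by (cases l) (auto simp: J'_def)
          have "slot_form k v J (\<lambda>l. y l (f l)) = 0"
            by (rule slot_form_repeat[of 0 k "Suc a"]) (use a in \<open>auto simp: y_def\<close>)
          then show ?thesis by simp
        qed
      qed
    qed
    also have "\<dots> = herm_inv H p q * slot_form k v J (\<lambda>l. column (J' l) H)"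
    proof -
      have "(\<Prod>l<Suc k. c l (f0 l)) = c 0 (f0 0) * (\<Prod>l<k. c (Suc l) (f0 (Suc l)))" by (rule prod.lessThan_Suc_shift)
      also have "\<dots> = herm_inv H p q" by (simp add: c_def f0_def)
      finally have 1: "(\<Prod>l<Suc k. c l (f0 l)) = herm_inv H p q" .
      have "slot_form k v J (\<lambda>l. y l (f0 l)) = slot_form k v J (\<lambda>l. column (J' l) H)"
        by (rule slot_form_cong) (auto simp: y_def f0_def J'_def)
      then show ?thesis using 1 by simp
    qed
    also have "\<dots> = slot_form k v J (\<lambda>l. axis (J' l) 1) * (det H * herm_inv H p q)"
      unfolding slot_form_det[OF J'] by (simp add: mult_ac)
    finally show ?thesis .
  qed
  then show ?thesis by blast
qed

context local_metric
begin

lemma pairing_prod_Ck: "Ck_on r (\<lambda>y. \<Prod>l<k. pairing (h y) (a l) (b l)) U"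
  unfolding pairing_def by (intro Ck_on_prod Ck_on_sum Ck_on_mult Ck_on_const U h_Ck)

lemma pairing_prod_expand:
  fixes k :: nat
  shows "(\<Prod>l<k. pairing H (a l) (b l)) = (\<Sum>J\<in>{..<k} \<rightarrow>\<^sub>E (UNIV :: 'n set).
     (\<Prod>l<k. dotc (column (J l) H) (a l)) * (\<Prod>l<k. cnj (b l $ J l)))"
proof -
  have "pairing H u w = (\<Sum>j\<in>UNIV. dotc (column j H) u * cnj (w $ j))" for u w
    unfolding pairing_def dotc_def column_def by (subst sum.swap) (simp add: sum_distrib_right)
  then have "(\<Prod>l<k. pairing H (a l) (b l)) = (\<Prod>l<k. \<Sum>j\<in>UNIV. dotc (column j H) (a l) * cnj (b l $ j))" by simp
  also have "\<dots> = (\<Sum>J\<in>{..<k} \<rightarrow>\<^sub>E (UNIV :: 'n set). \<Prod>l<k. dotc (column (J l) H) (a l) * cnj (b l $ J l))"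
    by (rule prod_sum_PiE) auto
  finally show ?thesis by (simp only: prod.distrib)
qed

text \<open>The \<open>(n, n - 1)\<close>-part of \<open>d (\<omega>\<^sup>n\<^sup>-\<^sup>1)\<close> vanishes: expanding each factor \<open>\<omega>\<close> in its conjugate linear argument turns its
  coefficients into linear combinations of the cofactors \<open>det h h\<^sup>p\<^sup>q\<close> with constant coefficients and a single \<open>q\<close> in each
  term.\<close>

lemma dz_part_zero:
  fixes v :: "nat \<Rightarrow> complex^'n"
  assumes n: "CARD('n) = Suc k" and z: "z \<in> U"
    and div: "\<And>q. (\<Sum>p\<in>UNIV. dz p (\<lambda>y. det (h y) * Q p q y) z) = 0"
  shows "alt_sum (Suc (2 * k)) (\<lambda>\<sigma>. \<Sum>p\<in>UNIV. v (\<sigma> 0) $ p *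
      dz p (\<lambda>y. \<Prod>l<k. pairing (h y) (v (\<sigma> (Suc (2 * l)))) (v (\<sigma> (Suc (2 * l + 1))))) z) = 0"
proof -
  define F where "F \<sigma> y = (\<Prod>l<k. pairing (h y) (v (\<sigma> (Suc (2 * l)))) (v (\<sigma> (Suc (2 * l + 1)))))" for \<sigma> y
  define PJ where "PJ = {..<k} \<rightarrow>\<^sub>E (UNIV :: 'n set)"
  define x where "x J p y l = (if l = 0 then axis p 1 else column (J (l - 1)) (h y))" for J :: "nat \<Rightarrow> 'n" and p y and l :: nat
  have Fd: "F \<sigma> differentiable (at z)" for \<sigma>
    unfolding F_def using differentiable_all[OF pairing_prod_Ck z] .
  have vFd: "(\<lambda>y. c * F \<sigma> y) differentiable (at z)" for c \<sigma> by (intro differentiable_mult Fd) simp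
  have expand: "alt_sum (Suc (2 * k)) (\<lambda>\<sigma>. v (\<sigma> 0) $ p * F \<sigma> y) = (\<Sum>J\<in>PJ. slot_form k v J (x J p y))" for p y
  proof -
    have "v (\<sigma> 0) $ p * F \<sigma> y = (\<Sum>J\<in>PJ. (\<Prod>l<Suc k. dotc (x J p y l) (v (\<sigma> (slot l)))) * (\<Prod>l<k. cnj (v (\<sigma> (2 * l + 2)) $ J l)))" for \<sigma>
    proof -
      have "(\<Prod>l<Suc k. dotc (x J p y l) (v (\<sigma> (slot l))))
          = dotc (x J p y 0) (v (\<sigma> (slot 0))) * (\<Prod>l<k. dotc (x J p y (Suc l)) (v (\<sigma> (slot (Suc l)))))" for J
        by (rule prod.lessThan_Suc_shift)
      moreover have "dotc (x J p y 0) (v (\<sigma> (slot 0))) = v (\<sigma> 0) $ p" for J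
        by (simp add: x_def slot_def dotc_def axis_def if_distrib[of "\<lambda>x. x * _"] cong: if_cong)
      moreover have "slot (Suc l) = Suc (2 * l)" for l by (simp add: slot_def)
      ultimately show ?thesis unfolding F_def PJ_def pairing_prod_expand
        by (simp add: x_def sum_distrib_left mult.assoc)
    qed
    then show ?thesis unfolding slot_form_def alt_sum_sum[symmetric] by simp
  qed
  have "\<forall>J. \<exists>C q. \<forall>H. det H \<noteq> 0 \<longrightarrow> (\<forall>p. slot_form k v J (\<lambda>l. if l = 0 then axis p 1 else column (J (l - 1)) H) = C * (det H * herm_inv H p q))"
    using slot_form_cofactor[OF n] by blast
  then have "\<exists>C q. \<forall>J H. det H \<noteq> 0 \<longrightarrow> (\<forall>p. slot_form k v J (\<lambda>l. if l = 0 then axis p 1 else column (J (l - 1)) H) = C J * (det H * herm_inv H p (q J)))"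
    unfolding choice_iff by blast
  then obtain C q where C: "\<And>J H p. det H \<noteq> 0 \<Longrightarrow> slot_form k v J (\<lambda>l. if l = 0 then axis p 1 else column (J (l - 1)) H) = C J * (det H * herm_inv H p (q J))"
    by blast
  have cof: "slot_form k v J (x J p y) = C J * (det (h y) * Q p (q J) y)" if "y \<in> U" for J p y
    unfolding x_def Q_def by (rule C[OF pos_hermitian_det[OF h_pos[OF that]]])
  have Dd: "(\<lambda>y. det (h y) * Q p q y) differentiable (at z)" for p q
    by (intro differentiable_mult Q_diff z differentiable_all[OF Ck_on_det[OF U h_Ck]])
  have CDd: "(\<lambda>y. c * (det (h y) * Q p q y)) differentiable (at z)" for c p q by (intro differentiable_mult Dd) simp
  have "alt_sum (Suc (2 * k)) (\<lambda>\<sigma>. \<Sum>p\<in>UNIV. v (\<sigma> 0) $ p * dz p (F \<sigma>) z)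
      = (\<Sum>p\<in>UNIV. alt_sum (Suc (2 * k)) (\<lambda>\<sigma>. v (\<sigma> 0) $ p * dz p (F \<sigma>) z))" by (rule alt_sum_sum)
  also have "\<dots> = (\<Sum>p\<in>UNIV. dz p (\<lambda>y. alt_sum (Suc (2 * k)) (\<lambda>\<sigma>. v (\<sigma> 0) $ p * F \<sigma> y)) z)"
    unfolding alt_sum_def using Fd vFd by (simp add: dz_sum dz_cmult differentiable_mult)
  also have "\<dots> = (\<Sum>p\<in>UNIV. dz p (\<lambda>y. \<Sum>J\<in>PJ. C J * (det (h y) * Q p (q J) y)) z)"
    unfolding expand by (intro sum.cong refl dz_cong_open[OF U z] cof)
  also have "\<dots> = (\<Sum>p\<in>UNIV. \<Sum>J\<in>PJ. C J * dz p (\<lambda>y. det (h y) * Q p (q J) y) z)"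
    using CDd Dd by (simp add: dz_sum dz_cmult)
  also have "\<dots> = (\<Sum>J\<in>PJ. C J * (\<Sum>p\<in>UNIV. dz p (\<lambda>y. det (h y) * Q p (q J) y) z))"
    unfolding sum_distrib_left by (rule sum.swap)
  also have "\<dots> = 0" unfolding div by simp
  finally show ?thesis unfolding F_def[abs_def] .
qed

text \<open>The involution that exchanges the two arguments of each factor of \<open>\<omega>\<^sup>k\<close> and fixes the direction of differentiation.\<close>

definition flip_pairs :: "nat \<Rightarrow> nat \<Rightarrow> nat" where
  "flip_pairs k i = (if i = 0 \<or> i > 2 * k then i else if odd i then Suc i else i - 1)"

lemma flip_pairs_permutes: "flip_pairs k permutes {..<Suc (2 * k)}"
proof -
  have inv: "flip_pairs k (flip_pairs k i) = i" for i unfolding flip_pairs_def by auto presburger+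
  have "flip_pairs k i < Suc (2 * k)" if "i < Suc (2 * k)" for i using that unfolding flip_pairs_def by auto presburger
  then have "bij_betw (flip_pairs k) {..<Suc (2 * k)} {..<Suc (2 * k)}"
    by (intro bij_betw_byWitness[where f' = "flip_pairs k"]) (auto simp: inv)
  then show ?thesis by (rule bij_imp_permutes) (auto simp: flip_pairs_def)
qed

text \<open>The derivative splits into its \<open>\<partial>\<close>- and \<open>\<partial>bar\<close>-parts.  The first one vanishes by \<open>dz_part_zero\<close>.  The second one is the conjugate of the
  first up to sign, because exchanging the two arguments of a hermitian form conjugates its value.\<close>

theorem closed_power_of_divergence_free:
  fixes v :: "nat \<Rightarrow> complex^'n"
  assumes n: "CARD('n) = Suc k" and z: "z \<in> U"
    and div: "\<And>q. (\<Sum>p\<in>UNIV. dz p (\<lambda>y. det (h y) * Q p q y) z) = 0"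
  shows "ext_deriv (2 * k) (two_form_power (form11 h) k) z v = 0"
proof -
  define F where "F \<iota> y = (\<Prod>l<k. pairing (h y) (v (\<iota> (2 * l))) (v (\<iota> (2 * l + 1))))" for \<iota> :: "nat \<Rightarrow> nat" and y
  define s where "s i j = (if j < i then j else Suc j)" for i j :: nat
  have Fd: "F \<iota> differentiable (at z)" for \<iota>
    unfolding F_def using differentiable_all[OF pairing_prod_Ck z] .
  note FD = differentiable_frechet[OF Fd]
  obtain c where c: "\<And>h z v. two_form_power (form11 h :: (complex^'n) form) k z v
      = c * alt_sum (2 * k) (\<lambda>\<sigma>. \<Prod>l<k. pairing (h z) (v (\<sigma> (2 * l))) (v (\<sigma> (2 * l + 1))))"
    using two_form_power_expand[of k] by blast
  have fr: "frechet_derivative (\<lambda>y. two_form_power (form11 h) k y (\<lambda>j. if j < i then v j else v (Suc j))) (at z) (v i)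
      = c * alt_sum (2 * k) (\<lambda>\<tau>. frechet_derivative (F (\<lambda>l. s i (\<tau> l))) (at z) (v i))" for i
  proof -
    have "(\<lambda>j. if j < i then v j else v (Suc j)) = (\<lambda>j. v (s i j))" by (auto simp: s_def)
    then have E: "(\<lambda>y. two_form_power (form11 h) k y (\<lambda>j. if j < i then v j else v (Suc j)))
        = (\<lambda>y. c * (\<Sum>\<tau> | \<tau> permutes {..<2 * k}. of_int (sign \<tau>) * F (\<lambda>l. s i (\<tau> l)) y))"
      by (simp only: c F_def alt_sum_def)
    have D: "((\<lambda>y. c * (\<Sum>\<tau> | \<tau> permutes {..<2 * k}. of_int (sign \<tau>) * F (\<lambda>l. s i (\<tau> l)) y)) has_derivative
       (\<lambda>w. c * (\<Sum>\<tau> | \<tau> permutes {..<2 * k}. of_int (sign \<tau>) * frechet_derivative (F (\<lambda>l. s i (\<tau> l))) (at z) w))) (at z)"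
      by (intro has_derivative_mult_right has_derivative_sum FD)
    show ?thesis unfolding E alt_sum_def by (rule frechet_derivative_eqI[OF D])
  qed
  have "ext_deriv (2 * k) (two_form_power (form11 h) k) z v
      = c * (\<Sum>i\<le>2 * k. (-1) ^ i * alt_sum (2 * k) (\<lambda>\<tau>. frechet_derivative (F (\<lambda>l. s i (\<tau> l))) (at z) (v i)))"
    unfolding ext_deriv_def fr by (simp add: sum_distrib_left mult_ac)
  also have "\<dots> = c * alt_sum (Suc (2 * k)) (\<lambda>\<sigma>. frechet_derivative (F (\<lambda>l. \<sigma> (Suc l))) (at z) (v (\<sigma> 0)))"
    unfolding s_def alt_sum_expand_first[of "2 * k" "\<lambda>i \<iota>. frechet_derivative (F \<iota>) (at z) (v i)"] ..
  also have "alt_sum (Suc (2 * k)) (\<lambda>\<sigma>. frechet_derivative (F (\<lambda>l. \<sigma> (Suc l))) (at z) (v (\<sigma> 0)))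
     = alt_sum (Suc (2 * k)) (\<lambda>\<sigma>. \<Sum>p\<in>UNIV. v (\<sigma> 0) $ p * dz p (F (\<lambda>l. \<sigma> (Suc l))) z)
     + alt_sum (Suc (2 * k)) (\<lambda>\<sigma>. \<Sum>p\<in>UNIV. cnj (v (\<sigma> 0) $ p) * dzbar p (F (\<lambda>l. \<sigma> (Suc l))) z)"
    unfolding has_derivative_wirtinger[OF FD] sum.distrib alt_sum_add by (simp add: mult.commute)
  also have "alt_sum (Suc (2 * k)) (\<lambda>\<sigma>. \<Sum>p\<in>UNIV. v (\<sigma> 0) $ p * dz p (F (\<lambda>l. \<sigma> (Suc l))) z) = 0"
    unfolding F_def[abs_def] by (rule dz_part_zero[OF n z div])
  also have "alt_sum (Suc (2 * k)) (\<lambda>\<sigma>. \<Sum>p\<in>UNIV. cnj (v (\<sigma> 0) $ p) * dzbar p (F (\<lambda>l. \<sigma> (Suc l))) z) = 0"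
  proof -
    define f where "f \<sigma> = (\<Sum>p\<in>UNIV. v (\<sigma> 0) $ p * dz p (F (\<lambda>l. \<sigma> (Suc l))) z)" for \<sigma> :: "nat \<Rightarrow> nat"
    have "(\<Sum>p\<in>UNIV. cnj (v (\<sigma> 0) $ p) * dzbar p (F (\<lambda>l. \<sigma> (Suc l))) z) = cnj (f (\<sigma> \<circ> flip_pairs k))" for \<sigma>
    proof -
      have fp: "flip_pairs k 0 = 0" by (simp add: flip_pairs_def)
      have "dzbar p (F (\<lambda>l. \<sigma> (Suc l))) z = cnj (dz p (F (\<lambda>l. (\<sigma> \<circ> flip_pairs k) (Suc l))) z)" for p
      proof -
        have "cnj (F (\<lambda>l. (\<sigma> \<circ> flip_pairs k) (Suc l)) y) = F (\<lambda>l. \<sigma> (Suc l)) y" if y: "y \<in> U" for y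
        proof -
          have sw: "cnj (pairing (h y) a b) = pairing (h y) b a" for a b
            unfolding pairing_def by (simp add: h_cnj[OF y] mult_ac) (rule sum.swap)
          have "flip_pairs k (Suc (2 * l)) = Suc (2 * l + 1)" "flip_pairs k (Suc (2 * l + 1)) = Suc (2 * l)" if "l < k" for l
            using that by (auto simp: flip_pairs_def)
          then show ?thesis unfolding F_def cnj_prod sw by (intro prod.cong refl) simp
        qed
        then have "dzbar p (F (\<lambda>l. \<sigma> (Suc l))) z = dzbar p (\<lambda>y. cnj (F (\<lambda>l. (\<sigma> \<circ> flip_pairs k) (Suc l)) y)) z"
          by (intro dzbar_cong_open[OF U z]) simp
        then show ?thesis by (simp only: dzbar_cnj[OF Fd])
      qed
      then show ?thesis unfolding f_def by (simp add: fp)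
    qed
    then have "alt_sum (Suc (2 * k)) (\<lambda>\<sigma>. \<Sum>p\<in>UNIV. cnj (v (\<sigma> 0) $ p) * dzbar p (F (\<lambda>l. \<sigma> (Suc l))) z)
        = cnj (alt_sum (Suc (2 * k)) (\<lambda>\<sigma>. f (\<sigma> \<circ> flip_pairs k)))"
      unfolding alt_sum_def by simp
    also have "\<dots> = cnj (of_int (sign (flip_pairs k)) * alt_sum (Suc (2 * k)) f)"
      unfolding alt_sum_compose[OF flip_pairs_permutes, where f = f] ..
    also have "alt_sum (Suc (2 * k)) f = 0"
      unfolding f_def F_def[abs_def] by (rule dz_part_zero[OF n z div])
    finally show ?thesis by simp
  qed
  finally show ?thesis by simp
qed

end

section \<open>Consequences of a pluricanonical section without zeros\<close>

lemma holomorphic_Cn_compose_field: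
  fixes f :: "complex^'n::finite \<Rightarrow> complex"
  assumes f: "holomorphic_Cn_on f S"
    and \<phi>: "\<And>z. z \<in> S \<Longrightarrow> (\<phi> has_field_derivative \<phi>' (f z)) (at (f z))"
  shows "holomorphic_Cn_on (\<lambda>z. \<phi> (f z)) S"
  unfolding holomorphic_Cn_on_def
proof
  fix z assume z: "z \<in> S"
  note D = holomorphic_Cn_has_derivative[OF f z]
  have "((\<lambda>z. \<phi> (f z)) has_derivative (\<lambda>v. \<phi>' (f z) * frechet_derivative f (at z) v)) (at z)"
    using has_derivative_compose[OF D(1) \<phi>[OF z, unfolded has_field_derivative_def]] .
  moreover have "\<forall>c v. \<phi>' (f z) * frechet_derivative f (at z) (c *s v) = c * (\<phi>' (f z) * frechet_derivative f (at z) v)"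
    by (simp add: D(2) mult.left_commute)
  ultimately show "\<exists>D. ((\<lambda>z. \<phi> (f z)) has_derivative D) (at z) \<and> (\<forall>c v. D (c *s v) = c * D v)"
    by (intro exI conjI)
qed

lemma Ck_on_exp:
  fixes f :: "'v::euclidean_space \<Rightarrow> real"
  assumes "open S" "Ck_on k f S"
  shows "Ck_on k (\<lambda>x. exp (f x)) S"
  by (rule Ck_on_field_compose[OF assms, where T = UNIV and \<phi> = "\<lambda>_. exp"])
    (auto intro: DERIV_exp continuous_on_exp)

lemma pos_hermitian_scale:
  assumes M: "pos_hermitian M" and c: "c > 0"
  shows "pos_hermitian (\<chi> i j. complex_of_real c * M $ i $ j)"
  unfolding pos_hermitian_def
proof (intro conjI allI impI)
  note M = M[unfolded pos_hermitian_def]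
  fix i j
  have "cnj (M $ i $ j) = M $ j $ i" by (rule conjunct1[OF M, rule_format, symmetric])
  then show "(\<chi> i j. complex_of_real c * M $ i $ j) $ j $ i = cnj ((\<chi> i j. complex_of_real c * M $ i $ j) $ i $ j)"
    by (simp only: vec_lambda_beta complex_cnj_mult complex_cnj_complex_of_real)
next
  note M = M[unfolded pos_hermitian_def]
  fix v :: "complex^'a" assume "v \<noteq> 0"
  then have "0 < Re (\<Sum>i\<in>UNIV. \<Sum>j\<in>UNIV. M $ i $ j * v $ i * cnj (v $ j))" by (rule conjunct2[OF M, rule_format])
  moreover have "(\<Sum>i\<in>UNIV. \<Sum>j\<in>UNIV. complex_of_real c * M $ i $ j * v $ i * cnj (v $ j))
      = of_real c * (\<Sum>i\<in>UNIV. \<Sum>j\<in>UNIV. M $ i $ j * v $ i * cnj (v $ j))"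
    by (simp add: sum_distrib_left mult.assoc)
  ultimately show "0 < Re (\<Sum>i\<in>UNIV. \<Sum>j\<in>UNIV. (\<chi> i j. complex_of_real c * M $ i $ j) $ i $ j * v $ i * cnj (v $ j))"
    using c by simp
qed

lemma det_scale: "det (\<chi> i j. c * M $ i $ j) = c ^ CARD('n) * det M"
  for M :: "complex^'n^'n::finite"
proof -
  have "(\<chi> i j. c * M $ i $ j) = (\<chi> i. c *s M $ i)" by (simp add: vec_eq_iff)
  then show ?thesis using det_rows_mul[of "\<lambda>_. c" "\<lambda>i. M $ i"] by simp
qed

lemma herm_inv_scale:
  fixes M :: "complex^'n^'n::finite"
  assumes "det M \<noteq> 0" "c \<noteq> 0"
  shows "herm_inv (\<chi> i j. c * M $ i $ j) k l = herm_inv M k l / c"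
proof -
  have "matrix_inv (transpose (\<chi> i j. c * M $ i $ j)) = (\<chi> k l. herm_inv M k l / c)"
  proof (rule matrix_inv_eqI)
    have "(\<Sum>l\<in>UNIV. herm_inv M k l / c * (c * M $ j $ l)) = (if k = j then 1 else 0)" for k j
      using herm_inv_right[OF assms(1), of k j] assms(2) by (auto simp: field_simps)
    then show "(\<chi> k l. herm_inv M k l / c) ** transpose (\<chi> i j. c * M $ i $ j) = mat 1"
      by (simp add: matrix_matrix_mult_def transpose_def mat_def vec_eq_iff)
  qed
  then show ?thesis by (simp add: herm_inv_def)
qed

context ricci_flat_manifold
begin

subsection \<open>The Kodaira dimension\<close>

text \<open>If \<open>s\<close> has no zero, subtracting a suitable multiple of \<open>s\<close> from another section produces a zero, and hence the zero section.\<close>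

lemma h0_pluricanonical:
  assumes m: "m > 0"
  shows "h0 A (tensor_power canonical_bundle m)
    = (if \<exists>s\<in>sections A (tensor_power canonical_bundle m). s \<noteq> (\<lambda>c p. 0) then 1 else 0)"
proof -
  interpret vs: vector_space "scale_family :: complex \<Rightarrow> (('a, 'n) chart \<Rightarrow> 'a \<Rightarrow> complex) \<Rightarrow> _"
    by (rule vector_space_scale_family)
  define V where "V = sections A (tensor_power canonical_bundle m)"
  have sub: "vs.subspace V" unfolding V_def by (rule subspace_sections)
  have zero: "(0 :: ('a, 'n) chart \<Rightarrow> 'a \<Rightarrow> complex) = (\<lambda>c p. 0)" by (simp add: fun_eq_iff)
  show ?thesis
  proof (cases "\<exists>s\<in>V. s \<noteq> (\<lambda>c p. 0)")
    case True
    then obtain s where s: "s \<in> V" "s \<noteq> (\<lambda>c p. 0)" by blast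
    obtain p0 where p0: "p0 \<in> topspace X" using nonempty by blast
    then obtain c0 where c0: "c0 \<in> A" "p0 \<in> dom_of c0" using cover by blast
    have nz: "s c0 p0 \<noteq> 0" using section_dichotomy[OF s(1)[unfolded V_def] m] s(2) c0 by blast
    have "t \<in> vs.span {s}" if t: "t \<in> V" for t
    proof -
      define k where "k = t c0 p0 / s c0 p0"
      have mem: "t - scale_family k s \<in> V" using vs.subspace_diff[OF sub t vs.subspace_scale[OF sub s(1)]] .
      have "(t - scale_family k s) c0 p0 = 0" using nz by (simp add: k_def scale_family_def)
      then have "t - scale_family k s = (\<lambda>c p. 0)"
        using section_dichotomy[OF mem[unfolded V_def] m] c0 by blast
      then have "t = scale_family k s" unfolding zero[symmetric] by (rule eq_iff_diff_eq_0[THEN iffD2])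
      then show ?thesis by (auto simp: vs.span_singleton)
    qed
    then have "vs.dim V = 1"
      by (intro vs.dim_unique[of "{s}"]) (use s zero in auto)
    then show ?thesis using True unfolding h0_def V_def by simp
  next
    case False
    then have "V \<subseteq> vs.span {}" unfolding vs.span_empty zero by blast
    then have "vs.dim V = 0" by (intro vs.dim_unique[of "{}"]) (auto simp: vs.independent_empty)
    then show ?thesis using False unfolding h0_def V_def by simp
  qed
qed

lemma section_power:
  assumes s: "s \<in> sections A (tensor_power canonical_bundle m)" and k: "k > 0"
  shows "(\<lambda>c p. s c p ^ k) \<in> sections A (tensor_power canonical_bundle (m * k))"
proof -
  have hol: "holomorphic_Cn_on (\<lambda>z. local_section s c z ^ k) (img_of c)" if "c \<in> A" for c
    by (rule holomorphic_Cn_compose_field[OF section_holomorphic[OF s that], where \<phi>' = "\<lambda>x. of_nat k * x ^ (k - 1)"])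
      (auto intro!: derivative_eq_intros)
  show ?thesis unfolding sections_def mem_Collect_eq holomorphic_in_chart_def tensor_power_def canonical_bundle_def
  proof (intro conjI ballI allI impI)
    show "holomorphic_Cn_on (\<lambda>z. s c (chart_inv c z) ^ k) (img_of c)" if "c \<in> A" for c
      using hol[OF that] unfolding local_section_def .
    show "s c p ^ k = det (jac c d p) ^ (m * k) * s d p ^ k" if "c \<in> A" "d \<in> A" "p \<in> dom_of c \<inter> dom_of d" for c d p
      unfolding section_change[OF s that] by (simp add: power_mult_distrib power_mult)
    show "s c p ^ k = 0" if "c \<notin> A \<or> p \<notin> dom_of c" for c p
      using section_default[OF s that] k by simp
  qed
qed

text \<open>All plurigenera are 0 or 1, so the terms of the upper limit are \<open>-\<infinity>\<close> or 0.  The powers of one nonzero section of \<open>K\<^sup>m\<close> give infinitely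
  many terms equal to 0.\<close>

lemma kodaira_dim_cases:
  "kodaira_dim A = - \<infinity> \<or>
   kodaira_dim A = 0 \<and> (\<exists>m>0. \<exists>s\<in>sections A (tensor_power canonical_bundle m). s \<noteq> (\<lambda>c p. 0))"
proof (cases "\<exists>m>0. \<exists>s\<in>sections A (tensor_power canonical_bundle m). s \<noteq> (\<lambda>c p. 0)")
  case False
  have "kodaira_dim A = limsup (\<lambda>m. - \<infinity> :: ereal)"
    unfolding kodaira_dim_def
  proof (rule Limsup_eq, rule eventually_mono[OF eventually_gt_at_top[of 0]])
    fix m :: nat assume "m > 0"
    then have "h0 A (tensor_power canonical_bundle m) = 0" unfolding h0_pluricanonical[OF \<open>m > 0\<close>] using False \<open>m > 0\<close> by (intro if_not_P) blast
    then show "(let d = h0 A (tensor_power canonical_bundle m) in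
       (if d = 0 then - \<infinity> else ereal (ln (real d) / ln (real m)))) = - \<infinity>" by simp
  qed
  then show ?thesis by (simp add: Limsup_const)
next
  case True
  then obtain m s where m: "m > 0" and s: "s \<in> sections A (tensor_power canonical_bundle m)" "s \<noteq> (\<lambda>c p. 0)" by blast
  define Y where "Y m = (let d = h0 A (tensor_power canonical_bundle m) in
       (if d = 0 then - \<infinity> else ereal (ln (real d) / ln (real m))))" for m
  have kod: "kodaira_dim A = limsup Y" unfolding kodaira_dim_def Y_def ..
  have "limsup Y \<le> 0"
    by (rule Limsup_bounded, rule eventually_mono[OF eventually_gt_at_top[of 0]])
      (simp add: Y_def h0_pluricanonical)
  moreover have "0 \<le> limsup Y"
  proof -
    \<comment> \<open>\<open>Suc k\<close> avoids the meaningless term with index 0\<close>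
    define r where "r k = m * Suc k" for k
    have "strict_mono r" using m unfolding r_def by (intro strict_monoI) simp
    moreover have "Y (r k) = 0" for k
    proof -
      have "(\<lambda>c p. s c p ^ Suc k) \<in> sections A (tensor_power canonical_bundle (r k))"
        unfolding r_def by (rule section_power[OF s(1)]) simp
      moreover have "(\<lambda>c p. s c p ^ Suc k) \<noteq> (\<lambda>c p. 0)" using s(2) by (auto simp: fun_eq_iff)
      moreover have "r k > 0" using m by (simp add: r_def)
      ultimately have "h0 A (tensor_power canonical_bundle (r k)) = 1" by (subst h0_pluricanonical) auto
      then show ?thesis by (simp add: Y_def)
    qed
    ultimately show ?thesis
      using limsup_subseq_mono[of r Y] by (simp add: o_def Limsup_const)
  qed
  ultimately show ?thesis using kod m s by auto
qed

lemma pluricanonical_trivial: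
  assumes s: "s \<in> sections A (tensor_power canonical_bundle m)" and nz: "\<And>c p. c \<in> A \<Longrightarrow> p \<in> dom_of c \<Longrightarrow> s c p \<noteq> 0"
  shows "bundle_iso A (tensor_power canonical_bundle m) trivial_bundle"
  unfolding bundle_iso_def
proof (intro exI[of _ "\<lambda>c p. inverse (s c p)"] conjI ballI)
  fix c assume c: "c \<in> A"
  have "holomorphic_Cn_on (\<lambda>z. inverse (local_section s c z)) (img_of c)"
    by (rule holomorphic_Cn_compose_field[OF section_holomorphic[OF s c], where \<phi>' = "\<lambda>x. - (inverse x ^ Suc (Suc 0))"])
      (rule DERIV_inverse, simp add: local_section_def nz c)
  then show "holomorphic_in_chart c (\<lambda>p. inverse (s c p))"
    unfolding holomorphic_in_chart_def local_section_def .
  show "inverse (s c p) \<noteq> 0" if "p \<in> dom_of c" for p using nz[OF c that] by simp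
  show "inverse (s c p) * tensor_power canonical_bundle m c d p = trivial_bundle c d p * inverse (s d p)"
    if d: "d \<in> A" and p: "p \<in> dom_of c \<inter> dom_of d" for d p
    unfolding section_change[OF s c d p] tensor_power_def canonical_bundle_def trivial_bundle_def
    using det_metric_transform(2)[OF c d p] by simp
qed

subsection \<open>The conformal factor\<close>

text \<open>The function is \<open>|\<sigma>|\<^sup>2\<^sup>/\<^sup>m\<close>.  As \<open>\<sigma>\<close> is holomorphic, \<open>\<partial> |\<sigma>|\<^sup>2 = (\<partial>\<sigma>) cnj \<sigma> = m \<alpha> |\<sigma>|\<^sup>2\<close>, and the exponent \<open>1/m\<close> removes the factor \<open>m\<close>.\<close>

lemma section_weight_ode:
  assumes s: "s \<in> sections A (tensor_power canonical_bundle m)" and m: "m > 0" and c: "c \<in> A" and z: "z \<in> img_of c"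
    and nz: "local_section s c z \<noteq> 0"
  defines "\<nu> \<equiv> \<lambda>z. complex_of_real (exp (ln ((cmod (local_section s c z))\<^sup>2) / real m))"
  shows "dz l \<nu> z = \<nu> z * local_metric.alpha (h c) l z"
proof -
  interpret local_metric "img_of c" "h c" by (rule local_metric_chart[OF c])
  define \<sigma> where "\<sigma> = local_section s c"
  define N where "N z = (cmod (\<sigma> z))\<^sup>2" for z
  have hol: "holomorphic_Cn_on \<sigma> (img_of c)" unfolding \<sigma>_def by (rule section_holomorphic[OF s c])
  note D = holomorphic_Cn_has_derivative[OF hol z]
  have \<sigma>d: "\<sigma> differentiable (at z)" using D(1) unfolding differentiable_def by blast
  have cd: "(\<lambda>z. cnj (\<sigma> z)) differentiable (at z)"
    using bounded_linear.has_derivative[OF bounded_linear_cnj D(1)] unfolding differentiable_def by blast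
  have Neq: "complex_of_real (N w) = \<sigma> w * cnj (\<sigma> w)" for w unfolding N_def by (simp only: complex_norm_square)
  have Nre: "N w = Re (\<sigma> w * cnj (\<sigma> w))" for w unfolding Neq[symmetric] by simp
  have Nd: "N differentiable (at z)"
  proof -
    obtain E where "((\<lambda>w. \<sigma> w * cnj (\<sigma> w)) has_derivative E) (at z)"
      using differentiable_mult[OF \<sigma>d cd] unfolding differentiable_def by blast
    from bounded_linear.has_derivative[OF bounded_linear_Re this]
    show ?thesis unfolding differentiable_def Nre[abs_def] by blast
  qed
  have Npos: "N z > 0" unfolding N_def using nz by (simp add: \<sigma>_def)
  have "dz l (\<lambda>w. complex_of_real (N w)) z = dz l (\<lambda>w. \<sigma> w * cnj (\<sigma> w)) z" unfolding Neq ..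
  also have "\<dots> = dz l \<sigma> z * cnj (\<sigma> z)"
    using dz_mult[OF \<sigma>d cd] dz_cnj[OF \<sigma>d] dzbar_holomorphic[OF D] by simp
  also have "\<dots> = of_nat m * alpha l z * of_real (N z)"
    unfolding section_ode[OF s m c z, folded \<sigma>_def] Neq by simp
  finally have dN: "dz l (\<lambda>w. complex_of_real (N w)) z = of_nat m * alpha l z * of_real (N z)" .
  have "((\<lambda>x. exp (ln x / real m)) has_real_derivative exp (ln (N z) / real m) * (1 / N z / real m)) (at (N z))"
    using Npos m by (auto intro!: derivative_eq_intros)
  from dz_real_compose[OF Nd this, of l]
  have "dz l (\<lambda>w. of_real (exp (ln (N w) / real m))) z
     = of_real (exp (ln (N z) / real m) * (1 / N z / real m)) * (of_nat m * alpha l z * of_real (N z))"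
    unfolding dN .
  also have "\<dots> = of_real (exp (ln (N z) / real m)) * alpha l z"
    using Npos m by (simp add: field_simps)
  finally show ?thesis unfolding \<nu>_def N_def \<sigma>_def .
qed

text \<open>The cofactors \<open>det h h\<^sup>p\<^sup>q\<close> scale with \<open>e\<^sup>(\<^sup>n\<^sup>-\<^sup>1\<^sup>)\<^sup>f\<close> under the conformal change, so \<open>e\<^sup>(\<^sup>n\<^sup>-\<^sup>1\<^sup>)\<^sup>f = |s|\<^sup>2\<^sup>/\<^sup>m / det h\<close> turns them into
  \<open>|s|\<^sup>2\<^sup>/\<^sup>m h\<^sup>p\<^sup>q\<close>.  The quotient is independent of the chart, since numerator and denominator transform in the same way.\<close>

lemma conformally_balanced_of_section:
  assumes s: "s \<in> sections A (tensor_power canonical_bundle m)" and m: "m > 0"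
    and nz: "\<And>c p. c \<in> A \<Longrightarrow> p \<in> dom_of c \<Longrightarrow> s c p \<noteq> 0"
  shows "conformally_balanced A h"
proof (cases "CARD('n) = 1")
  case True
  have "balanced A (conformal_metric (\<lambda>_. 0) h)"
    unfolding balanced_def True by (simp add: ext_deriv_def frechet_derivative_const del: One_nat_def)
  moreover have "smooth_function A (\<lambda>_. 0)" unfolding smooth_function_def Cinf_on_def by (simp add: Ck_on_const)
  ultimately show ?thesis unfolding conformally_balanced_def by blast
next
  case False
  moreover have "CARD('n) > 0" by simp
  ultimately obtain k where n: "CARD('n) = Suc k" and k: "k > 0"
    by (cases "CARD('n)") auto
  define w where "w c p = (cmod (s c p))\<^sup>2 / det_metric c (snd c p) ^ m" for c p
  define chart_at where "chart_at p = (SOME c. c \<in> A \<and> p \<in> dom_of c)" for p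
  \<comment> \<open>\<open>k = n - 1\<close> and \<open>w = |s|\<^sup>2 / (det h)\<^sup>m = e\<^sup>m\<^sup>k\<^sup>f\<close>\<close>
  define f where "f p = ln (w (chart_at p) p) / (real m * real k)" for p
  have w_change: "w c p = w d p" if "c \<in> A" "d \<in> A" "p \<in> dom_of c \<inter> dom_of d" for c d p
    unfolding w_def section_change[OF s that] det_metric_change[OF that] using det_metric_transform(2)[OF that]
    by (simp add: norm_mult norm_power power_mult_distrib power_mult[symmetric] mult.commute)
  have f_eq: "f p = ln (w c p) / (real m * real k)" if "c \<in> A" "p \<in> dom_of c" for c p
  proof -
    have "chart_at p \<in> A \<and> p \<in> dom_of (chart_at p)"
      unfolding chart_at_def by (rule someI_ex) (use that in blast)
    then show ?thesis unfolding f_def using w_change[OF _ that(1), of "chart_at p" p] that by simp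
  qed
  have f_chart: "f (chart_inv c z) = ln ((cmod (local_section s c z))\<^sup>2 / det_metric c z ^ m) / (real m * real k)"
    if "c \<in> A" "z \<in> img_of c" for c z
    using f_eq[OF that(1), of "chart_inv c z"] that by (simp add: w_def local_section_def)
  have pos: "(cmod (local_section s c z))\<^sup>2 > 0" if "c \<in> A" "z \<in> img_of c" for c z
    unfolding local_section_def using nz[OF that(1), of "chart_inv c z"] that by simp
  have f_Ck: "Ck_on r (\<lambda>z. f (chart_inv c z)) (img_of c)" if c: "c \<in> A" for r c
  proof -
    have "Ck_on r (\<lambda>z. (cmod (local_section s c z))\<^sup>2) (img_of c)"
    proof -
      have "Ck_on r (local_section s c) (img_of c)"
        by (rule holomorphic_Cn_Ck[OF open_img[OF c] section_holomorphic[OF s c]])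
      then have "Ck_on r (\<lambda>z. Re (local_section s c z * cnj (local_section s c z))) (img_of c)"
        by (intro Ck_on_Re Ck_on_mult Ck_on_cnj open_img c)
      moreover have "Re (x * cnj x) = (cmod x)\<^sup>2" for x by (simp add: cmod_power2) (simp add: power2_eq_square)
      ultimately show ?thesis by simp
    qed
    moreover have "Ck_on r (\<lambda>z. det_metric c z ^ m) (img_of c)" by (intro Ck_on_power det_metric_Ck open_img c)
    ultimately have "Ck_on r (\<lambda>z. ln ((cmod (local_section s c z))\<^sup>2 / det_metric c z ^ m) / (real m * real k)) (img_of c)"
      using pos[OF c] det_metric_pos[OF c]
      by (intro Ck_on_divide Ck_on_ln Ck_on_const open_img c)
        (auto simp: m k less_imp_neq[THEN not_sym])
    then show ?thesis using Ck_on_cong[OF open_img[OF c] f_chart[OF c]] by simp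
  qed
  have "smooth_function A f" unfolding smooth_function_def Cinf_on_def using f_Ck by blast
  moreover have "balanced A (conformal_metric f h)" unfolding balanced_def n diff_Suc_1
  proof (intro ballI allI)
    fix c z v assume c: "c \<in> A" and z: "z \<in> img_of c"
    define h' where "h' = conformal_metric f h c"
    define E where "E z = complex_of_real (exp (f (chart_inv c z)))" for z
    define \<nu> where "\<nu> z = complex_of_real (exp (ln ((cmod (local_section s c z))\<^sup>2) / real m))" for z
    have h'E: "h' z = (\<chi> i j. E z * h c z $ i $ j)" for z by (simp add: h'_def E_def conformal_metric_def)
    interpret local_metric "img_of c" "h c" by (rule local_metric_chart[OF c])
    have lm': "local_metric (img_of c) h'"
    proof
      show "open (img_of c)" by (rule U)
      show "Ck_on r (\<lambda>z. h' z $ i $ j) (img_of c)" for r i j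
        unfolding h'E E_def by (simp, intro Ck_on_mult Ck_on_of_real Ck_on_exp f_Ck c U h_Ck)
      show "pos_hermitian (h' z)" if "z \<in> img_of c" for z
        unfolding h'E E_def by (rule pos_hermitian_scale[OF h_pos[OF that]]) simp
    qed
    interpret h': local_metric "img_of c" h' by (rule lm')
    have E0: "E y \<noteq> 0" for y by (simp add: E_def)
    have \<nu>_eq: "E y ^ k * det (h c y) = \<nu> y" if y: "y \<in> img_of c" for y
    proof -
      have D: "det_metric c y > 0" by (rule det_metric_pos[OF c y])
      have "real k * f (chart_inv c y) = ln ((cmod (local_section s c y))\<^sup>2) / real m - ln (det_metric c y)"
        unfolding f_chart[OF c y] using k m pos[OF c y] D by (simp add: ln_div ln_realpow field_simps)
      then have "exp (f (chart_inv c y)) ^ k * det_metric c y = exp (ln ((cmod (local_section s c y))\<^sup>2) / real m)"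
        using D by (simp add: exp_of_nat_mult[symmetric] exp_diff)
      from arg_cong[OF this, of complex_of_real]
      show ?thesis unfolding E_def \<nu>_def det_metric_eq[OF c y] by simp
    qed
    have cof: "det (h' y) * h'.Q p q y = \<nu> y * Q p q y" if y: "y \<in> img_of c" for p q y
    proof -
      have "det (h' y) * h'.Q p q y = E y ^ Suc k * det (h c y) * (Q p q y / E y)"
        unfolding h'.Q_def Q_def h'E det_scale n herm_inv_scale[OF pos_hermitian_det[OF h_pos[OF y]] E0] ..
      then show ?thesis using E0[of y] unfolding \<nu>_eq[OF y, symmetric] by (simp add: field_simps)
    qed
    show "ext_deriv (2 * k) (two_form_power (form11 (conformal_metric f h c)) k) z v = 0"
      unfolding h'_def[symmetric]
    proof (rule h'.closed_power_of_divergence_free[OF n z])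
      fix q
      have \<nu>d: "\<nu> differentiable (at z)"
      proof -
        have "Ck_on 1 (\<lambda>y. E y ^ k * det (h c y)) (img_of c)"
          unfolding E_def by (intro Ck_on_mult Ck_on_power Ck_on_of_real Ck_on_exp f_Ck c U Ck_on_det h_Ck)
        then have "Ck_on 1 \<nu> (img_of c)" using Ck_on_cong[OF U, of "\<lambda>y. E y ^ k * det (h c y)" \<nu> 1] \<nu>_eq by blast
        from Ck_on_differentiable[OF this _ z] show ?thesis by simp
      qed
      have "(\<Sum>p\<in>UNIV. dz p (\<lambda>y. det (h' y) * h'.Q p q y) z) = (\<Sum>p\<in>UNIV. dz p (\<lambda>y. \<nu> y * Q p q y) z)"
        by (intro sum.cong refl dz_cong_open[OF U z cof])
      also have "\<dots> = (\<Sum>p\<in>UNIV. \<nu> z * alpha p z * Q p q z + \<nu> z * dz p (Q p q) z)"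
      proof (intro sum.cong refl)
        fix p
        have "dz p \<nu> z = \<nu> z * alpha p z"
          unfolding \<nu>_def by (rule section_weight_ode[OF s m c z]) (use pos[OF c z] in auto)
        then show "dz p (\<lambda>y. \<nu> y * Q p q y) z = \<nu> z * alpha p z * Q p q z + \<nu> z * dz p (Q p q) z"
          by (simp add: dz_mult[OF \<nu>d Q_diff[OF z]])
      qed
      also have "\<dots> = \<nu> z * (\<Sum>p\<in>UNIV. Q p q z * alpha p z) + \<nu> z * (\<Sum>p\<in>UNIV. dz p (Q p q) z)"
        by (simp add: sum.distrib sum_distrib_left mult_ac)
      also have "\<dots> = 0" unfolding divergence_Q(1)[OF z] by simp
      finally show "(\<Sum>p\<in>UNIV. dz p (\<lambda>y. det (h' y) * h'.Q p q y) z) = 0" .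
    qed
  qed
  ultimately show ?thesis unfolding conformally_balanced_def by blast
qed

end

theorem theorem5p2:
  fixes X :: "'a topology"
    and A :: "('a, 'n::finite) chart set"
    and h :: "('a, 'n) metric"
  assumes "compact_complex_manifold X A"
    and "hermitian_metric A h"
    and "LC_Ricci_flat A h"
  shows "kodaira_dim A = - \<infinity> \<or>
    (kodaira_dim A = 0 \<and> conformally_balanced A h \<and>
     (\<exists>m>0. bundle_iso A (tensor_power canonical_bundle m) trivial_bundle))"
proof -
  interpret ricci_flat_manifold X A h by unfold_locales fact+
  show ?thesis
  proof (cases "kodaira_dim A = - \<infinity>")
    case False
    then obtain m s where kod: "kodaira_dim A = 0" and m: "m > 0"
      and s: "s \<in> sections A (tensor_power canonical_bundle m)" "s \<noteq> (\<lambda>c p. 0)"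
      using kodaira_dim_cases by blast
    have "\<forall>c\<in>A. \<forall>p\<in>dom_of c. s c p \<noteq> 0" using section_dichotomy[OF s(1) m] s(2) by blast
    then have nz: "\<And>c p. c \<in> A \<Longrightarrow> p \<in> dom_of c \<Longrightarrow> s c p \<noteq> 0" by blast
    show ?thesis using kod m conformally_balanced_of_section[OF s(1) m nz] pluricanonical_trivial[OF s(1) nz] by blast
  qed simp
qed

end
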